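(* Let $R$ be a Dedekind domain, $G$ an affine flat $R$-group scheme, and $M$ a $G$-module which is flat as an $R$-module. Let $A$ be a Noetherian $R$-algebra, and $V$ a finitely generated $A$-module (regarded as an $R$-module via $R\to A$). Let $\varphi\colon V\rightarrow M^G$ be an $R$-linear map. If the induced map $\varphi_K\colon K\otimes_R V\rightarrow (K\otimes_R M)^{K\otimes_R G}$ is an isomorphism for every algebraically closed field $K$ which is an $R$-algebra, then the canonical map $\varphi_S\colon S\otimes_R V\rightarrow (S\otimes_R M)^{S\otimes_R G}$ is an isomorphism for every $R$-algebra $S$.
   Context: Let $C=R[G]$ be the coordinate ring of $G$; it is an $R$-flat commutative Hopf algebra over $R$. A $G$-module is a right $C$-comodule $M$, with coaction $\omega\colon M\to M\otimes_R C$. Its invariants are the $R$-submodule $M^G=\{m\in M\mid \omega(m)=m\otimes 1\}$. In the claim $S$ ranges over commutative $R$-algebras. For an $R$-algebra $S$, $S\otimes_R G$ denotes the base change of $G$ to $S$, with coordinate ring $S\otimes_R C$, and $S\otimes_R M$ is an $S\otimes_R G$-module via the composite $$S\otimes_R M\xrightarrow{1_S\otimes\omega}S\otimes_R M\otimes_R C\xrightarrow{\ \alpha\ }(S\otimes_R M)\otimes_S(S\otimes_R C),$$ where $\alpha(s\otimes m\otimes c)=(s\otimes m)\otimes(1\otimes c)$. Thus $(S\otimes_R M)^{S\otimes_R G}=\{x\in S\otimes_R M\mid (1_S\otimes\omega)(x)=x\otimes 1\}$, an $S$-submodule of $S\otimes_R M$. For an $R$-linear map $\varphi\colon V\to M^G$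 and an $R$-algebra $S$, the $S$-linear map $\varphi_S\colon S\otimes_R V\to (S\otimes_R M)^{S\otimes_R G}$ is defined by $\varphi_S(s\otimes v)=s\otimes\varphi(v)$; $\varphi_K$ is the case $S=K$. *)

theory Defs
  imports "HOL-Algebra.Algebra" "HOL-Library.Equipollence"
begin

section \<open>Modules\<close>

definition module_hom ::
  "('r, 'x) ring_scheme \<Rightarrow> ('r, 'm) module \<Rightarrow> ('r, 'n) module \<Rightarrow> ('m \<Rightarrow> 'n) set" where
  "module_hom R M N =
    {h \<in> carrier M \<rightarrow> carrier N.
      (\<forall>x \<in> carrier M. \<forall>y \<in> carrier M. h (x \<oplus>\<^bsub>M\<^esub> y) = h x \<oplus>\<^bsub>N\<^esub> h y) \<and>
      (\<forall>r \<in> carrier R. \<forall>x \<in> carrier M. h (r \<odot>\<^bsub>M\<^esub> x) = r \<odot>\<^bsub>N\<^esub> h x)}"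

definition module_iso ::
  "('r, 'x) ring_scheme \<Rightarrow> ('r, 'm) module \<Rightarrow> ('r, 'n) module \<Rightarrow> ('m \<Rightarrow> 'n) set" where
  "module_iso R M N = {h \<in> module_hom R M N. bij_betw h (carrier M) (carrier N)}"

definition submodule_span ::
  "('r, 'x) ring_scheme \<Rightarrow> ('r, 'm) module \<Rightarrow> 'm set \<Rightarrow> 'm set" where
  "submodule_span R M U = \<Inter>{H. submodule H R M \<and> U \<subseteq> H}"

definition finitely_generated_module :: "('r, 'x) ring_scheme \<Rightarrow> ('r, 'm) module \<Rightarrow> bool" where
  "finitely_generated_module R M \<longleftrightarrow>
    (\<exists>U \<subseteq> carrier M. finite U \<and> submodule_span R M U = carrier M)"

definition with_smult :: "('a, 'm) module \<Rightarrow> ('b \<Rightarrow> 'm \<Rightarrow> 'm) \<Rightarrow> ('b, 'm) module" where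
  "with_smult M s =
    \<lparr>carrier = carrier M, monoid.mult = monoid.mult M, one = one M,
     ring.zero = ring.zero M, ring.add = ring.add M, smult = s\<rparr>"

text \<open>The structure map of an \<open>R\<close>-algebra \<open>S\<close> is \<open>r \<mapsto> r \<cdot> 1\<close>.\<close>

definition restrict_scalars :: "('r, 's) module \<Rightarrow> ('s, 'm) module \<Rightarrow> ('r, 'm) module" where
  "restrict_scalars S M = with_smult M (\<lambda>r m. (r \<odot>\<^bsub>S\<^esub> \<one>\<^bsub>S\<^esub>) \<odot>\<^bsub>M\<^esub> m)"

definition regular_algebra :: "('r, 'x) ring_scheme \<Rightarrow> ('r, 'r) module" where
  "regular_algebra R =
    \<lparr>carrier = carrier R, monoid.mult = monoid.mult R, one = one R,
     ring.zero = ring.zero R, ring.add = ring.add R, smult = monoid.mult R\<rparr>"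

definition algebra_hom ::
  "('r, 'x) ring_scheme \<Rightarrow> ('r, 'a) module \<Rightarrow> ('r, 'b) module \<Rightarrow> ('a \<Rightarrow> 'b) set" where
  "algebra_hom R A B = module_hom R A B \<inter> ring_hom A B"

text \<open>Free and quotient modules have no multiplication: their fields \<open>mult\<close> and \<open>one\<close> carry
  no information.\<close>

definition free_module :: "('r, 'x) ring_scheme \<Rightarrow> 'b set \<Rightarrow> ('r, 'b \<Rightarrow> 'r) module" where
  "free_module R B =
    \<lparr>carrier = {f. f \<in> B \<rightarrow> carrier R \<and> (\<forall>b. b \<notin> B \<longrightarrow> f b = \<zero>\<^bsub>R\<^esub>) \<and> finite {b. f b \<noteq> \<zero>\<^bsub>R\<^esub>}},
     monoid.mult = undefined, one = undefined,
     ring.zero = (\<lambda>b. \<zero>\<^bsub>R\<^esub>), ring.add = (\<lambda>f g b. f b \<oplus>\<^bsub>R\<^esub> g b), smult = (\<lambda>r f b. r \<otimes>\<^bsub>R\<^esub> f b)\<rparr>"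

definition free_basis :: "('r, 'x) ring_scheme \<Rightarrow> 'b \<Rightarrow> 'b \<Rightarrow> 'r" where
  "free_basis R b = (\<lambda>c. if c = b then \<one>\<^bsub>R\<^esub> else \<zero>\<^bsub>R\<^esub>)"

definition quotient_module :: "('r, 'm) module \<Rightarrow> 'm set \<Rightarrow> ('r, 'm set) module" where
  "quotient_module M H =
    \<lparr>carrier = a_rcosets\<^bsub>M\<^esub> H, monoid.mult = undefined, one = undefined,
     ring.zero = H, ring.add = set_add M, smult = (\<lambda>r U. \<Union>x\<in>U. H +>\<^bsub>M\<^esub> (r \<odot>\<^bsub>M\<^esub> x))\<rparr>"


section \<open>Tensor products\<close>

definition tensor_relations ::
  "('r, 'x) ring_scheme \<Rightarrow> ('r, 'm) module \<Rightarrow> ('r, 'n) module \<Rightarrow> ('m \<times> 'n \<Rightarrow> 'r) set" where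
  "tensor_relations R M N =
    (let F = free_module R (carrier M \<times> carrier N); e = free_basis R in
      {e (m \<oplus>\<^bsub>M\<^esub> m', n) \<ominus>\<^bsub>F\<^esub> (e (m, n) \<oplus>\<^bsub>F\<^esub> e (m', n)) | m m' n.
        m \<in> carrier M \<and> m' \<in> carrier M \<and> n \<in> carrier N} \<union>
      {e (m, n \<oplus>\<^bsub>N\<^esub> n') \<ominus>\<^bsub>F\<^esub> (e (m, n) \<oplus>\<^bsub>F\<^esub> e (m, n')) | m n n'.
        m \<in> carrier M \<and> n \<in> carrier N \<and> n' \<in> carrier N} \<union>
      {e (r \<odot>\<^bsub>M\<^esub> m, n) \<ominus>\<^bsub>F\<^esub> r \<odot>\<^bsub>F\<^esub> e (m, n) | r m n.
        r \<in> carrier R \<and> m \<in> carrier M \<and> n \<in> carrier N} \<union>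
      {e (m, r \<odot>\<^bsub>N\<^esub> n) \<ominus>\<^bsub>F\<^esub> r \<odot>\<^bsub>F\<^esub> e (m, n) | r m n.
        r \<in> carrier R \<and> m \<in> carrier M \<and> n \<in> carrier N})"

definition tensor_kernel ::
  "('r, 'x) ring_scheme \<Rightarrow> ('r, 'm) module \<Rightarrow> ('r, 'n) module \<Rightarrow> ('m \<times> 'n \<Rightarrow> 'r) set" where
  "tensor_kernel R M N =
    submodule_span R (free_module R (carrier M \<times> carrier N)) (tensor_relations R M N)"

definition tensor ::
  "('r, 'x) ring_scheme \<Rightarrow> ('r, 'm) module \<Rightarrow> ('r, 'n) module \<Rightarrow> ('r, ('m \<times> 'n \<Rightarrow> 'r) set) module" where
  "tensor R M N =
    quotient_module (free_module R (carrier M \<times> carrier N)) (tensor_kernel R M N)"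

definition pure_tensor ::
  "('r, 'x) ring_scheme \<Rightarrow> ('r, 'm) module \<Rightarrow> ('r, 'n) module \<Rightarrow> 'm \<Rightarrow> 'n \<Rightarrow> ('m \<times> 'n \<Rightarrow> 'r) set" where
  "pure_tensor R M N m n =
    tensor_kernel R M N +>\<^bsub>free_module R (carrier M \<times> carrier N)\<^esub> free_basis R (m, n)"

text \<open>The linear map out of a tensor product induced by a bilinear map \<open>\<beta>\<close> into \<open>P\<close>.
  When \<open>\<beta>\<close> is bilinear, all representatives \<open>x\<close> of the class \<open>U\<close> give the same value.\<close>

definition tensor_lift ::
  "('r, 'x) ring_scheme \<Rightarrow> ('r, 'p) module \<Rightarrow> ('m \<Rightarrow> 'n \<Rightarrow> 'p) \<Rightarrow> ('m \<times> 'n \<Rightarrow> 'r) set \<Rightarrow> 'p" where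
  "tensor_lift R P \<beta> U =
    the_elem ((\<lambda>x. \<Oplus>\<^bsub>P\<^esub>p\<in>{p. x p \<noteq> \<zero>\<^bsub>R\<^esub>}. x p \<odot>\<^bsub>P\<^esub> \<beta> (fst p) (snd p)) ` U)"

text \<open>\<open>f \<otimes> g\<close>, where \<open>M\<close> and \<open>N\<close> are the target modules of \<open>f\<close> and \<open>g\<close>.\<close>

definition tensor_map ::
  "('r, 'x) ring_scheme \<Rightarrow> ('r, 'm) module \<Rightarrow> ('r, 'n) module \<Rightarrow> ('a \<Rightarrow> 'm) \<Rightarrow> ('b \<Rightarrow> 'n)
    \<Rightarrow> ('a \<times> 'b \<Rightarrow> 'r) set \<Rightarrow> ('m \<times> 'n \<Rightarrow> 'r) set" where
  "tensor_map R M N f g = tensor_lift R (tensor R M N) (\<lambda>a b. pure_tensor R M N (f a) (g b))"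

text \<open>\<open>(L \<otimes> M) \<otimes> N \<rightarrow> L \<otimes> (M \<otimes> N)\<close>\<close>

definition tensor_assoc ::
  "('r, 'x) ring_scheme \<Rightarrow> ('r, 'l) module \<Rightarrow> ('r, 'm) module \<Rightarrow> ('r, 'n) module
    \<Rightarrow> (('l \<times> 'm \<Rightarrow> 'r) set \<times> 'n \<Rightarrow> 'r) set \<Rightarrow> ('l \<times> ('m \<times> 'n \<Rightarrow> 'r) set \<Rightarrow> 'r) set" where
  "tensor_assoc R L M N =
    tensor_lift R (tensor R L (tensor R M N))
      (\<lambda>y n. tensor_lift R (tensor R L (tensor R M N))
        (\<lambda>l m. pure_tensor R L (tensor R M N) l (pure_tensor R M N m n)) y)"

definition tensor_algebra ::
  "('r, 'x) ring_scheme \<Rightarrow> ('r, 'a) module \<Rightarrow> ('r, 'b) module \<Rightarrow> ('r, ('a \<times> 'b \<Rightarrow> 'r) set) module" where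
  "tensor_algebra R A B =
    (tensor R A B)
      \<lparr>monoid.mult := \<lambda>U W. tensor_lift R (tensor R A B)
          (\<lambda>a b. tensor_lift R (tensor R A B)
            (\<lambda>a' b'. pure_tensor R A B (a \<otimes>\<^bsub>A\<^esub> a') (b \<otimes>\<^bsub>B\<^esub> b')) W) U,
       one := pure_tensor R A B \<one>\<^bsub>A\<^esub> \<one>\<^bsub>B\<^esub>\<rparr>"

text \<open>Exactness of \<open>_ \<otimes> M\<close>. It is tested on modules carried by subsets of the type of \<open>R\<close>; as these
  include \<open>R\<close> and all its ideals, this implies preservation of injections between modules
  carried by arbitrary types.\<close>

definition flat_module :: "('r, 'x) ring_scheme \<Rightarrow> ('r, 'm) module \<Rightarrow> bool" where
  "flat_module R M \<longleftrightarrow>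
    module R M \<and>
    (\<forall>(N :: ('r, 'r) module) (N' :: ('r, 'r) module) f.
      module R N \<and> module R N' \<and> f \<in> module_hom R N N' \<and> inj_on f (carrier N) \<longrightarrow>
      inj_on (tensor_map R N' M f id) (carrier (tensor R N M)))"


section \<open>Base change\<close>

definition base_change_smult ::
  "('r, 'x) ring_scheme \<Rightarrow> ('r, 's) module \<Rightarrow> ('r, 'm) module
    \<Rightarrow> 's \<Rightarrow> ('s \<times> 'm \<Rightarrow> 'r) set \<Rightarrow> ('s \<times> 'm \<Rightarrow> 'r) set" where
  "base_change_smult R S M s = tensor_map R S M (\<lambda>t. s \<otimes>\<^bsub>S\<^esub> t) id"

definition base_change ::
  "('r, 'x) ring_scheme \<Rightarrow> ('r, 's) module \<Rightarrow> ('r, 'm) module \<Rightarrow> ('s, ('s \<times> 'm \<Rightarrow> 'r) set) module" where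
  "base_change R S M = with_smult (tensor R S M) (base_change_smult R S M)"

definition base_change_algebra ::
  "('r, 'x) ring_scheme \<Rightarrow> ('r, 's) module \<Rightarrow> ('r, 'c) module \<Rightarrow> ('s, ('s \<times> 'c \<Rightarrow> 'r) set) module" where
  "base_change_algebra R S C = with_smult (tensor_algebra R S C) (base_change_smult R S C)"


section \<open>Hopf algebras and comodules\<close>

text \<open>An affine group scheme over \<open>R\<close> is given by its coordinate ring, a commutative Hopf algebra.
  Commutativity is part of the library's \<^locale>\<open>algebra\<close>.\<close>

locale hopf_algebra = algebra R C
  for R :: "('r, 'x) ring_scheme" (structure) and C :: "('r, 'c) module" (structure) +
  fixes \<Delta> \<epsilon> \<iota>
  assumes comult_hom: "\<Delta> \<in> algebra_hom R C (tensor_algebra R C C)"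
    and counit_hom: "\<epsilon> \<in> algebra_hom R C (regular_algebra R)"
    and antipode_hom: "\<iota> \<in> module_hom R C C"
    and coassoc: "c \<in> carrier C \<Longrightarrow>
      tensor_assoc R C C C (tensor_map R (tensor R C C) C \<Delta> id (\<Delta> c)) =
      tensor_map R C (tensor R C C) id \<Delta> (\<Delta> c)"
    and counit_left: "c \<in> carrier C \<Longrightarrow> tensor_lift R C (\<lambda>a b. \<epsilon> a \<odot>\<^bsub>C\<^esub> b) (\<Delta> c) = c"
    and counit_right: "c \<in> carrier C \<Longrightarrow> tensor_lift R C (\<lambda>a b. \<epsilon> b \<odot>\<^bsub>C\<^esub> a) (\<Delta> c) = c"
    and antipode_left: "c \<in> carrier C \<Longrightarrow>
      tensor_lift R C (\<lambda>a b. \<iota> a \<otimes>\<^bsub>C\<^esub> b) (\<Delta> c) = \<epsilon> c \<odot>\<^bsub>C\<^esub> \<one>\<^bsub>C\<^esub>"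
    and antipode_right: "c \<in> carrier C \<Longrightarrow>
      tensor_lift R C (\<lambda>a b. a \<otimes>\<^bsub>C\<^esub> \<iota> b) (\<Delta> c) = \<epsilon> c \<odot>\<^bsub>C\<^esub> \<one>\<^bsub>C\<^esub>"

locale right_comodule = hopf_algebra R C \<Delta> \<epsilon> \<iota> + M: module R M
  for R :: "('r, 'x) ring_scheme" (structure) and C :: "('r, 'c) module" (structure)
    and \<Delta> \<epsilon> \<iota> and M :: "('r, 'm) module" (structure) +
  fixes \<omega>
  assumes coaction_hom: "\<omega> \<in> module_hom R M (tensor R M C)"
    and coaction_coassoc: "m \<in> carrier M \<Longrightarrow>
      tensor_assoc R M C C (tensor_map R (tensor R M C) C \<omega> id (\<omega> m)) =
      tensor_map R M (tensor R C C) id \<Delta> (\<omega> m)"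
    and coaction_counit: "m \<in> carrier M \<Longrightarrow> tensor_lift R M (\<lambda>x c. \<epsilon> c \<odot>\<^bsub>M\<^esub> x) (\<omega> m) = m"

definition invariants ::
  "('r, 'x) ring_scheme \<Rightarrow> ('r, 'c) module \<Rightarrow> ('r, 'm) module \<Rightarrow> ('m \<Rightarrow> ('m \<times> 'c \<Rightarrow> 'r) set)
    \<Rightarrow> ('r, 'm) module" where
  "invariants R C M \<omega> = M\<lparr>carrier := {m \<in> carrier M. \<omega> m = pure_tensor R M C m \<one>\<^bsub>C\<^esub>}\<rparr>"

text \<open>\<open>S \<otimes>\<^sub>R (M \<otimes>\<^sub>R C) \<rightarrow> (S \<otimes>\<^sub>R M) \<otimes>\<^sub>S (S \<otimes>\<^sub>R C)\<close>, \<open>s \<otimes> m \<otimes> c \<mapsto> (s \<otimes> m) \<otimes> (1 \<otimes> c)\<close>\<close>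

definition base_change_distrib ::
  "('r, 'x) ring_scheme \<Rightarrow> ('r, 's) module \<Rightarrow> ('r, 'm) module \<Rightarrow> ('r, 'c) module
    \<Rightarrow> ('s \<times> ('m \<times> 'c \<Rightarrow> 'r) set \<Rightarrow> 'r) set
    \<Rightarrow> (('s \<times> 'm \<Rightarrow> 'r) set \<times> ('s \<times> 'c \<Rightarrow> 'r) set \<Rightarrow> 's) set" where
  "base_change_distrib R S M C =
    (let SM = base_change R S M; SC = base_change_algebra R S C;
         P = restrict_scalars S (tensor S SM SC) in
      tensor_lift R P (\<lambda>s y. tensor_lift R P
        (\<lambda>m c. pure_tensor S SM SC (pure_tensor R S M s m) (pure_tensor R S C \<one>\<^bsub>S\<^esub> c)) y))"

definition base_change_coaction ::
  "('r, 'x) ring_scheme \<Rightarrow> ('r, 's) module \<Rightarrow> ('r, 'm) module \<Rightarrow> ('r, 'c) module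
    \<Rightarrow> ('m \<Rightarrow> ('m \<times> 'c \<Rightarrow> 'r) set) \<Rightarrow> ('s \<times> 'm \<Rightarrow> 'r) set
    \<Rightarrow> (('s \<times> 'm \<Rightarrow> 'r) set \<times> ('s \<times> 'c \<Rightarrow> 'r) set \<Rightarrow> 's) set" where
  "base_change_coaction R S M C \<omega> =
    base_change_distrib R S M C \<circ> tensor_map R S (tensor R M C) id \<omega>"

text \<open>\<open>(S \<otimes> M)\<^sup>S\<^sup>\<otimes>\<^sup>G\<close>\<close>

definition base_change_invariants ::
  "('r, 'x) ring_scheme \<Rightarrow> ('r, 's) module \<Rightarrow> ('r, 'c) module \<Rightarrow> ('r, 'm) module
    \<Rightarrow> ('m \<Rightarrow> ('m \<times> 'c \<Rightarrow> 'r) set) \<Rightarrow> ('s, ('s \<times> 'm \<Rightarrow> 'r) set) module" where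
  "base_change_invariants R S C M \<omega> =
    invariants S (base_change_algebra R S C) (base_change R S M) (base_change_coaction R S M C \<omega>)"

definition base_change_map ::
  "('r, 'x) ring_scheme \<Rightarrow> ('r, 's) module \<Rightarrow> ('r, 'm) module \<Rightarrow> ('v \<Rightarrow> 'm)
    \<Rightarrow> ('s \<times> 'v \<Rightarrow> 'r) set \<Rightarrow> ('s \<times> 'm \<Rightarrow> 'r) set" where
  "base_change_map R S M \<phi> = tensor_map R S M id \<phi>"


section \<open>Dedekind domains\<close>

text \<open>Integral closedness in the field of fractions: the displayed equation is a monic polynomial
  equation with coefficients \<open>c i\<close> for \<open>a / b\<close>, multiplied by the \<open>n\<close>-th power of \<open>b\<close>;
  the conclusion says that \<open>a / b\<close> lies in \<open>R\<close>.\<close>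

definition integrally_closed_domain :: "('r, 'x) ring_scheme \<Rightarrow> bool" where
  "integrally_closed_domain R \<longleftrightarrow>
    domain R \<and>
    (\<forall>a \<in> carrier R. \<forall>b \<in> carrier R - {\<zero>\<^bsub>R\<^esub>}. \<forall>(n :: nat) c.
      c \<in> {..n} \<rightarrow> carrier R \<and> c n = \<one>\<^bsub>R\<^esub> \<and>
      (\<Oplus>\<^bsub>R\<^esub>i\<in>{..n}. c i \<otimes>\<^bsub>R\<^esub> (a [^]\<^bsub>R\<^esub> i \<otimes>\<^bsub>R\<^esub> b [^]\<^bsub>R\<^esub> (n - i))) = \<zero>\<^bsub>R\<^esub> \<longrightarrow>
      (\<exists>q \<in> carrier R. a = b \<otimes>\<^bsub>R\<^esub> q))"

text \<open>Fields count as Dedekind domains.\<close>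

definition dedekind_domain :: "('r, 'x) ring_scheme \<Rightarrow> bool" where
  "dedekind_domain R \<longleftrightarrow>
    noetherian_ring R \<and> integrally_closed_domain R \<and>
    (\<forall>P. primeideal P R \<and> P \<noteq> {\<zero>\<^bsub>R\<^esub>} \<longrightarrow> maximalideal P R)"

end

theory Submission
  imports Defs
begin

text \<open>Put \<open>\<delta> m = \<omega> m - m \<otimes> 1\<close> and \<open>N = M \<otimes> C\<close>, so that \<open>M\<^sup>G\<close> is the kernel of \<open>\<delta>\<close>. As the map
  \<open>S \<otimes> N \<rightarrow> (S \<otimes> M) \<otimes> (S \<otimes> C)\<close> is injective, \<open>\<phi>\<^sub>S\<close> is an isomorphism if and only if
  \<open>0 \<rightarrow> S \<otimes> V \<rightarrow> S \<otimes> M \<rightarrow> S \<otimes> N\<close> is exact. Since \<open>M\<close> and \<open>N\<close> are flat, splitting off one coordinate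
  of a presentation of \<open>S\<close> at a time reduces exactness to the modules \<open>S = R / I\<close>.

  For \<open>I \<noteq> 0\<close> one argues by Noetherian induction along
  \<open>0 \<rightarrow> R / (I : j) \<rightarrow> R / I \<rightarrow> R / (I + j) \<rightarrow> 0\<close>, where \<open>j\<close> is chosen such that \<open>(I : j)\<close> is prime, hence
  maximal; for a maximal ideal \<open>P\<close>, exactness descends to \<open>R / P\<close> from its algebraic closure.

  For \<open>I = 0\<close> the algebraic closure of the field of fractions gives exactness up to multiplication by
  some \<open>d \<noteq> 0\<close>. Let \<open>\<phi> v = 0\<close> and \<open>d v = 0\<close>. The submodules of \<open>V\<close> killed by the powers of \<open>d\<close>
  are \<open>A\<close>-submodules, hence become stationary at some \<open>d\<^sup>k\<close>; exactness modulo \<open>d\<^sup>k\<close> gives \<open>v = d\<^sup>k u\<close>, and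
  then \<open>d\<^sup>k\<^sup>+\<^sup>1 u = 0\<close> forces \<open>v = 0\<close>. Likewise \<open>\<delta> m = 0\<close> and \<open>d m = \<phi> v\<close> give \<open>v = d u\<close> by exactness
  modulo \<open>d\<close>, so that \<open>m = \<phi> u\<close>.\<close>

section \<open>Homomorphisms, submodules, additive spans and quotients of modules\<close>

section \<open>Modules\<close>

text \<open>Exactness has to be tested on modules of unrelated types, whereas
  \<open>flat_module\<close> speaks only of modules carried by the type of \<open>R\<close>. Tensors
  are therefore handled by coordinates: an element of \<open>S \<otimes> L\<close> is a finite sum
  of terms \<open>s \<otimes> f s\<close>, it vanishes exactly when \<open>f\<close> is a
  combination, with coefficients in \<open>L\<close>, of relations among finitely many elements of
  \<open>S\<close>, and flatness becomes a condition on such functions \<open>f\<close> that makes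
  sense for every index type. Descent from a field \<open>K\<close> is done without tensor products
  over the residue field. A maximal \<open>R\<close>-submodule \<open>W\<close> of \<open>K\<close>
  that meets the image of \<open>R\<close> only in zero makes every element of \<open>K\<close> a
  fraction modulo \<open>W\<close>; finitely many relations over \<open>K\<close> are then pushed
  down to \<open>R / P\<close> with one common denominator \<open>d\<close>. Hence exactness at a
  prime is formulated up to a factor \<open>d\<close> outside \<open>P\<close>. The condition on the
  type \<open>'k\<close> reflects that an algebraic closure of the field of fractions of
  \<open>R / P\<close> is no larger than any infinite set at least as large as \<open>R\<close>, so
  that it can be copied into \<open>'k\<close>.\<close>

lemma module_cring: "module R M \<Longrightarrow> cring R"
  by (rule module.axioms(1))

lemma module_abelian_group: "module R M \<Longrightarrow> abelian_group M"
  by (rule module.axioms(2))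

lemma (in abelian_group) add_minus_cancel:
  "x \<in> carrier G \<Longrightarrow> y \<in> carrier G \<Longrightarrow> (x \<ominus> y) \<oplus> y = x"
  by (simp add: a_minus_def a_assoc l_neg)

lemma (in abelian_group) minus_eq_zero_iff:
  "x \<in> carrier G \<Longrightarrow> y \<in> carrier G \<Longrightarrow> x \<ominus> y = \<zero> \<longleftrightarrow> x = y"
  using add_minus_cancel[of x y] by (auto simp: a_minus_def r_neg)

lemma (in abelian_group) a_inv_zero [simp]: "\<ominus> \<zero> = \<zero>"
  using r_neg[OF zero_closed] by simp

lemma (in abelian_group) minus_zero_right: "x \<in> carrier G \<Longrightarrow> x \<ominus> \<zero> = x"
  by (simp add: a_minus_def)

lemma module_homI:
  assumes "\<And>x. x \<in> carrier M \<Longrightarrow> h x \<in> carrier N"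
    and "\<And>x y. x \<in> carrier M \<Longrightarrow> y \<in> carrier M \<Longrightarrow> h (x \<oplus>\<^bsub>M\<^esub> y) = h x \<oplus>\<^bsub>N\<^esub> h y"
    and "\<And>r x. r \<in> carrier R \<Longrightarrow> x \<in> carrier M \<Longrightarrow> h (r \<odot>\<^bsub>M\<^esub> x) = r \<odot>\<^bsub>N\<^esub> h x"
  shows "h \<in> module_hom R M N"
  using assms unfolding module_hom_def by auto

lemma module_hom_closed: "h \<in> module_hom R M N \<Longrightarrow> x \<in> carrier M \<Longrightarrow> h x \<in> carrier N"
  unfolding module_hom_def by auto

lemma module_hom_add:
  "h \<in> module_hom R M N \<Longrightarrow> x \<in> carrier M \<Longrightarrow> y \<in> carrier M \<Longrightarrow>
    h (x \<oplus>\<^bsub>M\<^esub> y) = h x \<oplus>\<^bsub>N\<^esub> h y"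
  unfolding module_hom_def by auto

lemma module_hom_smult:
  "h \<in> module_hom R M N \<Longrightarrow> r \<in> carrier R \<Longrightarrow> x \<in> carrier M \<Longrightarrow>
    h (r \<odot>\<^bsub>M\<^esub> x) = r \<odot>\<^bsub>N\<^esub> h x"
  unfolding module_hom_def by auto

lemma module_hom_zero:
  assumes "module R M" "module R N" "h \<in> module_hom R M N"
  shows "h \<zero>\<^bsub>M\<^esub> = \<zero>\<^bsub>N\<^esub>"
proof -
  interpret M: module R M by fact
  interpret N: module R N by fact
  have "h (\<zero>\<^bsub>R\<^esub> \<odot>\<^bsub>M\<^esub> \<zero>\<^bsub>M\<^esub>) = \<zero>\<^bsub>R\<^esub> \<odot>\<^bsub>N\<^esub> h \<zero>\<^bsub>M\<^esub>"
    by (rule module_hom_smult[OF assms(3)]) auto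
  then show ?thesis using module_hom_closed[OF assms(3)] by simp
qed

lemma module_hom_neg:
  assumes "module R M" "module R N" "h \<in> module_hom R M N" "x \<in> carrier M"
  shows "h (\<ominus>\<^bsub>M\<^esub> x) = \<ominus>\<^bsub>N\<^esub> h x"
proof -
  interpret M: module R M by fact
  interpret N: module R N by fact
  have "h ((\<ominus>\<^bsub>R\<^esub> \<one>\<^bsub>R\<^esub>) \<odot>\<^bsub>M\<^esub> x) = (\<ominus>\<^bsub>R\<^esub> \<one>\<^bsub>R\<^esub>) \<odot>\<^bsub>N\<^esub> h x"
    by (rule module_hom_smult[OF assms(3)]) (use assms(4) in auto)
  then show ?thesis using module_hom_closed[OF assms(3)] assms(4)
    by (simp add: M.smult_l_minus N.smult_l_minus)
qed

lemma module_hom_minus: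
  assumes "module R M" "module R N" "h \<in> module_hom R M N" "x \<in> carrier M" "y \<in> carrier M"
  shows "h (x \<ominus>\<^bsub>M\<^esub> y) = h x \<ominus>\<^bsub>N\<^esub> h y"
proof -
  interpret M: module R M by fact
  show ?thesis
    using assms(4,5) unfolding a_minus_def
    by (simp add: module_hom_add[OF assms(3)] module_hom_neg[OF assms(1-3)])
qed

lemma module_hom_comp:
  "g \<in> module_hom R N P \<Longrightarrow> h \<in> module_hom R M N \<Longrightarrow> (\<lambda>x. g (h x)) \<in> module_hom R M P"
  by (rule module_homI) (simp_all add: module_hom_closed module_hom_add module_hom_smult)

lemma module_hom_id: "(\<lambda>x. x) \<in> module_hom R M M"
  unfolding module_hom_def by auto

lemma module_hom_plus:
  assumes "module R N" "g \<in> module_hom R M N" "h \<in> module_hom R M N"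
  shows "(\<lambda>x. g x \<oplus>\<^bsub>N\<^esub> h x) \<in> module_hom R M N"
proof -
  interpret N: module R N by fact
  show ?thesis
    by (rule module_homI)
      (use assms(2,3) in \<open>auto simp: module_hom_closed module_hom_add module_hom_smult
          N.smult_r_distr N.a_ac\<close>)
qed

lemma module_hom_scaled:
  assumes "module R N" "g \<in> module_hom R M N" "r \<in> carrier R"
  shows "(\<lambda>x. r \<odot>\<^bsub>N\<^esub> g x) \<in> module_hom R M N"
proof -
  interpret N: module R N by fact
  show ?thesis
    by (rule module_homI)
      (use assms(2,3) in \<open>auto simp: module_hom_closed module_hom_add module_hom_smult
          N.smult_r_distr N.smult_assoc1[symmetric] N.m_comm\<close>)
qed

lemma module_hom_diff:
  assumes "module R N" "g \<in> module_hom R M N" "h \<in> module_hom R M N"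
  shows "(\<lambda>x. g x \<ominus>\<^bsub>N\<^esub> h x) \<in> module_hom R M N"
proof -
  interpret N: module R N by fact
  show ?thesis
    by (rule module_homI)
      (use assms(2,3) in \<open>auto simp: module_hom_closed module_hom_add module_hom_smult a_minus_def
          N.smult_r_distr N.a_ac N.minus_add N.smult_r_minus\<close>)
qed

lemma module_regular:
  assumes "cring R"
  shows "module R (regular_algebra R)"
proof -
  interpret R: cring R by fact
  show ?thesis
  proof (rule moduleI)
    show "abelian_group (regular_algebra R)"
      by (rule abelian_groupI)
        (auto simp: regular_algebra_def R.a_ac intro: R.l_neg)
  qed (auto simp: regular_algebra_def R.l_distr R.r_distr R.m_ac assms)
qed

lemma regular_simps [simp]:
  "carrier (regular_algebra R) = carrier R" "add (regular_algebra R) = add R"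
  "\<zero>\<^bsub>regular_algebra R\<^esub> = \<zero>\<^bsub>R\<^esub>" "smult (regular_algebra R) = monoid.mult R"
  unfolding regular_algebra_def by auto

lemma submodule_carrier: "submodule H R M \<Longrightarrow> x \<in> H \<Longrightarrow> x \<in> carrier M"
  using subgroup.subset[OF submodule.axioms(1)] by fastforce

lemma submodule_zero: "submodule H R M \<Longrightarrow> \<zero>\<^bsub>M\<^esub> \<in> H"
  using subgroup.one_closed[OF submodule.axioms(1)] by fastforce

lemma submodule_add: "submodule H R M \<Longrightarrow> x \<in> H \<Longrightarrow> y \<in> H \<Longrightarrow> x \<oplus>\<^bsub>M\<^esub> y \<in> H"
  using subgroup.m_closed[OF submodule.axioms(1)] by fastforce

lemma submodule_neg: "submodule H R M \<Longrightarrow> x \<in> H \<Longrightarrow> \<ominus>\<^bsub>M\<^esub> x \<in> H"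
  using subgroup.m_inv_closed[OF submodule.axioms(1)] unfolding a_inv_def by fastforce

lemma submodule_minus: "submodule H R M \<Longrightarrow> x \<in> H \<Longrightarrow> y \<in> H \<Longrightarrow> x \<ominus>\<^bsub>M\<^esub> y \<in> H"
  unfolding a_minus_def by (intro submodule_add submodule_neg)

lemma submodule_smult: "submodule H R M \<Longrightarrow> r \<in> carrier R \<Longrightarrow> x \<in> H \<Longrightarrow> r \<odot>\<^bsub>M\<^esub> x \<in> H"
  using submodule.smult_closed by fast

lemma submoduleI':
  assumes "module R M" "H \<subseteq> carrier M" "\<zero>\<^bsub>M\<^esub> \<in> H"
    and "\<And>x y. x \<in> H \<Longrightarrow> y \<in> H \<Longrightarrow> x \<oplus>\<^bsub>M\<^esub> y \<in> H"
    and "\<And>r x. r \<in> carrier R \<Longrightarrow> x \<in> H \<Longrightarrow> r \<odot>\<^bsub>M\<^esub> x \<in> H"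
  shows "submodule H R M"
proof -
  interpret module R M by fact
  show ?thesis
  proof (rule submoduleI)
    fix a assume a: "a \<in> H"
    then have "(\<ominus>\<^bsub>R\<^esub> \<one>\<^bsub>R\<^esub>) \<odot>\<^bsub>M\<^esub> a \<in> H" using assms(5) by auto
    moreover have "a \<in> carrier M" using a assms(2) by auto
    ultimately show "\<ominus>\<^bsub>M\<^esub> a \<in> H" by (simp add: smult_l_minus)
  qed (use assms in auto)
qed

lemma module_submodule: "module R M \<Longrightarrow> submodule H R M \<Longrightarrow> module R (M\<lparr>carrier := H\<rparr>)"
  by (rule submodule.submodule_is_module)

lemma module_hom_kernel_submodule:
  assumes "module R M" "module R N" "h \<in> module_hom R M N"
  shows "submodule {x \<in> carrier M. h x = \<zero>\<^bsub>N\<^esub>} R M"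
proof -
  interpret M: module R M by fact
  interpret N: module R N by fact
  show ?thesis
    by (rule submoduleI'[OF assms(1)])
      (auto simp: module_hom_zero[OF assms] module_hom_add[OF assms(3)] module_hom_smult[OF assms(3)])
qed

lemma submodule_span_superset: "U \<subseteq> submodule_span R M U"
  unfolding submodule_span_def by auto

lemma submodule_span_least: "submodule H R M \<Longrightarrow> U \<subseteq> H \<Longrightarrow> submodule_span R M U \<subseteq> H"
  unfolding submodule_span_def by auto

lemma submodule_span_submodule:
  assumes "module R M" "U \<subseteq> carrier M"
  shows "submodule (submodule_span R M U) R M"
proof -
  interpret module R M by fact
  show ?thesis
  proof (rule submoduleI'[OF assms(1)])
    show "submodule_span R M U \<subseteq> carrier M"
      by (rule submodule_span_least[OF carrier_is_submodule assms(2)])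
  qed (auto simp: submodule_span_def intro: submodule_zero submodule_add submodule_smult)
qed

lemma module_hom_finsum:
  assumes "module R M" "module R N" "h \<in> module_hom R M N" "f \<in> A \<rightarrow> carrier M"
  shows "h (finsum M f A) = finsum N (\<lambda>a. h (f a)) A"
proof -
  interpret M: module R M by fact
  interpret N: module R N by fact
  show ?thesis using assms(4)
  proof (induction A rule: infinite_finite_induct)
    case (infinite A)
    then show ?case by (simp add: M.finsum_infinite N.finsum_infinite module_hom_zero[OF assms(1-3)])
  next
    case empty
    then show ?case by (simp add: module_hom_zero[OF assms(1-3)])
  next
    case (insert a A)
    have "(\<lambda>a. h (f a)) \<in> A \<rightarrow> carrier N" "h (f a) \<in> carrier N"
      using insert.prems module_hom_closed[OF assms(3)] by auto
    then show ?case using insert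
      by (simp add: module_hom_add[OF assms(3)] Pi_iff)
  qed
qed

subsection \<open>Additive spans\<close>

text \<open>\<open>submodule_span\<close> is an intersection and offers no induction. When the
  generators are stable under scalars, their sums already form a submodule, so this additive closure
  serves as the span and comes with an induction that adds one generator at a time.\<close>

inductive_set add_span :: "('r, 'm) module \<Rightarrow> 'm set \<Rightarrow> 'm set" for Y G where
  zero: "\<zero>\<^bsub>Y\<^esub> \<in> add_span Y G"
| add: "y \<in> add_span Y G \<Longrightarrow> g \<in> G \<Longrightarrow> y \<oplus>\<^bsub>Y\<^esub> g \<in> add_span Y G"

lemma add_span_carrier:
  assumes "abelian_group Y" "G \<subseteq> carrier Y" "y \<in> add_span Y G"
  shows "y \<in> carrier Y"
proof -
  interpret abelian_group Y by fact
  from assms(3) show ?thesis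
    by induction (use assms(2) in auto)
qed

lemma add_span_base:
  assumes "abelian_group Y" "G \<subseteq> carrier Y" "g \<in> G"
  shows "g \<in> add_span Y G"
proof -
  interpret abelian_group Y by fact
  show ?thesis using add_span.add[OF add_span.zero assms(3), of Y] assms(2,3) by auto
qed

lemma add_span_plus:
  assumes "abelian_group Y" "G \<subseteq> carrier Y" "x \<in> add_span Y G" "y \<in> add_span Y G"
  shows "x \<oplus>\<^bsub>Y\<^esub> y \<in> add_span Y G"
proof -
  interpret abelian_group Y by fact
  note car = add_span_carrier[OF assms(1,2)]
  from assms(4) show ?thesis
  proof induction
    case zero
    then show ?case using assms(3) car by simp
  next
    case (add y g)
    have "x \<oplus>\<^bsub>Y\<^esub> (y \<oplus>\<^bsub>Y\<^esub> g) = (x \<oplus>\<^bsub>Y\<^esub> y) \<oplus>\<^bsub>Y\<^esub> g"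
      using add assms(2,3) car by (intro a_assoc[symmetric]) auto
    then show ?case using add_span.add[OF add.IH add.hyps(2)] by simp
  qed
qed

lemma add_span_submodule:
  assumes "module R Y" "G \<subseteq> carrier Y"
    and sm: "\<And>r g. r \<in> carrier R \<Longrightarrow> g \<in> G \<Longrightarrow> r \<odot>\<^bsub>Y\<^esub> g \<in> G"
  shows "submodule (add_span Y G) R Y"
proof -
  interpret module R Y by fact
  note ag = module_abelian_group[OF assms(1)]
  note car = add_span_carrier[OF ag assms(2)]
  show ?thesis
  proof (rule submoduleI'[OF assms(1)])
    fix r y assume r: "r \<in> carrier R" and "y \<in> add_span Y G"
    from this(2) show "r \<odot>\<^bsub>Y\<^esub> y \<in> add_span Y G"
    proof induction
      case (add y g)
      have "y \<in> carrier Y" "g \<in> carrier Y" using add car assms(2) by auto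
      then show ?case using add_span.add[OF add.IH sm[OF r add.hyps(2)]] r by (simp add: smult_r_distr)
    qed (use r add_span.zero in auto)
  qed (auto intro: add_span.zero add_span_plus[OF ag assms(2)] car)
qed

lemma add_span_mono:
  assumes "y \<in> add_span Y G" "G \<subseteq> G'"
  shows "y \<in> add_span Y G'"
  using assms by induction (auto intro: add_span.intros)

lemma add_span_least:
  assumes "y \<in> add_span Y G" "submodule H R Y" "G \<subseteq> H"
  shows "y \<in> H"
  using assms by induction (auto intro: submodule_zero submodule_add)

lemma add_span_image:
  assumes "module R Y" "module R Y'" "h \<in> module_hom R Y Y'" "G \<subseteq> carrier Y" "G' \<subseteq> carrier Y'"
    and "\<And>g. g \<in> G \<Longrightarrow> h g \<in> add_span Y' G'" and "y \<in> add_span Y G"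
  shows "h y \<in> add_span Y' G'"
proof -
  interpret Y: module R Y by fact
  interpret Y': module R Y' by fact
  from assms(7) show ?thesis
  proof induction
    case zero
    then show ?case by (simp add: module_hom_zero[OF assms(1-3)] add_span.zero)
  next
    case (add y g)
    then show ?case
      using add_span_carrier[OF module_abelian_group[OF assms(1)] assms(4)] assms(4,6)
        add_span_plus[OF module_abelian_group[OF assms(2)] assms(5)]
      by (auto simp: module_hom_add[OF assms(3)])
  qed
qed

subsection \<open>Quotients\<close>

lemma submodule_abelian_subgroup:
  assumes "module R M" "submodule H R M"
  shows "abelian_subgroup H M"
proof -
  interpret M: module R M by fact
  show ?thesis
    by (intro abelian_subgroupI3 additive_subgroupI submodule.axioms(1)[OF assms(2)] module_abelian_group[OF assms(1)])
qed

lemma quotient_simps: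
  "carrier (quotient_module M H) = a_rcosets\<^bsub>M\<^esub> H" "add (quotient_module M H) = set_add M"
  "\<zero>\<^bsub>quotient_module M H\<^esub> = H"
  unfolding quotient_module_def by auto

lemma quotient_carrierE:
  assumes "U \<in> carrier (quotient_module M H)"
  obtains x where "x \<in> carrier M" "U = H +>\<^bsub>M\<^esub> x"
  using assms unfolding quotient_simps A_RCOSETS_def' by auto

context
  fixes R :: "('r, 'x) ring_scheme" and M :: "('r, 'm) module" and H
  assumes M: "module R M" and H: "submodule H R M"
begin

interpretation M: module R M by (fact M)
interpretation AS: abelian_subgroup H M by (rule submodule_abelian_subgroup[OF M H])

lemma quotient_class_carrier: "x \<in> carrier M \<Longrightarrow> H +>\<^bsub>M\<^esub> x \<in> carrier (quotient_module M H)"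
  unfolding quotient_simps A_RCOSETS_def' by auto

lemma quotient_class_add:
  "x \<in> carrier M \<Longrightarrow> y \<in> carrier M \<Longrightarrow>
    (H +>\<^bsub>M\<^esub> x) \<oplus>\<^bsub>quotient_module M H\<^esub> (H +>\<^bsub>M\<^esub> y) = H +>\<^bsub>M\<^esub> (x \<oplus>\<^bsub>M\<^esub> y)"
  unfolding quotient_simps by (rule AS.a_rcos_sum)

lemma quotient_class_eq_iff:
  assumes "x \<in> carrier M" "y \<in> carrier M"
  shows "H +>\<^bsub>M\<^esub> x = H +>\<^bsub>M\<^esub> y \<longleftrightarrow> x \<ominus>\<^bsub>M\<^esub> y \<in> H"
proof -
  have "H +>\<^bsub>M\<^esub> x = H +>\<^bsub>M\<^esub> y \<longleftrightarrow> x \<in> H +>\<^bsub>M\<^esub> y"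
    using AS.a_repr_independence'[of x y] AS.a_rcos_self[OF assms(1)] assms by blast
  also have "\<dots> \<longleftrightarrow> x \<ominus>\<^bsub>M\<^esub> y \<in> H"
    using AS.a_rcos_module[OF assms(2,1)] by (simp add: a_minus_def)
  finally show ?thesis .
qed

text \<open>The union in \<open>quotient_module\<close> runs over the representatives of one class,
  and all its members are the same coset.\<close>

lemma quotient_class_smult:
  assumes r: "r \<in> carrier R" and x: "x \<in> carrier M"
  shows "r \<odot>\<^bsub>quotient_module M H\<^esub> (H +>\<^bsub>M\<^esub> x) = H +>\<^bsub>M\<^esub> (r \<odot>\<^bsub>M\<^esub> x)"
proof -
  have "H +>\<^bsub>M\<^esub> (r \<odot>\<^bsub>M\<^esub> y) = H +>\<^bsub>M\<^esub> (r \<odot>\<^bsub>M\<^esub> x)" if y: "y \<in> H +>\<^bsub>M\<^esub> x" for y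
  proof -
    have yc: "y \<in> carrier M" using y x AS.a_elemrcos_carrier by auto
    have "H +>\<^bsub>M\<^esub> y = H +>\<^bsub>M\<^esub> x" using AS.a_repr_independence' y x by auto
    then have "y \<ominus>\<^bsub>M\<^esub> x \<in> H" using quotient_class_eq_iff yc x by simp
    then have "r \<odot>\<^bsub>M\<^esub> (y \<ominus>\<^bsub>M\<^esub> x) \<in> H" by (rule submodule_smult[OF H r])
    moreover have "r \<odot>\<^bsub>M\<^esub> (y \<ominus>\<^bsub>M\<^esub> x) = r \<odot>\<^bsub>M\<^esub> y \<ominus>\<^bsub>M\<^esub> r \<odot>\<^bsub>M\<^esub> x"
      using r x yc by (simp add: a_minus_def M.smult_r_distr M.smult_r_minus)
    ultimately show ?thesis using quotient_class_eq_iff r x yc by simp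
  qed
  moreover have "x \<in> H +>\<^bsub>M\<^esub> x" using x by (rule AS.a_rcos_self)
  ultimately have "(\<Union>y\<in>H +>\<^bsub>M\<^esub> x. H +>\<^bsub>M\<^esub> (r \<odot>\<^bsub>M\<^esub> y)) = (\<Union>y\<in>H +>\<^bsub>M\<^esub> x. H +>\<^bsub>M\<^esub> (r \<odot>\<^bsub>M\<^esub> x))"
    by (intro SUP_cong refl)
  also have "\<dots> = H +>\<^bsub>M\<^esub> (r \<odot>\<^bsub>M\<^esub> x)"
    using \<open>x \<in> H +>\<^bsub>M\<^esub> x\<close> by (simp only: UN_constant) auto
  finally show ?thesis by (simp add: quotient_module_def)
qed

lemma quotient_class_zero: "H +>\<^bsub>M\<^esub> \<zero>\<^bsub>M\<^esub> = \<zero>\<^bsub>quotient_module M H\<^esub>"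
  using AS.a_subset by (simp add: quotient_simps)

lemma quotient_module: "module R (quotient_module M H)"
proof (rule moduleI)
  show "cring R" by (rule M.R.is_cring)
  show "abelian_group (quotient_module M H)"
  proof (rule abelian_groupI)
    show "\<zero>\<^bsub>quotient_module M H\<^esub> \<in> carrier (quotient_module M H)"
      using quotient_class_carrier[OF M.zero_closed] by (simp add: quotient_class_zero)
  next
    fix U assume "U \<in> carrier (quotient_module M H)"
    then obtain x where x: "x \<in> carrier M" "U = H +>\<^bsub>M\<^esub> x" by (rule quotient_carrierE)
    show "\<zero>\<^bsub>quotient_module M H\<^esub> \<oplus>\<^bsub>quotient_module M H\<^esub> U = U"
      using x quotient_class_add[OF M.zero_closed x(1)] by (simp add: quotient_class_zero)
    have "(H +>\<^bsub>M\<^esub> (\<ominus>\<^bsub>M\<^esub> x)) \<oplus>\<^bsub>quotient_module M H\<^esub> U = \<zero>\<^bsub>quotient_module M H\<^esub>"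
      using x by (simp add: quotient_class_add M.l_neg quotient_class_zero)
    then show "\<exists>y\<in>carrier (quotient_module M H).
        y \<oplus>\<^bsub>quotient_module M H\<^esub> U = \<zero>\<^bsub>quotient_module M H\<^esub>"
      using quotient_class_carrier x(1) by blast
  qed (auto elim!: quotient_carrierE
      simp: quotient_class_carrier quotient_class_add M.a_assoc M.a_comm M.a_lcomm)
qed (auto elim!: quotient_carrierE
      simp: quotient_class_carrier quotient_class_add quotient_class_smult M.smult_l_distr M.smult_r_distr M.smult_assoc1)

lemma quotient_class_hom: "(\<lambda>x. H +>\<^bsub>M\<^esub> x) \<in> module_hom R M (quotient_module M H)"
  by (rule module_homI) (simp_all add: quotient_class_carrier quotient_class_add quotient_class_smult)

lemma quotient_class_zero_iff: "x \<in> carrier M \<Longrightarrow> H +>\<^bsub>M\<^esub> x = \<zero>\<^bsub>quotient_module M H\<^esub> \<longleftrightarrow> x \<in> H"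
  using quotient_class_eq_iff[OF _ M.zero_closed, of x]
  by (simp add: quotient_class_zero M.minus_zero_right)

end

section \<open>Free modules, the universal property of the tensor product, and multilinear maps
  lifted in stages\<close>

section \<open>Tensor products\<close>

context
  fixes R :: "('r, 'x) ring_scheme" and B :: "'b set"
  assumes R: "cring R"
begin

interpretation R: cring R by (fact R)

lemma free_module: "module R (free_module R B)"
proof (rule moduleI)
  show "cring R" by (fact R)
  have fin_add: "finite {b. f b \<oplus>\<^bsub>R\<^esub> g b \<noteq> \<zero>\<^bsub>R\<^esub>}"
    if "finite {b. f b \<noteq> \<zero>\<^bsub>R\<^esub>}" "finite {b. g b \<noteq> \<zero>\<^bsub>R\<^esub>}" for f g :: "'b \<Rightarrow> 'r"
    by (rule finite_subset[OF _ finite_UnI[OF that]]) auto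
  have fin_smult: "finite {b. r \<otimes>\<^bsub>R\<^esub> f b \<noteq> \<zero>\<^bsub>R\<^esub>}"
    if "r \<in> carrier R" "finite {b. f b \<noteq> \<zero>\<^bsub>R\<^esub>}" for f :: "'b \<Rightarrow> 'r" and r
    by (rule finite_subset[OF _ that(2)]) (use that in auto)
  have car: "f b \<in> carrier R" if "f \<in> carrier (free_module R B)" for f and b :: 'b
    using that by (cases "b \<in> B") (auto simp: free_module_def)
  show "abelian_group (free_module R B)"
  proof (rule abelian_groupI)
    fix f assume f: "f \<in> carrier (free_module R B)"
    define g where "g = (\<lambda>b. (\<ominus>\<^bsub>R\<^esub> \<one>\<^bsub>R\<^esub>) \<otimes>\<^bsub>R\<^esub> f b)"
    have "finite {b. g b \<noteq> \<zero>\<^bsub>R\<^esub>}"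
      unfolding g_def by (rule fin_smult) (use f in \<open>auto simp: free_module_def\<close>)
    then have "g \<in> carrier (free_module R B)"
      unfolding g_def using f car[OF f] by (auto simp: free_module_def)
    moreover have "g \<oplus>\<^bsub>free_module R B\<^esub> f = \<zero>\<^bsub>free_module R B\<^esub>"
      using car[OF f] by (auto simp: free_module_def g_def R.l_minus R.l_neg)
    ultimately show "\<exists>g\<in>carrier (free_module R B). g \<oplus>\<^bsub>free_module R B\<^esub> f = \<zero>\<^bsub>free_module R B\<^esub>"
      by blast
  next
    fix f g assume fg: "f \<in> carrier (free_module R B)" "g \<in> carrier (free_module R B)"
    then show "f \<oplus>\<^bsub>free_module R B\<^esub> g \<in> carrier (free_module R B)"
      using car[OF fg(1)] car[OF fg(2)] fin_add[of f g] by (auto simp: free_module_def)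
    show "f \<oplus>\<^bsub>free_module R B\<^esub> g = g \<oplus>\<^bsub>free_module R B\<^esub> f"
      using car[OF fg(1)] car[OF fg(2)] by (auto simp: free_module_def R.a_comm)
  next
    fix f g h assume fgh: "f \<in> carrier (free_module R B)" "g \<in> carrier (free_module R B)"
      "h \<in> carrier (free_module R B)"
    show "(f \<oplus>\<^bsub>free_module R B\<^esub> g) \<oplus>\<^bsub>free_module R B\<^esub> h = f \<oplus>\<^bsub>free_module R B\<^esub> (g \<oplus>\<^bsub>free_module R B\<^esub> h)"
      using car[OF fgh(1)] car[OF fgh(2)] car[OF fgh(3)] by (auto simp: free_module_def R.a_assoc)
  next
    fix f assume "f \<in> carrier (free_module R B)"
    then show "\<zero>\<^bsub>free_module R B\<^esub> \<oplus>\<^bsub>free_module R B\<^esub> f = f"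
      using car[of f] by (auto simp: free_module_def)
  qed (auto simp: free_module_def)
  fix f assume f: "f \<in> carrier (free_module R B)"
  show "\<one>\<^bsub>R\<^esub> \<odot>\<^bsub>free_module R B\<^esub> f = f"
    using car[OF f] by (simp add: free_module_def)
  fix r assume r: "r \<in> carrier R"
  show "r \<odot>\<^bsub>free_module R B\<^esub> f \<in> carrier (free_module R B)"
    using f fin_smult[OF r] car[OF f] r by (auto simp: free_module_def)
  fix s assume s: "s \<in> carrier R"
  show "(r \<oplus>\<^bsub>R\<^esub> s) \<odot>\<^bsub>free_module R B\<^esub> f =
      r \<odot>\<^bsub>free_module R B\<^esub> f \<oplus>\<^bsub>free_module R B\<^esub> s \<odot>\<^bsub>free_module R B\<^esub> f"
    using car[OF f] r s by (auto simp: free_module_def R.l_distr)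
  show "(r \<otimes>\<^bsub>R\<^esub> s) \<odot>\<^bsub>free_module R B\<^esub> f = r \<odot>\<^bsub>free_module R B\<^esub> (s \<odot>\<^bsub>free_module R B\<^esub> f)"
    using car[OF f] r s by (auto simp: free_module_def R.m_assoc)
next
  fix r f g assume "r \<in> carrier R" "f \<in> carrier (free_module R B)" "g \<in> carrier (free_module R B)"
  then show "r \<odot>\<^bsub>free_module R B\<^esub> (f \<oplus>\<^bsub>free_module R B\<^esub> g) =
      r \<odot>\<^bsub>free_module R B\<^esub> f \<oplus>\<^bsub>free_module R B\<^esub> r \<odot>\<^bsub>free_module R B\<^esub> g"
    by (auto simp: free_module_def Pi_iff fun_eq_iff R.r_distr) (metis R.r_distr R.zero_closed)
qed

lemma free_module_value: "f \<in> carrier (free_module R B) \<Longrightarrow> f b \<in> carrier R"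
  by (cases "b \<in> B") (auto simp: free_module_def)

lemma free_basis_carrier: "b \<in> B \<Longrightarrow> free_basis R b \<in> carrier (free_module R B)"
  by (auto simp: free_module_def free_basis_def intro: finite_subset[of _ "{b}"])

text \<open>Induction on the support: replacing the value at one point by zero removes that point
  and splits off a multiple of a basis element.\<close>

lemma free_module_induct [consumes 1, case_names zero add]:
  assumes "f \<in> carrier (free_module R B)"
    and "Q \<zero>\<^bsub>free_module R B\<^esub>"
    and "\<And>f r b. f \<in> carrier (free_module R B) \<Longrightarrow> Q f \<Longrightarrow> r \<in> carrier R \<Longrightarrow> b \<in> B \<Longrightarrow>
      Q (f \<oplus>\<^bsub>free_module R B\<^esub> r \<odot>\<^bsub>free_module R B\<^esub> free_basis R b)"
  shows "Q f"
proof -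
  have "finite A \<Longrightarrow> f \<in> carrier (free_module R B) \<Longrightarrow> {b. f b \<noteq> \<zero>\<^bsub>R\<^esub>} = A \<Longrightarrow> Q f" for A f
  proof (induction A arbitrary: f rule: finite_induct)
    case empty
    then have "f = \<zero>\<^bsub>free_module R B\<^esub>" by (auto simp: free_module_def)
    then show ?case using assms(2) by simp
  next
    case (insert b A)
    have b: "b \<in> B" using insert.prems by (auto simp: free_module_def)
    define g where "g = (\<lambda>c. if c = b then \<zero>\<^bsub>R\<^esub> else f c)"
    have supp: "{c. g c \<noteq> \<zero>\<^bsub>R\<^esub>} = A" using insert.prems(2) insert.hyps(2) by (auto simp: g_def)
    have gc: "g \<in> carrier (free_module R B)"
      using insert.prems(1) supp insert.hyps(1) by (auto simp: free_module_def g_def)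
    have fb: "f b \<in> carrier R" using free_module_value insert.prems(1) .
    have "f = g \<oplus>\<^bsub>free_module R B\<^esub> f b \<odot>\<^bsub>free_module R B\<^esub> free_basis R b"
      using free_module_value[OF insert.prems(1)]
      by (auto simp: free_module_def g_def free_basis_def fun_eq_iff)
    then show ?case using assms(3)[OF gc insert.IH[OF gc supp] fb b] by simp
  qed
  then show ?thesis using assms(1) by (auto simp: free_module_def)
qed

text \<open>This is the sum that \<open>tensor_lift\<close> evaluates at each representative; its
  linearity is established on the free module, before passing to the quotient.\<close>

definition lin_ext :: "('r, 'p) module \<Rightarrow> ('b \<Rightarrow> 'p) \<Rightarrow> ('b \<Rightarrow> 'r) \<Rightarrow> 'p" where
  "lin_ext P \<gamma> x = (\<Oplus>\<^bsub>P\<^esub>p\<in>{p. x p \<noteq> \<zero>\<^bsub>R\<^esub>}. x p \<odot>\<^bsub>P\<^esub> \<gamma> p)"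

text \<open>Additivity requires sums over a common finite set, since the support of a sum need not
  be the union of the supports.\<close>

lemma lin_ext_superset:
  assumes P: "module R P" and \<gamma>: "\<gamma> \<in> B \<rightarrow> carrier P" and x: "x \<in> carrier (free_module R B)"
    and A: "finite A" "A \<subseteq> B" "{p. x p \<noteq> \<zero>\<^bsub>R\<^esub>} \<subseteq> A"
  shows "lin_ext P \<gamma> x = (\<Oplus>\<^bsub>P\<^esub>p\<in>A. x p \<odot>\<^bsub>P\<^esub> \<gamma> p)"
proof -
  interpret P: module R P by fact
  show ?thesis unfolding lin_ext_def
    by (rule P.add.finprod_mono_neutral_cong_left)
      (use A \<gamma> free_module_value[OF x] in \<open>auto simp: Pi_iff subset_iff\<close>)
qed

lemma lin_ext_hom:
  assumes P: "module R P" and \<gamma>: "\<gamma> \<in> B \<rightarrow> carrier P"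
  shows "lin_ext P \<gamma> \<in> module_hom R (free_module R B) P"
proof -
  interpret P: module R P by fact
  interpret F: module R "free_module R B" by (rule free_module)
  let ?s = "\<lambda>x. {p. x p \<noteq> \<zero>\<^bsub>R\<^esub>}"
  have s: "finite (?s x)" "?s x \<subseteq> B" if "x \<in> carrier (free_module R B)" for x
    using that by (auto simp: free_module_def)
  have cl: "(\<lambda>p. x p \<odot>\<^bsub>P\<^esub> \<gamma> p) \<in> A \<rightarrow> carrier P" if "x \<in> carrier (free_module R B)" "A \<subseteq> B" for x A
    using free_module_value[OF that(1)] that(2) \<gamma> by (auto simp: Pi_iff subset_iff)
  show ?thesis
  proof (rule module_homI)
    fix x assume x: "x \<in> carrier (free_module R B)"
    show "lin_ext P \<gamma> x \<in> carrier P"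
      unfolding lin_ext_def by (rule P.finsum_closed[OF cl[OF x s(2)[OF x]]])
    fix r assume r: "r \<in> carrier R"
    have rx: "r \<odot>\<^bsub>free_module R B\<^esub> x \<in> carrier (free_module R B)" using r x by simp
    have "lin_ext P \<gamma> (r \<odot>\<^bsub>free_module R B\<^esub> x) =
        (\<Oplus>\<^bsub>P\<^esub>p\<in>?s x. (r \<odot>\<^bsub>free_module R B\<^esub> x) p \<odot>\<^bsub>P\<^esub> \<gamma> p)"
      by (rule lin_ext_superset[OF P \<gamma> rx s[OF x]]) (use r in \<open>auto simp: free_module_def\<close>)
    also have "\<dots> = (\<Oplus>\<^bsub>P\<^esub>p\<in>?s x. r \<odot>\<^bsub>P\<^esub> (x p \<odot>\<^bsub>P\<^esub> \<gamma> p))"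
    proof (rule P.finsum_cong')
      fix p assume "p \<in> ?s x"
      then have "p \<in> B" using s(2)[OF x] by auto
      then have "\<gamma> p \<in> carrier P" using \<gamma> by auto
      then show "(r \<odot>\<^bsub>free_module R B\<^esub> x) p \<odot>\<^bsub>P\<^esub> \<gamma> p = r \<odot>\<^bsub>P\<^esub> (x p \<odot>\<^bsub>P\<^esub> \<gamma> p)"
        using r free_module_value[OF x] by (auto simp: free_module_def P.smult_assoc1)
    qed (use cl[OF x s(2)[OF x]] r in \<open>auto simp: Pi_iff\<close>)
    also have "\<dots> = r \<odot>\<^bsub>P\<^esub> lin_ext P \<gamma> x"
      unfolding lin_ext_def
      by (rule P.finsum_smult_ldistr[symmetric, OF s(1)[OF x] r cl[OF x s(2)[OF x]]])
    finally show "lin_ext P \<gamma> (r \<odot>\<^bsub>free_module R B\<^esub> x) = r \<odot>\<^bsub>P\<^esub> lin_ext P \<gamma> x" .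
  next
    fix x y assume x: "x \<in> carrier (free_module R B)" and y: "y \<in> carrier (free_module R B)"
    have xy: "x \<oplus>\<^bsub>free_module R B\<^esub> y \<in> carrier (free_module R B)" using x y by simp
    let ?A = "?s x \<union> ?s y"
    have A: "finite ?A" "?A \<subseteq> B" using s[OF x] s[OF y] by auto
    have "lin_ext P \<gamma> (x \<oplus>\<^bsub>free_module R B\<^esub> y) =
        (\<Oplus>\<^bsub>P\<^esub>p\<in>?A. (x \<oplus>\<^bsub>free_module R B\<^esub> y) p \<odot>\<^bsub>P\<^esub> \<gamma> p)"
      by (rule lin_ext_superset[OF P \<gamma> xy A]) (auto simp: free_module_def)
    also have "\<dots> = (\<Oplus>\<^bsub>P\<^esub>p\<in>?A. x p \<odot>\<^bsub>P\<^esub> \<gamma> p \<oplus>\<^bsub>P\<^esub> y p \<odot>\<^bsub>P\<^esub> \<gamma> p)"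
    proof (rule P.finsum_cong')
      fix p assume "p \<in> ?A"
      then have "p \<in> B" using A by auto
      then have "\<gamma> p \<in> carrier P" using \<gamma> by auto
      then show "(x \<oplus>\<^bsub>free_module R B\<^esub> y) p \<odot>\<^bsub>P\<^esub> \<gamma> p = x p \<odot>\<^bsub>P\<^esub> \<gamma> p \<oplus>\<^bsub>P\<^esub> y p \<odot>\<^bsub>P\<^esub> \<gamma> p"
        using free_module_value[OF x] free_module_value[OF y]
        by (auto simp: free_module_def P.smult_l_distr)
    qed (use cl[OF x A(2)] cl[OF y A(2)] in \<open>auto simp: Pi_iff\<close>)
    also have "\<dots> = lin_ext P \<gamma> x \<oplus>\<^bsub>P\<^esub> lin_ext P \<gamma> y"
      using lin_ext_superset[OF P \<gamma> x A] lin_ext_superset[OF P \<gamma> y A]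
        P.finsum_addf[OF cl[OF x A(2)] cl[OF y A(2)]] by auto
    finally show "lin_ext P \<gamma> (x \<oplus>\<^bsub>free_module R B\<^esub> y) = lin_ext P \<gamma> x \<oplus>\<^bsub>P\<^esub> lin_ext P \<gamma> y" .
  qed
qed

lemma lin_ext_basis:
  assumes P: "module R P" and \<gamma>: "\<gamma> \<in> B \<rightarrow> carrier P" and b: "b \<in> B"
  shows "lin_ext P \<gamma> (free_basis R b) = \<gamma> b"
proof -
  interpret P: module R P by fact
  have "lin_ext P \<gamma> (free_basis R b) = (\<Oplus>\<^bsub>P\<^esub>p\<in>{b}. free_basis R b p \<odot>\<^bsub>P\<^esub> \<gamma> p)"
    by (rule lin_ext_superset[OF P \<gamma> free_basis_carrier[OF b]]) (use b in \<open>auto simp: free_basis_def\<close>)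
  also have "\<dots> = \<gamma> b" using \<gamma> b by (simp add: free_basis_def Pi_iff)
  finally show ?thesis .
qed

end

definition bilinear ::
  "('r, 'x) ring_scheme \<Rightarrow> ('r, 'm) module \<Rightarrow> ('r, 'n) module \<Rightarrow> ('r, 'p) module \<Rightarrow> ('m \<Rightarrow> 'n \<Rightarrow> 'p) \<Rightarrow> bool"
  where "bilinear R M N P \<beta> \<longleftrightarrow>
    (\<forall>m \<in> carrier M. \<beta> m \<in> module_hom R N P) \<and>
    (\<forall>n \<in> carrier N. (\<lambda>m. \<beta> m n) \<in> module_hom R M P)"

definition trilinear ::
  "('r, 'x) ring_scheme \<Rightarrow> ('r, 'l) module \<Rightarrow> ('r, 'm) module \<Rightarrow> ('r, 'n) module \<Rightarrow> ('r, 'p) module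
    \<Rightarrow> ('l \<Rightarrow> 'm \<Rightarrow> 'n \<Rightarrow> 'p) \<Rightarrow> bool"
  where "trilinear R L M N P \<gamma> \<longleftrightarrow>
    (\<forall>l \<in> carrier L. \<forall>m \<in> carrier M. \<gamma> l m \<in> module_hom R N P) \<and>
    (\<forall>l \<in> carrier L. \<forall>n \<in> carrier N. (\<lambda>m. \<gamma> l m n) \<in> module_hom R M P) \<and>
    (\<forall>m \<in> carrier M. \<forall>n \<in> carrier N. (\<lambda>l. \<gamma> l m n) \<in> module_hom R L P)"

context
  fixes R :: "('r, 'x) ring_scheme" and M :: "('r, 'm) module" and N :: "('r, 'n) module"
  assumes M: "module R M" and N: "module R N"
begin

interpretation M: module R M by (fact M)
interpretation N: module R N by (fact N)

private abbreviation (input) "F \<equiv> free_module R (carrier M \<times> carrier N)"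
private abbreviation (input) "T \<equiv> tensor R M N"

lemma tensor_free: "module R F"
  by (rule free_module[OF M.R.is_cring])

interpretation F: module R F by (fact tensor_free)

lemma basis_carrier: "m \<in> carrier M \<Longrightarrow> n \<in> carrier N \<Longrightarrow> free_basis R (m, n) \<in> carrier F"
  by (rule free_basis_carrier[OF M.R.is_cring]) simp

lemma tensor_relations_carrier: "tensor_relations R M N \<subseteq> carrier F"
  unfolding tensor_relations_def Let_def
  by (auto intro!: F.minus_closed F.a_closed F.smult_closed basis_carrier)

lemma tensor_kernel_submodule: "submodule (tensor_kernel R M N) R F"
  unfolding tensor_kernel_def
  by (rule submodule_span_submodule[OF tensor_free tensor_relations_carrier])

lemma tensor_module: "module R T"
  unfolding tensor_def by (rule quotient_module[OF tensor_free tensor_kernel_submodule])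

interpretation T: module R T by (fact tensor_module)

private abbreviation (input) "cls \<equiv> (\<lambda>x. tensor_kernel R M N +>\<^bsub>F\<^esub> x)"

lemma tensor_class_hom: "cls \<in> module_hom R F T"
  unfolding tensor_def by (rule quotient_class_hom[OF tensor_free tensor_kernel_submodule])

lemma pure_class: "pure_tensor R M N m n = cls (free_basis R (m, n))"
  unfolding pure_tensor_def ..

lemma tensor_relation_eq:
  assumes "x \<in> carrier F" "y \<in> carrier F" "x \<ominus>\<^bsub>F\<^esub> y \<in> tensor_relations R M N"
  shows "cls x = cls y"
  unfolding quotient_class_eq_iff[OF tensor_free tensor_kernel_submodule assms(1,2)]
  using assms(3) submodule_span_superset unfolding tensor_kernel_def by fast

lemma pure_tensor_closed: "m \<in> carrier M \<Longrightarrow> n \<in> carrier N \<Longrightarrow> pure_tensor R M N m n \<in> carrier T"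
  unfolding pure_class by (rule module_hom_closed[OF tensor_class_hom basis_carrier])

lemma pure_tensor_bilinear: "bilinear R M N T (pure_tensor R M N)"
proof -
  have *: "cls (free_basis R p \<oplus>\<^bsub>F\<^esub> free_basis R q) = cls (free_basis R p) \<oplus>\<^bsub>T\<^esub> cls (free_basis R q)"
    if "free_basis R p \<in> carrier F" "free_basis R q \<in> carrier F" for p q
    using that by (rule module_hom_add[OF tensor_class_hom])
  have **: "cls (r \<odot>\<^bsub>F\<^esub> free_basis R p) = r \<odot>\<^bsub>T\<^esub> cls (free_basis R p)"
    if "r \<in> carrier R" "free_basis R p \<in> carrier F" for p r
    using that by (rule module_hom_smult[OF tensor_class_hom])
  show ?thesis unfolding bilinear_def
  proof (intro conjI ballI)
    fix m assume m: "m \<in> carrier M"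
    show "pure_tensor R M N m \<in> module_hom R N T"
    proof (rule module_homI)
      fix x y assume xy: "x \<in> carrier N" "y \<in> carrier N"
      have "cls (free_basis R (m, x \<oplus>\<^bsub>N\<^esub> y)) = cls (free_basis R (m, x) \<oplus>\<^bsub>F\<^esub> free_basis R (m, y))"
        by (rule tensor_relation_eq)
          (use m xy in \<open>auto intro!: basis_carrier simp: tensor_relations_def Let_def\<close>)
      then show "pure_tensor R M N m (x \<oplus>\<^bsub>N\<^esub> y) = pure_tensor R M N m x \<oplus>\<^bsub>T\<^esub> pure_tensor R M N m y"
        unfolding pure_class using * m xy basis_carrier by simp
    next
      fix r x assume rx: "r \<in> carrier R" "x \<in> carrier N"
      have "cls (free_basis R (m, r \<odot>\<^bsub>N\<^esub> x)) = cls (r \<odot>\<^bsub>F\<^esub> free_basis R (m, x))"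
        by (rule tensor_relation_eq)
          (use m rx in \<open>auto intro!: basis_carrier simp: tensor_relations_def Let_def\<close>)
      then show "pure_tensor R M N m (r \<odot>\<^bsub>N\<^esub> x) = r \<odot>\<^bsub>T\<^esub> pure_tensor R M N m x"
        unfolding pure_class using ** m rx basis_carrier by simp
    qed (use m pure_tensor_closed in auto)
  next
    fix n assume n: "n \<in> carrier N"
    show "(\<lambda>m. pure_tensor R M N m n) \<in> module_hom R M T"
    proof (rule module_homI)
      fix x y assume xy: "x \<in> carrier M" "y \<in> carrier M"
      have "cls (free_basis R (x \<oplus>\<^bsub>M\<^esub> y, n)) = cls (free_basis R (x, n) \<oplus>\<^bsub>F\<^esub> free_basis R (y, n))"
        by (rule tensor_relation_eq)
          (use n xy in \<open>auto intro!: basis_carrier simp: tensor_relations_def Let_def\<close>)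
      then show "pure_tensor R M N (x \<oplus>\<^bsub>M\<^esub> y) n = pure_tensor R M N x n \<oplus>\<^bsub>T\<^esub> pure_tensor R M N y n"
        unfolding pure_class using * n xy basis_carrier by simp
    next
      fix r x assume rx: "r \<in> carrier R" "x \<in> carrier M"
      have "cls (free_basis R (r \<odot>\<^bsub>M\<^esub> x, n)) = cls (r \<odot>\<^bsub>F\<^esub> free_basis R (x, n))"
        by (rule tensor_relation_eq)
          (use n rx in \<open>auto intro!: basis_carrier simp: tensor_relations_def Let_def\<close>)
      then show "pure_tensor R M N (r \<odot>\<^bsub>M\<^esub> x) n = r \<odot>\<^bsub>T\<^esub> pure_tensor R M N x n"
        unfolding pure_class using ** n rx basis_carrier by simp
    qed (use n pure_tensor_closed in auto)
  qed
qed

lemma pure_hom_right: "m \<in> carrier M \<Longrightarrow> pure_tensor R M N m \<in> module_hom R N T"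
  and pure_hom_left: "n \<in> carrier N \<Longrightarrow> (\<lambda>m. pure_tensor R M N m n) \<in> module_hom R M T"
  using pure_tensor_bilinear unfolding bilinear_def by auto

text \<open>A coefficient can be absorbed into the left factor,
  \<open>r (m \<otimes> n) = (r m) \<otimes> n\<close>, so sums of pure tensors without coefficients
  exhaust the tensor product.\<close>

lemma tensor_induct [consumes 1, case_names zero add]:
  assumes "y \<in> carrier T" "Q \<zero>\<^bsub>T\<^esub>"
    and "\<And>y m n. y \<in> carrier T \<Longrightarrow> Q y \<Longrightarrow> m \<in> carrier M \<Longrightarrow> n \<in> carrier N \<Longrightarrow>
      Q (y \<oplus>\<^bsub>T\<^esub> pure_tensor R M N m n)"
  shows "Q y"
proof -
  obtain x where x: "x \<in> carrier F" "y = cls x"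
    using assms(1) unfolding tensor_def by (rule quotient_carrierE)
  from x(1) have "Q (cls x)"
  proof (induction rule: free_module_induct[OF M.R.is_cring, consumes 1, case_names zero add])
    case zero
    then show ?case using assms(2) module_hom_zero[OF tensor_free tensor_module tensor_class_hom] by simp
  next
    case (add f r b)
    obtain m n where b: "b = (m, n)" "m \<in> carrier M" "n \<in> carrier N" using add by auto
    have bc: "free_basis R b \<in> carrier F" using b basis_carrier by simp
    have "cls (f \<oplus>\<^bsub>F\<^esub> r \<odot>\<^bsub>F\<^esub> free_basis R b) = cls f \<oplus>\<^bsub>T\<^esub> pure_tensor R M N (r \<odot>\<^bsub>M\<^esub> m) n"
      using add bc b module_hom_smult[OF pure_hom_left[OF b(3)], of r m]
      by (simp add: module_hom_add[OF tensor_class_hom] module_hom_smult[OF tensor_class_hom] pure_class)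
    then show ?case
      using assms(3)[of "cls f" "r \<odot>\<^bsub>M\<^esub> m" n] add b module_hom_closed[OF tensor_class_hom]
      by simp
  qed
  then show ?thesis using x by simp
qed

lemma tensor_hom_ext:
  assumes "module R P" "g \<in> module_hom R T P" "h \<in> module_hom R T P"
    and "\<And>m n. m \<in> carrier M \<Longrightarrow> n \<in> carrier N \<Longrightarrow> g (pure_tensor R M N m n) = h (pure_tensor R M N m n)"
    and "y \<in> carrier T"
  shows "g y = h y"
  using assms(5)
proof (induction rule: tensor_induct)
  case zero
  then show ?case
    using module_hom_zero[OF tensor_module assms(1,2)] module_hom_zero[OF tensor_module assms(1,3)] by simp
next
  case (add y m n)
  then show ?case
    using assms(4) pure_tensor_closed by (simp add: module_hom_add[OF assms(2)] module_hom_add[OF assms(3)])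
qed

context
  fixes P :: "('r, 'p) module" and \<beta>
  assumes P: "module R P" and \<beta>: "bilinear R M N P \<beta>"
begin

interpretation P: module R P by (fact P)

private abbreviation (input) "ext \<equiv> lin_ext R P (\<lambda>p. \<beta> (fst p) (snd p))"

lemma bilinear_range: "(\<lambda>p. \<beta> (fst p) (snd p)) \<in> carrier M \<times> carrier N \<rightarrow> carrier P"
  using \<beta> by (auto simp: bilinear_def module_hom_def Pi_iff)

lemma ext_hom: "ext \<in> module_hom R F P"
  by (rule lin_ext_hom[OF M.R.is_cring P bilinear_range])

lemma ext_basis: "m \<in> carrier M \<Longrightarrow> n \<in> carrier N \<Longrightarrow> ext (free_basis R (m, n)) = \<beta> m n"
  using lin_ext_basis[OF M.R.is_cring P bilinear_range, of "(m, n)"] by simp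

lemma ext_kernel: "x \<in> tensor_kernel R M N \<Longrightarrow> ext x = \<zero>\<^bsub>P\<^esub>"
proof -
  let ?K = "{x \<in> carrier F. ext x = \<zero>\<^bsub>P\<^esub>}"
  have \<beta>r: "\<beta> m \<in> module_hom R N P" if "m \<in> carrier M" for m
    using \<beta> that unfolding bilinear_def by auto
  have \<beta>l: "(\<lambda>m. \<beta> m n) \<in> module_hom R M P" if "n \<in> carrier N" for n
    using \<beta> that unfolding bilinear_def by auto
  have mc: "\<beta> m n \<in> carrier P" if "m \<in> carrier M" "n \<in> carrier N" for m n
    using module_hom_closed[OF \<beta>r] that .
  note simps = module_hom_minus[OF tensor_free P ext_hom] module_hom_add[OF ext_hom]
    module_hom_smult[OF ext_hom] ext_basis basis_carrier
    module_hom_add[OF \<beta>r] module_hom_smult[OF \<beta>r] module_hom_add[OF \<beta>l] module_hom_smult[OF \<beta>l]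
    P.minus_eq_zero_iff mc F.minus_closed
  have "tensor_relations R M N \<subseteq> ?K"
    unfolding tensor_relations_def Let_def by (auto simp: simps)
  then have "tensor_kernel R M N \<subseteq> ?K"
    unfolding tensor_kernel_def
    by (rule submodule_span_least[OF module_hom_kernel_submodule[OF tensor_free P ext_hom]])
  then show "x \<in> tensor_kernel R M N \<Longrightarrow> ext x = \<zero>\<^bsub>P\<^esub>" by auto
qed

text \<open>Representatives of one class differ by elements of the tensor kernel, on which the
  linear extension vanishes. The image set in \<open>tensor_lift\<close> is therefore a singleton
  and \<open>the_elem\<close> is legitimate.\<close>

lemma lift_class:
  assumes x: "x \<in> carrier F"
  shows "tensor_lift R P \<beta> (cls x) = ext x"
proof -
  interpret AS: abelian_subgroup "tensor_kernel R M N" F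
    by (rule submodule_abelian_subgroup[OF tensor_free tensor_kernel_submodule])
  have "ext y = ext x" if y: "y \<in> cls x" for y
  proof -
    have yc: "y \<in> carrier F" using AS.a_elemrcos_carrier[OF x y] .
    have "cls y = cls x" using AS.a_repr_independence'[OF y x] by simp
    then have "y \<ominus>\<^bsub>F\<^esub> x \<in> tensor_kernel R M N"
      using quotient_class_eq_iff[OF tensor_free tensor_kernel_submodule yc x] by simp
    then have "ext (y \<ominus>\<^bsub>F\<^esub> x) = \<zero>\<^bsub>P\<^esub>" by (rule ext_kernel)
    then show ?thesis
      using x yc module_hom_closed[OF ext_hom]
      by (simp add: module_hom_minus[OF tensor_free P ext_hom] P.minus_eq_zero_iff)
  qed
  moreover have "x \<in> cls x" by (rule AS.a_rcos_self[OF x])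
  ultimately have "ext ` cls x = {ext x}"
    by blast
  moreover have "tensor_lift R P \<beta> (cls x) = the_elem (ext ` cls x)"
    unfolding tensor_lift_def lin_ext_def[OF M.R.is_cring, abs_def] ..
  ultimately show ?thesis by (simp only: the_elem_eq)
qed

lemma tensor_lift_hom: "tensor_lift R P \<beta> \<in> module_hom R T P"
proof (rule module_homI)
  fix x y assume xy: "x \<in> carrier T" "y \<in> carrier T"
  obtain u where u: "u \<in> carrier F" "x = cls u"
    using xy(1) unfolding tensor_def by (rule quotient_carrierE)
  obtain v where v: "v \<in> carrier F" "y = cls v"
    using xy(2) unfolding tensor_def by (rule quotient_carrierE)
  note uv = u v
  have "x \<oplus>\<^bsub>T\<^esub> y = cls (u \<oplus>\<^bsub>F\<^esub> v)" using uv by (simp add: module_hom_add[OF tensor_class_hom])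
  then show "tensor_lift R P \<beta> (x \<oplus>\<^bsub>T\<^esub> y) = tensor_lift R P \<beta> x \<oplus>\<^bsub>P\<^esub> tensor_lift R P \<beta> y"
    using uv by (simp add: lift_class module_hom_add[OF ext_hom])
next
  fix r x assume rx: "r \<in> carrier R" "x \<in> carrier T"
  obtain u where u: "u \<in> carrier F" "x = cls u"
    using rx(2) unfolding tensor_def by (rule quotient_carrierE)
  have "r \<odot>\<^bsub>T\<^esub> x = cls (r \<odot>\<^bsub>F\<^esub> u)" using u rx by (simp add: module_hom_smult[OF tensor_class_hom])
  then show "tensor_lift R P \<beta> (r \<odot>\<^bsub>T\<^esub> x) = r \<odot>\<^bsub>P\<^esub> tensor_lift R P \<beta> x"
    using u rx by (simp add: lift_class module_hom_smult[OF ext_hom])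
next
  fix x assume "x \<in> carrier T"
  then obtain u where "u \<in> carrier F" "x = cls u"
    unfolding tensor_def by (rule quotient_carrierE)
  then show "tensor_lift R P \<beta> x \<in> carrier P"
    using module_hom_closed[OF ext_hom] by (simp add: lift_class)
qed

lemma tensor_lift_pure:
  "m \<in> carrier M \<Longrightarrow> n \<in> carrier N \<Longrightarrow> tensor_lift R P \<beta> (pure_tensor R M N m n) = \<beta> m n"
  unfolding pure_class by (simp add: lift_class basis_carrier ext_basis)

end

end

lemma bilinearI:
  assumes "\<And>m. m \<in> carrier M \<Longrightarrow> \<beta> m \<in> module_hom R N P"
    and "\<And>n. n \<in> carrier N \<Longrightarrow> (\<lambda>m. \<beta> m n) \<in> module_hom R M P"
  shows "bilinear R M N P \<beta>"
  using assms unfolding bilinear_def by auto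

context
  fixes R :: "('r, 'x) ring_scheme" and L :: "('r, 'l) module" and M :: "('r, 'm) module"
    and N :: "('r, 'n) module" and P :: "('r, 'p) module" and \<gamma>
  assumes L: "module R L" and M: "module R M" and N: "module R N" and P: "module R P"
    and \<gamma>: "trilinear R L M N P \<gamma>"
begin

interpretation P: module R P by (fact P)
interpretation L: module R L by (fact L)
interpretation N: module R N by (fact N)

lemma trilinear_bilinear_right: "l \<in> carrier L \<Longrightarrow> bilinear R M N P (\<gamma> l)"
  using \<gamma> unfolding trilinear_def bilinear_def by auto

lemma trilinear_bilinear_left: "n \<in> carrier N \<Longrightarrow> bilinear R L M P (\<lambda>l m. \<gamma> l m n)"
  using \<gamma> unfolding trilinear_def bilinear_def by auto

text \<open>For a fixed tensor \<open>y\<close>, linearity in \<open>l\<close> is an identity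
  between two homomorphisms evaluated at \<open>y\<close>, so it suffices to compare them on pure
  tensors. This is what makes maps out of iterated tensor products, such as
  \<open>base_change_distrib\<close>, well defined.\<close>

lemma nested_lift_right: "bilinear R L (tensor R M N) P (\<lambda>l. tensor_lift R P (\<gamma> l))"
proof (rule bilinearI)
  fix l assume "l \<in> carrier L"
  then show "tensor_lift R P (\<gamma> l) \<in> module_hom R (tensor R M N) P"
    by (intro tensor_lift_hom[OF M N P] trilinear_bilinear_right)
next
  fix y assume y: "y \<in> carrier (tensor R M N)"
  note hom = tensor_lift_hom[OF M N P trilinear_bilinear_right]
  note pure = tensor_lift_pure[OF M N P trilinear_bilinear_right]
  have h: "(\<lambda>l. \<gamma> l m n) \<in> module_hom R L P" if "m \<in> carrier M" "n \<in> carrier N" for m n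
    using \<gamma> that unfolding trilinear_def by auto
  show "(\<lambda>l. tensor_lift R P (\<gamma> l) y) \<in> module_hom R L P"
  proof (rule module_homI)
    fix l assume "l \<in> carrier L"
    then show "tensor_lift R P (\<gamma> l) y \<in> carrier P" using hom y by (blast intro: module_hom_closed)
  next
    fix k l assume kl: "k \<in> carrier L" "l \<in> carrier L"
    show "tensor_lift R P (\<gamma> (k \<oplus>\<^bsub>L\<^esub> l)) y = tensor_lift R P (\<gamma> k) y \<oplus>\<^bsub>P\<^esub> tensor_lift R P (\<gamma> l) y"
      by (rule tensor_hom_ext[OF M N P hom module_hom_plus[OF P hom hom] _ y])
        (use kl in \<open>auto simp: pure module_hom_add[OF h]\<close>)
  next
    fix r l assume rl: "r \<in> carrier R" "l \<in> carrier L"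
    show "tensor_lift R P (\<gamma> (r \<odot>\<^bsub>L\<^esub> l)) y = r \<odot>\<^bsub>P\<^esub> tensor_lift R P (\<gamma> l) y"
      by (rule tensor_hom_ext[OF M N P hom module_hom_scaled[OF P hom] _ y])
        (use rl in \<open>auto simp: pure module_hom_smult[OF h]\<close>)
  qed
qed

lemma nested_lift_left: "bilinear R (tensor R L M) N P (\<lambda>y n. tensor_lift R P (\<lambda>l m. \<gamma> l m n) y)"
proof (rule bilinearI)
  fix n assume "n \<in> carrier N"
  then show "(\<lambda>y. tensor_lift R P (\<lambda>l m. \<gamma> l m n) y) \<in> module_hom R (tensor R L M) P"
    by (intro tensor_lift_hom[OF L M P] trilinear_bilinear_left)
next
  fix y assume y: "y \<in> carrier (tensor R L M)"
  note hom = tensor_lift_hom[OF L M P trilinear_bilinear_left]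
  note pure = tensor_lift_pure[OF L M P trilinear_bilinear_left]
  have h: "\<gamma> l m \<in> module_hom R N P" if "l \<in> carrier L" "m \<in> carrier M" for l m
    using \<gamma> that unfolding trilinear_def by auto
  show "(\<lambda>n. tensor_lift R P (\<lambda>l m. \<gamma> l m n) y) \<in> module_hom R N P"
  proof (rule module_homI)
    fix n assume "n \<in> carrier N"
    then show "tensor_lift R P (\<lambda>l m. \<gamma> l m n) y \<in> carrier P" using hom y by (blast intro: module_hom_closed)
  next
    fix k n assume kn: "k \<in> carrier N" "n \<in> carrier N"
    show "tensor_lift R P (\<lambda>l m. \<gamma> l m (k \<oplus>\<^bsub>N\<^esub> n)) y =
        tensor_lift R P (\<lambda>l m. \<gamma> l m k) y \<oplus>\<^bsub>P\<^esub> tensor_lift R P (\<lambda>l m. \<gamma> l m n) y"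
      by (rule tensor_hom_ext[OF L M P hom module_hom_plus[OF P hom hom] _ y])
        (use kn in \<open>auto simp: pure module_hom_add[OF h]\<close>)
  next
    fix r n assume rn: "r \<in> carrier R" "n \<in> carrier N"
    show "tensor_lift R P (\<lambda>l m. \<gamma> l m (r \<odot>\<^bsub>N\<^esub> n)) y = r \<odot>\<^bsub>P\<^esub> tensor_lift R P (\<lambda>l m. \<gamma> l m n) y"
      by (rule tensor_hom_ext[OF L M P hom module_hom_scaled[OF P hom] _ y])
        (use rn in \<open>auto simp: pure module_hom_smult[OF h]\<close>)
  qed
qed

end

context
  fixes R :: "('r, 'x) ring_scheme" and M :: "('r, 'm) module" and N :: "('r, 'n) module"
    and M' :: "('r, 'k) module" and N' :: "('r, 'l) module" and f g
  assumes M: "module R M" and N: "module R N" and M': "module R M'" and N': "module R N'"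
    and f: "f \<in> module_hom R M M'" and g: "g \<in> module_hom R N N'"
begin

lemma tensor_map_bilinear: "bilinear R M N (tensor R M' N') (\<lambda>a b. pure_tensor R M' N' (f a) (g b))"
proof (rule bilinearI)
  fix m assume "m \<in> carrier M"
  then show "(\<lambda>n. pure_tensor R M' N' (f m) (g n)) \<in> module_hom R N (tensor R M' N')"
    by (intro module_hom_comp[OF pure_hom_right[OF M' N'] g] module_hom_closed[OF f])
next
  fix n assume "n \<in> carrier N"
  then show "(\<lambda>m. pure_tensor R M' N' (f m) (g n)) \<in> module_hom R M (tensor R M' N')"
    by (intro module_hom_comp[OF pure_hom_left[OF M' N'] f] module_hom_closed[OF g])
qed

lemma tensor_map_hom: "tensor_map R M' N' f g \<in> module_hom R (tensor R M N) (tensor R M' N')"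
  unfolding tensor_map_def
  by (rule tensor_lift_hom[OF M N tensor_module[OF M' N'] tensor_map_bilinear])

lemma tensor_map_pure:
  "m \<in> carrier M \<Longrightarrow> n \<in> carrier N \<Longrightarrow>
    tensor_map R M' N' f g (pure_tensor R M N m n) = pure_tensor R M' N' (f m) (g n)"
  unfolding tensor_map_def
  by (rule tensor_lift_pure[OF M N tensor_module[OF M' N'] tensor_map_bilinear])

end

section \<open>Function modules as systems of coordinates\<close>

section \<open>Modules of functions\<close>

text \<open>All functions on an index type, without a support condition: submodules belonging to
  different finite index sets then live in one ambient module, and finite support is imposed only
  where it matters.\<close>

definition function_module :: "('r, 'm) module \<Rightarrow> ('r, 'b \<Rightarrow> 'm) module" where
  "function_module M =
    \<lparr>carrier = {f. \<forall>b. f b \<in> carrier M}, monoid.mult = undefined, one = undefined,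
     ring.zero = (\<lambda>b. \<zero>\<^bsub>M\<^esub>), ring.add = (\<lambda>f g b. f b \<oplus>\<^bsub>M\<^esub> g b), smult = (\<lambda>r f b. r \<odot>\<^bsub>M\<^esub> f b)\<rparr>"

lemma function_simps [simp]:
  "f \<in> carrier (function_module M) \<longleftrightarrow> (\<forall>b. f b \<in> carrier M)"
  "\<zero>\<^bsub>function_module M\<^esub> = (\<lambda>b. \<zero>\<^bsub>M\<^esub>)"
  "f \<oplus>\<^bsub>function_module M\<^esub> g = (\<lambda>b. f b \<oplus>\<^bsub>M\<^esub> g b)"
  "r \<odot>\<^bsub>function_module M\<^esub> f = (\<lambda>b. r \<odot>\<^bsub>M\<^esub> f b)"
  unfolding function_module_def by auto

lemma function_module:
  assumes "module R M"
  shows "module R (function_module M)"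
proof -
  interpret M: module R M by fact
  show ?thesis
  proof (rule moduleI)
    show "abelian_group (function_module M :: ('a, 'd \<Rightarrow> 'c) module)"
    proof (rule abelian_groupI)
      fix f :: "'d \<Rightarrow> 'c" assume f: "f \<in> carrier (function_module M)"
      then have "(\<lambda>b. \<ominus>\<^bsub>M\<^esub> f b) \<in> carrier (function_module M)"
        "(\<lambda>b. \<ominus>\<^bsub>M\<^esub> f b) \<oplus>\<^bsub>function_module M\<^esub> f = \<zero>\<^bsub>function_module M\<^esub>"
        by (auto simp: M.l_neg)
      then show "\<exists>g\<in>carrier (function_module M). g \<oplus>\<^bsub>function_module M\<^esub> f = \<zero>\<^bsub>function_module M\<^esub>"
        by blast
    qed (auto simp: M.a_ac)
  qed (auto simp: M.smult_l_distr M.smult_r_distr M.smult_assoc1 M.R.is_cring)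
qed

lemma (in abelian_group) plus_minus_cancel:
  "x \<in> carrier G \<Longrightarrow> y \<in> carrier G \<Longrightarrow> (x \<oplus> y) \<ominus> y = x"
  by (simp add: a_minus_def a_assoc r_neg)

lemma function_minus:
  assumes "module R M" "f \<in> carrier (function_module M)" "g \<in> carrier (function_module M)"
  shows "f \<ominus>\<^bsub>function_module M\<^esub> g = (\<lambda>b. f b \<ominus>\<^bsub>M\<^esub> g b)"
proof -
  interpret M: module R M by fact
  interpret F: module R "function_module M" by (rule function_module[OF assms(1)])
  let ?d = "\<lambda>b. f b \<ominus>\<^bsub>M\<^esub> g b"
  have d: "?d \<in> carrier (function_module M)" "f = ?d \<oplus>\<^bsub>function_module M\<^esub> g"
    using assms by (auto simp: M.add_minus_cancel)
  show ?thesis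
    by (subst d(2)) (rule F.plus_minus_cancel[OF d(1) assms(3)])
qed

abbreviation coeff_functions :: "('r, 'x) ring_scheme \<Rightarrow> ('r, 'b \<Rightarrow> 'r) module" where
  "coeff_functions R \<equiv> function_module (regular_algebra R)"

lemma coeff_functions_module: "cring R \<Longrightarrow> module R (coeff_functions R)"
  by (intro function_module module_regular)

lemma coordinate_hom: "(\<lambda>f. f b) \<in> module_hom R (function_module L) L"
  by (rule module_homI) auto

lemma pointwise_hom:
  "h \<in> module_hom R L L' \<Longrightarrow> (\<lambda>f b. h (f b)) \<in> module_hom R (function_module L) (function_module L')"
  by (rule module_homI) (auto simp: module_hom_closed module_hom_add module_hom_smult)

lemma function_hom:
  assumes "\<And>b. h b \<in> module_hom R L Y"
  shows "(\<lambda>x b. h b x) \<in> module_hom R L (function_module Y)"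
  by (rule module_homI)
    (simp_all add: module_hom_closed[OF assms] module_hom_add[OF assms] module_hom_smult[OF assms])

lemma scale_hom:
  assumes "module R L" "x \<in> carrier L"
  shows "(\<lambda>r. r \<odot>\<^bsub>L\<^esub> x) \<in> module_hom R (regular_algebra R) L"
proof -
  interpret L: module R L by fact
  show ?thesis by (rule module_homI) (use assms(2) in \<open>auto simp: L.smult_l_distr L.smult_assoc1\<close>)
qed

lemma smult_hom:
  assumes "module R L" "r \<in> carrier R"
  shows "(\<lambda>x. r \<odot>\<^bsub>L\<^esub> x) \<in> module_hom R L L"
  by (rule module_hom_scaled[OF assms(1) module_hom_id assms(2)])

text \<open>Common source of linearity for the evaluation of relations \<open>\<Sum> q s s\<close>,
  for \<open>tensor_sum\<close>, and for the retractions \<open>\<Sum> \<rho> s f s\<close> used in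
  the descent from a field.\<close>

lemma finsum_coordinates_hom:
  fixes D :: "'s set"
  assumes "module R L" "module R P" "finite D" "\<And>s. s \<in> D \<Longrightarrow> h s \<in> module_hom R L P"
  shows "(\<lambda>f. \<Oplus>\<^bsub>P\<^esub>s\<in>D. h s (f s)) \<in> module_hom R (function_module L) P"
proof -
  interpret L: module R L by fact
  interpret P: module R P by fact
  have cl: "(\<lambda>s. h s (f s)) \<in> D \<rightarrow> carrier P" if "f \<in> carrier (function_module L)" for f
    using that assms(4) by (auto intro: module_hom_closed)
  show ?thesis
  proof (rule module_homI)
    fix f g :: "'s \<Rightarrow> _" assume f: "f \<in> carrier (function_module L)" and g: "g \<in> carrier (function_module L)"
    have "(\<Oplus>\<^bsub>P\<^esub>s\<in>D. h s ((f \<oplus>\<^bsub>function_module L\<^esub> g) s)) = (\<Oplus>\<^bsub>P\<^esub>s\<in>D. h s (f s) \<oplus>\<^bsub>P\<^esub> h s (g s))"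
      by (rule P.finsum_cong') (use f g cl[OF f] cl[OF g] in \<open>auto simp: module_hom_add[OF assms(4)]\<close>)
    also have "\<dots> = (\<Oplus>\<^bsub>P\<^esub>s\<in>D. h s (f s)) \<oplus>\<^bsub>P\<^esub> (\<Oplus>\<^bsub>P\<^esub>s\<in>D. h s (g s))"
      by (rule P.finsum_addf[OF cl[OF f] cl[OF g]])
    finally show "(\<Oplus>\<^bsub>P\<^esub>s\<in>D. h s ((f \<oplus>\<^bsub>function_module L\<^esub> g) s)) =
      (\<Oplus>\<^bsub>P\<^esub>s\<in>D. h s (f s)) \<oplus>\<^bsub>P\<^esub> (\<Oplus>\<^bsub>P\<^esub>s\<in>D. h s (g s))" .
  next
    fix r and f :: "'s \<Rightarrow> _" assume r: "r \<in> carrier R" and f: "f \<in> carrier (function_module L)"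
    have "(\<Oplus>\<^bsub>P\<^esub>s\<in>D. h s ((r \<odot>\<^bsub>function_module L\<^esub> f) s)) = (\<Oplus>\<^bsub>P\<^esub>s\<in>D. r \<odot>\<^bsub>P\<^esub> h s (f s))"
      by (rule P.finsum_cong') (use r f cl[OF f] in \<open>auto simp: module_hom_smult[OF assms(4)]\<close>)
    also have "\<dots> = r \<odot>\<^bsub>P\<^esub> (\<Oplus>\<^bsub>P\<^esub>s\<in>D. h s (f s))"
      by (rule P.finsum_smult_ldistr[symmetric, OF assms(3) r cl[OF f]])
    finally show "(\<Oplus>\<^bsub>P\<^esub>s\<in>D. h s ((r \<odot>\<^bsub>function_module L\<^esub> f) s)) = r \<odot>\<^bsub>P\<^esub> (\<Oplus>\<^bsub>P\<^esub>s\<in>D. h s (f s))" .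
  qed (rule P.finsum_closed[OF cl])
qed

text \<open>\<open>fun_span L H\<close> is the image of \<open>H \<otimes> L\<close> in the module of functions with values in \<open>L\<close>.\<close>

definition fun_span :: "('r, 'm) module \<Rightarrow> ('b \<Rightarrow> 'r) set \<Rightarrow> ('b \<Rightarrow> 'm) set" where
  "fun_span L H = add_span (function_module L) {\<lambda>b. h b \<odot>\<^bsub>L\<^esub> x | h x. h \<in> H \<and> x \<in> carrier L}"

context
  fixes R :: "('r, 'x) ring_scheme" and L :: "('r, 'm) module" and H :: "('b \<Rightarrow> 'r) set"
  assumes L: "module R L" and H: "H \<subseteq> carrier (coeff_functions R)"
begin

interpretation L: module R L by (fact L)

lemma fun_span_generators:
  "{\<lambda>b. h b \<odot>\<^bsub>L\<^esub> x | h x. h \<in> H \<and> x \<in> carrier L} \<subseteq> carrier (function_module L)"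
  using H by (auto intro!: L.smult_closed)

lemma fun_span_submodule: "submodule (fun_span L H) R (function_module L)"
  unfolding fun_span_def
proof (rule add_span_submodule[OF function_module[OF L] fun_span_generators])
  fix r and g :: "'b \<Rightarrow> 'm"
  assume r: "r \<in> carrier R" and "g \<in> {\<lambda>b. h b \<odot>\<^bsub>L\<^esub> x | h x. h \<in> H \<and> x \<in> carrier L}"
  then obtain h x where g: "g = (\<lambda>b. h b \<odot>\<^bsub>L\<^esub> x)" "h \<in> H" "x \<in> carrier L" by blast
  have "h b \<in> carrier R" for b using H g(2) by auto
  then have "r \<odot>\<^bsub>function_module L\<^esub> g = (\<lambda>b. h b \<odot>\<^bsub>L\<^esub> (r \<odot>\<^bsub>L\<^esub> x))"
    using g r by (auto simp: L.smult_assoc1[symmetric] L.m_comm)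
  then show "r \<odot>\<^bsub>function_module L\<^esub> g \<in> {\<lambda>b. h b \<odot>\<^bsub>L\<^esub> x | h x. h \<in> H \<and> x \<in> carrier L}"
    using g r by blast
qed

lemma fun_span_base: "h \<in> H \<Longrightarrow> x \<in> carrier L \<Longrightarrow> (\<lambda>b. h b \<odot>\<^bsub>L\<^esub> x) \<in> fun_span L H"
  unfolding fun_span_def
  by (rule add_span_base[OF module_abelian_group[OF function_module[OF L]] fun_span_generators]) blast

lemma fun_span_least:
  assumes "f \<in> fun_span L H" "submodule K R (function_module L)"
    and "\<And>h x. h \<in> H \<Longrightarrow> x \<in> carrier L \<Longrightarrow> (\<lambda>b. h b \<odot>\<^bsub>L\<^esub> x) \<in> K"
  shows "f \<in> K"
  using assms(1) unfolding fun_span_def by (rule add_span_least[OF _ assms(2)]) (use assms(3) in blast)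

lemma fun_span_image:
  assumes "module R L'" "k \<in> module_hom R L L'" "f \<in> fun_span L H"
  shows "(\<lambda>b. k (f b)) \<in> fun_span L' H"
  unfolding fun_span_def
proof (rule add_span_image[OF function_module[OF L] function_module[OF assms(1)] pointwise_hom[OF assms(2)]
      fun_span_generators])
  interpret L': module R L' by fact
  let ?G = "{\<lambda>b. h b \<odot>\<^bsub>L'\<^esub> x | h x. h \<in> H \<and> x \<in> carrier L'}"
  show G: "?G \<subseteq> carrier (function_module L')"
    using H by (auto intro!: L'.smult_closed)
  show "f \<in> add_span (function_module L) {\<lambda>b. h b \<odot>\<^bsub>L\<^esub> x | h x. h \<in> H \<and> x \<in> carrier L}"
    using assms(3) unfolding fun_span_def .
  fix g assume "g \<in> {\<lambda>b. h b \<odot>\<^bsub>L\<^esub> x | h x. h \<in> H \<and> x \<in> carrier L}"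
  then obtain h x where g: "g = (\<lambda>b. h b \<odot>\<^bsub>L\<^esub> x)" "h \<in> H" "x \<in> carrier L" by blast
  have "h b \<in> carrier R" for b using H g(2) by auto
  then have "(\<lambda>b. k (g b)) = (\<lambda>b. h b \<odot>\<^bsub>L'\<^esub> k x)"
    using g by (simp add: module_hom_smult[OF assms(2)])
  then have "(\<lambda>b. k (g b)) \<in> ?G" using g module_hom_closed[OF assms(2)] by blast
  then show "(\<lambda>b. k (g b)) \<in> add_span (function_module L') ?G"
    by (rule add_span_base[OF module_abelian_group[OF function_module[OF assms(1)]] G])
qed

end

lemma fun_span_mono: "f \<in> fun_span L H \<Longrightarrow> H \<subseteq> H' \<Longrightarrow> f \<in> fun_span L H'"
  unfolding fun_span_def by (erule add_span_mono) auto

lemma coord_kernel_submodule: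
  assumes "cring R" "submodule H R (coeff_functions R)"
  shows "submodule {h \<in> H. h b = \<zero>\<^bsub>R\<^esub>} R (coeff_functions R)"
proof -
  interpret R: cring R by fact
  show ?thesis
    by (rule submoduleI'[OF coeff_functions_module[OF assms(1)]])
      (use submodule_carrier[OF assms(2)] submodule_zero[OF assms(2)] submodule_add[OF assms(2)]
        submodule_smult[OF assms(2)] in auto)
qed

section \<open>Flatness as a condition on one coordinate, and its passage to tensor products\<close>

section \<open>Coordinatewise flatness\<close>

text \<open>With \<open>I = {h b | h. h \<in> H}\<close> and \<open>H'\<close> the kernel of \<open>H \<rightarrow> I\<close>, the condition below says
  that \<open>(H / H') \<otimes> L = I \<otimes> L \<rightarrow> L\<close> is injective. Unlike \<^const>\<open>flat_module\<close>, it
  makes sense for index sets of arbitrary type.\<close>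

definition coord_flat :: "'b itself \<Rightarrow> ('r, 'x) ring_scheme \<Rightarrow> ('r, 'm) module \<Rightarrow> bool" where
  "coord_flat (T :: 'b itself) R L \<longleftrightarrow>
    (\<forall>H (b :: 'b) f. submodule H R (coeff_functions R) \<longrightarrow> f \<in> fun_span L H \<longrightarrow> f b = \<zero>\<^bsub>L\<^esub> \<longrightarrow>
      f \<in> fun_span L {h \<in> H. h b = \<zero>\<^bsub>R\<^esub>})"

lemma coord_flatD:
  assumes "coord_flat TYPE('b) R L" "submodule H R (coeff_functions R)" "f \<in> fun_span L H" "f (b :: 'b) = \<zero>\<^bsub>L\<^esub>"
  shows "f \<in> fun_span L {h \<in> H. h b = \<zero>\<^bsub>R\<^esub>}"
  using assms unfolding coord_flat_def by blast

text \<open>The kernel of a coordinate on \<open>H\<close> is again a submodule of coefficient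
  functions, so the one-coordinate condition can be iterated over \<open>E\<close>.\<close>

lemma coord_flat_finite:
  assumes "cring R" "coord_flat TYPE('b) R L" "finite E" "submodule H R (coeff_functions R)" "f \<in> fun_span L H"
    and "\<And>b :: 'b. b \<in> E \<Longrightarrow> f b = \<zero>\<^bsub>L\<^esub>"
  shows "f \<in> fun_span L {h \<in> H. \<forall>b\<in>E. h b = \<zero>\<^bsub>R\<^esub>}"
  using assms(3-)
proof (induction E arbitrary: H)
  case empty
  then show ?case by simp
next
  case (insert b E)
  have "f \<in> fun_span L {h \<in> H. h b = \<zero>\<^bsub>R\<^esub>}"
    by (rule coord_flatD[OF assms(2)]) (use insert in auto)
  then have "f \<in> fun_span L {h \<in> {h \<in> H. h b = \<zero>\<^bsub>R\<^esub>}. \<forall>b\<in>E. h b = \<zero>\<^bsub>R\<^esub>}"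
    by (intro insert.IH coord_kernel_submodule[OF assms(1)]) (use insert in auto)
  moreover have "{h \<in> {h \<in> H. h b = \<zero>\<^bsub>R\<^esub>}. \<forall>b\<in>E. h b = \<zero>\<^bsub>R\<^esub>} = {h \<in> H. \<forall>b\<in>insert b E. h b = \<zero>\<^bsub>R\<^esub>}"
    by auto
  ultimately show ?case by simp
qed

text \<open>A submodule \<open>H\<close> is already closed under multiplication by \<open>R\<close>,
  so for \<open>L = R\<close> every \<open>f\<close> in the span lies in \<open>H\<close> itself and
  is its own witness, with coefficient one.\<close>

lemma coord_flat_regular:
  assumes "cring R"
  shows "coord_flat TYPE('b) R (regular_algebra R)"
  unfolding coord_flat_def
proof (intro allI impI)
  interpret R: cring R by fact
  fix H and b :: 'b and f
  assume H: "submodule H R (coeff_functions R)" and f: "f \<in> fun_span (regular_algebra R) H"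
    and fb: "f b = \<zero>\<^bsub>regular_algebra R\<^esub>"
  have sub: "K \<subseteq> carrier (coeff_functions R)" if "K \<subseteq> H" for K
    using submodule_carrier[OF H] that by blast
  have "f \<in> H" using f
  proof (rule fun_span_least[OF module_regular[OF assms] sub[OF subset_refl] _ H])
    fix h x assume hx: "h \<in> H" "x \<in> carrier (regular_algebra R)"
    then have "x \<odot>\<^bsub>coeff_functions R\<^esub> h \<in> H" by (intro submodule_smult[OF H]) auto
    moreover have "x \<odot>\<^bsub>coeff_functions R\<^esub> h = (\<lambda>b. h b \<odot>\<^bsub>regular_algebra R\<^esub> x)"
      using hx submodule_carrier[OF H hx(1)] by (auto simp: R.m_comm)
    ultimately show "(\<lambda>b. h b \<odot>\<^bsub>regular_algebra R\<^esub> x) \<in> H" by simp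
  qed
  then have "f \<in> {h \<in> H. h b = \<zero>\<^bsub>R\<^esub>}" using fb by simp
  then have "(\<lambda>b. f b \<odot>\<^bsub>regular_algebra R\<^esub> \<one>\<^bsub>R\<^esub>) \<in> fun_span (regular_algebra R) {h \<in> H. h b = \<zero>\<^bsub>R\<^esub>}"
    by (intro fun_span_base[OF module_regular[OF assms]] sub) auto
  then show "f \<in> fun_span (regular_algebra R) {h \<in> H. h b = \<zero>\<^bsub>R\<^esub>}"
    using submodule_carrier[OF H \<open>f \<in> H\<close>] by simp
qed

lemma module_hom_inj_onI:
  assumes "module R M" "module R N" "h \<in> module_hom R M N"
    and "\<And>x. x \<in> carrier M \<Longrightarrow> h x = \<zero>\<^bsub>N\<^esub> \<Longrightarrow> x = \<zero>\<^bsub>M\<^esub>"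
  shows "inj_on h (carrier M)"
proof (rule inj_onI)
  interpret M: module R M by fact
  interpret N: module R N by fact
  fix x y assume "x \<in> carrier M" "y \<in> carrier M" "h x = h y"
  then have "h (x \<ominus>\<^bsub>M\<^esub> y) = \<zero>\<^bsub>N\<^esub>"
    using module_hom_closed[OF assms(3)] by (simp add: module_hom_minus[OF assms(1-3)] N.minus_eq_zero_iff)
  then show "x = y"
    using assms(4)[of "x \<ominus>\<^bsub>M\<^esub> y"] \<open>x \<in> carrier M\<close> \<open>y \<in> carrier M\<close> by (simp add: M.minus_eq_zero_iff)
qed

lemma module_hom_inj_onD:
  assumes "module R M" "module R N" "h \<in> module_hom R M N" "inj_on h (carrier M)"
    and "x \<in> carrier M" "h x = \<zero>\<^bsub>N\<^esub>"
  shows "x = \<zero>\<^bsub>M\<^esub>"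
proof -
  interpret M: module R M by fact
  show ?thesis
    using inj_onD[OF assms(4), of x "\<zero>\<^bsub>M\<^esub>"] assms(5,6) module_hom_zero[OF assms(1-3)] by simp
qed

lemma inclusion_hom: "U \<subseteq> carrier M \<Longrightarrow> id \<in> module_hom R (M\<lparr>carrier := U\<rparr>) M"
  by (rule module_homI) auto

lemma id_hom: "id \<in> module_hom R M M"
  by (rule module_homI) auto

lemma module_hom_image_submodule:
  assumes "module R M" "module R N" "h \<in> module_hom R M N" "submodule H R M"
  shows "submodule (h ` H) R N"
proof -
  interpret N: module R N by fact
  note car = submodule_carrier[OF assms(4)]
  show ?thesis
  proof (rule submoduleI'[OF assms(2)])
    show "h ` H \<subseteq> carrier N" using car module_hom_closed[OF assms(3)] by auto
    show "\<zero>\<^bsub>N\<^esub> \<in> h ` H" using module_hom_zero[OF assms(1-3)] submodule_zero[OF assms(4)] by force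
  next
    fix x y assume "x \<in> h ` H" "y \<in> h ` H"
    then obtain u v where "u \<in> H" "v \<in> H" "x = h u" "y = h v" by blast
    then show "x \<oplus>\<^bsub>N\<^esub> y \<in> h ` H"
      using module_hom_add[OF assms(3), of u v] car submodule_add[OF assms(4), of u v] by (metis imageI)
  next
    fix r x assume "r \<in> carrier R" "x \<in> h ` H"
    then obtain u where "u \<in> H" "x = h u" by blast
    then show "r \<odot>\<^bsub>N\<^esub> x \<in> h ` H"
      using module_hom_smult[OF assms(3) \<open>r \<in> carrier R\<close>, of u] car
        submodule_smult[OF assms(4) \<open>r \<in> carrier R\<close>, of u] by (metis imageI)
  qed
qed

text \<open>For the image \<open>U\<close> of \<open>H \<otimes> M\<close> under the coordinate \<open>b\<close> and a section
  \<open>\<tau>\<close> of \<open>H \<otimes> M \<rightarrow> U\<close>, the map \<open>u \<otimes> c \<mapsto> \<tau> u \<otimes> c\<close> is well defined modulo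
  the functions coming from \<open>{h \<in> H. h b = 0}\<close>.\<close>

lemma coord_flat_tensor:
  fixes R :: "('r, 'x) ring_scheme" and M :: "('r, 'm) module" and C :: "('r, 'c) module"
  assumes M: "module R M" and C: "module R C" and flat: "coord_flat TYPE('b) R M"
    and inj: "\<And>U. submodule U R M \<Longrightarrow>
      inj_on (tensor_map R M C id id) (carrier (tensor R (M\<lparr>carrier := U\<rparr>) C))"
  shows "coord_flat TYPE('b) R (tensor R M C)"
  unfolding coord_flat_def
proof (intro allI impI)
  interpret M: module R M by fact
  interpret C: module R C by fact
  let ?N = "tensor R M C"
  let ?p = "pure_tensor R M C"
  have N: "module R ?N" by (rule tensor_module[OF M C])
  interpret N: module R ?N by (fact N)
  fix H and b :: 'b and f
  assume H: "submodule H R (coeff_functions R)" and f: "f \<in> fun_span ?N H" and fb: "f b = \<zero>\<^bsub>?N\<^esub>"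
  define H' where "H' = {h \<in> H. h b = \<zero>\<^bsub>R\<^esub>}"
  have Hc: "H \<subseteq> carrier (coeff_functions R)" using submodule_carrier[OF H] by blast
  have H'c: "H' \<subseteq> carrier (coeff_functions R)" using Hc unfolding H'_def by blast
  note HM = fun_span_submodule[OF M Hc]
  note H'N = fun_span_submodule[OF N H'c]
  define U where "U = (\<lambda>g. g b) ` fun_span M H"
  have U: "submodule U R M"
    unfolding U_def by (rule module_hom_image_submodule[OF function_module[OF M] M coordinate_hom HM])
  let ?U = "M\<lparr>carrier := U\<rparr>"
  have Um: "module R ?U" by (rule module_submodule[OF M U])
  have UM: "U \<subseteq> carrier M" using submodule_carrier[OF U] by blast
  let ?Y = "function_module ?N :: ('r, 'b \<Rightarrow> _) module"
  let ?Q = "quotient_module ?Y (fun_span ?N H')"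
  have Y: "module R ?Y" by (rule function_module[OF N])
  have Q: "module R ?Q" by (rule quotient_module[OF Y H'N])
  interpret Y: module R ?Y by (fact Y)
  interpret Q: module R ?Q by (fact Q)
  interpret FM: module R "function_module M :: ('r, 'b \<Rightarrow> _) module" by (rule function_module[OF M])
  define cls where "cls = (\<lambda>x. fun_span ?N H' +>\<^bsub>?Y\<^esub> x)"
  have cls: "cls \<in> module_hom R ?Y ?Q" unfolding cls_def by (rule quotient_class_hom[OF Y H'N])
  define ten where "ten = (\<lambda>g c (t :: 'b). ?p (g t) c)"
  have ten_l: "(\<lambda>g. ten g c) \<in> module_hom R (function_module M) ?Y" if "c \<in> carrier C" for c
    unfolding ten_def by (rule pointwise_hom[OF pure_hom_left[OF M C that]])
  have ten_r: "ten g \<in> module_hom R C ?Y" if "g \<in> carrier (function_module M)" for g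
    unfolding ten_def by (rule function_hom, rule pure_hom_right[OF M C]) (use that in auto)
  have ten_H: "ten (\<lambda>t. h t \<odot>\<^bsub>M\<^esub> m) c = (\<lambda>t. h t \<odot>\<^bsub>?N\<^esub> ?p m c)"
    if "h \<in> H" "m \<in> carrier M" "c \<in> carrier C" for h m c
  proof -
    have "h t \<in> carrier R" for t using Hc that(1) by auto
    then show ?thesis unfolding ten_def
      using that by (simp add: module_hom_smult[OF pure_hom_left[OF M C]])
  qed
  \<comment> \<open>Flatness of \<open>M\<close> at the coordinate \<open>b\<close>: a function of
    the span that vanishes there already comes from \<open>H'\<close>, and tensoring with
    \<open>c\<close> preserves this.\<close>
  have key: "ten g c \<in> fun_span ?N H'" if g: "g \<in> fun_span M H" "g b = \<zero>\<^bsub>M\<^esub>" and c: "c \<in> carrier C" for g c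
  proof -
    have "g \<in> fun_span M H'" unfolding H'_def by (rule coord_flatD[OF flat H g])
    then show ?thesis unfolding ten_def
      by (rule fun_span_image[OF M H'c N pure_hom_left[OF M C c]])
  qed
  have cls_eq: "cls (ten g c) = cls (ten g' c)"
    if "g \<in> fun_span M H" "g' \<in> fun_span M H" "g b = g' b" "c \<in> carrier C" for g g' c
  proof -
    have gc: "g \<in> carrier (function_module M)" "g' \<in> carrier (function_module M)"
      using that submodule_carrier[OF HM] by auto
    have "g \<ominus>\<^bsub>function_module M\<^esub> g' \<in> fun_span M H" by (rule submodule_minus[OF HM that(1,2)])
    moreover have "(g \<ominus>\<^bsub>function_module M\<^esub> g') b = \<zero>\<^bsub>M\<^esub>"
      using gc that(3) by (simp add: function_minus[OF M] M.minus_eq_zero_iff)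
    ultimately have "ten (g \<ominus>\<^bsub>function_module M\<^esub> g') c \<in> fun_span ?N H'" using key that(4) by blast
    then have "ten g c \<ominus>\<^bsub>?Y\<^esub> ten g' c \<in> fun_span ?N H'"
      using module_hom_minus[OF FM.module_axioms Y ten_l[OF that(4)] gc] by simp
    then show ?thesis unfolding cls_def
      using quotient_class_eq_iff[OF Y H'N] module_hom_closed[OF ten_l[OF that(4)]] gc by blast
  qed
  \<comment> \<open>An arbitrary choice of preimages, in general not linear. Linearity is recovered
    modulo the span of \<open>H'\<close>, because by \<open>cls_eq\<close> the class of
    \<open>ten g c\<close> depends only on the value at \<open>b\<close> of a function
    \<open>g\<close> in the span of \<open>H\<close>.\<close>
  define \<tau> where "\<tau> u = (SOME g. g \<in> fun_span M H \<and> g b = u)" for u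
  have \<tau>: "\<tau> u \<in> fun_span M H" "\<tau> u b = u" if "u \<in> U" for u
  proof -
    have "\<exists>g. g \<in> fun_span M H \<and> g b = u" using that unfolding U_def by blast
    from someI_ex[OF this] show "\<tau> u \<in> fun_span M H" "\<tau> u b = u" unfolding \<tau>_def by auto
  qed
  have \<tau>c: "\<tau> u \<in> carrier (function_module M)" if "u \<in> U" for u
    using submodule_carrier[OF HM \<tau>(1)[OF that]] .
  define \<beta> where "\<beta> u c = cls (ten (\<tau> u) c)" for u c
  have bil: "bilinear R ?U C ?Q \<beta>"
  proof (rule bilinearI)
    fix u assume "u \<in> carrier ?U"
    then show "\<beta> u \<in> module_hom R C ?Q" unfolding \<beta>_def
      by (intro module_hom_comp[OF cls ten_r]) (use \<tau>c in auto)
  next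
    fix c assume c: "c \<in> carrier C"
    note h = module_hom_comp[OF cls ten_l[OF c]]
    show "(\<lambda>u. \<beta> u c) \<in> module_hom R ?U ?Q"
    proof (rule module_homI)
      fix x y assume "x \<in> carrier ?U" "y \<in> carrier ?U"
      then have xy: "x \<in> U" "y \<in> U" by auto
      have "\<beta> (x \<oplus>\<^bsub>M\<^esub> y) c = cls (ten (\<tau> x \<oplus>\<^bsub>function_module M\<^esub> \<tau> y) c)" unfolding \<beta>_def
        by (rule cls_eq) (use \<tau> xy c submodule_add[OF U] submodule_add[OF HM] in \<open>auto simp del: function_simps(3)\<close>, use \<tau> xy in simp)
      then show "\<beta> (x \<oplus>\<^bsub>?U\<^esub> y) c = \<beta> x c \<oplus>\<^bsub>?Q\<^esub> \<beta> y c"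
        using module_hom_add[OF h \<tau>c \<tau>c, OF xy] unfolding \<beta>_def by simp
    next
      fix r x assume "x \<in> carrier ?U" and r: "r \<in> carrier R"
      then have x: "x \<in> U" by auto
      have "\<beta> (r \<odot>\<^bsub>M\<^esub> x) c = cls (ten (r \<odot>\<^bsub>function_module M\<^esub> \<tau> x) c)" unfolding \<beta>_def
        by (rule cls_eq) (use \<tau> x r c submodule_smult[OF U] submodule_smult[OF HM] in \<open>auto simp del: function_simps(4)\<close>, use \<tau> x in simp)
      then show "\<beta> (r \<odot>\<^bsub>?U\<^esub> x) c = r \<odot>\<^bsub>?Q\<^esub> \<beta> x c"
        using module_hom_smult[OF h r \<tau>c, OF x] unfolding \<beta>_def by simp
    qed (use module_hom_closed[OF h] \<tau>c in \<open>simp add: \<beta>_def\<close>)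
  qed
  let ?T = "tensor R ?U C"
  have T: "module R ?T" by (rule tensor_module[OF Um C])
  interpret T: module R ?T by (fact T)
  define \<Theta> where "\<Theta> = tensor_lift R ?Q \<beta>"
  have \<Theta>: "\<Theta> \<in> module_hom R ?T ?Q" unfolding \<Theta>_def by (rule tensor_lift_hom[OF Um C Q bil])
  define inc where "inc = tensor_map R M C id id"
  have inc: "inc \<in> module_hom R ?T ?N" unfolding inc_def
    by (rule tensor_map_hom[OF Um C M C inclusion_hom[OF UM] id_hom])
  \<comment> \<open>Functions whose class and whose value at \<open>b\<close> come from one and the
    same tensor \<open>t\<close> of \<open>U \<otimes> C\<close>. This submodule contains the
    generators, hence \<open>f\<close>; then \<open>f b = 0\<close> and the injectivity of
    \<open>U \<otimes> C \<rightarrow> M \<otimes> C\<close> force \<open>t = 0\<close>, so the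
    class of \<open>f\<close> is zero.\<close>
  define Z where "Z = {f \<in> carrier ?Y. \<exists>t \<in> carrier ?T. \<Theta> t = cls f \<and> inc t = f b}"
  have Z: "submodule Z R ?Y"
  proof (rule submoduleI'[OF Y])
    show "\<zero>\<^bsub>?Y\<^esub> \<in> Z"
      unfolding Z_def using module_hom_zero[OF T Q \<Theta>] module_hom_zero[OF T N inc] module_hom_zero[OF Y Q cls]
      by (auto intro!: bexI[of _ "\<zero>\<^bsub>?T\<^esub>"])
  next
    fix x y assume "x \<in> Z" "y \<in> Z"
    then obtain t u where tu: "x \<in> carrier ?Y" "y \<in> carrier ?Y" "t \<in> carrier ?T" "u \<in> carrier ?T"
      "\<Theta> t = cls x" "\<Theta> u = cls y" "inc t = x b" "inc u = y b" unfolding Z_def by blast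
    have "\<Theta> (t \<oplus>\<^bsub>?T\<^esub> u) = cls (x \<oplus>\<^bsub>?Y\<^esub> y)" "inc (t \<oplus>\<^bsub>?T\<^esub> u) = (x \<oplus>\<^bsub>?Y\<^esub> y) b"
      using tu by (simp_all add: module_hom_add[OF \<Theta>] module_hom_add[OF inc] module_hom_add[OF cls] del: function_simps(3))
        (simp add: tu)
    then show "x \<oplus>\<^bsub>?Y\<^esub> y \<in> Z" unfolding Z_def using tu(1-4) by blast
  next
    fix r x assume r: "r \<in> carrier R" and "x \<in> Z"
    then obtain t where t: "x \<in> carrier ?Y" "t \<in> carrier ?T" "\<Theta> t = cls x" "inc t = x b"
      unfolding Z_def by blast
    have "\<Theta> (r \<odot>\<^bsub>?T\<^esub> t) = cls (r \<odot>\<^bsub>?Y\<^esub> x)" "inc (r \<odot>\<^bsub>?T\<^esub> t) = (r \<odot>\<^bsub>?Y\<^esub> x) b"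
      using t r by (simp_all add: module_hom_smult[OF \<Theta>] module_hom_smult[OF inc] module_hom_smult[OF cls] del: function_simps(4))
        (simp add: t)
    then show "r \<odot>\<^bsub>?Y\<^esub> x \<in> Z" unfolding Z_def using t(1,2) r by blast
  qed (auto simp: Z_def)
  have "f \<in> Z" using f
  proof (rule fun_span_least[OF N Hc _ Z])
    fix h n assume h: "h \<in> H" and n: "n \<in> carrier ?N"
    have hc: "h t \<in> carrier R" for t using Hc h by auto
    from n show "(\<lambda>b. h b \<odot>\<^bsub>?N\<^esub> n) \<in> Z"
    proof (induction rule: tensor_induct[OF M C, consumes 1, case_names zero add])
      case zero
      then show ?case using submodule_zero[OF Z] hc by simp
    next
      case (add y m c)
      have pc: "?p m c \<in> carrier ?N" using pure_tensor_closed[OF M C] add by blast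
      have hm: "(\<lambda>t. h t \<odot>\<^bsub>M\<^esub> m) \<in> fun_span M H" by (rule fun_span_base[OF M Hc h]) (use add in auto)
      then have u: "h b \<odot>\<^bsub>M\<^esub> m \<in> U" unfolding U_def by force
      let ?t = "pure_tensor R ?U C (h b \<odot>\<^bsub>M\<^esub> m) c"
      have "\<Theta> ?t = cls (ten (\<tau> (h b \<odot>\<^bsub>M\<^esub> m)) c)"
        unfolding \<Theta>_def using u add by (simp add: tensor_lift_pure[OF Um C Q bil] \<beta>_def)
      also have "\<dots> = cls (ten (\<lambda>t. h t \<odot>\<^bsub>M\<^esub> m) c)"
        by (rule cls_eq) (use \<tau> u hm add in auto)
      finally have "\<Theta> ?t = cls (\<lambda>t. h t \<odot>\<^bsub>?N\<^esub> ?p m c)" using ten_H h add by simp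
      moreover have "inc ?t = h b \<odot>\<^bsub>?N\<^esub> ?p m c"
        unfolding inc_def using u add hc
        by (simp add: tensor_map_pure[OF Um C M C inclusion_hom[OF UM] id_hom]
            module_hom_smult[OF pure_hom_left[OF M C]])
      moreover have "?t \<in> carrier ?T" by (rule pure_tensor_closed[OF Um C]) (use u add in auto)
      ultimately have "(\<lambda>t. h t \<odot>\<^bsub>?N\<^esub> ?p m c) \<in> Z" unfolding Z_def using hc pc by auto
      then have "(\<lambda>b. h b \<odot>\<^bsub>?N\<^esub> y) \<oplus>\<^bsub>?Y\<^esub> (\<lambda>t. h t \<odot>\<^bsub>?N\<^esub> ?p m c) \<in> Z"
        by (rule submodule_add[OF Z add.IH])
      then show ?case using hc pc add by (simp add: N.smult_r_distr)
    qed
  qed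
  then have fZ: "f \<in> carrier ?Y \<and> (\<exists>t \<in> carrier ?T. \<Theta> t = cls f \<and> inc t = \<zero>\<^bsub>?N\<^esub>)"
    unfolding Z_def mem_Collect_eq fb .
  from conjunct2[OF fZ] obtain t where tT: "t \<in> carrier ?T"
    and t2: "\<Theta> t = cls f \<and> inc t = \<zero>\<^bsub>?N\<^esub>" by (rule bexE)
  note t = tT conjunct1[OF t2] conjunct2[OF t2] conjunct1[OF fZ]
  have "t = \<zero>\<^bsub>?T\<^esub>"
    by (rule module_hom_inj_onD[OF T N inc _ t(1,3)]) (use inj[OF U] in \<open>simp add: inc_def\<close>)
  then have "cls f = \<zero>\<^bsub>?Q\<^esub>" using t(2) module_hom_zero[OF T Q \<Theta>] by simp
  then show "f \<in> fun_span ?N {h \<in> H. h b = \<zero>\<^bsub>R\<^esub>}"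
    using quotient_class_zero_iff[OF Y H'N t(4)] unfolding cls_def H'_def by simp
qed

text \<open>For \<open>M = R\<close> the submodules in the injectivity hypothesis of
  \<open>coord_flat_tensor\<close> are ideals, carried by the type of \<open>R\<close>, so that
  \<open>flat_module\<close> applies. This settles \<open>R \<otimes> L\<close>; the maps
  \<open>x \<mapsto> 1 \<otimes> x\<close> and multiplication carry the condition over to
  \<open>L\<close>.\<close>

lemma flat_imp_coord_flat:
  fixes R :: "('r, 'x) ring_scheme"
  assumes "flat_module R L"
  shows "coord_flat TYPE('b) R L"
proof -
  have L: "module R L" using assms unfolding flat_module_def by blast
  interpret L: module R L by (fact L)
  let ?R = "regular_algebra R"
  have R: "module R ?R" by (rule module_regular[OF L.R.is_cring])
  let ?T = "tensor R ?R L"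
  have T: "module R ?T" by (rule tensor_module[OF R L])
  have "inj_on (tensor_map R ?R L id id) (carrier (tensor R (?R\<lparr>carrier := U\<rparr>) L))" if "submodule U R ?R" for U
  proof -
    have "id \<in> module_hom R (?R\<lparr>carrier := U\<rparr>) ?R"
      by (rule inclusion_hom) (use submodule_carrier[OF that] in blast)
    then show ?thesis
      using assms R module_submodule[OF R that] unfolding flat_module_def by (metis inj_on_id)
  qed
  then have flat: "coord_flat TYPE('b) R ?T"
    by (intro coord_flat_tensor R L coord_flat_regular L.R.is_cring)
  have bil: "bilinear R ?R L L (\<lambda>r x. r \<odot>\<^bsub>L\<^esub> x)"
    by (rule bilinearI) (auto intro: smult_hom[OF L] scale_hom[OF L])
  define mul where "mul = tensor_lift R L (\<lambda>r x. r \<odot>\<^bsub>L\<^esub> x)"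
  have mul: "mul \<in> module_hom R ?T L" unfolding mul_def by (rule tensor_lift_hom[OF R L L bil])
  have one: "\<one>\<^bsub>R\<^esub> \<in> carrier ?R" by simp
  show ?thesis unfolding coord_flat_def
  proof (intro allI impI)
    fix H and b :: 'b and f
    assume H: "submodule H R (coeff_functions R)" and f: "f \<in> fun_span L H" and fb: "f b = \<zero>\<^bsub>L\<^esub>"
    have Hc: "H \<subseteq> carrier (coeff_functions R)" using submodule_carrier[OF H] by blast
    have fc: "f t \<in> carrier L" for t using submodule_carrier[OF fun_span_submodule[OF L Hc] f] by simp
    let ?g = "\<lambda>t. pure_tensor R ?R L \<one>\<^bsub>R\<^esub> (f t)"
    have "?g \<in> fun_span ?T H" by (rule fun_span_image[OF L Hc T pure_hom_right[OF R L one] f])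
    moreover have "?g b = \<zero>\<^bsub>?T\<^esub>" using fb module_hom_zero[OF L T pure_hom_right[OF R L one]] by simp
    ultimately have "?g \<in> fun_span ?T {h \<in> H. h b = \<zero>\<^bsub>R\<^esub>}" by (rule coord_flatD[OF flat H])
    then have "(\<lambda>t. mul (?g t)) \<in> fun_span L {h \<in> H. h b = \<zero>\<^bsub>R\<^esub>}"
      by (intro fun_span_image[OF T _ L mul]) (use Hc in auto)
    moreover have "mul (?g t) = f t" for t
      unfolding mul_def using tensor_lift_pure[OF R L L bil one fc] fc by simp
    ultimately show "f \<in> fun_span L {h \<in> H. h b = \<zero>\<^bsub>R\<^esub>}" by simp
  qed
qed

section \<open>The equational criterion for the vanishing of a tensor\<close>

section \<open>Vanishing of tensors\<close>

lemma regular_minus [simp]: "x \<ominus>\<^bsub>regular_algebra R\<^esub> y = x \<ominus>\<^bsub>R\<^esub> y"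
  unfolding a_minus_def a_inv_def m_inv_def by simp

text \<open>Elements of \<open>S\<close> serve as their own indices: this is the kernel of the map
  from the free module on \<open>D\<close> to \<open>S\<close>, and relations for different sets
  \<open>D\<close> can be compared without renaming.\<close>

definition relations_on :: "('r, 'x) ring_scheme \<Rightarrow> ('r, 's) module \<Rightarrow> 's set \<Rightarrow> ('s \<Rightarrow> 'r) set" where
  "relations_on R S D = {q \<in> carrier (coeff_functions R).
    (\<forall>s. s \<notin> D \<longrightarrow> q s = \<zero>\<^bsub>R\<^esub>) \<and> (\<Oplus>\<^bsub>S\<^esub>s\<in>D. q s \<odot>\<^bsub>S\<^esub> s) = \<zero>\<^bsub>S\<^esub>}"

text \<open>A normal form for tensors: the terms are grouped by their first factor, which leaves one
  coefficient in \<open>L\<close> for each \<open>s\<close>.\<close>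

definition tensor_sum ::
  "('r, 'x) ring_scheme \<Rightarrow> ('r, 's) module \<Rightarrow> ('r, 'm) module \<Rightarrow> 's set \<Rightarrow> ('s \<Rightarrow> 'm) \<Rightarrow> ('s \<times> 'm \<Rightarrow> 'r) set"
  where "tensor_sum R S L D f = (\<Oplus>\<^bsub>tensor R S L\<^esub>s\<in>D. pure_tensor R S L s (f s))"

definition single :: "('r, 'm) module \<Rightarrow> 's \<Rightarrow> 'm \<Rightarrow> 's \<Rightarrow> 'm" where
  "single L s x = (\<lambda>t. if t = s then x else \<zero>\<^bsub>L\<^esub>)"

context
  fixes R :: "('r, 'x) ring_scheme" and S :: "('r, 's) module"
  assumes S: "module R S"
begin

interpretation S: module R S by (fact S)

lemma relation_sum_hom:
  assumes "finite D" "D \<subseteq> carrier S"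
  shows "(\<lambda>q. \<Oplus>\<^bsub>S\<^esub>s\<in>D. q s \<odot>\<^bsub>S\<^esub> s) \<in> module_hom R (coeff_functions R) S"
  by (rule finsum_coordinates_hom[OF module_regular[OF S.R.is_cring] S assms(1)])
    (rule scale_hom[OF S], use assms(2) in blast)

lemma relations_on_submodule:
  assumes "finite D" "D \<subseteq> carrier S"
  shows "submodule (relations_on R S D) R (coeff_functions R)"
proof -
  have F: "module R (coeff_functions R)" by (rule coeff_functions_module[OF S.R.is_cring])
  note K = module_hom_kernel_submodule[OF F S relation_sum_hom[OF assms]]
  show ?thesis
    by (rule submoduleI'[OF F])
      (use submodule_zero[OF K] submodule_add[OF K] submodule_smult[OF K] in
        \<open>auto simp: relations_on_def\<close>)
qed

lemma relations_on_carrier: "relations_on R S D \<subseteq> carrier (coeff_functions R)"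
  unfolding relations_on_def by blast

lemma relations_on_mono:
  assumes "finite D'" "D \<subseteq> D'" "D' \<subseteq> carrier S"
  shows "relations_on R S D \<subseteq> relations_on R S D'"
proof
  fix q assume q: "q \<in> relations_on R S D"
  then have qc: "q s \<in> carrier R" "s \<notin> D \<Longrightarrow> q s = \<zero>\<^bsub>R\<^esub>" for s
    unfolding relations_on_def by auto
  have "(\<Oplus>\<^bsub>S\<^esub>s\<in>D. q s \<odot>\<^bsub>S\<^esub> s) = (\<Oplus>\<^bsub>S\<^esub>s\<in>D'. q s \<odot>\<^bsub>S\<^esub> s)"
    by (rule S.add.finprod_mono_neutral_cong_left[OF assms(1,2)]) (use assms qc in auto)
  then show "q \<in> relations_on R S D'" using q assms(2) unfolding relations_on_def by auto
qed

lemma relation_sum_basis: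
  assumes "finite D" "D \<subseteq> carrier S" "s \<in> D"
  shows "(\<Oplus>\<^bsub>S\<^esub>t\<in>D. free_basis R s t \<odot>\<^bsub>S\<^esub> t) = s"
proof -
  have "(\<Oplus>\<^bsub>S\<^esub>t\<in>{s}. free_basis R s t \<odot>\<^bsub>S\<^esub> t) = (\<Oplus>\<^bsub>S\<^esub>t\<in>D. free_basis R s t \<odot>\<^bsub>S\<^esub> t)"
    by (rule S.add.finprod_mono_neutral_cong_left) (use assms in \<open>auto simp: free_basis_def\<close>)
  moreover have "s \<in> carrier S" using assms by auto
  ultimately show ?thesis by (simp add: free_basis_def)
qed

context
  fixes L :: "('r, 'm) module"
  assumes L: "module R L"
begin

interpretation L: module R L by (fact L)

private abbreviation (input) "SL \<equiv> tensor R S L"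

lemma tensor_left_module: "module R SL" by (rule tensor_module[OF S L])

interpretation T: module R SL by (fact tensor_left_module)

lemma tensor_sum_hom:
  assumes "finite D" "D \<subseteq> carrier S"
  shows "tensor_sum R S L D \<in> module_hom R (function_module L) SL"
  unfolding tensor_sum_def
  by (rule finsum_coordinates_hom[OF L tensor_left_module assms(1)])
    (rule pure_hom_right[OF S L], use assms(2) in blast)

lemma tensor_sum_mono:
  assumes "finite D'" "D \<subseteq> D'" "D' \<subseteq> carrier S" "f \<in> carrier (function_module L)"
    and "\<And>s. s \<notin> D \<Longrightarrow> f s = \<zero>\<^bsub>L\<^esub>"
  shows "tensor_sum R S L D f = tensor_sum R S L D' f"
  unfolding tensor_sum_def
proof (rule T.add.finprod_mono_neutral_cong_left[OF assms(1,2)])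
  fix s assume "s \<in> D' - D"
  then show "pure_tensor R S L s (f s) = \<zero>\<^bsub>SL\<^esub>"
    using assms(3,5) module_hom_zero[OF L tensor_left_module pure_hom_right[OF S L]] by auto
next
  show "(\<lambda>s. pure_tensor R S L s (f s)) \<in> D' \<rightarrow> carrier SL"
    using assms(3,4) pure_tensor_closed[OF S L] by auto
qed auto

lemma single_carrier: "x \<in> carrier L \<Longrightarrow> single L s x \<in> carrier (function_module L)"
  by (auto simp: single_def)

lemma single_hom: "single L s \<in> module_hom R L (function_module L)"
  by (rule module_homI) (auto simp: single_def)

lemma tensor_sum_single:
  assumes "finite D" "D \<subseteq> carrier S" "s \<in> D" "x \<in> carrier L"
  shows "tensor_sum R S L D (single L s x) = pure_tensor R S L s x"
proof -
  have s: "s \<in> carrier S" using assms by auto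
  have "tensor_sum R S L {s} (single L s x) = tensor_sum R S L D (single L s x)"
    by (rule tensor_sum_mono) (use assms single_carrier in \<open>auto simp: single_def\<close>)
  then show ?thesis
    using pure_tensor_closed[OF S L s assms(4)] by (simp add: tensor_sum_def single_def)
qed

text \<open>Adding \<open>s \<otimes> x\<close> enlarges the index set by \<open>s\<close> and adds
  \<open>x\<close> to the coordinate at \<open>s\<close>; this also covers the case in which
  \<open>s\<close> is already present.\<close>

lemma tensor_sum_surj:
  assumes "y \<in> carrier SL"
  shows "\<exists>D f. finite D \<and> D \<subseteq> carrier S \<and> f \<in> carrier (function_module L) \<and>
    (\<forall>s. s \<notin> D \<longrightarrow> f s = \<zero>\<^bsub>L\<^esub>) \<and> y = tensor_sum R S L D f"
  using assms
proof (induction rule: tensor_induct[OF S L, consumes 1, case_names zero add])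
  case zero
  show ?case
    by (rule exI[of _ "{}"], rule exI[of _ "\<lambda>s. \<zero>\<^bsub>L\<^esub>"]) (auto simp: tensor_sum_def)
next
  case (add y s x)
  then obtain D f where D: "finite D" "D \<subseteq> carrier S" and f: "f \<in> carrier (function_module L)"
    "\<forall>s. s \<notin> D \<longrightarrow> f s = \<zero>\<^bsub>L\<^esub>" and y: "y = tensor_sum R S L D f" by blast
  have D': "finite (insert s D)" "insert s D \<subseteq> carrier S" using D add by auto
  have "y = tensor_sum R S L (insert s D) f"
    unfolding y by (rule tensor_sum_mono) (use D' f in auto)
  then have "y \<oplus>\<^bsub>SL\<^esub> pure_tensor R S L s x =
      tensor_sum R S L (insert s D) (f \<oplus>\<^bsub>function_module L\<^esub> single L s x)"
    using module_hom_add[OF tensor_sum_hom[OF D'] f(1) single_carrier] tensor_sum_single[OF D'] add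
    by simp
  moreover have "f \<oplus>\<^bsub>function_module L\<^esub> single L s x \<in> carrier (function_module L)"
    using f(1) single_carrier[OF \<open>x \<in> carrier L\<close>, of s] by auto
  moreover have "\<forall>t. t \<notin> insert s D \<longrightarrow> (f \<oplus>\<^bsub>function_module L\<^esub> single L s x) t = \<zero>\<^bsub>L\<^esub>"
    using f(2) by (auto simp: single_def)
  ultimately show ?case using D' by blast
qed

text \<open>Coefficients move across the tensor sign,
  \<open>\<Sum> s \<otimes> (q s x) = (\<Sum> q s s) \<otimes> x = 0\<close>. This is the easy half
  of the vanishing criterion.\<close>

lemma tensor_sum_relations:
  assumes D: "finite D" "D \<subseteq> carrier S" and f: "f \<in> fun_span L (relations_on R S D)"
  shows "tensor_sum R S L D f = \<zero>\<^bsub>SL\<^esub>"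
proof -
  have "f \<in> {f \<in> carrier (function_module L). tensor_sum R S L D f = \<zero>\<^bsub>SL\<^esub>}" using f
  proof (rule fun_span_least[OF L relations_on_carrier _
        module_hom_kernel_submodule[OF function_module[OF L] tensor_left_module tensor_sum_hom[OF D]]])
    fix q x assume q: "q \<in> relations_on R S D" and x: "x \<in> carrier L"
    have qc: "q s \<in> carrier R" for s using subsetD[OF relations_on_carrier q] by simp
    have h: "(\<lambda>s. pure_tensor R S L s x) \<in> module_hom R S SL" by (rule pure_hom_left[OF S L x])
    have "tensor_sum R S L D (\<lambda>s. q s \<odot>\<^bsub>L\<^esub> x) = (\<Oplus>\<^bsub>SL\<^esub>s\<in>D. pure_tensor R S L (q s \<odot>\<^bsub>S\<^esub> s) x)"
      unfolding tensor_sum_def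
    proof (rule T.finsum_cong')
      fix s assume "s \<in> D"
      then have s: "s \<in> carrier S" using D by auto
      show "pure_tensor R S L s (q s \<odot>\<^bsub>L\<^esub> x) = pure_tensor R S L (q s \<odot>\<^bsub>S\<^esub> s) x"
        using module_hom_smult[OF h qc s] module_hom_smult[OF pure_hom_right[OF S L s] qc x] by simp
    qed (use D qc x pure_tensor_closed[OF S L] in auto)
    also have "\<dots> = pure_tensor R S L (\<Oplus>\<^bsub>S\<^esub>s\<in>D. q s \<odot>\<^bsub>S\<^esub> s) x"
      by (rule module_hom_finsum[OF S tensor_left_module h, symmetric]) (use D qc in auto)
    also have "\<dots> = \<zero>\<^bsub>SL\<^esub>"
      using q module_hom_zero[OF S tensor_left_module h] by (simp add: relations_on_def)
    finally show "(\<lambda>s. q s \<odot>\<^bsub>L\<^esub> x) \<in> {f \<in> carrier (function_module L). tensor_sum R S L D f = \<zero>\<^bsub>SL\<^esub>}"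
      using qc x by auto
  qed
  then show ?thesis by simp
qed

private abbreviation (input) "K \<equiv> {f. \<exists>D. finite D \<and> D \<subseteq> carrier S \<and> f \<in> fun_span L (relations_on R S D)}"

text \<open>The union is directed, since relations on \<open>D\<close> and relations on
  \<open>E\<close> are both relations on \<open>D \<union> E\<close>.\<close>

lemma relation_span_submodule: "submodule K R (function_module L)"
proof (rule submoduleI'[OF function_module[OF L]])
  note sub = fun_span_submodule[OF L relations_on_carrier]
  show "K \<subseteq> carrier (function_module L)" using submodule_carrier[OF sub] by blast
  show "\<zero>\<^bsub>function_module L\<^esub> \<in> K" using submodule_zero[OF sub] by blast
  fix f assume "f \<in> K"
  then obtain D where D: "finite D" "D \<subseteq> carrier S" "f \<in> fun_span L (relations_on R S D)" by blast
  then show "r \<odot>\<^bsub>function_module L\<^esub> f \<in> K" if "r \<in> carrier R" for r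
    using submodule_smult[OF sub that] by blast
  fix g assume "g \<in> K"
  then obtain E where E: "finite E" "E \<subseteq> carrier S" "g \<in> fun_span L (relations_on R S E)" by blast
  have DE: "finite (D \<union> E)" "D \<union> E \<subseteq> carrier S" using D E by auto
  have "f \<in> fun_span L (relations_on R S (D \<union> E))" "g \<in> fun_span L (relations_on R S (D \<union> E))"
    using fun_span_mono[OF D(3) relations_on_mono] fun_span_mono[OF E(3) relations_on_mono] DE by auto
  then show "f \<oplus>\<^bsub>function_module L\<^esub> g \<in> K" using submodule_add[OF sub] DE by blast
qed

lemma single_relation:
  assumes D: "finite D" "D \<subseteq> carrier S" and q: "q \<in> carrier (coeff_functions R)"
    and off: "\<And>s. s \<notin> D \<Longrightarrow> q s = \<zero>\<^bsub>R\<^esub>" and sum: "(\<Oplus>\<^bsub>S\<^esub>s\<in>D. q s \<odot>\<^bsub>S\<^esub> s) = \<zero>\<^bsub>S\<^esub>"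
    and x: "x \<in> carrier L"
  shows "(\<lambda>s. q s \<odot>\<^bsub>L\<^esub> x) \<in> K"
proof -
  have "q \<in> relations_on R S D" unfolding relations_on_def using q off sum by auto
  then show ?thesis using D fun_span_base[OF L relations_on_carrier _ x] by blast
qed

text \<open>The hard half of the vanishing criterion. Sending \<open>(s, x)\<close> to the class of
  the function with value \<open>x\<close> at \<open>s\<close> is bilinear modulo the relations, and
  the induced map on \<open>S \<otimes> L\<close> carries the tensor sum to the class of
  \<open>f\<close>. The relations may involve elements of \<open>S\<close> outside \<open>D\<close>,
  hence the larger set \<open>E\<close>.\<close>

lemma tensor_sum_eq_zeroE:
  assumes D: "finite D" "D \<subseteq> carrier S" and f: "f \<in> carrier (function_module L)"
    and off: "\<And>s. s \<notin> D \<Longrightarrow> f s = \<zero>\<^bsub>L\<^esub>" and zero: "tensor_sum R S L D f = \<zero>\<^bsub>SL\<^esub>"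
  obtains E where "finite E" "D \<subseteq> E" "E \<subseteq> carrier S" "f \<in> fun_span L (relations_on R S E)"
proof -
  let ?Y = "function_module L"
  let ?F = "coeff_functions R"
  let ?Q = "quotient_module ?Y K"
  have Y: "module R ?Y" by (rule function_module[OF L])
  have F: "module R ?F" by (rule coeff_functions_module[OF S.R.is_cring])
  have Q: "module R ?Q" by (rule quotient_module[OF Y relation_span_submodule])
  interpret Q: module R ?Q by (fact Q)
  interpret F: module R ?F by (fact F)
  define cls where "cls = (\<lambda>x. K +>\<^bsub>?Y\<^esub> x)"
  have cls: "cls \<in> module_hom R ?Y ?Q"
    unfolding cls_def by (rule quotient_class_hom[OF Y relation_span_submodule])
  have cls_zero: "cls g = \<zero>\<^bsub>?Q\<^esub> \<longleftrightarrow> g \<in> K" if "g \<in> carrier ?Y" for g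
    unfolding cls_def by (rule quotient_class_zero_iff[OF Y relation_span_submodule that])
  have basis: "free_basis R s \<in> carrier ?F" for s :: 's by (auto simp: free_basis_def)
  have scale: "(\<lambda>q s. q s \<odot>\<^bsub>L\<^esub> x) \<in> module_hom R ?F ?Y" if "x \<in> carrier L" for x
    by (rule pointwise_hom[OF scale_hom[OF L that]])
  have cs: "(\<lambda>q. cls (\<lambda>s. q s \<odot>\<^bsub>L\<^esub> x)) \<in> module_hom R ?F ?Q" if "x \<in> carrier L" for x
    by (rule module_hom_comp[OF cls scale[OF that]])
  have single: "single L s x = (\<lambda>t. free_basis R s t \<odot>\<^bsub>L\<^esub> x)" if "x \<in> carrier L" for s :: 's and x
    using that by (auto simp: single_def free_basis_def)
  \<comment> \<open>Coefficient functions with the same value in \<open>S\<close> differ by a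
    relation and so define the same class; additivity and homogeneity in \<open>s\<close> are both
    instances of this.\<close>
  have rel: "cls (\<lambda>t. p t \<odot>\<^bsub>L\<^esub> x) = cls (\<lambda>t. q t \<odot>\<^bsub>L\<^esub> x)"
    if "finite D" "D \<subseteq> carrier S" "p \<in> carrier ?F" "q \<in> carrier ?F"
      "\<And>s. s \<notin> D \<Longrightarrow> p s = \<zero>\<^bsub>R\<^esub>" "\<And>s. s \<notin> D \<Longrightarrow> q s = \<zero>\<^bsub>R\<^esub>"
      "(\<Oplus>\<^bsub>S\<^esub>s\<in>D. p s \<odot>\<^bsub>S\<^esub> s) = (\<Oplus>\<^bsub>S\<^esub>s\<in>D. q s \<odot>\<^bsub>S\<^esub> s)" "x \<in> carrier L" for D p q x
  proof -
    have fm: "p \<ominus>\<^bsub>?F\<^esub> q = (\<lambda>b. p b \<ominus>\<^bsub>R\<^esub> q b)"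
      using function_minus[OF module_regular[OF S.R.is_cring] that(3,4)] by (simp add: regular_minus)
    have "(\<lambda>s. (p \<ominus>\<^bsub>?F\<^esub> q) s \<odot>\<^bsub>L\<^esub> x) \<in> K"
    proof (rule single_relation[OF that(1,2)])
      show "p \<ominus>\<^bsub>?F\<^esub> q \<in> carrier ?F" using that by (intro F.minus_closed)
      show "(p \<ominus>\<^bsub>?F\<^esub> q) s = \<zero>\<^bsub>R\<^esub>" if "s \<notin> D" for s
        unfolding fm using that \<open>\<And>s. s \<notin> D \<Longrightarrow> p s = \<zero>\<^bsub>R\<^esub>\<close> \<open>\<And>s. s \<notin> D \<Longrightarrow> q s = \<zero>\<^bsub>R\<^esub>\<close>
        by (simp add: a_minus_def)
      show "(\<Oplus>\<^bsub>S\<^esub>s\<in>D. (p \<ominus>\<^bsub>?F\<^esub> q) s \<odot>\<^bsub>S\<^esub> s) = \<zero>\<^bsub>S\<^esub>"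
        using that(7) module_hom_closed[OF relation_sum_hom[OF that(1,2)] that(4)]
        by (simp only: module_hom_minus[OF F S relation_sum_hom[OF that(1,2)] that(3,4)])
          (simp only: S.minus_eq_zero_iff)
    qed (fact that(8))
    then have "cls (\<lambda>s. (p \<ominus>\<^bsub>?F\<^esub> q) s \<odot>\<^bsub>L\<^esub> x) = \<zero>\<^bsub>?Q\<^esub>"
      using cls_zero submodule_carrier[OF relation_span_submodule] by blast
    then show ?thesis
      using module_hom_minus[OF F Q cs[OF that(8)] that(3,4)] module_hom_closed[OF cs[OF that(8)]] that(3,4)
      by (simp only: Q.minus_eq_zero_iff)
  qed
  have bil: "bilinear R S L ?Q (\<lambda>s x. cls (single L s x))"
  proof (rule bilinearI)
    fix s show "(\<lambda>x. cls (single L s x)) \<in> module_hom R L ?Q"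
      by (rule module_hom_comp[OF cls single_hom])
  next
    fix x assume x: "x \<in> carrier L"
    show "(\<lambda>s. cls (single L s x)) \<in> module_hom R S ?Q"
    proof (rule module_homI)
      fix s t assume st: "s \<in> carrier S" "t \<in> carrier S"
      \<comment> \<open>The relation between the basis elements at \<open>s\<close>,
        \<open>t\<close> and \<open>s + t\<close> lives here. Coincidences among the three are
        harmless, because sums run over the set.\<close>
      let ?D = "{s, t, s \<oplus>\<^bsub>S\<^esub> t}"
      have D: "finite ?D" "?D \<subseteq> carrier S" using st by auto
      have "cls (\<lambda>u. free_basis R (s \<oplus>\<^bsub>S\<^esub> t) u \<odot>\<^bsub>L\<^esub> x) =
          cls (\<lambda>u. (free_basis R s \<oplus>\<^bsub>?F\<^esub> free_basis R t) u \<odot>\<^bsub>L\<^esub> x)"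
      proof (rule rel[OF D basis F.a_closed[OF basis basis]])
        show "(\<Oplus>\<^bsub>S\<^esub>u\<in>?D. free_basis R (s \<oplus>\<^bsub>S\<^esub> t) u \<odot>\<^bsub>S\<^esub> u) =
            (\<Oplus>\<^bsub>S\<^esub>u\<in>?D. (free_basis R s \<oplus>\<^bsub>?F\<^esub> free_basis R t) u \<odot>\<^bsub>S\<^esub> u)"
          by (simp only: module_hom_add[OF relation_sum_hom[OF D] basis basis] relation_sum_basis[OF D] insert_iff simp_thms)
      qed (use x in \<open>auto simp: free_basis_def\<close>)
      then show "cls (single L (s \<oplus>\<^bsub>S\<^esub> t) x) = cls (single L s x) \<oplus>\<^bsub>?Q\<^esub> cls (single L t x)"
        unfolding single[OF x] module_hom_add[OF cs[OF x] basis basis] .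
    next
      fix r s assume r: "r \<in> carrier R" and s: "s \<in> carrier S"
      let ?D = "{s, r \<odot>\<^bsub>S\<^esub> s}"
      have D: "finite ?D" "?D \<subseteq> carrier S" using r s by auto
      have "cls (\<lambda>u. free_basis R (r \<odot>\<^bsub>S\<^esub> s) u \<odot>\<^bsub>L\<^esub> x) =
          cls (\<lambda>u. (r \<odot>\<^bsub>?F\<^esub> free_basis R s) u \<odot>\<^bsub>L\<^esub> x)"
      proof (rule rel[OF D basis F.smult_closed[OF r basis]])
        show "(\<Oplus>\<^bsub>S\<^esub>u\<in>?D. free_basis R (r \<odot>\<^bsub>S\<^esub> s) u \<odot>\<^bsub>S\<^esub> u) =
            (\<Oplus>\<^bsub>S\<^esub>u\<in>?D. (r \<odot>\<^bsub>?F\<^esub> free_basis R s) u \<odot>\<^bsub>S\<^esub> u)"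
          by (simp only: module_hom_smult[OF relation_sum_hom[OF D] r basis] relation_sum_basis[OF D] insert_iff simp_thms)
      qed (use x r in \<open>auto simp: free_basis_def\<close>)
      then show "cls (single L (r \<odot>\<^bsub>S\<^esub> s) x) = r \<odot>\<^bsub>?Q\<^esub> cls (single L s x)"
        unfolding single[OF x] module_hom_smult[OF cs[OF x] r basis] .
    qed (rule module_hom_closed[OF cls single_carrier[OF x]])
  qed
  define \<Theta> where "\<Theta> = tensor_lift R ?Q (\<lambda>s x. cls (single L s x))"
  have \<Theta>: "\<Theta> \<in> module_hom R SL ?Q" unfolding \<Theta>_def by (rule tensor_lift_hom[OF S L Q bil])
  have fY: "f s \<in> carrier L" for s using f by simp
  have "\<Theta> (tensor_sum R S L D f) = (\<Oplus>\<^bsub>?Q\<^esub>s\<in>D. cls (single L s (f s)))"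
    unfolding tensor_sum_def
  proof (subst module_hom_finsum[OF tensor_left_module Q \<Theta>])
    show "(\<Oplus>\<^bsub>?Q\<^esub>s\<in>D. \<Theta> (pure_tensor R S L s (f s))) = (\<Oplus>\<^bsub>?Q\<^esub>s\<in>D. cls (single L s (f s)))"
      by (rule Q.finsum_cong')
        (use D fY tensor_lift_pure[OF S L Q bil] module_hom_closed[OF cls single_carrier] in
          \<open>auto simp: \<Theta>_def subset_iff\<close>)
  qed (use D fY pure_tensor_closed[OF S L] in auto)
  also have "\<dots> = cls (\<Oplus>\<^bsub>?Y\<^esub>s\<in>D. single L s (f s))"
    by (rule module_hom_finsum[OF Y Q cls, symmetric]) (rule Pi_I, rule single_carrier, rule fY)
  also have "(\<Oplus>\<^bsub>?Y\<^esub>s\<in>D. single L s (f s)) = f"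
  proof
    fix t
    have "(\<Oplus>\<^bsub>?Y\<^esub>s\<in>D. single L s (f s)) t = (\<Oplus>\<^bsub>L\<^esub>s\<in>D. single L s (f s) t)"
      by (rule module_hom_finsum[OF Y L coordinate_hom]) (rule Pi_I, rule single_carrier, rule fY)
    also have "\<dots> = f t"
    proof (cases "t \<in> D")
      case True
      have "(\<Oplus>\<^bsub>L\<^esub>s\<in>{t}. single L s (f s) t) = (\<Oplus>\<^bsub>L\<^esub>s\<in>D. single L s (f s) t)"
        by (rule L.add.finprod_mono_neutral_cong_left) (use D True fY in \<open>auto simp: single_def\<close>)
      then show ?thesis using fY by (simp add: single_def)
    next
      case False
      have "(\<Oplus>\<^bsub>L\<^esub>s\<in>D. single L s (f s) t) = (\<Oplus>\<^bsub>L\<^esub>s\<in>D. \<zero>\<^bsub>L\<^esub>)"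
        by (rule L.finsum_cong') (use False in \<open>auto simp: single_def\<close>)
      then show ?thesis using off[OF False] by simp
    qed
    finally show "(\<Oplus>\<^bsub>?Y\<^esub>s\<in>D. single L s (f s)) t = f t" .
  qed
  finally have "cls f = \<zero>\<^bsub>?Q\<^esub>" using zero module_hom_zero[OF tensor_left_module Q \<Theta>] by simp
  then obtain E where E: "finite E" "E \<subseteq> carrier S" "f \<in> fun_span L (relations_on R S E)"
    using cls_zero[OF f] by blast
  show ?thesis
  proof (rule that)
    show "f \<in> fun_span L (relations_on R S (D \<union> E))"
      by (rule fun_span_mono[OF E(3) relations_on_mono]) (use D E in auto)
  qed (use D E in auto)
qed

end

end

section \<open>Flat modules preserve inclusions of submodules of any type\<close>

section \<open>Injectivity on tensor products\<close>

lemma tensor_map_tensor_sum: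
  assumes "module R S" "module R S'" "module R L" "h \<in> module_hom R S S'"
    and "inj_on h D" "finite D" "D \<subseteq> carrier S" "f \<in> carrier (function_module L)"
  shows "tensor_map R S' L h id (tensor_sum R S L D f) =
    (\<Oplus>\<^bsub>tensor R S' L\<^esub>s\<in>D. pure_tensor R S' L (h s) (f s))"
proof -
  have T': "module R (tensor R S' L)" by (rule tensor_module[OF assms(2,3)])
  interpret T': module R "tensor R S' L" by (fact T')
  have fc: "f s \<in> carrier L" for s using assms(8) by simp
  show ?thesis
    unfolding tensor_sum_def
  proof (subst module_hom_finsum[OF tensor_module[OF assms(1,3)] T' tensor_map_hom[OF assms(1,3,2,3,4) id_hom]])
    show "(\<Oplus>\<^bsub>tensor R S' L\<^esub>a\<in>D. tensor_map R S' L h id (pure_tensor R S L a (f a))) =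
        (\<Oplus>\<^bsub>tensor R S' L\<^esub>s\<in>D. pure_tensor R S' L (h s) (f s))"
      by (rule T'.finsum_cong')
        (use assms(7) fc tensor_map_pure[OF assms(1,3,2,3,4) id_hom] pure_tensor_closed[OF assms(2,3)]
          module_hom_closed[OF assms(4)] in \<open>auto simp: subset_iff\<close>)
  qed (use assms(7) fc pure_tensor_closed[OF assms(1,3)] in auto)
qed

text \<open>A tensor that dies in \<open>Z \<otimes> L\<close> does so through relations on a finite
  set \<open>E\<close> of elements of \<open>Z\<close>. Its coordinates outside \<open>U\<close> are
  zero, so flatness allows relations with zero coefficients outside \<open>U\<close>, and these are
  relations in \<open>U\<close>.\<close>

lemma coord_flat_submodule_inj:
  fixes Z :: "('r, 'z) module"
  assumes Z: "module R Z" and L: "module R L" and flat: "coord_flat TYPE('z) R L" and U: "submodule U R Z"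
  shows "inj_on (tensor_map R Z L id id) (carrier (tensor R (Z\<lparr>carrier := U\<rparr>) L))"
proof -
  interpret Z: module R Z by (fact Z)
  let ?U = "Z\<lparr>carrier := U\<rparr>"
  have Um: "module R ?U" by (rule module_submodule[OF Z U])
  have UZ: "U \<subseteq> carrier Z" using submodule_carrier[OF U] by blast
  have inc: "id \<in> module_hom R ?U Z" by (rule inclusion_hom[OF UZ])
  note T = tensor_module[OF Um L] and T' = tensor_module[OF Z L]
  show ?thesis
  proof (rule module_hom_inj_onI[OF T T' tensor_map_hom[OF Um L Z L inc id_hom]])
    fix y assume y: "y \<in> carrier (tensor R ?U L)" and zero: "tensor_map R Z L id id y = \<zero>\<^bsub>tensor R Z L\<^esub>"
    obtain D f where D: "finite D" "D \<subseteq> carrier ?U" and f: "f \<in> carrier (function_module L)"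
      "\<forall>s. s \<notin> D \<longrightarrow> f s = \<zero>\<^bsub>L\<^esub>" and yf: "y = tensor_sum R ?U L D f"
      using tensor_sum_surj[OF Um L y] by blast
    have DZ: "D \<subseteq> carrier Z" and DU: "D \<subseteq> U" using D UZ by auto
    have z: "tensor_sum R Z L D f = \<zero>\<^bsub>tensor R Z L\<^esub>"
      using tensor_map_tensor_sum[OF Um Z L inc _ D f(1)] zero unfolding yf tensor_sum_def by simp
    obtain E where E: "finite E" "D \<subseteq> E" "E \<subseteq> carrier Z" "f \<in> fun_span L (relations_on R Z E)"
      by (rule tensor_sum_eq_zeroE[OF Z L D(1) DZ f(1) _ z]) (use f(2) in auto)
    have "f \<in> fun_span L {q \<in> relations_on R Z E. \<forall>b\<in>E - U. q b = \<zero>\<^bsub>R\<^esub>}"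
      by (rule coord_flat_finite[OF Z.R.is_cring flat _ relations_on_submodule[OF Z E(1,3)] E(4)])
        (use E(1) f(2) DU in auto)
    moreover have "{q \<in> relations_on R Z E. \<forall>b\<in>E - U. q b = \<zero>\<^bsub>R\<^esub>} \<subseteq> relations_on R ?U (E \<inter> U)"
    proof
      fix q assume "q \<in> {q \<in> relations_on R Z E. \<forall>b\<in>E - U. q b = \<zero>\<^bsub>R\<^esub>}"
      then have q: "q \<in> carrier (coeff_functions R)" "\<And>s. s \<notin> E \<inter> U \<Longrightarrow> q s = \<zero>\<^bsub>R\<^esub>"
        "(\<Oplus>\<^bsub>Z\<^esub>s\<in>E. q s \<odot>\<^bsub>Z\<^esub> s) = \<zero>\<^bsub>Z\<^esub>" unfolding relations_on_def by auto
      have qc: "q s \<in> carrier R" for s using q(1) by simp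
      have "id (\<Oplus>\<^bsub>?U\<^esub>s\<in>E \<inter> U. q s \<odot>\<^bsub>Z\<^esub> s) = (\<Oplus>\<^bsub>Z\<^esub>s\<in>E \<inter> U. id (q s \<odot>\<^bsub>Z\<^esub> s))"
        by (rule module_hom_finsum[OF Um Z inc]) (use qc submodule_smult[OF U] in auto)
      also have "\<dots> = (\<Oplus>\<^bsub>Z\<^esub>s\<in>E. q s \<odot>\<^bsub>Z\<^esub> s)"
        by (rule Z.add.finprod_mono_neutral_cong_left) (use E qc q(2) in auto)
      finally show "q \<in> relations_on R ?U (E \<inter> U)"
        using q unfolding relations_on_def by auto
    qed
    ultimately have "f \<in> fun_span L (relations_on R ?U (E \<inter> U))" by (rule fun_span_mono)
    then have "tensor_sum R ?U L (E \<inter> U) f = \<zero>\<^bsub>tensor R ?U L\<^esub>"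
      by (intro tensor_sum_relations[OF Um L]) (use E in auto)
    moreover have "tensor_sum R ?U L D f = tensor_sum R ?U L (E \<inter> U) f"
      by (rule tensor_sum_mono[OF Um L]) (use E DU f in auto)
    ultimately show "y = \<zero>\<^bsub>tensor R ?U L\<^esub>" using yf by simp
  qed
qed

text \<open>Flatness of \<open>C\<close> gives injectivity of
  \<open>U \<otimes> C \<rightarrow> M \<otimes> C\<close> for submodules \<open>U\<close> of
  \<open>M\<close>, although \<open>M\<close> need not be carried by the type of \<open>R\<close>;
  flatness of \<open>M\<close> does the rest.\<close>

corollary flat_tensor_coord_flat:
  assumes "flat_module R M" "flat_module R C"
  shows "coord_flat TYPE('b) R (tensor R M C)"
proof -
  have M: "module R M" and C: "module R C" using assms unfolding flat_module_def by blast+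
  show ?thesis
    by (rule coord_flat_tensor[OF M C flat_imp_coord_flat[OF assms(1)]])
      (rule coord_flat_submodule_inj[OF M C flat_imp_coord_flat[OF assms(2)]])
qed

section \<open>Submodules \<open>I L\<close> and their relation to coordinates of function
  spans\<close>

section \<open>Products of ideals and modules\<close>

text \<open>The submodule \<open>I L\<close>; working modulo it stands for tensoring
  \<open>L\<close> with \<open>R / I\<close>.\<close>

definition ideal_span :: "('r, 'm) module \<Rightarrow> 'r set \<Rightarrow> 'm set" where
  "ideal_span L I = add_span L {a \<odot>\<^bsub>L\<^esub> x | a x. a \<in> I \<and> x \<in> carrier L}"

context
  fixes R :: "('r, 'x) ring_scheme" and L :: "('r, 'm) module" and I :: "'r set"
  assumes L: "module R L" and I: "I \<subseteq> carrier R"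
begin

interpretation L: module R L by (fact L)

lemma ideal_span_generators: "{a \<odot>\<^bsub>L\<^esub> x | a x. a \<in> I \<and> x \<in> carrier L} \<subseteq> carrier L"
  using I by auto

lemma ideal_span_submodule: "submodule (ideal_span L I) R L"
  unfolding ideal_span_def
proof (rule add_span_submodule[OF L ideal_span_generators])
  fix r g assume r: "r \<in> carrier R" and "g \<in> {a \<odot>\<^bsub>L\<^esub> x | a x. a \<in> I \<and> x \<in> carrier L}"
  then obtain a x where g: "g = a \<odot>\<^bsub>L\<^esub> x" "a \<in> I" "x \<in> carrier L" by blast
  then have "r \<odot>\<^bsub>L\<^esub> g = a \<odot>\<^bsub>L\<^esub> (r \<odot>\<^bsub>L\<^esub> x)"
    using r I by (auto simp: L.smult_assoc1[symmetric] L.m_comm)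
  then show "r \<odot>\<^bsub>L\<^esub> g \<in> {a \<odot>\<^bsub>L\<^esub> x | a x. a \<in> I \<and> x \<in> carrier L}" using g r by blast
qed

lemma ideal_span_base: "a \<in> I \<Longrightarrow> x \<in> carrier L \<Longrightarrow> a \<odot>\<^bsub>L\<^esub> x \<in> ideal_span L I"
  unfolding ideal_span_def
  by (rule add_span_base[OF module_abelian_group[OF L] ideal_span_generators]) blast

lemma ideal_span_least:
  assumes "y \<in> ideal_span L I" "submodule K R L"
    and "\<And>a x. a \<in> I \<Longrightarrow> x \<in> carrier L \<Longrightarrow> a \<odot>\<^bsub>L\<^esub> x \<in> K"
  shows "y \<in> K"
  using assms(1) unfolding ideal_span_def by (rule add_span_least[OF _ assms(2)]) (use assms(3) in blast)

lemma ideal_span_image: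
  assumes "module R L'" "h \<in> module_hom R L L'" "y \<in> ideal_span L I"
  shows "h y \<in> ideal_span L' I"
  unfolding ideal_span_def
proof (rule add_span_image[OF L assms(1,2) ideal_span_generators])
  interpret L': module R L' by fact
  let ?G = "{a \<odot>\<^bsub>L'\<^esub> x | a x. a \<in> I \<and> x \<in> carrier L'}"
  show G: "?G \<subseteq> carrier L'" using I by auto
  show "y \<in> add_span L {a \<odot>\<^bsub>L\<^esub> x | a x. a \<in> I \<and> x \<in> carrier L}"
    using assms(3) unfolding ideal_span_def .
  fix g assume "g \<in> {a \<odot>\<^bsub>L\<^esub> x | a x. a \<in> I \<and> x \<in> carrier L}"
  then obtain a x where g: "g = a \<odot>\<^bsub>L\<^esub> x" "a \<in> I" "x \<in> carrier L" by blast
  then have "h g = a \<odot>\<^bsub>L'\<^esub> h x" using I module_hom_smult[OF assms(2)] by auto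
  then have "h g \<in> ?G" using g module_hom_closed[OF assms(2)] by blast
  then show "h g \<in> add_span L' ?G" by (rule add_span_base[OF module_abelian_group[OF assms(1)] G])
qed

end

lemma ideal_span_mono: "y \<in> ideal_span L I \<Longrightarrow> I \<subseteq> J \<Longrightarrow> y \<in> ideal_span L J"
  unfolding ideal_span_def by (erule add_span_mono) auto

lemma ideal_span_zero:
  assumes "module R L" "y \<in> ideal_span L {\<zero>\<^bsub>R\<^esub>}"
  shows "y = \<zero>\<^bsub>L\<^esub>"
proof -
  interpret L: module R L by fact
  have "y \<in> {\<zero>\<^bsub>L\<^esub>}"
    by (rule ideal_span_least[OF assms(1) _ assms(2)]) (auto intro: submoduleI'[OF assms(1)])
  then show ?thesis by simp
qed

text \<open>From \<open>(c a) x = a (c x)\<close> and because the multiples of \<open>a\<close> in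
  \<open>L\<close> already form a submodule, one factor \<open>a\<close> can be pulled out of a
  whole sum.\<close>

lemma ideal_span_principal:
  assumes "module R L" "a \<in> carrier R" "y \<in> ideal_span L (PIdl\<^bsub>R\<^esub> a)"
  shows "\<exists>x \<in> carrier L. y = a \<odot>\<^bsub>L\<^esub> x"
proof -
  interpret L: module R L by fact
  note h = smult_hom[OF assms(1,2)]
  have K: "submodule ((\<lambda>x. a \<odot>\<^bsub>L\<^esub> x) ` carrier L) R L"
    by (rule module_hom_image_submodule[OF assms(1,1) h L.carrier_is_submodule])
  have "y \<in> (\<lambda>x. a \<odot>\<^bsub>L\<^esub> x) ` carrier L"
  proof (rule ideal_span_least[OF assms(1) _ assms(3) K])
    fix b x assume "b \<in> PIdl\<^bsub>R\<^esub> a" and x: "x \<in> carrier L"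
    then obtain c where "c \<in> carrier R" "b = c \<otimes>\<^bsub>R\<^esub> a" unfolding cgenideal_def by blast
    then have "b \<odot>\<^bsub>L\<^esub> x = a \<odot>\<^bsub>L\<^esub> (c \<odot>\<^bsub>L\<^esub> x)"
      using assms(2) x by (simp add: L.smult_assoc1[symmetric] L.m_comm)
    then show "b \<odot>\<^bsub>L\<^esub> x \<in> (\<lambda>x. a \<odot>\<^bsub>L\<^esub> x) ` carrier L" using \<open>c \<in> carrier R\<close> x by blast
  qed (use assms(2) in \<open>auto simp: cgenideal_def\<close>)
  then show ?thesis by blast
qed

text \<open>A bridge that lets the closure and image lemmas for submodules be applied to
  ideals.\<close>

lemma submodule_regular_iff_ideal:
  assumes "cring R"
  shows "submodule I R (regular_algebra R) \<longleftrightarrow> ideal I R"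
proof
  interpret R: cring R by fact
  assume I: "submodule I R (regular_algebra R)"
  show "ideal I R"
  proof (rule idealI[OF R.ring_axioms])
    have "subgroup I (add_monoid (regular_algebra R))" by (rule submodule.axioms(1)[OF I])
    then show "subgroup I (add_monoid R)"
      unfolding subgroup_def m_inv_def by simp
    fix a x assume a: "a \<in> I" and x: "x \<in> carrier R"
    show "x \<otimes>\<^bsub>R\<^esub> a \<in> I" using submodule_smult[OF I x a] by simp
    then show "a \<otimes>\<^bsub>R\<^esub> x \<in> I" using submodule_carrier[OF I a] x by (simp add: R.m_comm)
  qed
next
  interpret R: cring R by fact
  assume "ideal I R"
  then interpret I: ideal I R .
  show "submodule I R (regular_algebra R)"
    by (rule submoduleI'[OF module_regular[OF assms]]) (auto intro: I.I_l_closed)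
qed

lemma ideal_of_coordinates:
  assumes "cring R" "submodule H R (coeff_functions R)"
  shows "ideal ((\<lambda>h. h b) ` H) R"
  unfolding submodule_regular_iff_ideal[OF assms(1), symmetric]
  by (rule module_hom_image_submodule[OF coeff_functions_module[OF assms(1)] module_regular[OF assms(1)]
        coordinate_hom assms(2)])

text \<open>Generators correspond to generators in both directions. Through this identity, exactness
  modulo ideals enters the induction over coordinates.\<close>

lemma fun_span_coordinate:
  assumes "module R L" "H \<subseteq> carrier (coeff_functions R)"
  shows "(\<lambda>f. f b) ` fun_span L H = ideal_span L ((\<lambda>h. h b) ` H)"
proof -
  have L: "module R L" by fact
  interpret L: module R L by fact
  let ?I = "(\<lambda>h. h b) ` H"
  have I: "?I \<subseteq> carrier R" using assms(2) by auto
  note H = fun_span_submodule[OF assms]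
  show ?thesis
  proof (intro equalityI subsetI)
    fix y assume "y \<in> (\<lambda>f. f b) ` fun_span L H"
    then obtain f where f: "f \<in> fun_span L H" "y = f b" by blast
    have "f \<in> {f \<in> carrier (function_module L). f b \<in> ideal_span L ?I}"
    proof (rule fun_span_least[OF assms f(1)])
      note K = ideal_span_submodule[OF L I]
      show "submodule {f \<in> carrier (function_module L). f b \<in> ideal_span L ?I} R (function_module L)"
        by (rule submoduleI'[OF function_module[OF L]])
          (use submodule_zero[OF K] submodule_add[OF K] submodule_smult[OF K] in auto)
    next
      fix h x assume hx: "h \<in> H" "x \<in> carrier L"
      have "h t \<in> carrier R" for t using assms(2) hx(1) by auto
      then show "(\<lambda>b. h b \<odot>\<^bsub>L\<^esub> x) \<in> {f \<in> carrier (function_module L). f b \<in> ideal_span L ?I}"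
        using hx ideal_span_base[OF L I, of "h b" x] by auto
    qed
    then show "y \<in> ideal_span L ?I" using f(2) by blast
  next
    fix y assume y: "y \<in> ideal_span L ?I"
    show "y \<in> (\<lambda>f. f b) ` fun_span L H"
    proof (rule ideal_span_least[OF L I y])
      show "submodule ((\<lambda>f. f b) ` fun_span L H) R L"
        by (rule module_hom_image_submodule[OF function_module[OF L] L coordinate_hom H])
      fix a x assume "a \<in> ?I" "x \<in> carrier L"
      then show "a \<odot>\<^bsub>L\<^esub> x \<in> (\<lambda>f. f b) ` fun_span L H" using fun_span_base[OF assms] by force
    qed
  qed
qed

section \<open>Colon ideals and associated primes\<close>

definition colon_ideal :: "('r, 'x) ring_scheme \<Rightarrow> 'r set \<Rightarrow> 'r \<Rightarrow> 'r set" where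
  "colon_ideal R I j = {r \<in> carrier R. r \<otimes>\<^bsub>R\<^esub> j \<in> I}"

lemma colon_ideal:
  assumes "cring R" "ideal I R" "j \<in> carrier R"
  shows "ideal (colon_ideal R I j) R"
proof -
  interpret R: cring R by fact
  interpret I: ideal I R by fact
  show ?thesis unfolding submodule_regular_iff_ideal[OF assms(1), symmetric]
    by (rule submoduleI'[OF module_regular[OF assms(1)]])
      (auto simp: colon_ideal_def assms(3) R.l_distr R.m_assoc intro: I.I_l_closed)
qed

text \<open>Flatness applied to the relation \<open>j x = \<Sum> a\<^sub>i x\<^sub>i\<close> with \<open>a\<^sub>i \<in> I\<close>, encoded by pairs
  (functions on \<^typ>\<open>bool\<close>).\<close>

lemma coord_flat_colon:
  assumes L: "module R L" and flat: "coord_flat TYPE(bool) R L" and I: "ideal I R"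
    and j: "j \<in> carrier R" and x: "x \<in> carrier L" and jx: "j \<odot>\<^bsub>L\<^esub> x \<in> ideal_span L I"
  shows "x \<in> ideal_span L (colon_ideal R I j)"
proof -
  interpret L: module R L by (fact L)
  interpret I: ideal I R by (fact I)
  have Ic: "I \<subseteq> carrier R" using I.a_subset .
  \<comment> \<open>Pairs whose entry at \<open>True\<close> is \<open>j\<close> times the entry at
    \<open>False\<close> modulo \<open>I\<close>. When the entry at \<open>True\<close> is zero, the
    entry at \<open>False\<close> lies in the colon ideal.\<close>
  define H where "H = {h \<in> carrier (coeff_functions R). j \<otimes>\<^bsub>R\<^esub> h False \<ominus>\<^bsub>R\<^esub> h True \<in> I}"
  have Hc: "H \<subseteq> carrier (coeff_functions R)" unfolding H_def by blast
  have hh: "(\<lambda>h. j \<otimes>\<^bsub>R\<^esub> h False \<ominus>\<^bsub>R\<^esub> h True) \<in> module_hom R (coeff_functions R) (regular_algebra R)"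
    using module_hom_diff[OF module_regular[OF L.R.is_cring]
        module_hom_scaled[OF module_regular[OF L.R.is_cring] coordinate_hom j] coordinate_hom]
    by simp
  have Is: "submodule I R (regular_algebra R)" using I submodule_regular_iff_ideal[OF L.R.is_cring] by blast
  have H: "submodule H R (coeff_functions R)"
  proof (rule submoduleI'[OF coeff_functions_module[OF L.R.is_cring]])
    show "\<zero>\<^bsub>coeff_functions R\<^esub> \<in> H"
      using module_hom_zero[OF coeff_functions_module[OF L.R.is_cring] module_regular[OF L.R.is_cring] hh]
      by (simp add: H_def)
  next
    fix f g assume "f \<in> H" "g \<in> H"
    then show "f \<oplus>\<^bsub>coeff_functions R\<^esub> g \<in> H"
      using module_hom_add[OF hh, of f g] submodule_add[OF Is] by (auto simp: H_def)
  next
    fix r f assume "r \<in> carrier R" "f \<in> H"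
    then show "r \<odot>\<^bsub>coeff_functions R\<^esub> f \<in> H"
      using module_hom_smult[OF hh, of r f] submodule_smult[OF Is] by (auto simp: H_def)
  qed (rule Hc)
  note HL = fun_span_submodule[OF L Hc]
  define e where "e = (\<lambda>y b. if b then y else \<zero>\<^bsub>L\<^esub>)"
  have "e y \<in> fun_span L H" if y: "y \<in> ideal_span L I" for y
  proof -
    have e: "e \<in> module_hom R L (function_module L)" by (rule module_homI) (auto simp: e_def)
    have "y \<in> {y \<in> carrier L. e y \<in> fun_span L H}"
    proof (rule ideal_span_least[OF L Ic y])
      show "submodule {y \<in> carrier L. e y \<in> fun_span L H} R L"
        by (rule submoduleI'[OF L])
          (auto simp del: function_simps simp: module_hom_zero[OF L function_module[OF L] e]
            module_hom_add[OF e] module_hom_smult[OF e]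
            intro: submodule_zero[OF HL] submodule_add[OF HL] submodule_smult[OF HL])
      fix a z assume a: "a \<in> I" and z: "z \<in> carrier L"
      have ac: "a \<in> carrier R" using a Ic by blast
      have "(\<lambda>b. if b then a else \<zero>\<^bsub>R\<^esub>) \<in> H"
        using a ac j I.a_inv_closed[OF a] by (simp add: H_def a_minus_def)
      then have "(\<lambda>b. (if b then a else \<zero>\<^bsub>R\<^esub>) \<odot>\<^bsub>L\<^esub> z) \<in> fun_span L H" by (rule fun_span_base[OF L Hc _ z])
      moreover have "(\<lambda>b. (if b then a else \<zero>\<^bsub>R\<^esub>) \<odot>\<^bsub>L\<^esub> z) = e (a \<odot>\<^bsub>L\<^esub> z)"
        using z by (auto simp: e_def)
      ultimately show "a \<odot>\<^bsub>L\<^esub> z \<in> {y \<in> carrier L. e y \<in> fun_span L H}" using ac z by simp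
    qed
    then show ?thesis by blast
  qed
  from this[OF jx] have e: "e (j \<odot>\<^bsub>L\<^esub> x) \<in> fun_span L H" .
  define p where "p = (\<lambda>b. if b then j else \<one>\<^bsub>R\<^esub>)"
  have "p \<in> H" using j by (simp add: H_def p_def a_minus_def L.R.r_neg)
  then have p: "(\<lambda>b. p b \<odot>\<^bsub>L\<^esub> x) \<in> fun_span L H" by (rule fun_span_base[OF L Hc _ x])
  \<comment> \<open>With entries listed as \<open>(False, True)\<close> this is
    \<open>(x, 0) = (x, j x) - (0, j x)\<close>: the first pair comes from \<open>(1, j)\<close> in
    \<open>H\<close>, the second from \<open>j x\<close> in \<open>I L\<close>.\<close>
  define f where "f = (\<lambda>b. if b then \<zero>\<^bsub>L\<^esub> else x)"
  have "f = (\<lambda>b. p b \<odot>\<^bsub>L\<^esub> x) \<ominus>\<^bsub>function_module L\<^esub> e (j \<odot>\<^bsub>L\<^esub> x)"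
    by (subst function_minus[OF L])
      (use x j in \<open>auto simp: f_def p_def e_def L.minus_zero_right a_minus_def L.r_neg\<close>)
  then have "f \<in> fun_span L H" using submodule_minus[OF HL p e] by simp
  moreover have "f True = \<zero>\<^bsub>L\<^esub>" by (simp add: f_def)
  ultimately have "f \<in> fun_span L {h \<in> H. h True = \<zero>\<^bsub>R\<^esub>}" by (rule coord_flatD[OF flat H])
  then have "f False \<in> (\<lambda>f. f False) ` fun_span L {h \<in> H. h True = \<zero>\<^bsub>R\<^esub>}" by blast
  also have "\<dots> = ideal_span L ((\<lambda>h. h False) ` {h \<in> H. h True = \<zero>\<^bsub>R\<^esub>})"
    by (rule fun_span_coordinate[OF L]) (use Hc in blast)
  finally have "f False \<in> ideal_span L ((\<lambda>h. h False) ` {h \<in> H. h True = \<zero>\<^bsub>R\<^esub>})" .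
  moreover have "(\<lambda>h. h False) ` {h \<in> H. h True = \<zero>\<^bsub>R\<^esub>} \<subseteq> colon_ideal R I j"
    using j by (auto simp: H_def colon_ideal_def L.R.m_comm L.R.minus_zero_right)
  ultimately have "f False \<in> ideal_span L (colon_ideal R I j)" by (rule ideal_span_mono)
  then show ?thesis by (simp add: f_def)
qed

text \<open>In a Noetherian ring the union of a nonempty chain of ideals belongs to the chain, so
  Zorn's lemma applies to any nonempty family of ideals.\<close>

lemma noetherian_maximal_ideal:
  assumes "noetherian_ring R" "\<F> \<noteq> {}" "\<And>I. I \<in> \<F> \<Longrightarrow> ideal I R"
  shows "\<exists>I \<in> \<F>. \<forall>J \<in> \<F>. I \<subseteq> J \<longrightarrow> J = I"
proof (rule subset_Zorn_nonempty[OF assms(2)])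
  interpret noetherian_ring R by fact
  fix \<C> assume C: "\<C> \<noteq> {}" "subset.chain \<F> \<C>"
  then have "subset.chain {I. ideal I R} \<C>"
    unfolding subset_chain_def by (auto intro: assms(3))
  then have "\<Union>\<C> \<in> \<C>" by (rule ideal_chain_is_trivial[OF C(1)])
  then show "\<Union>\<C> \<in> \<F>" using C(2) unfolding subset_chain_def by auto
qed

text \<open>These colon ideals are the annihilators of the nonzero elements of \<open>R / I\<close>;
  a maximal one among them is prime, that is, an associated prime of \<open>R / I\<close>.\<close>

lemma exists_prime_colon:
  assumes R: "cring R" and noeth: "noetherian_ring R" and I: "ideal I R" "I \<noteq> carrier R"
  shows "\<exists>j \<in> carrier R - I. primeideal (colon_ideal R I j) R"
proof -
  interpret R: cring R by fact
  interpret I: ideal I R by fact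
  let ?F = "colon_ideal R I ` (carrier R - I)"
  have ne: "?F \<noteq> {}" using I(2) I.a_subset by blast
  have "\<exists>P \<in> ?F. \<forall>J \<in> ?F. P \<subseteq> J \<longrightarrow> J = P"
    by (rule noetherian_maximal_ideal[OF noeth ne]) (use colon_ideal[OF R I(1)] in blast)
  then obtain P where P: "P \<in> ?F" "\<forall>J \<in> ?F. P \<subseteq> J \<longrightarrow> J = P" by (rule bexE)
  obtain j where j': "j \<in> carrier R - I" "P = colon_ideal R I j" using P(1) by (rule imageE)
  have j: "j \<in> carrier R" "j \<notin> I" using j'(1) by auto
  have max: "colon_ideal R I k = colon_ideal R I j"
    if "k \<in> carrier R - I" "colon_ideal R I j \<subseteq> colon_ideal R I k" for k
    using P(2) that unfolding j'(2) by simp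
  have "primeideal (colon_ideal R I j) R"
  proof (rule primeidealI[OF colon_ideal[OF R I(1) j(1)] R])
    show "carrier R \<noteq> colon_ideal R I j"
    proof
      assume "carrier R = colon_ideal R I j"
      then have "\<one>\<^bsub>R\<^esub> \<in> colon_ideal R I j" using R.one_closed by simp
      then show False using j by (simp add: colon_ideal_def)
    qed
    fix a b assume ab: "a \<in> carrier R" "b \<in> carrier R" "a \<otimes>\<^bsub>R\<^esub> b \<in> colon_ideal R I j"
    show "a \<in> colon_ideal R I j \<or> b \<in> colon_ideal R I j"
    proof (cases "b \<in> colon_ideal R I j")
      case False
      then have bj: "b \<otimes>\<^bsub>R\<^esub> j \<in> carrier R - I" using ab j by (simp add: colon_ideal_def)
      \<comment> \<open>Replacing \<open>j\<close> by \<open>b j\<close>, still outside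
        \<open>I\<close>, can only enlarge the annihilator. By maximality it is unchanged, and it
        contains \<open>a\<close> because \<open>a b j\<close> lies in \<open>I\<close>.\<close>
      have "colon_ideal R I j \<subseteq> colon_ideal R I (b \<otimes>\<^bsub>R\<^esub> j)"
      proof
        fix x assume "x \<in> colon_ideal R I j"
        then have x: "x \<in> carrier R" "x \<otimes>\<^bsub>R\<^esub> j \<in> I" unfolding colon_ideal_def by auto
        have "b \<otimes>\<^bsub>R\<^esub> (x \<otimes>\<^bsub>R\<^esub> j) \<in> I" by (rule I.I_l_closed[OF x(2) ab(2)])
        then show "x \<in> colon_ideal R I (b \<otimes>\<^bsub>R\<^esub> j)"
          using x(1) ab(2) j(1) by (simp add: colon_ideal_def R.m_lcomm)
      qed
      then have "colon_ideal R I (b \<otimes>\<^bsub>R\<^esub> j) = colon_ideal R I j" by (rule max[OF bj])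
      moreover have "a \<in> colon_ideal R I (b \<otimes>\<^bsub>R\<^esub> j)"
        using ab j by (simp add: colon_ideal_def R.m_assoc)
      ultimately show ?thesis by simp
    qed simp
  qed
  then show ?thesis using j by blast
qed

section \<open>Left exactness modulo an ideal, and its behaviour under extensions of cyclic
  modules\<close>

section \<open>Exactness of a complex after base change\<close>

locale module_complex =
  fixes R :: "('r, 'x) ring_scheme" and V :: "('r, 'v) module" and M :: "('r, 'm) module"
    and N :: "('r, 'n) module" and \<phi> \<delta>
  assumes V: "module R V" and M: "module R M" and N: "module R N"
    and \<phi>: "\<phi> \<in> module_hom R V M" and \<delta>: "\<delta> \<in> module_hom R M N"
    and complex: "v \<in> carrier V \<Longrightarrow> \<delta> (\<phi> v) = \<zero>\<^bsub>N\<^esub>"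
begin

interpretation V: module R V by (fact V)
interpretation M: module R M by (fact M)
interpretation N: module R N by (fact N)

text \<open>Exactness of \<open>0 \<rightarrow> V / I V \<rightarrow> M / I M \<rightarrow> N / I N\<close>.\<close>

definition exact_mod :: "'r set \<Rightarrow> bool" where
  "exact_mod I \<longleftrightarrow>
    (\<forall>v \<in> carrier V. \<phi> v \<in> ideal_span M I \<longrightarrow> v \<in> ideal_span V I) \<and>
    (\<forall>m \<in> carrier M. \<delta> m \<in> ideal_span N I \<longrightarrow>
      (\<exists>v \<in> carrier V. \<exists>w \<in> ideal_span M I. m = \<phi> v \<oplus>\<^bsub>M\<^esub> w))"

text \<open>Exactness after tensoring with the field of fractions of \<open>R / P\<close>.\<close>

definition exact_at :: "'r set \<Rightarrow> bool" where
  "exact_at P \<longleftrightarrow>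
    (\<forall>v \<in> carrier V. \<phi> v \<in> ideal_span M P \<longrightarrow> (\<exists>d \<in> carrier R - P. d \<odot>\<^bsub>V\<^esub> v \<in> ideal_span V P)) \<and>
    (\<forall>m \<in> carrier M. \<delta> m \<in> ideal_span N P \<longrightarrow>
      (\<exists>d \<in> carrier R - P. \<exists>v \<in> carrier V. \<exists>w \<in> ideal_span M P. d \<odot>\<^bsub>M\<^esub> m = \<phi> v \<oplus>\<^bsub>M\<^esub> w))"

text \<open>An element \<open>d\<close> outside a maximal ideal \<open>P\<close> is a unit modulo
  \<open>P\<close>. Writing \<open>1 = r d + p\<close> removes the denominator from
  \<open>exact_at\<close>, at the cost of a term with factor \<open>p\<close>, which is absorbed
  modulo \<open>P\<close>.\<close>

lemma exact_mod_maximal: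
  assumes "maximalideal P R" "exact_at P"
  shows "exact_mod P"
proof -
  interpret P: maximalideal P R by fact
  have Pc: "P \<subseteq> carrier R" using P.a_subset .
  have inv: "\<exists>r \<in> carrier R. \<exists>p \<in> P. \<one>\<^bsub>R\<^esub> = r \<otimes>\<^bsub>R\<^esub> d \<oplus>\<^bsub>R\<^esub> p" if d: "d \<in> carrier R - P" for d
  proof -
    have id: "ideal (PIdl\<^bsub>R\<^esub> d <+>\<^bsub>R\<^esub> P) R"
      by (rule V.R.add_ideals[OF V.R.cgenideal_ideal P.is_ideal]) (use d in blast)
    have "P \<subseteq> PIdl\<^bsub>R\<^esub> d <+>\<^bsub>R\<^esub> P"
    proof
      fix p assume p: "p \<in> P"
      have "\<zero>\<^bsub>R\<^esub> \<in> PIdl\<^bsub>R\<^esub> d" using d by (auto simp: cgenideal_def intro!: exI[of _ "\<zero>\<^bsub>R\<^esub>"])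
      moreover have "p = \<zero>\<^bsub>R\<^esub> \<oplus>\<^bsub>R\<^esub> p" using p Pc by auto
      ultimately show "p \<in> PIdl\<^bsub>R\<^esub> d <+>\<^bsub>R\<^esub> P" using p unfolding set_add_def' by blast
    qed
    moreover have "d \<in> PIdl\<^bsub>R\<^esub> d <+>\<^bsub>R\<^esub> P"
    proof -
      have "d = d \<oplus>\<^bsub>R\<^esub> \<zero>\<^bsub>R\<^esub>" "d \<in> PIdl\<^bsub>R\<^esub> d" using d V.R.cgenideal_self by auto
      then show ?thesis using P.zero_closed unfolding set_add_def' by blast
    qed
    ultimately have "PIdl\<^bsub>R\<^esub> d <+>\<^bsub>R\<^esub> P = carrier R"
      using P.I_maximal[OF id] d ideal.Icarr[OF id] by blast
    then have "\<one>\<^bsub>R\<^esub> \<in> PIdl\<^bsub>R\<^esub> d <+>\<^bsub>R\<^esub> P" by simp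
    then show ?thesis unfolding set_add_def' cgenideal_def by blast
  qed
  show ?thesis unfolding exact_mod_def
  proof (intro conjI ballI impI)
    fix v assume v: "v \<in> carrier V" "\<phi> v \<in> ideal_span M P"
    then obtain d where d: "d \<in> carrier R - P" "d \<odot>\<^bsub>V\<^esub> v \<in> ideal_span V P"
      using assms(2) unfolding exact_at_def by blast
    then obtain r p where r: "r \<in> carrier R" "p \<in> P" "\<one>\<^bsub>R\<^esub> = r \<otimes>\<^bsub>R\<^esub> d \<oplus>\<^bsub>R\<^esub> p" using inv by blast
    have pc: "p \<in> carrier R" using r Pc by blast
    have "v = (r \<otimes>\<^bsub>R\<^esub> d \<oplus>\<^bsub>R\<^esub> p) \<odot>\<^bsub>V\<^esub> v" unfolding r(3)[symmetric] using v by simp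
    also have "\<dots> = r \<odot>\<^bsub>V\<^esub> (d \<odot>\<^bsub>V\<^esub> v) \<oplus>\<^bsub>V\<^esub> p \<odot>\<^bsub>V\<^esub> v"
      using d r pc v by (simp add: V.smult_l_distr V.smult_assoc1)
    also have "\<dots> \<in> ideal_span V P"
      by (intro submodule_add[OF ideal_span_submodule[OF V Pc]]
          submodule_smult[OF ideal_span_submodule[OF V Pc]] ideal_span_base[OF V Pc] r d v)
    finally show "v \<in> ideal_span V P" .
  next
    fix m assume m: "m \<in> carrier M" "\<delta> m \<in> ideal_span N P"
    then obtain d v w where d: "d \<in> carrier R - P" "v \<in> carrier V" "w \<in> ideal_span M P"
      "d \<odot>\<^bsub>M\<^esub> m = \<phi> v \<oplus>\<^bsub>M\<^esub> w" using assms(2) unfolding exact_at_def by blast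
    then obtain r p where r: "r \<in> carrier R" "p \<in> P" "\<one>\<^bsub>R\<^esub> = r \<otimes>\<^bsub>R\<^esub> d \<oplus>\<^bsub>R\<^esub> p" using inv by blast
    have pc: "p \<in> carrier R" using r Pc by blast
    note sub = ideal_span_submodule[OF M Pc]
    have wc: "w \<in> carrier M" using submodule_carrier[OF sub] d by blast
    have "m = (r \<otimes>\<^bsub>R\<^esub> d \<oplus>\<^bsub>R\<^esub> p) \<odot>\<^bsub>M\<^esub> m" unfolding r(3)[symmetric] using m by simp
    also have "\<dots> = r \<odot>\<^bsub>M\<^esub> (d \<odot>\<^bsub>M\<^esub> m) \<oplus>\<^bsub>M\<^esub> p \<odot>\<^bsub>M\<^esub> m"
      using d r pc m by (simp add: M.smult_l_distr M.smult_assoc1)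
    also have "\<dots> = \<phi> (r \<odot>\<^bsub>V\<^esub> v) \<oplus>\<^bsub>M\<^esub> (r \<odot>\<^bsub>M\<^esub> w \<oplus>\<^bsub>M\<^esub> p \<odot>\<^bsub>M\<^esub> m)"
      unfolding d(4) using d r pc m wc module_hom_closed[OF \<phi>]
      by (simp add: M.smult_r_distr module_hom_smult[OF \<phi>] M.a_assoc)
    finally have "m = \<phi> (r \<odot>\<^bsub>V\<^esub> v) \<oplus>\<^bsub>M\<^esub> (r \<odot>\<^bsub>M\<^esub> w \<oplus>\<^bsub>M\<^esub> p \<odot>\<^bsub>M\<^esub> m)" .
    moreover have "r \<odot>\<^bsub>M\<^esub> w \<oplus>\<^bsub>M\<^esub> p \<odot>\<^bsub>M\<^esub> m \<in> ideal_span M P"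
      by (intro submodule_add[OF sub] submodule_smult[OF sub] ideal_span_base[OF M Pc] r d m)
    ultimately show "\<exists>v \<in> carrier V. \<exists>w \<in> ideal_span M P. m = \<phi> v \<oplus>\<^bsub>M\<^esub> w" using r(1) d(2) by blast
  qed
qed

text \<open>A single term \<open>j x\<close> suffices, since multiples of \<open>j\<close> are
  collected in \<open>x\<close> while the contributions of \<open>I\<close> accumulate in
  \<open>w\<close>.\<close>

lemma ideal_span_insert:
  assumes "module R L" "I \<subseteq> carrier R" "j \<in> carrier R" "y \<in> ideal_span L (I <+>\<^bsub>R\<^esub> PIdl\<^bsub>R\<^esub> j)"
  shows "\<exists>w \<in> ideal_span L I. \<exists>x \<in> carrier L. y = w \<oplus>\<^bsub>L\<^esub> j \<odot>\<^bsub>L\<^esub> x"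
proof -
  interpret L: module R L by fact
  note sub = ideal_span_submodule[OF assms(1,2)]
  show ?thesis using assms(4) unfolding ideal_span_def[of L "I <+>\<^bsub>R\<^esub> PIdl\<^bsub>R\<^esub> j"]
  proof induction
    case zero
    show ?case
      by (rule bexI[OF _ submodule_zero[OF sub]], rule bexI[OF _ L.zero_closed]) (use assms(3) in simp)
  next
    case (add y g)
    then obtain w x where wx: "w \<in> ideal_span L I" "x \<in> carrier L" "y = w \<oplus>\<^bsub>L\<^esub> j \<odot>\<^bsub>L\<^esub> x" by blast
    obtain c z where "c \<in> I <+>\<^bsub>R\<^esub> PIdl\<^bsub>R\<^esub> j" and z: "z \<in> carrier L" "g = c \<odot>\<^bsub>L\<^esub> z" using add.hyps by blast
    then obtain a r where a: "a \<in> I" "r \<in> carrier R" "c = a \<oplus>\<^bsub>R\<^esub> r \<otimes>\<^bsub>R\<^esub> j"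
      unfolding set_add_def' cgenideal_def by blast
    have ac: "a \<in> carrier R" and wc: "w \<in> carrier L" using a wx assms(2) submodule_carrier[OF sub] by auto
    have "(r \<otimes>\<^bsub>R\<^esub> j) \<odot>\<^bsub>L\<^esub> z = j \<odot>\<^bsub>L\<^esub> (r \<odot>\<^bsub>L\<^esub> z)"
      using a z assms(3) by (simp add: L.smult_assoc1[symmetric] V.R.m_comm)
    then have "y \<oplus>\<^bsub>L\<^esub> g = (w \<oplus>\<^bsub>L\<^esub> a \<odot>\<^bsub>L\<^esub> z) \<oplus>\<^bsub>L\<^esub> j \<odot>\<^bsub>L\<^esub> (x \<oplus>\<^bsub>L\<^esub> r \<odot>\<^bsub>L\<^esub> z)"
      using wx(2,3) a z ac wc assms(3) by (simp add: L.smult_l_distr L.smult_r_distr L.a_ac)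
    moreover have "w \<oplus>\<^bsub>L\<^esub> a \<odot>\<^bsub>L\<^esub> z \<in> ideal_span L I"
      by (intro submodule_add[OF sub] wx ideal_span_base[OF assms(1,2)] a z)
    moreover have "x \<oplus>\<^bsub>L\<^esub> r \<odot>\<^bsub>L\<^esub> z \<in> carrier L" using wx a z by simp
    ultimately show ?case by blast
  qed
qed

text \<open>Passage along \<open>0 \<rightarrow> R / (I : j) \<rightarrow> R / I \<rightarrow> R / (I + j) \<rightarrow> 0\<close>.\<close>

lemma exact_mod_extension:
  assumes flat_M: "coord_flat TYPE(bool) R M" and flat_N: "coord_flat TYPE(bool) R N"
    and I: "ideal I R" and j: "j \<in> carrier R"
    and colon: "exact_mod (colon_ideal R I j)" and sum: "exact_mod (I <+>\<^bsub>R\<^esub> PIdl\<^bsub>R\<^esub> j)"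
  shows "exact_mod I"
proof -
  interpret I: ideal I R by (fact I)
  let ?J = "I <+>\<^bsub>R\<^esub> PIdl\<^bsub>R\<^esub> j"
  let ?P = "colon_ideal R I j"
  have Ic: "I \<subseteq> carrier R" by (rule I.a_subset)
  have Pc: "?P \<subseteq> carrier R" unfolding colon_ideal_def by blast
  have IJ: "I \<subseteq> ?J"
  proof
    fix a assume a: "a \<in> I"
    have "\<zero>\<^bsub>R\<^esub> \<in> PIdl\<^bsub>R\<^esub> j" using j by (auto simp: cgenideal_def intro!: exI[of _ "\<zero>\<^bsub>R\<^esub>"])
    moreover have "a = a \<oplus>\<^bsub>R\<^esub> \<zero>\<^bsub>R\<^esub>" using a Ic by auto
    ultimately show "a \<in> ?J" using a unfolding set_add_def' by blast
  qed
  \<comment> \<open>Multiplication by \<open>j\<close> is well defined as a map from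
    \<open>L / (I : j) L\<close> to \<open>L / I L\<close>.\<close>
  have jP: "j \<odot>\<^bsub>L\<^esub> x \<in> ideal_span L I" if L: "module R L" and x: "x \<in> ideal_span L ?P" for L :: "('r, 'l) module" and x
  proof -
    interpret L: module R L by (fact L)
    note sub = ideal_span_submodule[OF L Ic]
    have "x \<in> {x \<in> carrier L. j \<odot>\<^bsub>L\<^esub> x \<in> ideal_span L I}"
    proof (rule ideal_span_least[OF L Pc x])
      show "submodule {x \<in> carrier L. j \<odot>\<^bsub>L\<^esub> x \<in> ideal_span L I} R L"
        by (rule submoduleI'[OF L])
          (use j submodule_zero[OF sub] submodule_add[OF sub] in
            \<open>auto simp: L.smult_r_distr module_hom_smult[OF smult_hom[OF L j]] intro: submodule_smult[OF sub]\<close>)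
      fix a z assume a: "a \<in> ?P" and z: "z \<in> carrier L"
      have "j \<odot>\<^bsub>L\<^esub> (a \<odot>\<^bsub>L\<^esub> z) = (a \<otimes>\<^bsub>R\<^esub> j) \<odot>\<^bsub>L\<^esub> z"
        using a z j by (simp add: colon_ideal_def L.smult_assoc1[symmetric] V.R.m_comm)
      then show "a \<odot>\<^bsub>L\<^esub> z \<in> {x \<in> carrier L. j \<odot>\<^bsub>L\<^esub> x \<in> ideal_span L I}"
        using a z ideal_span_base[OF L Ic _ z] by (auto simp: colon_ideal_def)
    qed
    then show ?thesis by blast
  qed
  note VI = ideal_span_submodule[OF V Ic] and MI = ideal_span_submodule[OF M Ic]
    and NI = ideal_span_submodule[OF N Ic]
  show ?thesis unfolding exact_mod_def
  proof (intro conjI ballI impI)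
    fix v assume v: "v \<in> carrier V" "\<phi> v \<in> ideal_span M I"
    have "v \<in> ideal_span V ?J"
      using sum v(1) ideal_span_mono[OF v(2) IJ] unfolding exact_mod_def by blast
    then obtain w x where wx: "w \<in> ideal_span V I" "x \<in> carrier V" "v = w \<oplus>\<^bsub>V\<^esub> j \<odot>\<^bsub>V\<^esub> x"
      using ideal_span_insert[OF V Ic j] by blast
    have wc: "w \<in> carrier V" using submodule_carrier[OF VI wx(1)] .
    have w: "\<phi> w \<in> ideal_span M I" by (rule ideal_span_image[OF V Ic M \<phi> wx(1)])
    have "j \<odot>\<^bsub>M\<^esub> \<phi> x = \<phi> v \<ominus>\<^bsub>M\<^esub> \<phi> w"
    proof -
      have "\<phi> v = j \<odot>\<^bsub>M\<^esub> \<phi> x \<oplus>\<^bsub>M\<^esub> \<phi> w"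
        using wx wc j module_hom_closed[OF \<phi>]
        by (simp add: module_hom_add[OF \<phi>] module_hom_smult[OF \<phi>] M.a_comm)
      then show ?thesis using wx wc j module_hom_closed[OF \<phi>] by (simp add: M.plus_minus_cancel)
    qed
    then have "j \<odot>\<^bsub>M\<^esub> \<phi> x \<in> ideal_span M I" using submodule_minus[OF MI v(2) w] by simp
    \<comment> \<open>Flatness of \<open>M\<close>: multiplication by \<open>j\<close>, which embeds
      \<open>R / (I : j)\<close> into \<open>R / I\<close>, stays injective after tensoring with
      \<open>M\<close>.\<close>
    then have "\<phi> x \<in> ideal_span M ?P"
      by (intro coord_flat_colon[OF M flat_M I j] module_hom_closed[OF \<phi>] wx)
    then have "x \<in> ideal_span V ?P" using colon wx(2) unfolding exact_mod_def by blast
    then show "v \<in> ideal_span V I" unfolding wx(3) by (intro submodule_add[OF VI wx(1)] jP[OF V])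
  next
    fix m assume m: "m \<in> carrier M" "\<delta> m \<in> ideal_span N I"
    have "\<exists>v \<in> carrier V. \<exists>w \<in> ideal_span M ?J. m = \<phi> v \<oplus>\<^bsub>M\<^esub> w"
      using sum m(1) ideal_span_mono[OF m(2) IJ] unfolding exact_mod_def by blast
    then obtain v y where v: "v \<in> carrier V" "y \<in> ideal_span M ?J" "m = \<phi> v \<oplus>\<^bsub>M\<^esub> y" by blast
    obtain w x where wx: "w \<in> ideal_span M I" "x \<in> carrier M" "y = w \<oplus>\<^bsub>M\<^esub> j \<odot>\<^bsub>M\<^esub> x"
      using ideal_span_insert[OF M Ic j v(2)] by blast
    have wc: "w \<in> carrier M" using submodule_carrier[OF MI wx(1)] .
    have w: "\<delta> w \<in> ideal_span N I" by (rule ideal_span_image[OF M Ic N \<delta> wx(1)])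
    have "j \<odot>\<^bsub>N\<^esub> \<delta> x = \<delta> m \<ominus>\<^bsub>N\<^esub> \<delta> w"
    proof -
      have "\<delta> m = j \<odot>\<^bsub>N\<^esub> \<delta> x \<oplus>\<^bsub>N\<^esub> \<delta> w"
        using v wx wc j module_hom_closed[OF \<delta>] module_hom_closed[OF \<phi>]
        by (simp add: module_hom_add[OF \<delta>] module_hom_smult[OF \<delta>] N.a_comm complex)
      then show ?thesis using wx wc j module_hom_closed[OF \<delta>] by (simp add: N.plus_minus_cancel)
    qed
    then have "j \<odot>\<^bsub>N\<^esub> \<delta> x \<in> ideal_span N I" using submodule_minus[OF NI m(2) w] by simp
    then have "\<delta> x \<in> ideal_span N ?P"
      by (intro coord_flat_colon[OF N flat_N I j] module_hom_closed[OF \<delta>] wx)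
    then obtain u z where u: "u \<in> carrier V" "z \<in> ideal_span M ?P" "x = \<phi> u \<oplus>\<^bsub>M\<^esub> z"
      using colon wx(2) unfolding exact_mod_def by blast
    have zc: "z \<in> carrier M" using submodule_carrier[OF ideal_span_submodule[OF M Pc] u(2)] .
    \<comment> \<open>The lift is found in two stages: \<open>v\<close> lifts \<open>m\<close>
      modulo the larger ideal, and \<open>j u\<close> takes care of the remainder
      \<open>j x\<close>, where \<open>u\<close> lifts \<open>x\<close> modulo the colon
      ideal.\<close>
    have "m = \<phi> (v \<oplus>\<^bsub>V\<^esub> j \<odot>\<^bsub>V\<^esub> u) \<oplus>\<^bsub>M\<^esub> (w \<oplus>\<^bsub>M\<^esub> j \<odot>\<^bsub>M\<^esub> z)"
      unfolding v(3) wx(3) u(3) using v(1) u(1) wc zc j module_hom_closed[OF \<phi>]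
      by (simp add: module_hom_add[OF \<phi>] module_hom_smult[OF \<phi>] M.smult_r_distr M.a_ac)
    moreover have "w \<oplus>\<^bsub>M\<^esub> j \<odot>\<^bsub>M\<^esub> z \<in> ideal_span M I"
      by (intro submodule_add[OF MI wx(1)] jP[OF M u(2)])
    moreover have "v \<oplus>\<^bsub>V\<^esub> j \<odot>\<^bsub>V\<^esub> u \<in> carrier V" using v u j by simp
    ultimately show "\<exists>v \<in> carrier V. \<exists>w \<in> ideal_span M I. m = \<phi> v \<oplus>\<^bsub>M\<^esub> w" by blast
  qed
qed

lemma exact_mod_carrier: "exact_mod (carrier R)"
  unfolding exact_mod_def
proof (intro conjI ballI impI)
  fix v assume "v \<in> carrier V"
  then show "v \<in> ideal_span V (carrier R)" using ideal_span_base[OF V subset_refl V.R.one_closed] by force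
next
  fix m assume m: "m \<in> carrier M"
  then have "m \<in> ideal_span M (carrier R)" using ideal_span_base[OF M subset_refl V.R.one_closed] by force
  moreover have "m = \<phi> \<zero>\<^bsub>V\<^esub> \<oplus>\<^bsub>M\<^esub> m" using m by (simp add: module_hom_zero[OF V M \<phi>])
  ultimately show "\<exists>v \<in> carrier V. \<exists>w \<in> ideal_span M (carrier R). m = \<phi> v \<oplus>\<^bsub>M\<^esub> w" by blast
qed

section \<open>Exactness modulo every ideal of a Noetherian domain whose nonzero primes are
  maximal\<close>

context
  assumes dom: "domain R" and noeth: "noetherian_ring R"
    and dim: "\<And>P. primeideal P R \<Longrightarrow> P \<noteq> {\<zero>\<^bsub>R\<^esub>} \<Longrightarrow> maximalideal P R"
    and flat_M: "coord_flat TYPE(bool) R M" and flat_N: "coord_flat TYPE(bool) R N"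
    and fibres: "\<And>P. primeideal P R \<Longrightarrow> exact_at P"
    and torsion: "\<And>d. d \<in> carrier R \<Longrightarrow>
      \<exists>k :: nat. \<forall>v \<in> carrier V. d [^]\<^bsub>R\<^esub> (Suc k) \<odot>\<^bsub>V\<^esub> v = \<zero>\<^bsub>V\<^esub> \<longrightarrow> d [^]\<^bsub>R\<^esub> k \<odot>\<^bsub>V\<^esub> v = \<zero>\<^bsub>V\<^esub>"
begin

interpretation R: domain R by (fact dom)

lemma exact_mod_nonzero:
  assumes "ideal I R" "I \<noteq> {\<zero>\<^bsub>R\<^esub>}"
  shows "exact_mod I"
proof (rule ccontr)
  assume "\<not> exact_mod I"
  let ?F = "{I. ideal I R \<and> I \<noteq> {\<zero>\<^bsub>R\<^esub>} \<and> \<not> exact_mod I}"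
  have "\<exists>I \<in> ?F. \<forall>J \<in> ?F. I \<subseteq> J \<longrightarrow> J = I"
    by (rule noetherian_maximal_ideal[OF noeth]) (use assms \<open>\<not> exact_mod I\<close> in auto)
  then obtain I where I: "ideal I R" "I \<noteq> {\<zero>\<^bsub>R\<^esub>}" "\<not> exact_mod I"
    and max: "\<And>J. ideal J R \<Longrightarrow> J \<noteq> {\<zero>\<^bsub>R\<^esub>} \<Longrightarrow> I \<subset> J \<Longrightarrow> exact_mod J" by blast
  interpret I: ideal I R by (fact I(1))
  have Ic: "I \<subseteq> carrier R" by (rule I.a_subset)
  have "I \<noteq> carrier R" using I(3) exact_mod_carrier by blast
  then obtain j where j: "j \<in> carrier R" "j \<notin> I" "primeideal (colon_ideal R I j) R"
    using exists_prime_colon[OF V.R.is_cring noeth I(1)] by blast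
  have nonzero: "\<exists>a \<in> I. a \<noteq> \<zero>\<^bsub>R\<^esub>" using I(2) I.zero_closed by blast
  \<comment> \<open>The colon ideal contains the nonzero ideal \<open>I\<close>, so it is a nonzero
    prime, to which the dimension hypothesis applies.\<close>
  have "I \<subseteq> colon_ideal R I j" using Ic j(1) I.I_r_closed unfolding colon_ideal_def by blast
  then have "colon_ideal R I j \<noteq> {\<zero>\<^bsub>R\<^esub>}" using nonzero by blast
  then have "exact_mod (colon_ideal R I j)"
    using dim[OF j(3)] fibres[OF j(3)] by (intro exact_mod_maximal)
  moreover have "exact_mod (I <+>\<^bsub>R\<^esub> PIdl\<^bsub>R\<^esub> j)"
  proof (rule max)
    show "ideal (I <+>\<^bsub>R\<^esub> PIdl\<^bsub>R\<^esub> j) R" by (rule V.R.add_ideals[OF I(1) V.R.cgenideal_ideal[OF j(1)]])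
    have "a \<in> I <+>\<^bsub>R\<^esub> PIdl\<^bsub>R\<^esub> j" if a: "a \<in> I" for a
    proof -
      have "a = a \<oplus>\<^bsub>R\<^esub> \<zero>\<^bsub>R\<^esub>" using a Ic by auto
      moreover have "\<zero>\<^bsub>R\<^esub> \<in> PIdl\<^bsub>R\<^esub> j" using j(1) by (auto simp: cgenideal_def intro!: exI[of _ "\<zero>\<^bsub>R\<^esub>"])
      ultimately show ?thesis using a unfolding set_add_def' by blast
    qed
    moreover have "j \<in> I <+>\<^bsub>R\<^esub> PIdl\<^bsub>R\<^esub> j"
    proof -
      have "j = \<zero>\<^bsub>R\<^esub> \<oplus>\<^bsub>R\<^esub> j" "j \<in> PIdl\<^bsub>R\<^esub> j" using j(1) V.R.cgenideal_self by auto
      then show ?thesis using I.zero_closed unfolding set_add_def' by blast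
    qed
    ultimately show "I \<subset> I <+>\<^bsub>R\<^esub> PIdl\<^bsub>R\<^esub> j" "I <+>\<^bsub>R\<^esub> PIdl\<^bsub>R\<^esub> j \<noteq> {\<zero>\<^bsub>R\<^esub>}" using j(2) nonzero by blast+
  qed
  ultimately have "exact_mod I" by (rule exact_mod_extension[OF flat_M flat_N I(1) j(1)])
  then show False using I(3) by blast
qed

lemma principal_nonzero:
  assumes "d \<in> carrier R" "d \<noteq> \<zero>\<^bsub>R\<^esub>"
  shows "ideal (PIdl\<^bsub>R\<^esub> d) R" "PIdl\<^bsub>R\<^esub> d \<noteq> {\<zero>\<^bsub>R\<^esub>}"
  using V.R.cgenideal_ideal V.R.cgenideal_self assms by blast+

text \<open>In a domain the colon ideal \<open>(0 : d)\<close> is zero, so this is the case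
  \<open>I = 0\<close> of \<open>coord_flat_colon\<close>.\<close>

lemma torsion_free:
  assumes "d \<in> carrier R" "d \<noteq> \<zero>\<^bsub>R\<^esub>" "m \<in> carrier M" "d \<odot>\<^bsub>M\<^esub> m = \<zero>\<^bsub>M\<^esub>"
  shows "m = \<zero>\<^bsub>M\<^esub>"
proof -
  have z: "{\<zero>\<^bsub>R\<^esub>} \<subseteq> carrier R" by simp
  have "m \<in> ideal_span M (colon_ideal R {\<zero>\<^bsub>R\<^esub>} d)"
    by (rule coord_flat_colon[OF M flat_M V.R.zeroideal assms(1,3)])
      (use assms(4) submodule_zero[OF ideal_span_submodule[OF M z]] in simp)
  moreover have "colon_ideal R {\<zero>\<^bsub>R\<^esub>} d \<subseteq> {\<zero>\<^bsub>R\<^esub>}"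
    using assms(1,2) R.integral unfolding colon_ideal_def by blast
  ultimately have "m \<in> ideal_span M {\<zero>\<^bsub>R\<^esub>}" by (rule ideal_span_mono)
  then show ?thesis by (rule ideal_span_zero[OF M])
qed

theorem exact_mod_all:
  assumes "ideal I R"
  shows "exact_mod I"
proof (cases "I = {\<zero>\<^bsub>R\<^esub>}")
  case False
  then show ?thesis by (rule exact_mod_nonzero[OF assms])
next
  case True
  have z: "{\<zero>\<^bsub>R\<^esub>} \<subseteq> carrier R" by simp
  have fibre: "exact_at {\<zero>\<^bsub>R\<^esub>}"
    by (rule fibres[OF R.zeroprimeideal])
  have zero_in: "\<zero>\<^bsub>L\<^esub> \<in> ideal_span L J" if "module R L" "J \<subseteq> carrier R" for L :: "('r, 'l) module" and J
    by (rule submodule_zero[OF ideal_span_submodule[OF that]])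
  show ?thesis unfolding True exact_mod_def
  proof (intro conjI ballI impI)
    fix v assume v: "v \<in> carrier V" "\<phi> v \<in> ideal_span M {\<zero>\<^bsub>R\<^esub>}"
    have \<phi>v: "\<phi> v = \<zero>\<^bsub>M\<^esub>" by (rule ideal_span_zero[OF M v(2)])
    obtain d where d: "d \<in> carrier R" "d \<noteq> \<zero>\<^bsub>R\<^esub>" "d \<odot>\<^bsub>V\<^esub> v \<in> ideal_span V {\<zero>\<^bsub>R\<^esub>}"
      using fibre v unfolding exact_at_def by blast
    have dv: "d \<odot>\<^bsub>V\<^esub> v = \<zero>\<^bsub>V\<^esub>" by (rule ideal_span_zero[OF V d(3)])
    obtain k :: nat where k: "\<And>v. v \<in> carrier V \<Longrightarrow> d [^]\<^bsub>R\<^esub> (Suc k) \<odot>\<^bsub>V\<^esub> v = \<zero>\<^bsub>V\<^esub> \<Longrightarrow> d [^]\<^bsub>R\<^esub> k \<odot>\<^bsub>V\<^esub> v = \<zero>\<^bsub>V\<^esub>"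
      using torsion[OF d(1)] by blast
    let ?e = "d [^]\<^bsub>R\<^esub> k"
    have "d [^]\<^bsub>R\<^esub> n \<noteq> \<zero>\<^bsub>R\<^esub>" for n :: nat
      using d(1,2) by (induction n) (simp_all add: R.integral_iff)
    then have e: "?e \<in> carrier R" "?e \<noteq> \<zero>\<^bsub>R\<^esub>" using d(1) by simp_all
    have "exact_mod (PIdl\<^bsub>R\<^esub> ?e)" by (rule exact_mod_nonzero[OF principal_nonzero[OF e]])
    moreover have "PIdl\<^bsub>R\<^esub> ?e \<subseteq> carrier R" using e by (auto simp: cgenideal_def)
    then have "\<phi> v \<in> ideal_span M (PIdl\<^bsub>R\<^esub> ?e)" unfolding \<phi>v by (rule zero_in[OF M])
    ultimately have "v \<in> ideal_span V (PIdl\<^bsub>R\<^esub> ?e)" using v(1) unfolding exact_mod_def by blast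
    then obtain u where u: "u \<in> carrier V" "v = ?e \<odot>\<^bsub>V\<^esub> u" using ideal_span_principal[OF V e(1)] by blast
    have "d [^]\<^bsub>R\<^esub> (Suc k) \<odot>\<^bsub>V\<^esub> u = d \<odot>\<^bsub>V\<^esub> v"
      unfolding u(2) using d e u by (simp add: V.smult_assoc1[symmetric] V.R.m_comm)
    then have "v = \<zero>\<^bsub>V\<^esub>" using k[OF u(1)] dv u(2) by simp
    then show "v \<in> ideal_span V {\<zero>\<^bsub>R\<^esub>}" using zero_in[OF V z] by simp
  next
    fix m assume m: "m \<in> carrier M" "\<delta> m \<in> ideal_span N {\<zero>\<^bsub>R\<^esub>}"
    obtain d v w where d: "d \<in> carrier R" "d \<noteq> \<zero>\<^bsub>R\<^esub>" "v \<in> carrier V" "w \<in> ideal_span M {\<zero>\<^bsub>R\<^esub>}"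
      "d \<odot>\<^bsub>M\<^esub> m = \<phi> v \<oplus>\<^bsub>M\<^esub> w" using fibre m unfolding exact_at_def by blast
    have \<phi>v: "\<phi> v = d \<odot>\<^bsub>M\<^esub> m"
      using d(3,5) ideal_span_zero[OF M d(4)] module_hom_closed[OF \<phi>] by simp
    have "exact_mod (PIdl\<^bsub>R\<^esub> d)" by (rule exact_mod_nonzero[OF principal_nonzero[OF d(1,2)]])
    moreover have "\<phi> v \<in> ideal_span M (PIdl\<^bsub>R\<^esub> d)" unfolding \<phi>v
      by (rule ideal_span_base[OF M]) (use d V.R.cgenideal_self m in \<open>auto simp: cgenideal_def\<close>)
    ultimately have "v \<in> ideal_span V (PIdl\<^bsub>R\<^esub> d)" using d(3) unfolding exact_mod_def by blast
    then obtain u where u: "u \<in> carrier V" "v = d \<odot>\<^bsub>V\<^esub> u" using ideal_span_principal[OF V d(1)] by blast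
    have \<phi>u: "\<phi> u \<in> carrier M" using module_hom_closed[OF \<phi> u(1)] .
    \<comment> \<open>The difference \<open>m - \<phi> u\<close> is killed by \<open>d\<close>,
      hence zero, because \<open>M\<close> is torsion-free.\<close>
    have "d \<odot>\<^bsub>M\<^esub> (m \<ominus>\<^bsub>M\<^esub> \<phi> u) = d \<odot>\<^bsub>M\<^esub> m \<ominus>\<^bsub>M\<^esub> d \<odot>\<^bsub>M\<^esub> \<phi> u"
      by (rule module_hom_minus[OF M M smult_hom[OF M d(1)] m(1) \<phi>u])
    also have "\<dots> = \<zero>\<^bsub>M\<^esub>"
      unfolding \<phi>v[symmetric] u(2) using d(1) u(1) \<phi>u by (simp add: module_hom_smult[OF \<phi>] M.minus_eq_zero_iff)
    finally have "d \<odot>\<^bsub>M\<^esub> (m \<ominus>\<^bsub>M\<^esub> \<phi> u) = \<zero>\<^bsub>M\<^esub>" .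
    then have "m \<ominus>\<^bsub>M\<^esub> \<phi> u = \<zero>\<^bsub>M\<^esub>"
      by (rule torsion_free[OF d(1,2) M.minus_closed[OF m(1) \<phi>u]])
    then have "m = \<phi> u \<oplus>\<^bsub>M\<^esub> \<zero>\<^bsub>M\<^esub>" using m(1) \<phi>u by (simp add: M.minus_eq_zero_iff)
    then show "\<exists>v \<in> carrier V. \<exists>w \<in> ideal_span M {\<zero>\<^bsub>R\<^esub>}. m = \<phi> v \<oplus>\<^bsub>M\<^esub> w"
      using u(1) zero_in[OF M z] by blast
  qed
qed

end

end

section \<open>From cyclic modules to finitely generated ones, in coordinates\<close>

context module_complex
begin

interpretation V: module R V by (fact V)
interpretation M: module R M by (fact M)
interpretation N: module R N by (fact N)

context
  fixes T :: "'s itself"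
  assumes ideals: "\<And>I. ideal I R \<Longrightarrow> exact_mod I"
    and flat_M: "coord_flat TYPE('s) R M" and flat_N: "coord_flat TYPE('s) R N"
begin

text \<open>By induction on the support, splitting off one coordinate at a time:
  \<open>R\<^sup>n / H\<close> is an extension of \<open>R / I\<close> by \<open>R\<^sup>n\<^sup>-\<^sup>1 / H'\<close>.\<close>

lemma exact_functions_inj:
  fixes B :: "'s set"
  assumes "finite B" "submodule H R (coeff_functions R)" "\<And>h s. h \<in> H \<Longrightarrow> s \<notin> B \<Longrightarrow> h s = \<zero>\<^bsub>R\<^esub>"
    and "f \<in> carrier (function_module V)" "\<And>s. s \<notin> B \<Longrightarrow> f s = \<zero>\<^bsub>V\<^esub>"
    and "(\<lambda>s. \<phi> (f s)) \<in> fun_span M H"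
  shows "f \<in> fun_span V H"
  using assms
proof (induction B arbitrary: H f)
  case empty
  have "H \<subseteq> carrier (coeff_functions R)" using submodule_carrier[OF empty(1)] by blast
  note sub = fun_span_submodule[OF V this]
  have "f = \<zero>\<^bsub>function_module V\<^esub>" using empty by auto
  then show ?case using submodule_zero[OF sub] by simp
next
  case (insert b B)
  note H = \<open>submodule H R (coeff_functions R)\<close>
  have Hc: "H \<subseteq> carrier (coeff_functions R)" using submodule_carrier[OF H] by blast
  note subV = fun_span_submodule[OF V Hc] and subM = fun_span_submodule[OF M Hc]
  let ?H = "{h \<in> H. h b = \<zero>\<^bsub>R\<^esub>}"
  let ?I = "(\<lambda>h. h b) ` H"
  have I: "exact_mod ?I" by (rule ideals[OF ideal_of_coordinates[OF V.R.is_cring H]])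
  have fc: "f s \<in> carrier V" for s using insert.prems(3) by simp
  have "\<phi> (f b) \<in> ideal_span M ?I"
    unfolding fun_span_coordinate[OF M Hc, symmetric] using imageI[OF insert.prems(5), of "\<lambda>f. f b"] by simp
  then have "f b \<in> ideal_span V ?I" using I fc unfolding exact_mod_def by blast
  \<comment> \<open>An element of the span with the prescribed value at \<open>b\<close>:
    subtracting it makes the coordinate \<open>b\<close> vanish without changing \<open>f\<close>
    modulo the span.\<close>
  then obtain w where w: "w \<in> fun_span V H" "w b = f b"
    unfolding fun_span_coordinate[OF V Hc, symmetric] by fastforce
  have wc: "w \<in> carrier (function_module V)" by (rule submodule_carrier[OF subV w(1)])
  \<comment> \<open>All functions in \<open>H\<close> vanish off \<open>insert b B\<close>, hence so
    does the span; subtracting \<open>w\<close> does not spoil the support of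
    \<open>f\<close>.\<close>
  have woff: "w s = \<zero>\<^bsub>V\<^esub>" if "s \<notin> insert b B" for s
  proof -
    have "w s \<in> ideal_span V ((\<lambda>h. h s) ` H)"
      unfolding fun_span_coordinate[OF V Hc, symmetric] using w(1) by blast
    moreover have "(\<lambda>h. h s) ` H \<subseteq> {\<zero>\<^bsub>R\<^esub>}" using insert.prems(2) that by blast
    ultimately have "w s \<in> ideal_span V {\<zero>\<^bsub>R\<^esub>}" by (rule ideal_span_mono)
    then show ?thesis by (rule ideal_span_zero[OF V])
  qed
  define g where "g = f \<ominus>\<^bsub>function_module V\<^esub> w"
  have g: "g = (\<lambda>s. f s \<ominus>\<^bsub>V\<^esub> w s)" unfolding g_def by (rule function_minus[OF V insert.prems(3) wc])
  have \<phi>w: "(\<lambda>s. \<phi> (w s)) \<in> fun_span M H" by (rule fun_span_image[OF V Hc M \<phi> w(1)])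
  have "(\<lambda>s. \<phi> (g s)) = (\<lambda>s. \<phi> (f s)) \<ominus>\<^bsub>function_module M\<^esub> (\<lambda>s. \<phi> (w s))"
    by (subst function_minus[OF M])
      (use fc wc module_hom_closed[OF \<phi>] in \<open>auto simp: g module_hom_minus[OF V M \<phi>]\<close>)
  then have "(\<lambda>s. \<phi> (g s)) \<in> fun_span M H" using submodule_minus[OF subM insert.prems(5) \<phi>w] by simp
  moreover have gb: "g b = \<zero>\<^bsub>V\<^esub>" using fc w(2) by (simp add: g a_minus_def V.r_neg)
  then have "\<phi> (g b) = \<zero>\<^bsub>M\<^esub>" using module_hom_zero[OF V M \<phi>] by simp
  \<comment> \<open>Flatness of \<open>M\<close> replaces \<open>H\<close> by its kernel at
    \<open>b\<close>, whose members are supported in \<open>B\<close>; this makes the induction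
    hypothesis applicable.\<close>
  ultimately have \<phi>g: "(\<lambda>s. \<phi> (g s)) \<in> fun_span M ?H" by (rule coord_flatD[OF flat_M H])
  have "g \<in> fun_span V ?H"
  proof (rule insert.IH[OF coord_kernel_submodule[OF V.R.is_cring H] _ _ _ \<phi>g])
    show "h s = \<zero>\<^bsub>R\<^esub>" if "h \<in> ?H" "s \<notin> B" for h s
      using insert.prems(2)[of h s] that by (cases "s = b") auto
    show "g \<in> carrier (function_module V)" using fc wc by (auto simp: g)
    show "g s = \<zero>\<^bsub>V\<^esub>" if "s \<notin> B" for s
    proof (cases "s = b")
      case False
      then have "f s = \<zero>\<^bsub>V\<^esub>" "w s = \<zero>\<^bsub>V\<^esub>" using that insert.prems(4)[of s] woff[of s] by auto
      then show ?thesis by (simp add: g a_minus_def)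
    qed (use gb in simp)
  qed
  then have "g \<in> fun_span V H" by (rule fun_span_mono) blast
  then have "g \<oplus>\<^bsub>function_module V\<^esub> w \<in> fun_span V H" by (rule submodule_add[OF subV _ w(1)])
  moreover have "g \<oplus>\<^bsub>function_module V\<^esub> w = f"
    using fc wc by (auto simp: g V.add_minus_cancel)
  ultimately show ?case by simp
qed

text \<open>The induction is the one for injectivity. At \<open>b\<close>, exactness modulo the
  coordinate ideal writes \<open>f b\<close> as \<open>\<phi> v\<close> plus an element of the ideal
  span; the latter extends to a function \<open>w\<close> of the span. Removing both leaves a
  function that vanishes at \<open>b\<close>, and flatness of \<open>N\<close> reduces it to the
  smaller support.\<close>

lemma exact_functions:
  fixes B :: "'s set"
  assumes "finite B" "submodule H R (coeff_functions R)" "\<And>h s. h \<in> H \<Longrightarrow> s \<notin> B \<Longrightarrow> h s = \<zero>\<^bsub>R\<^esub>"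
    and "f \<in> carrier (function_module M)" "\<And>s. s \<notin> B \<Longrightarrow> f s = \<zero>\<^bsub>M\<^esub>"
    and "(\<lambda>s. \<delta> (f s)) \<in> fun_span N H"
  shows "\<exists>g \<in> carrier (function_module V). \<exists>w \<in> fun_span M H.
    (\<forall>s. s \<notin> B \<longrightarrow> g s = \<zero>\<^bsub>V\<^esub>) \<and> f = (\<lambda>s. \<phi> (g s) \<oplus>\<^bsub>M\<^esub> w s)"
  using assms
proof (induction B arbitrary: H f)
  case empty
  have "H \<subseteq> carrier (coeff_functions R)" using submodule_carrier[OF empty(1)] by blast
  note sub = fun_span_submodule[OF M this]
  show ?case
    by (rule bexI[of _ "\<zero>\<^bsub>function_module V\<^esub>"], rule bexI[OF _ submodule_zero[OF sub]])
      (use empty in \<open>auto simp: module_hom_zero[OF V M \<phi>]\<close>)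
next
  case (insert b B)
  note H = \<open>submodule H R (coeff_functions R)\<close>
  have Hc: "H \<subseteq> carrier (coeff_functions R)" using submodule_carrier[OF H] by blast
  note subM = fun_span_submodule[OF M Hc] and subN = fun_span_submodule[OF N Hc]
  let ?H = "{h \<in> H. h b = \<zero>\<^bsub>R\<^esub>}"
  let ?I = "(\<lambda>h. h b) ` H"
  have I: "exact_mod ?I" by (rule ideals[OF ideal_of_coordinates[OF V.R.is_cring H]])
  have fc: "f s \<in> carrier M" for s using insert.prems(3) by simp
  have "\<delta> (f b) \<in> ideal_span N ?I"
    unfolding fun_span_coordinate[OF N Hc, symmetric] using imageI[OF insert.prems(5), of "\<lambda>f. f b"] by simp
  then obtain v y where v: "v \<in> carrier V" and y: "y \<in> ideal_span M ?I" "f b = \<phi> v \<oplus>\<^bsub>M\<^esub> y"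
    using I fc unfolding exact_mod_def by blast
  obtain w where w: "w \<in> fun_span M H" "w b = y"
    using y(1) unfolding fun_span_coordinate[OF M Hc, symmetric] by fastforce
  have wc: "w s \<in> carrier M" for s using submodule_carrier[OF subM w(1)] by simp
  have woff: "w s = \<zero>\<^bsub>M\<^esub>" if "s \<notin> insert b B" for s
  proof -
    have "w s \<in> ideal_span M ((\<lambda>h. h s) ` H)"
      unfolding fun_span_coordinate[OF M Hc, symmetric] using w(1) by blast
    moreover have "(\<lambda>h. h s) ` H \<subseteq> {\<zero>\<^bsub>R\<^esub>}" using insert.prems(2) that by blast
    ultimately have "w s \<in> ideal_span M {\<zero>\<^bsub>R\<^esub>}" by (rule ideal_span_mono)
    then show ?thesis by (rule ideal_span_zero[OF M])
  qed
  let ?v = "single V b v"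
  have vc: "?v s \<in> carrier V" for s using v by (simp add: single_def)
  have \<phi>v: "\<phi> (?v s) \<in> carrier M" for s by (rule module_hom_closed[OF \<phi> vc])
  define g where "g = (\<lambda>s. f s \<ominus>\<^bsub>M\<^esub> (\<phi> (?v s) \<oplus>\<^bsub>M\<^esub> w s))"
  have gc: "g s \<in> carrier M" for s unfolding g_def using fc \<phi>v wc by simp
  have f: "f s = g s \<oplus>\<^bsub>M\<^esub> (\<phi> (?v s) \<oplus>\<^bsub>M\<^esub> w s)" for s
    unfolding g_def using fc \<phi>v wc by (simp add: M.add_minus_cancel)
  have gb: "g b = \<zero>\<^bsub>M\<^esub>" unfolding g_def using y w(2) wc[of b] module_hom_closed[OF \<phi> v]
    by (simp add: single_def M.minus_eq_zero_iff)
  have \<delta>w: "(\<lambda>s. \<delta> (w s)) \<in> fun_span N H" by (rule fun_span_image[OF M Hc N \<delta> w(1)])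
  have "(\<lambda>s. \<delta> (g s)) = (\<lambda>s. \<delta> (f s)) \<ominus>\<^bsub>function_module N\<^esub> (\<lambda>s. \<delta> (w s))"
    by (subst function_minus[OF N])
      (use fc wc \<phi>v vc module_hom_closed[OF \<delta>] in
        \<open>auto simp: g_def module_hom_minus[OF M N \<delta>] module_hom_add[OF \<delta>] complex\<close>)
  then have "(\<lambda>s. \<delta> (g s)) \<in> fun_span N H" using submodule_minus[OF subN insert.prems(5) \<delta>w] by simp
  moreover have "\<delta> (g b) = \<zero>\<^bsub>N\<^esub>" using gb module_hom_zero[OF M N \<delta>] by simp
  ultimately have \<delta>g: "(\<lambda>s. \<delta> (g s)) \<in> fun_span N ?H" by (rule coord_flatD[OF flat_N H])
  have "\<exists>u \<in> carrier (function_module V). \<exists>z \<in> fun_span M ?H.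
    (\<forall>s. s \<notin> B \<longrightarrow> u s = \<zero>\<^bsub>V\<^esub>) \<and> g = (\<lambda>s. \<phi> (u s) \<oplus>\<^bsub>M\<^esub> z s)"
  proof (rule insert.IH[OF coord_kernel_submodule[OF V.R.is_cring H] _ _ _ \<delta>g])
    show "h s = \<zero>\<^bsub>R\<^esub>" if "h \<in> ?H" "s \<notin> B" for h s
      using insert.prems(2)[of h s] that by (cases "s = b") auto
    show "g \<in> carrier (function_module M)" using gc by simp
    show "g s = \<zero>\<^bsub>M\<^esub>" if "s \<notin> B" for s
    proof (cases "s = b")
      case False
      then have "f s = \<zero>\<^bsub>M\<^esub>" "w s = \<zero>\<^bsub>M\<^esub>" "?v s = \<zero>\<^bsub>V\<^esub>"
        using that insert.prems(4)[of s] woff[of s] by (auto simp: single_def)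
      then show ?thesis by (simp add: g_def a_minus_def module_hom_zero[OF V M \<phi>])
    qed (use gb in simp)
  qed
  then obtain u z where u: "u \<in> carrier (function_module V)" "z \<in> fun_span M ?H"
    "\<And>s. s \<notin> B \<Longrightarrow> u s = \<zero>\<^bsub>V\<^esub>" "g = (\<lambda>s. \<phi> (u s) \<oplus>\<^bsub>M\<^esub> z s)" by blast
  have uc: "u s \<in> carrier V" for s using u(1) by simp
  have zH: "z \<in> fun_span M H" by (rule fun_span_mono[OF u(2)]) blast
  have zc: "z s \<in> carrier M" for s using submodule_carrier[OF subM zH] by simp
  have "f s = \<phi> (u s \<oplus>\<^bsub>V\<^esub> ?v s) \<oplus>\<^bsub>M\<^esub> (z s \<oplus>\<^bsub>M\<^esub> w s)" for s
    unfolding f[of s] u(4) using uc vc zc wc module_hom_closed[OF \<phi>]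
    by (simp add: module_hom_add[OF \<phi>] M.a_ac)
  then have "f = (\<lambda>s. \<phi> ((u \<oplus>\<^bsub>function_module V\<^esub> ?v) s) \<oplus>\<^bsub>M\<^esub> (z \<oplus>\<^bsub>function_module M\<^esub> w) s)" by auto
  moreover have "z \<oplus>\<^bsub>function_module M\<^esub> w \<in> fun_span M H" by (rule submodule_add[OF subM zH w(1)])
  moreover have "u \<oplus>\<^bsub>function_module V\<^esub> ?v \<in> carrier (function_module V)" using uc vc by simp
  moreover have "(u \<oplus>\<^bsub>function_module V\<^esub> ?v) s = \<zero>\<^bsub>V\<^esub>" if "s \<notin> insert b B" for s
    using u(3)[of s] that by (simp add: single_def)
  ultimately show ?case by blast
qed

end

end

section \<open>Exactness after tensoring with an arbitrary module\<close>

lemma tensor_map_id_sum: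
  assumes "module R S" "module R L" "module R L'" "h \<in> module_hom R L L'"
    and "finite D" "D \<subseteq> carrier S" "f \<in> carrier (function_module L)"
  shows "tensor_map R S L' id h (tensor_sum R S L D f) = tensor_sum R S L' D (\<lambda>s. h (f s))"
proof -
  have T': "module R (tensor R S L')" by (rule tensor_module[OF assms(1,3)])
  interpret T': module R "tensor R S L'" by (fact T')
  have fc: "f s \<in> carrier L" for s using assms(7) by simp
  show ?thesis
    unfolding tensor_sum_def
  proof (subst module_hom_finsum[OF tensor_module[OF assms(1,2)] T' tensor_map_hom[OF assms(1,2,1,3) id_hom assms(4)]])
    show "(\<Oplus>\<^bsub>tensor R S L'\<^esub>a\<in>D. tensor_map R S L' id h (pure_tensor R S L a (f a))) =
        (\<Oplus>\<^bsub>tensor R S L'\<^esub>s\<in>D. pure_tensor R S L' s (h (f s)))"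
      by (rule T'.finsum_cong')
        (use assms(6) fc tensor_map_pure[OF assms(1,2,1,3) id_hom assms(4)] pure_tensor_closed[OF assms(1,3)]
          module_hom_closed[OF assms(4)] in \<open>auto simp: subset_iff\<close>)
  qed (use assms(6) fc pure_tensor_closed[OF assms(1,2)] in auto)
qed

context module_complex
begin

context
  fixes S :: "('r, 's) module"
  assumes S: "module R S" and ideals: "\<And>I. ideal I R \<Longrightarrow> exact_mod I"
    and flat_M: "coord_flat TYPE('s) R M" and flat_N: "coord_flat TYPE('s) R N"
begin

text \<open>In coordinates the hypothesis says that \<open>\<phi> \<circ> f\<close> lies in the span
  of relations on a finite set \<open>E\<close>. Exactness for functions puts \<open>f\<close>
  itself into the corresponding span, and relations evaluate to zero.\<close>

lemma tensor_exact_left: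
  assumes "y \<in> carrier (tensor R S V)" "tensor_map R S M id \<phi> y = \<zero>\<^bsub>tensor R S M\<^esub>"
  shows "y = \<zero>\<^bsub>tensor R S V\<^esub>"
proof -
  obtain D f where D: "finite D" "D \<subseteq> carrier S" and f: "f \<in> carrier (function_module V)"
    "\<forall>s. s \<notin> D \<longrightarrow> f s = \<zero>\<^bsub>V\<^esub>" and y: "y = tensor_sum R S V D f"
    using tensor_sum_surj[OF S V assms(1)] by blast
  have fc: "f s \<in> carrier V" for s using f(1) by simp
  have z: "tensor_sum R S M D (\<lambda>s. \<phi> (f s)) = \<zero>\<^bsub>tensor R S M\<^esub>"
    using assms(2) unfolding y tensor_map_id_sum[OF S V M \<phi> D f(1)] .
  obtain E where E: "finite E" "D \<subseteq> E" "E \<subseteq> carrier S" "(\<lambda>s. \<phi> (f s)) \<in> fun_span M (relations_on R S E)"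
    by (rule tensor_sum_eq_zeroE[OF S M D _ _ z])
      (use f(2) fc module_hom_closed[OF \<phi>] module_hom_zero[OF V M \<phi>] in auto)
  have "f \<in> fun_span V (relations_on R S E)"
    by (rule exact_functions_inj[OF ideals flat_M flat_N E(1) relations_on_submodule[OF S E(1,3)] _ f(1) _ E(4)])
      (use f(2) E(2) in \<open>auto simp: relations_on_def\<close>)
  then have "tensor_sum R S V E f = \<zero>\<^bsub>tensor R S V\<^esub>" by (rule tensor_sum_relations[OF S V E(1,3)])
  moreover have "tensor_sum R S V D f = tensor_sum R S V E f"
    by (rule tensor_sum_mono[OF S V E(1-3) f(1)]) (use f(2) in blast)
  ultimately show ?thesis using y by simp
qed

text \<open>The coordinates decompose as \<open>f = \<phi> \<circ> g + w\<close> with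
  \<open>w\<close> in the span of relations. So \<open>w\<close> contributes nothing to the tensor,
  and the tensor sum of \<open>g\<close> is the preimage.\<close>

lemma tensor_exact_middle:
  assumes "y \<in> carrier (tensor R S M)" "tensor_map R S N id \<delta> y = \<zero>\<^bsub>tensor R S N\<^esub>"
  shows "\<exists>z \<in> carrier (tensor R S V). y = tensor_map R S M id \<phi> z"
proof -
  interpret T: module R "tensor R S M" by (rule tensor_module[OF S M])
  obtain D f where D: "finite D" "D \<subseteq> carrier S" and f: "f \<in> carrier (function_module M)"
    "\<forall>s. s \<notin> D \<longrightarrow> f s = \<zero>\<^bsub>M\<^esub>" and y: "y = tensor_sum R S M D f"
    using tensor_sum_surj[OF S M assms(1)] by blast
  have fc: "f s \<in> carrier M" for s using f(1) by simp
  have z: "tensor_sum R S N D (\<lambda>s. \<delta> (f s)) = \<zero>\<^bsub>tensor R S N\<^esub>"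
    using assms(2) unfolding y tensor_map_id_sum[OF S M N \<delta> D f(1)] .
  obtain E where E: "finite E" "D \<subseteq> E" "E \<subseteq> carrier S" "(\<lambda>s. \<delta> (f s)) \<in> fun_span N (relations_on R S E)"
    by (rule tensor_sum_eq_zeroE[OF S N D _ _ z])
      (use f(2) fc module_hom_closed[OF \<delta>] module_hom_zero[OF M N \<delta>] in auto)
  have "\<exists>g \<in> carrier (function_module V). \<exists>w \<in> fun_span M (relations_on R S E).
    (\<forall>s. s \<notin> E \<longrightarrow> g s = \<zero>\<^bsub>V\<^esub>) \<and> f = (\<lambda>s. \<phi> (g s) \<oplus>\<^bsub>M\<^esub> w s)"
    by (rule exact_functions[OF ideals flat_M flat_N E(1) relations_on_submodule[OF S E(1,3)] _ f(1) _ E(4)])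
      (use f(2) E(2) in \<open>auto simp: relations_on_def\<close>)
  then obtain g w where g: "g \<in> carrier (function_module V)" and w: "w \<in> fun_span M (relations_on R S E)"
    and fgw: "f = (\<lambda>s. \<phi> (g s)) \<oplus>\<^bsub>function_module M\<^esub> w" by auto
  note hom = tensor_sum_hom[OF S M E(1,3)]
  have wc: "w \<in> carrier (function_module M)"
    using submodule_carrier[OF fun_span_submodule[OF M relations_on_carrier[OF S]] w] .
  have \<phi>g: "(\<lambda>s. \<phi> (g s)) \<in> carrier (function_module M)" using g module_hom_closed[OF \<phi>] by simp
  have "y = tensor_sum R S M E f"
    unfolding y by (rule tensor_sum_mono[OF S M E(1-3) f(1)]) (use f(2) in blast)
  also have "\<dots> = tensor_sum R S M E (\<lambda>s. \<phi> (g s)) \<oplus>\<^bsub>tensor R S M\<^esub> tensor_sum R S M E w"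
    unfolding fgw by (rule module_hom_add[OF hom \<phi>g wc])
  also have "\<dots> = tensor_map R S M id \<phi> (tensor_sum R S V E g)"
    unfolding tensor_map_id_sum[OF S V M \<phi> E(1,3) g] tensor_sum_relations[OF S M E(1,3) w]
    using module_hom_closed[OF hom \<phi>g] by simp
  finally show ?thesis using module_hom_closed[OF tensor_sum_hom[OF S V E(1,3)] g] by blast
qed

end

end

section \<open>The ascending chain condition and bounded torsion\<close>

section \<open>Finitely generated modules over Noetherian rings\<close>

text \<open>Induction on the generators. Claiming stability only inside the span of \<open>U\<close>
  lets the induction proceed within the fixed module \<open>V\<close>, without forming
  quotients.\<close>

lemma noetherian_chain_stable:
  fixes N :: "nat \<Rightarrow> 'v set"
  assumes V: "module A V" and noeth: "noetherian_ring A" and "finite U" "U \<subseteq> carrier V"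
    and sub: "\<And>n. submodule (N n) A V" and mono: "\<And>m n. m \<le> n \<Longrightarrow> N m \<subseteq> N n"
  shows "\<exists>k. \<forall>n \<ge> k. N n \<inter> submodule_span A V U \<subseteq> N k"
  using assms(3,4)
proof (induction U)
  case empty
  interpret V: module A V by (fact V)
  have "submodule_span A V {} \<subseteq> {\<zero>\<^bsub>V\<^esub>}"
    by (rule submodule_span_least) (auto intro: submoduleI'[OF V])
  then show ?case using submodule_zero[OF sub] by (intro exI[of _ 0]) auto
next
  case (insert u U)
  interpret V: module A V by (fact V)
  let ?W = "submodule_span A V U"
  have u: "u \<in> carrier V" and Uc: "U \<subseteq> carrier V" using insert.prems by auto
  have W: "submodule ?W A V" by (rule submodule_span_submodule[OF V Uc])
  obtain k0 where k0: "\<And>n. n \<ge> k0 \<Longrightarrow> N n \<inter> ?W \<subseteq> N k0" using insert.IH[OF Uc] by blast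
  \<comment> \<open>Coefficients of the new generator \<open>u\<close> in those elements of
    \<open>N n\<close> that have the form \<open>a u + w\<close>. These ideals stand for the image
    of \<open>N n\<close> in the quotient by the span of the old generators.\<close>
  define I where "I n = {a \<in> carrier A. \<exists>w \<in> ?W. a \<odot>\<^bsub>V\<^esub> u \<oplus>\<^bsub>V\<^esub> w \<in> N n}" for n
  have "ideal (I n) A" for n
    unfolding submodule_regular_iff_ideal[OF V.R.is_cring, symmetric]
  proof (rule submoduleI'[OF module_regular[OF V.R.is_cring]])
    show "\<zero>\<^bsub>regular_algebra A\<^esub> \<in> I n"
      using submodule_zero[OF W] submodule_zero[OF sub] u by (auto simp: I_def intro!: bexI[of _ "\<zero>\<^bsub>V\<^esub>"])
  next
    fix a b assume "a \<in> I n" "b \<in> I n"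
    then obtain v w where ab: "a \<in> carrier A" "b \<in> carrier A" "v \<in> ?W" "w \<in> ?W"
      "a \<odot>\<^bsub>V\<^esub> u \<oplus>\<^bsub>V\<^esub> v \<in> N n" "b \<odot>\<^bsub>V\<^esub> u \<oplus>\<^bsub>V\<^esub> w \<in> N n" unfolding I_def by blast
    have "(a \<oplus>\<^bsub>A\<^esub> b) \<odot>\<^bsub>V\<^esub> u \<oplus>\<^bsub>V\<^esub> (v \<oplus>\<^bsub>V\<^esub> w) = (a \<odot>\<^bsub>V\<^esub> u \<oplus>\<^bsub>V\<^esub> v) \<oplus>\<^bsub>V\<^esub> (b \<odot>\<^bsub>V\<^esub> u \<oplus>\<^bsub>V\<^esub> w)"
      using ab(1,2) u submodule_carrier[OF W ab(3)] submodule_carrier[OF W ab(4)]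
      by (simp add: V.smult_l_distr V.a_ac)
    then have "(a \<oplus>\<^bsub>A\<^esub> b) \<odot>\<^bsub>V\<^esub> u \<oplus>\<^bsub>V\<^esub> (v \<oplus>\<^bsub>V\<^esub> w) \<in> N n"
      using submodule_add[OF sub ab(5,6)] by simp
    then show "a \<oplus>\<^bsub>regular_algebra A\<^esub> b \<in> I n"
      using ab(1,2) submodule_add[OF W ab(3,4)] unfolding I_def by auto
  next
    fix r a assume r: "r \<in> carrier A" and "a \<in> I n"
    then obtain w where a: "a \<in> carrier A" "w \<in> ?W" "a \<odot>\<^bsub>V\<^esub> u \<oplus>\<^bsub>V\<^esub> w \<in> N n" unfolding I_def by blast
    have "(r \<otimes>\<^bsub>A\<^esub> a) \<odot>\<^bsub>V\<^esub> u \<oplus>\<^bsub>V\<^esub> r \<odot>\<^bsub>V\<^esub> w = r \<odot>\<^bsub>V\<^esub> (a \<odot>\<^bsub>V\<^esub> u \<oplus>\<^bsub>V\<^esub> w)"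
      using r a(1) u submodule_carrier[OF W a(2)] by (simp add: V.smult_r_distr V.smult_assoc1)
    then have "(r \<otimes>\<^bsub>A\<^esub> a) \<odot>\<^bsub>V\<^esub> u \<oplus>\<^bsub>V\<^esub> r \<odot>\<^bsub>V\<^esub> w \<in> N n" using submodule_smult[OF sub r a(3)] by simp
    then show "r \<odot>\<^bsub>regular_algebra A\<^esub> a \<in> I n"
      using r a(1) submodule_smult[OF W r a(2)] unfolding I_def by auto
  qed (auto simp: I_def)
  then have "\<exists>J \<in> range I. \<forall>K \<in> range I. J \<subseteq> K \<longrightarrow> K = J"
    by (intro noetherian_maximal_ideal[OF noeth]) auto
  then obtain k1 where k1: "\<And>n. I k1 \<subseteq> I n \<Longrightarrow> I n = I k1" by auto
  have Imono: "I m \<subseteq> I n" if "m \<le> n" for m n using mono[OF that] unfolding I_def by blast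
  define k where "k = max k0 k1"
  have "N n \<inter> submodule_span A V (insert u U) \<subseteq> N k" if n: "n \<ge> k" for n
  proof
    fix x assume "x \<in> N n \<inter> submodule_span A V (insert u U)"
    then have x: "x \<in> N n" "x \<in> submodule_span A V (insert u U)" by auto
    let ?Z = "{a \<odot>\<^bsub>V\<^esub> u \<oplus>\<^bsub>V\<^esub> w | a w. a \<in> carrier A \<and> w \<in> ?W}"
    have "submodule ?Z A V"
    proof (rule submoduleI'[OF V])
      show "?Z \<subseteq> carrier V" using u submodule_carrier[OF W] by auto
      have "\<zero>\<^bsub>V\<^esub> = \<zero>\<^bsub>A\<^esub> \<odot>\<^bsub>V\<^esub> u \<oplus>\<^bsub>V\<^esub> \<zero>\<^bsub>V\<^esub>" using u by simp
      then show "\<zero>\<^bsub>V\<^esub> \<in> ?Z" using submodule_zero[OF W] V.R.zero_closed by blast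
    next
      fix x y assume "x \<in> ?Z" "y \<in> ?Z"
      then obtain a b v w where ab: "a \<in> carrier A" "b \<in> carrier A" "v \<in> ?W" "w \<in> ?W"
        "x = a \<odot>\<^bsub>V\<^esub> u \<oplus>\<^bsub>V\<^esub> v" "y = b \<odot>\<^bsub>V\<^esub> u \<oplus>\<^bsub>V\<^esub> w" by blast
      then have "x \<oplus>\<^bsub>V\<^esub> y = (a \<oplus>\<^bsub>A\<^esub> b) \<odot>\<^bsub>V\<^esub> u \<oplus>\<^bsub>V\<^esub> (v \<oplus>\<^bsub>V\<^esub> w)"
        using u submodule_carrier[OF W ab(3)] submodule_carrier[OF W ab(4)]
        by (simp add: V.smult_l_distr V.a_ac)
      then show "x \<oplus>\<^bsub>V\<^esub> y \<in> ?Z" using ab(1,2) submodule_add[OF W ab(3,4)] by blast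
    next
      fix r x assume r: "r \<in> carrier A" and "x \<in> ?Z"
      then obtain a w where a: "a \<in> carrier A" "w \<in> ?W" "x = a \<odot>\<^bsub>V\<^esub> u \<oplus>\<^bsub>V\<^esub> w" by blast
      then have "r \<odot>\<^bsub>V\<^esub> x = (r \<otimes>\<^bsub>A\<^esub> a) \<odot>\<^bsub>V\<^esub> u \<oplus>\<^bsub>V\<^esub> r \<odot>\<^bsub>V\<^esub> w"
        using r u submodule_carrier[OF W a(2)] by (simp add: V.smult_r_distr V.smult_assoc1)
      then show "r \<odot>\<^bsub>V\<^esub> x \<in> ?Z" using r a(1) submodule_smult[OF W r a(2)] by blast
    qed
    moreover have "insert u U \<subseteq> ?Z"
    proof
      fix t assume "t \<in> insert u U"
      then consider "t = u" | "t \<in> U" by blast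
      then show "t \<in> ?Z"
      proof cases
        case 1
        then have "t = \<one>\<^bsub>A\<^esub> \<odot>\<^bsub>V\<^esub> u \<oplus>\<^bsub>V\<^esub> \<zero>\<^bsub>V\<^esub>" using u by simp
        then show ?thesis using submodule_zero[OF W] V.R.one_closed by blast
      next
        case 2
        then have "t = \<zero>\<^bsub>A\<^esub> \<odot>\<^bsub>V\<^esub> u \<oplus>\<^bsub>V\<^esub> t" "t \<in> ?W" using u Uc subsetD[OF submodule_span_superset 2] by auto
        then show ?thesis using V.R.zero_closed by blast
      qed
    qed
    ultimately have "x \<in> ?Z" using submodule_span_least x(2) by blast
    then obtain a w where a: "a \<in> carrier A" "w \<in> ?W" "x = a \<odot>\<^bsub>V\<^esub> u \<oplus>\<^bsub>V\<^esub> w" by blast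
    have "a \<in> I n" using a x(1) unfolding I_def by blast
    moreover have "I n = I k1" by (rule k1, rule Imono) (use n in \<open>simp add: k_def\<close>)
    ultimately have "a \<in> I k1" by simp
    then have "\<exists>w \<in> ?W. a \<odot>\<^bsub>V\<^esub> u \<oplus>\<^bsub>V\<^esub> w \<in> N k1" by (simp only: I_def mem_Collect_eq)
    then obtain w' where w': "w' \<in> ?W" "a \<odot>\<^bsub>V\<^esub> u \<oplus>\<^bsub>V\<^esub> w' \<in> N k1" by (rule bexE)
    \<comment> \<open>An element of \<open>N k\<close> with the same coefficient \<open>a\<close> as
      \<open>x\<close>. The difference \<open>x - ?y\<close> lies in the span of the old generators,
      where the chain is stable by induction.\<close>
    let ?y = "a \<odot>\<^bsub>V\<^esub> u \<oplus>\<^bsub>V\<^esub> w'"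
    have yk: "?y \<in> N k" using w'(2) mono[of k1 k] unfolding k_def by auto
    have c: "w \<in> carrier V" "w' \<in> carrier V" "a \<odot>\<^bsub>V\<^esub> u \<in> carrier V"
      using submodule_carrier[OF W] a w' u by auto
    have "(w \<ominus>\<^bsub>V\<^esub> w') \<oplus>\<^bsub>V\<^esub> ?y = ((w \<ominus>\<^bsub>V\<^esub> w') \<oplus>\<^bsub>V\<^esub> w') \<oplus>\<^bsub>V\<^esub> a \<odot>\<^bsub>V\<^esub> u"
      using c by (simp add: V.a_ac)
    also have "\<dots> = x" unfolding a(3) V.add_minus_cancel[OF c(1,2)] using c by (intro V.a_comm)
    finally have x_eq: "x = (w \<ominus>\<^bsub>V\<^esub> w') \<oplus>\<^bsub>V\<^esub> ?y" by (rule sym)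
    then have "w \<ominus>\<^bsub>V\<^esub> w' = x \<ominus>\<^bsub>V\<^esub> ?y"
      using V.plus_minus_cancel[of "w \<ominus>\<^bsub>V\<^esub> w'" ?y] c by simp
    moreover have "x \<ominus>\<^bsub>V\<^esub> ?y \<in> N n" using submodule_minus[OF sub x(1)] yk mono[OF n] by blast
    ultimately have "w \<ominus>\<^bsub>V\<^esub> w' \<in> N n \<inter> ?W" using submodule_minus[OF W a(2) w'(1)] by simp
    then have "w \<ominus>\<^bsub>V\<^esub> w' \<in> N k" using k0[of n] n mono[of k0 k] unfolding k_def by auto
    then show "x \<in> N k" using submodule_add[OF sub _ yk] x_eq by simp
  qed
  then show ?case by blast
qed

lemma with_smult_simps [simp]:
  "carrier (with_smult M s) = carrier M" "monoid.mult (with_smult M s) = monoid.mult M"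
  "one (with_smult M s) = one M" "ring.zero (with_smult M s) = ring.zero M"
  "ring.add (with_smult M s) = ring.add M" "smult (with_smult M s) = s"
  unfolding with_smult_def by simp_all

lemma restrict_scalars_simps [simp]:
  "carrier (restrict_scalars S M) = carrier M" "monoid.mult (restrict_scalars S M) = monoid.mult M"
  "one (restrict_scalars S M) = one M" "ring.zero (restrict_scalars S M) = ring.zero M"
  "ring.add (restrict_scalars S M) = ring.add M"
  "r \<odot>\<^bsub>restrict_scalars S M\<^esub> m = (r \<odot>\<^bsub>S\<^esub> \<one>\<^bsub>S\<^esub>) \<odot>\<^bsub>M\<^esub> m"
  unfolding restrict_scalars_def by simp_all

lemma abelian_group_with_smult: "abelian_group M \<Longrightarrow> abelian_group (with_smult M s)"
proof -
  assume "abelian_group M"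
  then interpret abelian_group M .
  show ?thesis by (rule abelian_groupI) (auto simp: a_ac intro: l_neg)
qed

lemma module_restrict_scalars:
  assumes "algebra R A" "module A V"
  shows "module R (restrict_scalars A V)"
proof -
  interpret A: algebra R A by fact
  interpret V: module A V by fact
  have one: "(r \<otimes>\<^bsub>R\<^esub> s) \<odot>\<^bsub>A\<^esub> \<one>\<^bsub>A\<^esub> = (r \<odot>\<^bsub>A\<^esub> \<one>\<^bsub>A\<^esub>) \<otimes>\<^bsub>A\<^esub> (s \<odot>\<^bsub>A\<^esub> \<one>\<^bsub>A\<^esub>)"
    if "r \<in> carrier R" "s \<in> carrier R" for r s
    using that by (simp add: A.smult_assoc2 A.smult_assoc1)
  show ?thesis
  proof (rule moduleI)
    show "cring R" by (rule A.R_cring)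
    show "abelian_group (restrict_scalars A V)"
      unfolding restrict_scalars_def by (rule abelian_group_with_smult[OF module_abelian_group[OF assms(2)]])
  qed (auto simp: one A.smult_l_distr V.smult_l_distr V.smult_r_distr V.smult_assoc1)
qed

text \<open>Powers of \<open>d\<close> act through the elements \<open>a n\<close> of
  \<open>A\<close>, so the kernels of their actions are submodules over \<open>A\<close>, and the
  chain condition over \<open>A\<close> applies to them.\<close>

lemma torsion_stable:
  assumes A: "algebra R A" and noeth: "noetherian_ring A" and V: "module A V"
    and fg: "finitely_generated_module A V" and d: "d \<in> carrier R"
  defines "V' \<equiv> restrict_scalars A V"
  shows "\<exists>k :: nat. \<forall>v \<in> carrier V'. d [^]\<^bsub>R\<^esub> (Suc k) \<odot>\<^bsub>V'\<^esub> v = \<zero>\<^bsub>V'\<^esub> \<longrightarrow> d [^]\<^bsub>R\<^esub> k \<odot>\<^bsub>V'\<^esub> v = \<zero>\<^bsub>V'\<^esub>"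
proof -
  interpret A: algebra R A by (fact A)
  interpret V: module A V by (fact V)
  have V': "module R V'" unfolding V'_def by (rule module_restrict_scalars[OF A V])
  interpret V': module R V' by (fact V')
  obtain U where U: "U \<subseteq> carrier V" "finite U" "submodule_span A V U = carrier V"
    using fg unfolding finitely_generated_module_def by blast
  define a where "a n = d [^]\<^bsub>R\<^esub> (n :: nat) \<odot>\<^bsub>A\<^esub> \<one>\<^bsub>A\<^esub>" for n
  have a: "a n \<in> carrier A" for n unfolding a_def using d by simp
  have sm: "d [^]\<^bsub>R\<^esub> n \<odot>\<^bsub>V'\<^esub> v = a n \<odot>\<^bsub>V\<^esub> v" for n :: nat and v unfolding V'_def a_def by simp
  define N where "N n = {v \<in> carrier V. a n \<odot>\<^bsub>V\<^esub> v = \<zero>\<^bsub>V\<^esub>}" for n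
  have "submodule (N n) A V" for n
    unfolding N_def by (rule module_hom_kernel_submodule[OF V V smult_hom[OF V a]])
  moreover have step: "N n \<subseteq> N (Suc n)" for n
  proof
    fix v assume v: "v \<in> N n"
    then have vc: "v \<in> carrier V'" unfolding N_def V'_def by simp
    have "d [^]\<^bsub>R\<^esub> (Suc n) \<odot>\<^bsub>V'\<^esub> v = d \<odot>\<^bsub>V'\<^esub> (d [^]\<^bsub>R\<^esub> n \<odot>\<^bsub>V'\<^esub> v)"
      using d vc by (simp only: A.R.nat_pow_Suc A.R.m_comm A.R.nat_pow_closed V'.smult_assoc1)
    also have "\<dots> = d \<odot>\<^bsub>V'\<^esub> \<zero>\<^bsub>V'\<^esub>" using v unfolding sm[of n] N_def by (simp add: V'_def)
    also have "\<dots> = \<zero>\<^bsub>V'\<^esub>" using d by (rule V'.smult_r_null)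
    finally have "a (Suc n) \<odot>\<^bsub>V\<^esub> v = \<zero>\<^bsub>V'\<^esub>" unfolding sm .
    then show "v \<in> N (Suc n)" using v by (simp add: N_def V'_def)
  qed
  then have "N m \<subseteq> N n" if "m \<le> n" for m n using that by (rule lift_Suc_mono_le)
  ultimately have "\<exists>k. \<forall>n \<ge> k. N n \<inter> submodule_span A V U \<subseteq> N k"
    by (intro noetherian_chain_stable[OF V noeth U(2,1)])
  then obtain k where k: "N (Suc k) \<inter> carrier V \<subseteq> N k" unfolding U(3) using le_SucI by blast
  show ?thesis
  proof (intro exI ballI impI)
    fix v assume v: "v \<in> carrier V'" "d [^]\<^bsub>R\<^esub> (Suc k) \<odot>\<^bsub>V'\<^esub> v = \<zero>\<^bsub>V'\<^esub>"
    from v(2) have "a (Suc k) \<odot>\<^bsub>V\<^esub> v = \<zero>\<^bsub>V'\<^esub>" unfolding sm .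
    then have "v \<in> N (Suc k) \<inter> carrier V" using v(1) by (simp add: N_def V'_def)
    then have "v \<in> N k" using k by blast
    then show "d [^]\<^bsub>R\<^esub> k \<odot>\<^bsub>V'\<^esub> v = \<zero>\<^bsub>V'\<^esub>" unfolding sm by (simp add: N_def V'_def)
  qed
qed

section \<open>The field of fractions of a domain and its cardinality\<close>

section \<open>Fields of fractions\<close>

text \<open>A fraction is the full set of pairs equivalent to \<open>(a, b)\<close>. The field
  operations use representatives chosen by \<open>fraction_rep\<close>; \<open>fraction_repE\<close>
  supplies the cross-multiplied equation that makes the choice immaterial.\<close>

definition fraction :: "('a, 'x) ring_scheme \<Rightarrow> 'a \<Rightarrow> 'a \<Rightarrow> ('a \<times> 'a) set" where
  "fraction D a b = {(c, d). c \<in> carrier D \<and> d \<in> carrier D - {\<zero>\<^bsub>D\<^esub>} \<and> a \<otimes>\<^bsub>D\<^esub> d = c \<otimes>\<^bsub>D\<^esub> b}"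

definition fraction_rep :: "('a, 'x) ring_scheme \<Rightarrow> ('a \<times> 'a) set \<Rightarrow> 'a \<times> 'a" where
  "fraction_rep D U = (SOME p. fst p \<in> carrier D \<and> snd p \<in> carrier D - {\<zero>\<^bsub>D\<^esub>} \<and> U = fraction D (fst p) (snd p))"

definition fraction_field :: "('a, 'x) ring_scheme \<Rightarrow> ('a \<times> 'a) set ring" where
  "fraction_field D =
    \<lparr>carrier = {fraction D a b | a b. a \<in> carrier D \<and> b \<in> carrier D - {\<zero>\<^bsub>D\<^esub>}},
     monoid.mult = (\<lambda>U W. let (a, b) = fraction_rep D U; (c, d) = fraction_rep D W in
       fraction D (a \<otimes>\<^bsub>D\<^esub> c) (b \<otimes>\<^bsub>D\<^esub> d)),
     one = fraction D \<one>\<^bsub>D\<^esub> \<one>\<^bsub>D\<^esub>, ring.zero = fraction D \<zero>\<^bsub>D\<^esub> \<one>\<^bsub>D\<^esub>,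
     ring.add = (\<lambda>U W. let (a, b) = fraction_rep D U; (c, d) = fraction_rep D W in
       fraction D (a \<otimes>\<^bsub>D\<^esub> d \<oplus>\<^bsub>D\<^esub> c \<otimes>\<^bsub>D\<^esub> b) (b \<otimes>\<^bsub>D\<^esub> d))\<rparr>"

context domain
begin

lemma fraction_eq_iff:
  assumes "a \<in> carrier R" "b \<in> carrier R - {\<zero>}" "c \<in> carrier R" "d \<in> carrier R - {\<zero>}"
  shows "fraction R a b = fraction R c d \<longleftrightarrow> a \<otimes> d = c \<otimes> b"
proof
  have "(c, d) \<in> fraction R c d" using assms by (simp add: fraction_def)
  moreover assume "fraction R a b = fraction R c d"
  ultimately show "a \<otimes> d = c \<otimes> b" by (auto simp: fraction_def)
next
  \<comment> \<open>Transitivity of the equivalence: both sides are multiplied by the middle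
    denominator \<open>d\<close>, which is nonzero and can be cancelled afterwards.\<close>
  have *: "a \<otimes> f = e \<otimes> b" if eq: "a \<otimes> d = c \<otimes> b" "c \<otimes> f = e \<otimes> d"
    and car: "a \<in> carrier R" "b \<in> carrier R" "c \<in> carrier R" "d \<in> carrier R - {\<zero>}" "e \<in> carrier R" "f \<in> carrier R"
    for a b c d e f
  proof -
    have "d \<otimes> (a \<otimes> f) = (a \<otimes> d) \<otimes> f" using car by (simp add: m_ac)
    also have "\<dots> = (c \<otimes> f) \<otimes> b" unfolding eq(1) using car by (simp add: m_ac)
    also have "\<dots> = d \<otimes> (e \<otimes> b)" unfolding eq(2) using car by (simp add: m_ac)
    finally show ?thesis using car m_lcancel by simp
  qed
  assume eq: "a \<otimes> d = c \<otimes> b"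
  show "fraction R a b = fraction R c d"
  proof (intro equalityI subsetI)
    fix p assume "p \<in> fraction R a b"
    then show "p \<in> fraction R c d" unfolding fraction_def using *[OF eq[symmetric]] assms by auto
  next
    fix p assume "p \<in> fraction R c d"
    then show "p \<in> fraction R a b" unfolding fraction_def using *[OF eq] assms by auto
  qed
qed

lemma fraction_repE:
  assumes "a \<in> carrier R" "b \<in> carrier R - {\<zero>}"
  obtains c d where "fraction_rep R (fraction R a b) = (c, d)" "c \<in> carrier R" "d \<in> carrier R - {\<zero>}" "c \<otimes> b = a \<otimes> d"
proof -
  let ?Q = "\<lambda>p. fst p \<in> carrier R \<and> snd p \<in> carrier R - {\<zero>} \<and> fraction R a b = fraction R (fst p) (snd p)"
  have "?Q (a, b)" using assms by simp
  then have "?Q (fraction_rep R (fraction R a b))" unfolding fraction_rep_def by (rule someI)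
  moreover obtain c d where cd: "fraction_rep R (fraction R a b) = (c, d)" by fastforce
  ultimately have "c \<in> carrier R" "d \<in> carrier R - {\<zero>}" "fraction R a b = fraction R c d" by auto
  moreover from this have "c \<otimes> b = a \<otimes> d" using fraction_eq_iff assms by metis
  ultimately show ?thesis using that cd by blast
qed

lemma fraction_mult:
  assumes "a \<in> carrier R" "b \<in> carrier R - {\<zero>}" "c \<in> carrier R" "d \<in> carrier R - {\<zero>}"
  shows "fraction R a b \<otimes>\<^bsub>fraction_field R\<^esub> fraction R c d = fraction R (a \<otimes> c) (b \<otimes> d)"
proof -
  obtain a' b' where r: "fraction_rep R (fraction R a b) = (a', b')" "a' \<in> carrier R" "b' \<in> carrier R - {\<zero>}" "a' \<otimes> b = a \<otimes> b'"
    using fraction_repE[OF assms(1,2)] .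
  obtain c' d' where s: "fraction_rep R (fraction R c d) = (c', d')" "c' \<in> carrier R" "d' \<in> carrier R - {\<zero>}" "c' \<otimes> d = c \<otimes> d'"
    using fraction_repE[OF assms(3,4)] .
  have "(a' \<otimes> c') \<otimes> (b \<otimes> d) = (a' \<otimes> b) \<otimes> (c' \<otimes> d)" using assms r(2,3) s(2,3) by (simp add: m_ac)
  also have "\<dots> = (a \<otimes> c) \<otimes> (b' \<otimes> d')" unfolding r(4) s(4) using assms r(2,3) s(2,3) by (simp add: m_ac)
  finally have "fraction R (a' \<otimes> c') (b' \<otimes> d') = fraction R (a \<otimes> c) (b \<otimes> d)"
    using assms r s by (subst fraction_eq_iff) (auto simp: integral_iff)
  then show ?thesis using r(1) s(1) by (simp add: fraction_field_def)
qed

lemma fraction_add: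
  assumes "a \<in> carrier R" "b \<in> carrier R - {\<zero>}" "c \<in> carrier R" "d \<in> carrier R - {\<zero>}"
  shows "fraction R a b \<oplus>\<^bsub>fraction_field R\<^esub> fraction R c d = fraction R (a \<otimes> d \<oplus> c \<otimes> b) (b \<otimes> d)"
proof -
  obtain a' b' where r: "fraction_rep R (fraction R a b) = (a', b')" "a' \<in> carrier R" "b' \<in> carrier R - {\<zero>}" "a' \<otimes> b = a \<otimes> b'"
    using fraction_repE[OF assms(1,2)] .
  obtain c' d' where s: "fraction_rep R (fraction R c d) = (c', d')" "c' \<in> carrier R" "d' \<in> carrier R - {\<zero>}" "c' \<otimes> d = c \<otimes> d'"
    using fraction_repE[OF assms(3,4)] .
  have "(a' \<otimes> d' \<oplus> c' \<otimes> b') \<otimes> (b \<otimes> d) = (a' \<otimes> b) \<otimes> (d' \<otimes> d) \<oplus> (c' \<otimes> d) \<otimes> (b' \<otimes> b)"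
    using assms r(2,3) s(2,3) by (simp add: l_distr r_distr m_ac)
  also have "\<dots> = (a \<otimes> d \<oplus> c \<otimes> b) \<otimes> (b' \<otimes> d')"
    unfolding r(4) s(4) using assms r(2,3) s(2,3) by (simp add: l_distr r_distr m_ac)
  finally have "fraction R (a' \<otimes> d' \<oplus> c' \<otimes> b') (b' \<otimes> d') = fraction R (a \<otimes> d \<oplus> c \<otimes> b) (b \<otimes> d)"
    using assms r s by (subst fraction_eq_iff) (auto simp: integral_iff)
  then show ?thesis using r(1) s(1) by (simp add: fraction_field_def)
qed

lemma fraction_carrier: "a \<in> carrier R \<Longrightarrow> b \<in> carrier R - {\<zero>} \<Longrightarrow> fraction R a b \<in> carrier (fraction_field R)"
  unfolding fraction_field_def by auto

lemma fraction_carrierE: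
  assumes "U \<in> carrier (fraction_field R)"
  obtains a b where "a \<in> carrier R" "b \<in> carrier R - {\<zero>}" "U = fraction R a b"
  using assms unfolding fraction_field_def by auto

lemma fraction_one: "\<one>\<^bsub>fraction_field R\<^esub> = fraction R \<one> \<one>"
  and fraction_zero: "\<zero>\<^bsub>fraction_field R\<^esub> = fraction R \<zero> \<one>"
  unfolding fraction_field_def by simp_all

lemma fraction_cring: "cring (fraction_field R)"
proof (rule cringI)
  have one: "\<one> \<in> carrier R - {\<zero>}" by simp
  show "abelian_group (fraction_field R)"
  proof (rule abelian_groupI)
    fix x y assume "x \<in> carrier (fraction_field R)" "y \<in> carrier (fraction_field R)"
    then obtain a b c d where "a \<in> carrier R" "b \<in> carrier R - {\<zero>}" "x = fraction R a b"
      "c \<in> carrier R" "d \<in> carrier R - {\<zero>}" "y = fraction R c d" by (metis fraction_carrierE)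
    then show "x \<oplus>\<^bsub>fraction_field R\<^esub> y \<in> carrier (fraction_field R)"
      "x \<oplus>\<^bsub>fraction_field R\<^esub> y = y \<oplus>\<^bsub>fraction_field R\<^esub> x"
      by (simp_all add: fraction_add fraction_carrier integral_iff a_comm m_comm)
  next
    fix x y z assume "x \<in> carrier (fraction_field R)" "y \<in> carrier (fraction_field R)"
      "z \<in> carrier (fraction_field R)"
    then show "(x \<oplus>\<^bsub>fraction_field R\<^esub> y) \<oplus>\<^bsub>fraction_field R\<^esub> z =
        x \<oplus>\<^bsub>fraction_field R\<^esub> (y \<oplus>\<^bsub>fraction_field R\<^esub> z)"
      by (auto elim!: fraction_carrierE simp: fraction_add integral_iff l_distr r_distr a_ac m_ac)
  next
    fix x assume "x \<in> carrier (fraction_field R)"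
    then obtain a b where ab: "a \<in> carrier R" "b \<in> carrier R - {\<zero>}" "x = fraction R a b" by (rule fraction_carrierE)
    show "\<zero>\<^bsub>fraction_field R\<^esub> \<oplus>\<^bsub>fraction_field R\<^esub> x = x"
      using ab by (simp add: fraction_zero fraction_add)
    have "fraction R (\<ominus> a) b \<oplus>\<^bsub>fraction_field R\<^esub> x = fraction R (\<ominus> a \<otimes> b \<oplus> a \<otimes> b) (b \<otimes> b)"
      using ab by (simp add: fraction_add)
    also have "\<dots> = \<zero>\<^bsub>fraction_field R\<^esub>"
      unfolding fraction_zero using ab by (subst fraction_eq_iff) (auto simp: integral_iff l_minus l_neg)
    finally show "\<exists>y\<in>carrier (fraction_field R). y \<oplus>\<^bsub>fraction_field R\<^esub> x = \<zero>\<^bsub>fraction_field R\<^esub>"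
      using ab fraction_carrier by (intro bexI[of _ "fraction R (\<ominus> a) b"]) auto
  qed (simp add: fraction_zero fraction_carrier)
  show "comm_monoid (fraction_field R)"
  proof (rule comm_monoidI)
    fix x y assume "x \<in> carrier (fraction_field R)" "y \<in> carrier (fraction_field R)"
    then obtain a b c d where "a \<in> carrier R" "b \<in> carrier R - {\<zero>}" "x = fraction R a b"
      "c \<in> carrier R" "d \<in> carrier R - {\<zero>}" "y = fraction R c d" by (metis fraction_carrierE)
    then show "x \<otimes>\<^bsub>fraction_field R\<^esub> y \<in> carrier (fraction_field R)"
      by (simp add: fraction_mult fraction_carrier integral_iff)
  next
    fix x y z assume "x \<in> carrier (fraction_field R)" "y \<in> carrier (fraction_field R)"
      "z \<in> carrier (fraction_field R)"
    then show "(x \<otimes>\<^bsub>fraction_field R\<^esub> y) \<otimes>\<^bsub>fraction_field R\<^esub> z =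
        x \<otimes>\<^bsub>fraction_field R\<^esub> (y \<otimes>\<^bsub>fraction_field R\<^esub> z)"
      by (auto elim!: fraction_carrierE simp: fraction_mult integral_iff m_ac)
  qed (auto elim!: fraction_carrierE simp: fraction_mult fraction_one integral_iff m_comm fraction_carrier)
  fix x y z assume "x \<in> carrier (fraction_field R)" "y \<in> carrier (fraction_field R)"
    "z \<in> carrier (fraction_field R)"
  then obtain a b c d e f where v: "a \<in> carrier R" "b \<in> carrier R - {\<zero>}" "c \<in> carrier R" "d \<in> carrier R - {\<zero>}"
    "e \<in> carrier R" "f \<in> carrier R - {\<zero>}" "x = fraction R a b" "y = fraction R c d" "z = fraction R e f"
    by (metis fraction_carrierE)
  have "(x \<oplus>\<^bsub>fraction_field R\<^esub> y) \<otimes>\<^bsub>fraction_field R\<^esub> z = fraction R ((a \<otimes> d \<oplus> c \<otimes> b) \<otimes> e) ((b \<otimes> d) \<otimes> f)"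
    using v by (simp add: fraction_add fraction_mult integral_iff)
  also have "\<dots> = fraction R ((a \<otimes> e) \<otimes> (d \<otimes> f) \<oplus> (c \<otimes> e) \<otimes> (b \<otimes> f)) ((b \<otimes> f) \<otimes> (d \<otimes> f))"
    using v by (subst fraction_eq_iff) (auto simp: integral_iff l_distr r_distr m_ac)
  also have "\<dots> = x \<otimes>\<^bsub>fraction_field R\<^esub> z \<oplus>\<^bsub>fraction_field R\<^esub> y \<otimes>\<^bsub>fraction_field R\<^esub> z"
    using v by (simp add: fraction_add fraction_mult integral_iff)
  finally show "(x \<oplus>\<^bsub>fraction_field R\<^esub> y) \<otimes>\<^bsub>fraction_field R\<^esub> z =
      x \<otimes>\<^bsub>fraction_field R\<^esub> z \<oplus>\<^bsub>fraction_field R\<^esub> y \<otimes>\<^bsub>fraction_field R\<^esub> z" .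
qed

lemma fraction_field: "field (fraction_field R)"
proof (rule cring.cring_fieldI2[OF fraction_cring])
  show "\<zero>\<^bsub>fraction_field R\<^esub> \<noteq> \<one>\<^bsub>fraction_field R\<^esub>"
    unfolding fraction_zero fraction_one by (subst fraction_eq_iff) auto
  fix x assume "x \<in> carrier (fraction_field R)" and nz: "x \<noteq> \<zero>\<^bsub>fraction_field R\<^esub>"
  then obtain a b where ab: "a \<in> carrier R" "b \<in> carrier R - {\<zero>}" "x = fraction R a b" by (elim fraction_carrierE)
  have a: "a \<in> carrier R - {\<zero>}"
  proof -
    have "a \<noteq> \<zero>" using nz ab unfolding fraction_zero by (auto simp: fraction_eq_iff)
    then show ?thesis using ab by simp
  qed
  have "x \<otimes>\<^bsub>fraction_field R\<^esub> fraction R b a = fraction R (a \<otimes> b) (b \<otimes> a)" using ab a by (simp add: fraction_mult)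
  also have "\<dots> = \<one>\<^bsub>fraction_field R\<^esub>"
    unfolding fraction_one using ab a by (subst fraction_eq_iff) (auto simp: integral_iff m_comm)
  finally show "\<exists>y\<in>carrier (fraction_field R). x \<otimes>\<^bsub>fraction_field R\<^esub> y = \<one>\<^bsub>fraction_field R\<^esub>"
    using ab a fraction_carrier by (intro bexI[of _ "fraction R b a"]) auto
qed

lemma fraction_embedding_hom: "(\<lambda>a. fraction R a \<one>) \<in> ring_hom R (fraction_field R)"
  by (rule ring_hom_memI) (simp_all add: fraction_carrier fraction_mult fraction_add fraction_one)

lemma fraction_embedding_inj: "inj_on (\<lambda>a. fraction R a \<one>) (carrier R)"
  by (rule inj_onI) (simp add: fraction_eq_iff)

text \<open>Keeps track of the size of the field, so that its algebraic closure can be placed in a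
  prescribed type.\<close>

lemma fraction_field_lepoll: "carrier (fraction_field R) \<lesssim> carrier R \<times> carrier R"
proof -
  have "carrier (fraction_field R) \<subseteq> (\<lambda>(a, b). fraction R a b) ` (carrier R \<times> carrier R)"
    unfolding fraction_field_def by auto
  then show ?thesis using image_lepoll subset_imp_lepoll lepoll_trans by metis
qed

end

section \<open>Cardinality of algebraic closures, and algebraically closed fields over
  \<open>R / P\<close> in a given type\<close>

section \<open>Algebraically closed fields of bounded cardinality\<close>

lemma infinite_times_lepoll:
  assumes "infinite (UNIV :: 'k set)" "A \<lesssim> (UNIV :: 'k set)" "B \<lesssim> (UNIV :: 'k set)"
  shows "A \<times> B \<lesssim> (UNIV :: 'k set)"
proof -
  have "\<exists>f. bij_betw f (UNIV \<times> UNIV :: ('k \<times> 'k) set) (UNIV :: 'k set)"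
    using card_of_Times_same_infinite[OF assms(1)] card_of_ordIso by blast
  then have "(UNIV \<times> UNIV :: ('k \<times> 'k) set) \<lesssim> (UNIV :: 'k set)"
    unfolding lepoll_def bij_betw_def by blast
  then show ?thesis using times_lepoll_mono[OF assms(2,3)] lepoll_trans by blast
qed

text \<open>Iterated pairing, started at an arbitrary seed, is injective on lists of one fixed
  length; recording the length as well, coded by \<open>c\<close>, separates the remaining
  lists.\<close>

lemma infinite_lists_lepoll:
  assumes "infinite (UNIV :: 'k set)" "A \<lesssim> (UNIV :: 'k set)"
  shows "lists A \<lesssim> (UNIV :: 'k set)"
proof -
  let ?U = "UNIV :: 'k set"
  have "?U \<times> ?U \<lesssim> ?U" by (rule infinite_times_lepoll[OF assms(1)]) (rule lepoll_refl)+
  then obtain p :: "'k \<times> 'k \<Rightarrow> 'k" where p: "inj p" unfolding lepoll_def by auto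
  have "(UNIV :: nat set) \<lesssim> ?U" using assms(1) infinite_le_lepoll by blast
  then obtain c :: "nat \<Rightarrow> 'k" where c: "inj c" unfolding lepoll_def by auto
  define e where "e = (\<lambda>xs. foldr (\<lambda>x y. p (x, y)) xs (c 0))"
  have e: "xs = ys" if "length xs = length ys" "e xs = e ys" for xs ys
    using that by (induction xs ys rule: list_induct2) (auto simp: e_def dest: injD[OF p])
  have "inj (\<lambda>xs. p (c (length xs), e xs))"
    by (rule injI) (auto dest!: injD[OF p] dest: injD[OF c] intro: e)
  then have "(UNIV :: 'k list set) \<lesssim> ?U" unfolding lepoll_def by blast
  moreover have "lists A \<lesssim> lists ?U" by (rule lists_lepoll_mono[OF assms(2)])
  ultimately show ?thesis using lepoll_trans by (metis lists_UNIV)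
qed

text \<open>An element is determined by a polynomial over \<open>F\<close> of which it is a root,
  together with its number in a fixed enumeration of the finitely many roots of that
  polynomial.\<close>

lemma algebraic_closure_lepoll:
  fixes L :: "('l, 'z) ring_scheme"
  assumes L: "algebraic_closure L F" and inf: "infinite (UNIV :: 'k set)" and F: "F \<lesssim> (UNIV :: 'k set)"
  shows "carrier L \<lesssim> (UNIV :: 'k set)"
proof -
  interpret algebraic_closure L F by fact
  have sub: "subring F L" by (rule subfieldE(1)[OF subfield_axioms])
  define Z where "Z p = {x. is_root p x}" for p
  have "\<exists>p. p \<in> lists F \<and> x \<in> Z p \<and> finite (Z p)" if x: "x \<in> carrier L" for x
  proof -
    obtain p where p: "p \<in> carrier (F[X]\<^bsub>L\<^esub>)" "p \<noteq> []" "eval p x = \<zero>\<^bsub>L\<^esub>"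
      by (rule algebraicE[OF sub x algebraic_extension[OF x]])
    have "p \<in> lists F" using p(1) unfolding univ_poly_carrier[symmetric] polynomial_def by auto
    moreover have "p \<in> carrier (poly_ring L)" using carrier_polynomial_shell[OF sub p(1)] .
    then have "finite (Z p)" unfolding Z_def by (rule finite_number_of_roots)
    moreover have "x \<in> Z p" using p x unfolding Z_def is_root_def by simp
    ultimately show ?thesis by blast
  qed
  then obtain p where p: "\<And>x. x \<in> carrier L \<Longrightarrow> p x \<in> lists F \<and> x \<in> Z (p x) \<and> finite (Z (p x))" by metis
  have "\<exists>g :: 'l \<Rightarrow> nat. inj_on g (Z q)" if "finite (Z q)" for q
    using finite_imp_inj_to_nat_seg[OF that] by blast
  then obtain g :: "'l list \<Rightarrow> 'l \<Rightarrow> nat" where g: "\<And>q. finite (Z q) \<Longrightarrow> inj_on (g q) (Z q)" by metis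
  let ?h = "\<lambda>x. (p x, g (p x) x)"
  have "inj_on ?h (carrier L)"
  proof (rule inj_onI)
    fix x y assume xy: "x \<in> carrier L" "y \<in> carrier L" "?h x = ?h y"
    then have "p x = p y" "g (p x) x = g (p x) y" by auto
    then show "x = y" using p[OF xy(1)] p[OF xy(2)] g[of "p x"] by (auto dest: inj_onD)
  qed
  moreover have "?h ` carrier L \<subseteq> lists F \<times> UNIV" using p by auto
  ultimately have "carrier L \<lesssim> lists F \<times> (UNIV :: nat set)" unfolding lepoll_def by blast
  moreover have "lists F \<times> (UNIV :: nat set) \<lesssim> (UNIV :: 'k set)"
    by (rule infinite_times_lepoll[OF inf infinite_lists_lepoll[OF inf F]])
      (use inf infinite_le_lepoll in blast)
  ultimately show ?thesis by (rule lepoll_trans)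
qed

text \<open>A polynomial over \<open>K\<close> is carried back along the inverse of
  \<open>j\<close>, has a root in \<open>L\<close> because the number of its roots equals its
  degree, and \<open>j\<close> maps this root to a root of the original polynomial.\<close>

lemma algebraically_closed_iso:
  assumes L: "algebraically_closed L" and K: "field K" and j: "j \<in> ring_iso L K"
  shows "algebraically_closed K"
proof -
  interpret L: algebraically_closed L by fact
  interpret K: field K by fact
  let ?g = "inv_into (carrier L) j"
  have g: "?g \<in> ring_hom K L" using ring_iso_set_sym[OF L.ring_axioms j] unfolding ring_iso_def by blast
  have jh: "j \<in> ring_hom L K" using j unfolding ring_iso_def by blast
  interpret J: ring_hom_ring L K j by (rule ring_hom_ringI2[OF L.ring_axioms K.ring_axioms jh])
  show ?thesis
  proof (rule K.algebraically_closedI)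
    fix p assume p: "p \<in> carrier (poly_ring K)" "degree p > 1"
    have q: "map ?g p \<in> carrier (poly_ring L)"
      by (rule polynomial_hom[OF g K.field_axioms L.field_axioms p(1)])
    have "size (L.roots (map ?g p)) = degree p" using L.roots_over_carrier[OF q] unfolding L.splitted_def by simp
    then obtain x where "x \<in># L.roots (map ?g p)" using p(2) by (metis less_nat_zero_code multiset_nonemptyE size_empty)
    then have "L.is_root (map ?g p) x" using L.roots_mem_iff_is_root[OF q] by simp
    then have x: "x \<in> carrier L" "L.eval (map ?g p) x = \<zero>\<^bsub>L\<^esub>" unfolding L.is_root_def by auto
    have pK: "set p \<subseteq> carrier K" using p(1) unfolding univ_poly_carrier[symmetric] polynomial_def by auto
    have pL: "set (map ?g p) \<subseteq> carrier L" using q unfolding univ_poly_carrier[symmetric] polynomial_def by auto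
    have "j (?g c) = c" if "c \<in> set p" for c
      using ring_iso_memE(5)[OF j] pK that by (auto simp: bij_betw_inv_into_right)
    then have "map j (map ?g p) = p" by (simp add: map_idI)
    then have "K.eval p (j x) = j (L.eval (map ?g p) x)" using J.eval_hom'[OF x(1) pL] by simp
    also have "\<dots> = \<zero>\<^bsub>K\<^esub>" using x(2) by simp
    finally show "\<exists>x \<in> carrier K. K.eval p x = \<zero>\<^bsub>K\<^esub>"
      by (rule bexI[OF _ J.hom_closed[OF x(1)]])
  qed
qed

text \<open>The algebraic closure of the field of fractions of \<open>R / P\<close> is first built
  in a large type; its cardinality then allows the ring structure to be copied along an injection
  \<open>j\<close> into \<open>'k\<close>.\<close>

lemma exists_algebraically_closed_algebra:
  fixes R :: "'r ring"
  assumes R: "cring R" and P: "primeideal P R"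
    and inf: "infinite (UNIV :: 'k set)" and card: "carrier R \<lesssim> (UNIV :: 'k set)"
  shows "\<exists>K :: ('r, 'k) module. algebra R K \<and> algebraically_closed K \<and>
    (\<forall>r \<in> carrier R. r \<odot>\<^bsub>K\<^esub> \<one>\<^bsub>K\<^esub> = \<zero>\<^bsub>K\<^esub> \<longleftrightarrow> r \<in> P)"
proof -
  interpret R: cring R by fact
  interpret P: primeideal P R by fact
  let ?D = "R Quot P"
  interpret D: domain ?D by (rule P.quotient_is_domain)
  let ?F = "fraction_field ?D"
  interpret F: field ?F by (rule D.fraction_field)
  obtain L :: "((('r set \<times> 'r set) set list \<times> nat) multiset \<Rightarrow> ('r set \<times> 'r set) set) ring"
    where L: "algebraic_closure L (F.indexed_const ` carrier ?F)" and cL: "F.indexed_const \<in> ring_hom ?F L"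
    by (rule F.exists_closure)
  interpret L: algebraic_closure L "F.indexed_const ` carrier ?F" by (fact L)
  have "carrier ?D \<subseteq> (\<lambda>x. P +>\<^bsub>R\<^esub> x) ` carrier R"
    unfolding FactRing_def A_RCOSETS_def' by auto
  then have D: "carrier ?D \<lesssim> (UNIV :: 'k set)"
    using image_lepoll subset_imp_lepoll lepoll_trans card by metis
  have "F.indexed_const ` carrier ?F \<lesssim> carrier ?F" by (rule image_lepoll)
  also have "carrier ?F \<lesssim> carrier ?D \<times> carrier ?D" by (rule D.fraction_field_lepoll)
  also have "\<dots> \<lesssim> (UNIV :: 'k set)" by (rule infinite_times_lepoll[OF inf D D])
  finally have "carrier L \<lesssim> (UNIV :: 'k set)" by (rule algebraic_closure_lepoll[OF L inf])
  then obtain j :: "_ \<Rightarrow> 'k" where j: "inj_on j (carrier L)" unfolding lepoll_def by auto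
  define h :: "'r \<Rightarrow> (('r set \<times> 'r set) set list \<times> nat) multiset \<Rightarrow> ('r set \<times> 'r set) set"
    where "h = (\<lambda>r. F.indexed_const (fraction ?D (P +>\<^bsub>R\<^esub> r) \<one>\<^bsub>?D\<^esub>))"
  have "h \<in> ring_hom R L"
    using ring_hom_trans[OF ring_hom_trans[OF P.rcos_ring_hom D.fraction_embedding_hom] cL]
    unfolding h_def comp_def .
  then interpret h: ring_hom_ring R L h by (rule ring_hom_ringI2[OF R.ring_axioms L.ring_axioms])
  \<comment> \<open>Of the three maps from \<open>R\<close> to \<open>R / P\<close>, to its
    fractions and to the closure, only the first has a kernel, namely \<open>P\<close>.\<close>
  have hker: "h r = \<zero>\<^bsub>L\<^esub> \<longleftrightarrow> r \<in> P" if r: "r \<in> carrier R" for r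
  proof -
    have rD: "P +>\<^bsub>R\<^esub> r \<in> carrier ?D" using r unfolding FactRing_def A_RCOSETS_def' by auto
    have "h \<zero>\<^bsub>R\<^esub> = \<zero>\<^bsub>L\<^esub>" by simp
    then have "h r = \<zero>\<^bsub>L\<^esub> \<longleftrightarrow> h r = h \<zero>\<^bsub>R\<^esub>" by simp
    also have "\<dots> \<longleftrightarrow> fraction ?D (P +>\<^bsub>R\<^esub> r) \<one>\<^bsub>?D\<^esub> = fraction ?D (P +>\<^bsub>R\<^esub> \<zero>\<^bsub>R\<^esub>) \<one>\<^bsub>?D\<^esub>"
      unfolding h_def
      by (rule inj_on_eq_iff[OF F.indexed_const_inj_on])
        (use D.fraction_carrier rD ring_hom_closed[OF P.rcos_ring_hom] in auto)
    also have "\<dots> \<longleftrightarrow> P +>\<^bsub>R\<^esub> r = P +>\<^bsub>R\<^esub> \<zero>\<^bsub>R\<^esub>"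
      by (rule inj_on_eq_iff[OF D.fraction_embedding_inj rD]) (rule ring_hom_closed[OF P.rcos_ring_hom R.zero_closed])
    also have "\<dots> \<longleftrightarrow> r \<in> P"
    proof -
      have "P +>\<^bsub>R\<^esub> \<zero>\<^bsub>R\<^esub> = P" using P.a_subset by simp
      then show ?thesis using R.a_coset_join2[OF r P.a_subgroup] P.a_rcos_self[OF r] by auto
    qed
    finally show ?thesis .
  qed
  let ?I = "image_ring j L"
  define K where "K = \<lparr>carrier = carrier ?I, monoid.mult = monoid.mult ?I, one = one ?I, ring.zero = ring.zero ?I,
    ring.add = ring.add ?I, smult = (\<lambda>r x. j (h r) \<otimes>\<^bsub>?I\<^esub> x)\<rparr>"
  have jI: "j \<in> ring_iso L ?I" by (rule inj_imp_image_ring_iso[OF j])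
  have jK: "j \<in> ring_iso L K"
    using jI unfolding ring_iso_def ring_hom_def K_def by simp
  have K: "field K"
    using L.ring_iso_imp_img_field[OF jK] by (simp add: K_def image_ring_zero)
  interpret K: field K by (fact K)
  have jh: "j \<in> ring_hom L K" using jK unfolding ring_iso_def by blast
  interpret J: ring_hom_ring L K j by (rule ring_hom_ringI2[OF L.ring_axioms K.ring_axioms jh])
  have sm: "r \<odot>\<^bsub>K\<^esub> x = j (h r) \<otimes>\<^bsub>K\<^esub> x" for r x unfolding K_def by simp
  have "algebra R K"
    by (rule algebraI) (auto simp: sm K.l_distr K.r_distr K.m_assoc R.is_cring K.is_cring)
  moreover have "algebraically_closed K"
    by (rule algebraically_closed_iso[OF L.algebraically_closed_axioms K jK])
  moreover have "r \<odot>\<^bsub>K\<^esub> \<one>\<^bsub>K\<^esub> = \<zero>\<^bsub>K\<^esub> \<longleftrightarrow> r \<in> P" if r: "r \<in> carrier R" for r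
  proof -
    have "r \<odot>\<^bsub>K\<^esub> \<one>\<^bsub>K\<^esub> = j (h r)" using r by (simp add: sm)
    moreover have "\<zero>\<^bsub>K\<^esub> = j \<zero>\<^bsub>L\<^esub>" unfolding K_def by (simp add: image_ring_zero)
    ultimately show ?thesis using inj_on_eq_iff[OF j, of "h r" "\<zero>\<^bsub>L\<^esub>"] r hker[OF r] by simp
  qed
  ultimately show ?thesis by blast
qed

section \<open>Descent from an extension field by a retraction with denominators\<close>

section \<open>Descent from algebraically closed fields\<close>

lemma module_hom_preimage_submodule:
  assumes "module R M" "module R N" "h \<in> module_hom R M N" "submodule H R N"
  shows "submodule {x \<in> carrier M. h x \<in> H} R M"
proof -
  interpret M: module R M by fact
  show ?thesis
    by (rule submoduleI'[OF assms(1)])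
      (auto simp: module_hom_zero[OF assms(1-3)] module_hom_add[OF assms(3)] module_hom_smult[OF assms(3)]
        intro: submodule_zero[OF assms(4)] submodule_add[OF assms(4)] submodule_smult[OF assms(4)])
qed

lemma submodule_finsum:
  assumes "module R M" "submodule H R M" "finite A" "\<And>a. a \<in> A \<Longrightarrow> f a \<in> H"
  shows "finsum M f A \<in> H"
proof -
  interpret M: module R M by fact
  show ?thesis using assms(3,4)
  proof (induction A)
    case empty
    then show ?case using submodule_zero[OF assms(2)] by simp
  next
    case (insert a A)
    have "f \<in> A \<rightarrow> carrier M" "f a \<in> carrier M" using insert.prems submodule_carrier[OF assms(2)] by auto
    then show ?case using insert submodule_add[OF assms(2)] by simp
  qed
qed

text \<open>The condition \<open>kernel\<close> makes \<open>K\<close> an extension of the field of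
  fractions of \<open>R / P\<close>. That subfield is never formed; its elements are represented by
  numerators and denominators in \<open>R\<close>.\<close>

locale field_algebra =
  fixes R :: "('r, 'x) ring_scheme" and K :: "('r, 'k) module" and P
  assumes K_algebra: "algebra R K" and K_field: "field K" and prime: "primeideal P R"
    and kernel: "r \<in> carrier R \<Longrightarrow> r \<odot>\<^bsub>K\<^esub> \<one>\<^bsub>K\<^esub> = \<zero>\<^bsub>K\<^esub> \<longleftrightarrow> r \<in> P"
begin

lemma K_module: "module R K" by (rule algebra.module[OF K_algebra])

interpretation R: cring R by (rule module_cring[OF K_module])
interpretation P: primeideal P R by (fact prime)
interpretation K: field K by (fact K_field)
interpretation K: algebra R K by (fact K_algebra)

lemma kernel_smult:
  assumes "r \<in> P" "x \<in> carrier K"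
  shows "r \<odot>\<^bsub>K\<^esub> x = \<zero>\<^bsub>K\<^esub>"
proof -
  have r: "r \<in> carrier R" using assms P.a_subset by blast
  have "r \<odot>\<^bsub>K\<^esub> x = (r \<odot>\<^bsub>K\<^esub> \<one>\<^bsub>K\<^esub>) \<otimes>\<^bsub>K\<^esub> x" using r assms by (simp add: K.smult_assoc2)
  also have "\<dots> = \<zero>\<^bsub>K\<^esub>" using kernel[OF r] assms by simp
  finally show ?thesis .
qed

text \<open>\<open>W\<close> plays the role of a complement of the field of fractions of \<open>R / P\<close> in \<open>K\<close>.\<close>

lemma exists_complement:
  obtains W where "submodule W R K" "\<forall>r \<in> carrier R. r \<odot>\<^bsub>K\<^esub> \<one>\<^bsub>K\<^esub> \<in> W \<longrightarrow> r \<in> P"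
    "\<forall>x \<in> carrier K. \<exists>d \<in> carrier R - P. \<exists>r \<in> carrier R. d \<odot>\<^bsub>K\<^esub> x \<ominus>\<^bsub>K\<^esub> r \<odot>\<^bsub>K\<^esub> \<one>\<^bsub>K\<^esub> \<in> W"
proof -
  \<comment> \<open>Submodules that meet the image of \<open>R\<close> in \<open>K\<close> only in
    zero.\<close>
  let ?A = "{W. submodule W R K \<and> (\<forall>r \<in> carrier R. r \<odot>\<^bsub>K\<^esub> \<one>\<^bsub>K\<^esub> \<in> W \<longrightarrow> r \<in> P)}"
  have "submodule {\<zero>\<^bsub>K\<^esub>} R K" by (rule submoduleI'[OF K_module]) auto
  then have ne: "?A \<noteq> {}" using kernel by blast
  have "\<exists>W \<in> ?A. \<forall>W' \<in> ?A. W \<subseteq> W' \<longrightarrow> W' = W"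
  proof (rule subset_Zorn_nonempty[OF ne])
    fix \<C> assume ne: "\<C> \<noteq> {}" and "subset.chain ?A \<C>"
    then have C: "\<C> \<subseteq> ?A" "\<And>U V. U \<in> \<C> \<Longrightarrow> V \<in> \<C> \<Longrightarrow> U \<subseteq> V \<or> V \<subseteq> U"
      unfolding subset_chain_def by auto
    have sub: "submodule W R K" if "W \<in> \<C>" for W using C(1) that by auto
    have "submodule (\<Union>\<C>) R K"
    proof (rule submoduleI'[OF K_module])
      show "\<Union>\<C> \<subseteq> carrier K" using submodule_carrier[OF sub] by auto
      show "\<zero>\<^bsub>K\<^esub> \<in> \<Union>\<C>" using ne submodule_zero[OF sub] by auto
      fix x assume "x \<in> \<Union>\<C>"
      then obtain U where U: "x \<in> U" "U \<in> \<C>" by blast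
      then show "r \<odot>\<^bsub>K\<^esub> x \<in> \<Union>\<C>" if "r \<in> carrier R" for r using submodule_smult[OF sub that] by blast
      fix y assume "y \<in> \<Union>\<C>"
      then obtain V where V: "y \<in> V" "V \<in> \<C>" by blast
      show "x \<oplus>\<^bsub>K\<^esub> y \<in> \<Union>\<C>"
      proof (cases "U \<subseteq> V")
        case True
        then show ?thesis using submodule_add[OF sub[OF V(2)]] U V by blast
      next
        case False
        then have "V \<subseteq> U" using C(2)[OF U(2) V(2)] by blast
        then show ?thesis using submodule_add[OF sub[OF U(2)]] U V by blast
      qed
    qed
    then show "\<Union>\<C> \<in> ?A" using C(1) by auto
  qed
  then obtain W where WA: "W \<in> ?A" and max: "\<forall>W' \<in> ?A. W \<subseteq> W' \<longrightarrow> W' = W" by (rule bexE)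
  have W: "submodule W R K" and WP: "\<forall>r \<in> carrier R. r \<odot>\<^bsub>K\<^esub> \<one>\<^bsub>K\<^esub> \<in> W \<longrightarrow> r \<in> P"
    using WA by auto
  have one: "\<one>\<^bsub>R\<^esub> \<in> carrier R - P" using P.I_notcarr P.one_imp_carrier by auto
  have "\<exists>d \<in> carrier R - P. \<exists>r \<in> carrier R. d \<odot>\<^bsub>K\<^esub> x \<ominus>\<^bsub>K\<^esub> r \<odot>\<^bsub>K\<^esub> \<one>\<^bsub>K\<^esub> \<in> W" if x: "x \<in> carrier K" for x
  proof (cases "x \<in> W")
    case True
    have "\<one>\<^bsub>R\<^esub> \<odot>\<^bsub>K\<^esub> x \<ominus>\<^bsub>K\<^esub> \<zero>\<^bsub>R\<^esub> \<odot>\<^bsub>K\<^esub> \<one>\<^bsub>K\<^esub> = x" using x by (simp add: K.minus_zero_right)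
    then show ?thesis using True one by (intro bexI[of _ "\<one>\<^bsub>R\<^esub>"] bexI[of _ "\<zero>\<^bsub>R\<^esub>"]) auto
  next
    case False
    let ?W = "{w \<oplus>\<^bsub>K\<^esub> s \<odot>\<^bsub>K\<^esub> x | w s. w \<in> W \<and> s \<in> carrier R}"
    have sub: "submodule ?W R K"
    proof (rule submoduleI'[OF K_module])
      show "?W \<subseteq> carrier K" using submodule_carrier[OF W] x by auto
      have "\<zero>\<^bsub>K\<^esub> = \<zero>\<^bsub>K\<^esub> \<oplus>\<^bsub>K\<^esub> \<zero>\<^bsub>R\<^esub> \<odot>\<^bsub>K\<^esub> x" using x by simp
      then show "\<zero>\<^bsub>K\<^esub> \<in> ?W" using submodule_zero[OF W] R.zero_closed by blast
    next
      fix y z assume "y \<in> ?W" "z \<in> ?W"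
      then obtain v w s t where v: "v \<in> W" "w \<in> W" "s \<in> carrier R" "t \<in> carrier R"
        "y = v \<oplus>\<^bsub>K\<^esub> s \<odot>\<^bsub>K\<^esub> x" "z = w \<oplus>\<^bsub>K\<^esub> t \<odot>\<^bsub>K\<^esub> x" by blast
      have "y \<oplus>\<^bsub>K\<^esub> z = (v \<oplus>\<^bsub>K\<^esub> w) \<oplus>\<^bsub>K\<^esub> (s \<oplus>\<^bsub>R\<^esub> t) \<odot>\<^bsub>K\<^esub> x"
        unfolding v(5,6) using v(3,4) x submodule_carrier[OF W v(1)] submodule_carrier[OF W v(2)]
        by (simp add: K.smult_l_distr K.a_ac)
      then show "y \<oplus>\<^bsub>K\<^esub> z \<in> ?W" using submodule_add[OF W v(1,2)] v(3,4) by blast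
    next
      fix r y assume r: "r \<in> carrier R" and "y \<in> ?W"
      then obtain v s where v: "v \<in> W" "s \<in> carrier R" "y = v \<oplus>\<^bsub>K\<^esub> s \<odot>\<^bsub>K\<^esub> x" by blast
      have "r \<odot>\<^bsub>K\<^esub> y = r \<odot>\<^bsub>K\<^esub> v \<oplus>\<^bsub>K\<^esub> (r \<otimes>\<^bsub>R\<^esub> s) \<odot>\<^bsub>K\<^esub> x"
        unfolding v(3) using v(2) r x submodule_carrier[OF W v(1)]
        by (simp add: K.smult_r_distr K.smult_assoc1)
      then show "r \<odot>\<^bsub>K\<^esub> y \<in> ?W" using submodule_smult[OF W r v(1)] v(2) r by blast
    qed
    have incl: "W \<subseteq> ?W"
    proof
      fix w assume w: "w \<in> W"
      have "w = w \<oplus>\<^bsub>K\<^esub> \<zero>\<^bsub>R\<^esub> \<odot>\<^bsub>K\<^esub> x" using submodule_carrier[OF W w] x by simp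
      then show "w \<in> ?W" using w R.zero_closed by blast
    qed
    have "x \<in> ?W"
    proof -
      have "x = \<zero>\<^bsub>K\<^esub> \<oplus>\<^bsub>K\<^esub> \<one>\<^bsub>R\<^esub> \<odot>\<^bsub>K\<^esub> x" using x by simp
      then show ?thesis using submodule_zero[OF W] R.one_closed by blast
    qed
    then have ne: "?W \<noteq> W" using False by metis
    have "?W \<notin> ?A"
    proof
      assume "?W \<in> ?A"
      from bspec[OF max this] incl have "?W = W" by (rule mp)
      then show False using ne by (rule notE[rotated])
    qed
    have "\<not> (\<forall>r \<in> carrier R. r \<odot>\<^bsub>K\<^esub> \<one>\<^bsub>K\<^esub> \<in> ?W \<longrightarrow> r \<in> P)"
    proof
      assume "\<forall>r \<in> carrier R. r \<odot>\<^bsub>K\<^esub> \<one>\<^bsub>K\<^esub> \<in> ?W \<longrightarrow> r \<in> P"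
      with sub have "?W \<in> ?A" by (intro CollectI conjI)
      with \<open>?W \<notin> ?A\<close> show False by (rule notE)
    qed
    \<comment> \<open>By maximality \<open>W + R x\<close> is not admissible, so some nonzero
      \<open>r 1\<close> equals \<open>w + s x\<close>. Here \<open>s\<close> is outside
      \<open>P\<close>, since otherwise \<open>s x = 0\<close> and \<open>r 1\<close> would lie in
      \<open>W\<close>. Thus \<open>s x - r 1 = - w\<close>, and \<open>s\<close> is the required
      denominator.\<close>
    then obtain r where r: "r \<in> carrier R" "r \<odot>\<^bsub>K\<^esub> \<one>\<^bsub>K\<^esub> \<in> ?W" "r \<notin> P" by blast
    then obtain w s where w: "w \<in> W" "s \<in> carrier R" "r \<odot>\<^bsub>K\<^esub> \<one>\<^bsub>K\<^esub> = w \<oplus>\<^bsub>K\<^esub> s \<odot>\<^bsub>K\<^esub> x" by blast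
    have wc: "w \<in> carrier K" by (rule submodule_carrier[OF W w(1)])
    have "s \<notin> P"
    proof
      assume "s \<in> P"
      then have "r \<odot>\<^bsub>K\<^esub> \<one>\<^bsub>K\<^esub> \<in> W" using w wc x by (simp add: kernel_smult)
      then show False using WP r by blast
    qed
    moreover have "s \<odot>\<^bsub>K\<^esub> x \<ominus>\<^bsub>K\<^esub> r \<odot>\<^bsub>K\<^esub> \<one>\<^bsub>K\<^esub> = \<ominus>\<^bsub>K\<^esub> w"
      unfolding w(3) using w(2) wc x by (simp add: a_minus_def K.minus_add K.a_ac K.r_neg2 K.r_neg1 K.r_neg)
    ultimately show ?thesis using w(1,2) r(1) submodule_neg[OF W w(1)]
      by (intro bexI[of _ s] bexI[of _ r]) auto
  qed
  then show ?thesis using that W WP by blast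
qed

text \<open>Finitely many elements receive a common denominator: \<open>\<rho> s / d\<close>
  represents the component of \<open>s\<close> in the field of fractions along
  \<open>W\<close>.\<close>

lemma exists_retraction:
  assumes "finite D" "D \<subseteq> carrier K"
  obtains d \<rho> W where "submodule W R K" "\<forall>r \<in> carrier R. r \<odot>\<^bsub>K\<^esub> \<one>\<^bsub>K\<^esub> \<in> W \<longrightarrow> r \<in> P"
    "d \<in> carrier R - P" "\<forall>s \<in> D. \<rho> s \<in> carrier R"
    "\<forall>s \<in> D. d \<odot>\<^bsub>K\<^esub> s \<ominus>\<^bsub>K\<^esub> \<rho> s \<odot>\<^bsub>K\<^esub> \<one>\<^bsub>K\<^esub> \<in> W"
proof -
  obtain W where W: "submodule W R K" "\<forall>r \<in> carrier R. r \<odot>\<^bsub>K\<^esub> \<one>\<^bsub>K\<^esub> \<in> W \<longrightarrow> r \<in> P"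
    and den: "\<forall>x \<in> carrier K. \<exists>d \<in> carrier R - P. \<exists>r \<in> carrier R. d \<odot>\<^bsub>K\<^esub> x \<ominus>\<^bsub>K\<^esub> r \<odot>\<^bsub>K\<^esub> \<one>\<^bsub>K\<^esub> \<in> W"
    by (rule exists_complement)
  have scale: "(e \<otimes>\<^bsub>R\<^esub> d) \<odot>\<^bsub>K\<^esub> s \<ominus>\<^bsub>K\<^esub> (e \<otimes>\<^bsub>R\<^esub> r) \<odot>\<^bsub>K\<^esub> \<one>\<^bsub>K\<^esub> \<in> W"
    if "d \<odot>\<^bsub>K\<^esub> s \<ominus>\<^bsub>K\<^esub> r \<odot>\<^bsub>K\<^esub> \<one>\<^bsub>K\<^esub> \<in> W" "d \<in> carrier R" "e \<in> carrier R" "r \<in> carrier R" "s \<in> carrier K" for d e r s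
  proof -
    have "(e \<otimes>\<^bsub>R\<^esub> d) \<odot>\<^bsub>K\<^esub> s \<ominus>\<^bsub>K\<^esub> (e \<otimes>\<^bsub>R\<^esub> r) \<odot>\<^bsub>K\<^esub> \<one>\<^bsub>K\<^esub> = e \<odot>\<^bsub>K\<^esub> (d \<odot>\<^bsub>K\<^esub> s \<ominus>\<^bsub>K\<^esub> r \<odot>\<^bsub>K\<^esub> \<one>\<^bsub>K\<^esub>)"
      using that(2-) by (simp add: K.smult_assoc1 a_minus_def K.smult_r_distr K.smult_r_minus)
    then show ?thesis using submodule_smult[OF W(1) that(3,1)] by simp
  qed
  have "\<exists>d \<in> carrier R - P. \<forall>s \<in> D. \<exists>r \<in> carrier R. d \<odot>\<^bsub>K\<^esub> s \<ominus>\<^bsub>K\<^esub> r \<odot>\<^bsub>K\<^esub> \<one>\<^bsub>K\<^esub> \<in> W"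
    using assms
  proof (induction D)
    case empty
    then show ?case using P.I_notcarr P.one_imp_carrier by auto
  next
    case (insert x D)
    then obtain d where d: "d \<in> carrier R - P" "\<And>s. s \<in> D \<Longrightarrow> \<exists>r \<in> carrier R. d \<odot>\<^bsub>K\<^esub> s \<ominus>\<^bsub>K\<^esub> r \<odot>\<^bsub>K\<^esub> \<one>\<^bsub>K\<^esub> \<in> W"
      by auto
    obtain e r where e: "e \<in> carrier R - P" "r \<in> carrier R" "e \<odot>\<^bsub>K\<^esub> x \<ominus>\<^bsub>K\<^esub> r \<odot>\<^bsub>K\<^esub> \<one>\<^bsub>K\<^esub> \<in> W"
      using den insert.prems by auto
    have "e \<otimes>\<^bsub>R\<^esub> d \<in> carrier R - P" using d(1) e(1) P.I_prime[of e d] by auto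
    moreover have "\<exists>r \<in> carrier R. (e \<otimes>\<^bsub>R\<^esub> d) \<odot>\<^bsub>K\<^esub> s \<ominus>\<^bsub>K\<^esub> r \<odot>\<^bsub>K\<^esub> \<one>\<^bsub>K\<^esub> \<in> W" if s: "s \<in> insert x D" for s
    proof (cases "s = x")
      case True
      then have "(d \<otimes>\<^bsub>R\<^esub> e) \<odot>\<^bsub>K\<^esub> s \<ominus>\<^bsub>K\<^esub> (d \<otimes>\<^bsub>R\<^esub> r) \<odot>\<^bsub>K\<^esub> \<one>\<^bsub>K\<^esub> \<in> W"
        using scale[OF e(3)] d(1) e(1,2) insert.prems by simp
      moreover have "d \<otimes>\<^bsub>R\<^esub> e = e \<otimes>\<^bsub>R\<^esub> d" using d(1) e(1) by (simp add: R.m_comm)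
      ultimately show ?thesis using d(1) e(2) by (intro bexI[of _ "d \<otimes>\<^bsub>R\<^esub> r"]) auto
    next
      case False
      then have sD: "s \<in> D" using s by simp
      then obtain t where t: "t \<in> carrier R" "d \<odot>\<^bsub>K\<^esub> s \<ominus>\<^bsub>K\<^esub> t \<odot>\<^bsub>K\<^esub> \<one>\<^bsub>K\<^esub> \<in> W" using d(2) by blast
      then show ?thesis
        using scale[OF t(2) _ _ t(1)] d(1) e(1) sD insert.prems by (intro bexI[of _ "e \<otimes>\<^bsub>R\<^esub> t"]) auto
    qed
    ultimately show ?case by blast
  qed
  then obtain d where d: "d \<in> carrier R - P" "\<And>s. s \<in> D \<Longrightarrow> \<exists>r \<in> carrier R. d \<odot>\<^bsub>K\<^esub> s \<ominus>\<^bsub>K\<^esub> r \<odot>\<^bsub>K\<^esub> \<one>\<^bsub>K\<^esub> \<in> W" by blast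
  then obtain \<rho> where "\<forall>s \<in> D. \<rho> s \<in> carrier R" "\<forall>s \<in> D. d \<odot>\<^bsub>K\<^esub> s \<ominus>\<^bsub>K\<^esub> \<rho> s \<odot>\<^bsub>K\<^esub> \<one>\<^bsub>K\<^esub> \<in> W"
    by metis
  then show ?thesis using that W d(1) by blast
qed

text \<open>Modulo \<open>W\<close> each \<open>\<rho> s 1\<close> equals \<open>d s\<close>.
  Multiplying the relation \<open>\<Sum> q s s = 0\<close> by \<open>d\<close> therefore shows that
  the image of \<open>\<Sum> \<rho> s q s\<close> in \<open>K\<close> lies in \<open>W\<close>, so
  that the sum is in \<open>P\<close>.\<close>

lemma retraction_relations:
  assumes D: "finite D" "D \<subseteq> carrier K" and W: "submodule W R K"
    and WP: "\<forall>r \<in> carrier R. r \<odot>\<^bsub>K\<^esub> \<one>\<^bsub>K\<^esub> \<in> W \<longrightarrow> r \<in> P" and d: "d \<in> carrier R"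
    and \<rho>: "\<forall>s \<in> D. \<rho> s \<in> carrier R" "\<forall>s \<in> D. d \<odot>\<^bsub>K\<^esub> s \<ominus>\<^bsub>K\<^esub> \<rho> s \<odot>\<^bsub>K\<^esub> \<one>\<^bsub>K\<^esub> \<in> W"
    and q: "q \<in> relations_on R K D"
  shows "(\<Oplus>\<^bsub>regular_algebra R\<^esub>s\<in>D. \<rho> s \<otimes>\<^bsub>R\<^esub> q s) \<in> P"
proof -
  let ?R = "regular_algebra R"
  have R: "module R ?R" by (rule module_regular[OF R.is_cring])
  interpret R': module R ?R by (fact R)
  have qc: "q s \<in> carrier R" for s using subsetD[OF relations_on_carrier[OF K_module] q] by simp
  have c: "(\<lambda>s. \<rho> s \<otimes>\<^bsub>R\<^esub> q s) \<in> D \<rightarrow> carrier ?R" using \<rho>(1) qc by auto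
  note h = scale_hom[OF K_module K.one_closed]
  let ?y = "\<lambda>s. d \<odot>\<^bsub>K\<^esub> s \<ominus>\<^bsub>K\<^esub> \<rho> s \<odot>\<^bsub>K\<^esub> \<one>\<^bsub>K\<^esub>"
  have yc: "?y s \<in> carrier K" if "s \<in> D" for s using submodule_carrier[OF W bspec[OF \<rho>(2) that]] .
  have eq: "(\<rho> s \<otimes>\<^bsub>R\<^esub> q s) \<odot>\<^bsub>K\<^esub> \<one>\<^bsub>K\<^esub> = d \<odot>\<^bsub>K\<^esub> (q s \<odot>\<^bsub>K\<^esub> s) \<oplus>\<^bsub>K\<^esub> (\<ominus>\<^bsub>R\<^esub> q s) \<odot>\<^bsub>K\<^esub> ?y s" if s: "s \<in> D" for s
  proof -
    have sc: "s \<in> carrier K" and r: "\<rho> s \<in> carrier R" using s D \<rho>(1) by auto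
    have comm: "d \<odot>\<^bsub>K\<^esub> (q s \<odot>\<^bsub>K\<^esub> s) = q s \<odot>\<^bsub>K\<^esub> (d \<odot>\<^bsub>K\<^esub> s)"
      "(\<rho> s \<otimes>\<^bsub>R\<^esub> q s) \<odot>\<^bsub>K\<^esub> \<one>\<^bsub>K\<^esub> = q s \<odot>\<^bsub>K\<^esub> (\<rho> s \<odot>\<^bsub>K\<^esub> \<one>\<^bsub>K\<^esub>)"
      using sc r d qc[of s] by (simp_all add: K.smult_assoc1[symmetric] R.m_comm)
    have "(\<ominus>\<^bsub>R\<^esub> q s) \<odot>\<^bsub>K\<^esub> ?y s = \<ominus>\<^bsub>K\<^esub> (q s \<odot>\<^bsub>K\<^esub> (d \<odot>\<^bsub>K\<^esub> s)) \<oplus>\<^bsub>K\<^esub> q s \<odot>\<^bsub>K\<^esub> (\<rho> s \<odot>\<^bsub>K\<^esub> \<one>\<^bsub>K\<^esub>)"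
      using sc r d qc[of s]
      by (simp add: a_minus_def K.smult_l_minus K.smult_r_distr K.smult_r_minus K.minus_add)
    then show ?thesis unfolding comm using sc r d qc[of s] by (simp add: K.r_neg2)
  qed
  have "(\<Oplus>\<^bsub>?R\<^esub>s\<in>D. \<rho> s \<otimes>\<^bsub>R\<^esub> q s) \<odot>\<^bsub>K\<^esub> \<one>\<^bsub>K\<^esub> = (\<Oplus>\<^bsub>K\<^esub>s\<in>D. (\<rho> s \<otimes>\<^bsub>R\<^esub> q s) \<odot>\<^bsub>K\<^esub> \<one>\<^bsub>K\<^esub>)"
    by (rule module_hom_finsum[OF R K_module h c])
  also have "\<dots> = (\<Oplus>\<^bsub>K\<^esub>s\<in>D. d \<odot>\<^bsub>K\<^esub> (q s \<odot>\<^bsub>K\<^esub> s) \<oplus>\<^bsub>K\<^esub> (\<ominus>\<^bsub>R\<^esub> q s) \<odot>\<^bsub>K\<^esub> ?y s)"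
    by (rule K.finsum_cong') (use eq yc qc d D in \<open>auto simp: subset_iff\<close>)
  also have "\<dots> = (\<Oplus>\<^bsub>K\<^esub>s\<in>D. d \<odot>\<^bsub>K\<^esub> (q s \<odot>\<^bsub>K\<^esub> s)) \<oplus>\<^bsub>K\<^esub> (\<Oplus>\<^bsub>K\<^esub>s\<in>D. (\<ominus>\<^bsub>R\<^esub> q s) \<odot>\<^bsub>K\<^esub> ?y s)"
    by (rule K.finsum_addf) (use yc qc d D in \<open>auto simp: subset_iff\<close>)
  also have "(\<Oplus>\<^bsub>K\<^esub>s\<in>D. d \<odot>\<^bsub>K\<^esub> (q s \<odot>\<^bsub>K\<^esub> s)) = d \<odot>\<^bsub>K\<^esub> (\<Oplus>\<^bsub>K\<^esub>s\<in>D. q s \<odot>\<^bsub>K\<^esub> s)"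
    by (rule K.finsum_smult_ldistr[symmetric, OF D(1) d]) (use qc D in \<open>auto simp: subset_iff\<close>)
  also have "\<dots> = \<zero>\<^bsub>K\<^esub>" using q d by (simp add: relations_on_def)
  finally have "(\<Oplus>\<^bsub>?R\<^esub>s\<in>D. \<rho> s \<otimes>\<^bsub>R\<^esub> q s) \<odot>\<^bsub>K\<^esub> \<one>\<^bsub>K\<^esub> = \<zero>\<^bsub>K\<^esub> \<oplus>\<^bsub>K\<^esub> (\<Oplus>\<^bsub>K\<^esub>s\<in>D. (\<ominus>\<^bsub>R\<^esub> q s) \<odot>\<^bsub>K\<^esub> ?y s)" .
  moreover have "(\<Oplus>\<^bsub>K\<^esub>s\<in>D. (\<ominus>\<^bsub>R\<^esub> q s) \<odot>\<^bsub>K\<^esub> ?y s) \<in> W"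
    by (rule submodule_finsum[OF K_module W D(1)], rule submodule_smult[OF W]) (use qc \<rho>(2) in auto)
  ultimately have "(\<Oplus>\<^bsub>?R\<^esub>s\<in>D. \<rho> s \<otimes>\<^bsub>R\<^esub> q s) \<odot>\<^bsub>K\<^esub> \<one>\<^bsub>K\<^esub> \<in> W"
    using submodule_carrier[OF W] by simp
  then show ?thesis using WP R'.finsum_closed[OF c] by simp
qed

text \<open>On a generator the sum is \<open>(\<Sum> \<rho> s q s) x\<close>, with coefficient in
  \<open>P\<close>. In other words, \<open>s \<otimes> x \<mapsto> \<rho> s x\<close> respects the
  relations on \<open>D\<close> modulo \<open>P L\<close>.\<close>

lemma retraction_span:
  assumes L: "module R L" and D: "finite D" "D \<subseteq> carrier K" and W: "submodule W R K"
    and WP: "\<forall>r \<in> carrier R. r \<odot>\<^bsub>K\<^esub> \<one>\<^bsub>K\<^esub> \<in> W \<longrightarrow> r \<in> P" and d: "d \<in> carrier R"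
    and \<rho>: "\<forall>s \<in> D. \<rho> s \<in> carrier R" "\<forall>s \<in> D. d \<odot>\<^bsub>K\<^esub> s \<ominus>\<^bsub>K\<^esub> \<rho> s \<odot>\<^bsub>K\<^esub> \<one>\<^bsub>K\<^esub> \<in> W"
    and f: "f \<in> fun_span L (relations_on R K D)"
  shows "(\<Oplus>\<^bsub>L\<^esub>s\<in>D. \<rho> s \<odot>\<^bsub>L\<^esub> f s) \<in> ideal_span L P"
proof -
  interpret L: module R L by fact
  have hom: "(\<lambda>f. \<Oplus>\<^bsub>L\<^esub>s\<in>D. \<rho> s \<odot>\<^bsub>L\<^esub> f s) \<in> module_hom R (function_module L) L"
    by (rule finsum_coordinates_hom[OF L L D(1) smult_hom[OF L bspec[OF \<rho>(1)]]])
  have "f \<in> {f \<in> carrier (function_module L). (\<Oplus>\<^bsub>L\<^esub>s\<in>D. \<rho> s \<odot>\<^bsub>L\<^esub> f s) \<in> ideal_span L P}"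
  proof (rule fun_span_least[OF L relations_on_carrier[OF K_module] f
        module_hom_preimage_submodule[OF function_module[OF L] L hom ideal_span_submodule[OF L P.a_subset]]])
    fix q x assume q: "q \<in> relations_on R K D" and x: "x \<in> carrier L"
    have qc: "q s \<in> carrier R" for s using subsetD[OF relations_on_carrier[OF K_module] q] by simp
    have "(\<Oplus>\<^bsub>L\<^esub>s\<in>D. \<rho> s \<odot>\<^bsub>L\<^esub> (q s \<odot>\<^bsub>L\<^esub> x)) = (\<Oplus>\<^bsub>L\<^esub>s\<in>D. (\<rho> s \<otimes>\<^bsub>R\<^esub> q s) \<odot>\<^bsub>L\<^esub> x)"
      by (rule L.finsum_cong') (use \<rho>(1) qc x in \<open>auto simp: L.smult_assoc1\<close>)
    also have "\<dots> = (\<Oplus>\<^bsub>regular_algebra R\<^esub>s\<in>D. \<rho> s \<otimes>\<^bsub>R\<^esub> q s) \<odot>\<^bsub>L\<^esub> x"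
      by (rule module_hom_finsum[symmetric, OF module_regular[OF R.is_cring] L scale_hom[OF L x]])
        (use \<rho>(1) qc in auto)
    also have "\<dots> \<in> ideal_span L P"
      by (rule ideal_span_base[OF L P.a_subset retraction_relations[OF D W WP d \<rho> q] x])
    finally show "(\<lambda>s. q s \<odot>\<^bsub>L\<^esub> x) \<in>
        {f \<in> carrier (function_module L). (\<Oplus>\<^bsub>L\<^esub>s\<in>D. \<rho> s \<odot>\<^bsub>L\<^esub> f s) \<in> ideal_span L P}"
      using qc x by simp
  qed
  then show ?thesis by blast
qed

text \<open>For \<open>a\<close> in \<open>P\<close>,
  \<open>1 \<otimes> a x = (a 1) \<otimes> x\<close> and \<open>a 1 = 0\<close>.\<close>

lemma one_tensor_zero:
  assumes L: "module R L" and x: "x \<in> ideal_span L P"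
  shows "pure_tensor R K L \<one>\<^bsub>K\<^esub> x = \<zero>\<^bsub>tensor R K L\<^esub>"
proof -
  interpret L: module R L by fact
  have T: "module R (tensor R K L)" by (rule tensor_module[OF K_module L])
  note h = pure_hom_right[OF K_module L K.one_closed]
  have "x \<in> {x \<in> carrier L. pure_tensor R K L \<one>\<^bsub>K\<^esub> x = \<zero>\<^bsub>tensor R K L\<^esub>}"
  proof (rule ideal_span_least[OF L P.a_subset x module_hom_kernel_submodule[OF L T h]])
    fix a z assume a: "a \<in> P" and z: "z \<in> carrier L"
    have ac: "a \<in> carrier R" using a P.a_subset by blast
    have "pure_tensor R K L \<one>\<^bsub>K\<^esub> (a \<odot>\<^bsub>L\<^esub> z) = pure_tensor R K L (a \<odot>\<^bsub>K\<^esub> \<one>\<^bsub>K\<^esub>) z"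
      using module_hom_smult[OF h ac z] module_hom_smult[OF pure_hom_left[OF K_module L z] ac K.one_closed] by simp
    also have "\<dots> = \<zero>\<^bsub>tensor R K L\<^esub>"
      using kernel[OF ac] a module_hom_zero[OF K_module T pure_hom_left[OF K_module L z]] by simp
    finally show "a \<odot>\<^bsub>L\<^esub> z \<in> {x \<in> carrier L. pure_tensor R K L \<one>\<^bsub>K\<^esub> x = \<zero>\<^bsub>tensor R K L\<^esub>}"
      using ac z by simp
  qed
  then show ?thesis by blast
qed

text \<open>As \<open>1\<close> belongs to \<open>E\<close> and the multiples of \<open>1\<close>
  from \<open>R\<close> meet \<open>W\<close> only in zero, \<open>\<rho> 1\<close> agrees with
  \<open>d\<close> modulo \<open>P\<close>. This allows \<open>d x\<close> to be recovered from
  \<open>1 \<otimes> x\<close>.\<close>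

lemma exists_retracted_relation:
  assumes L: "module R L" and E: "finite E" "E \<subseteq> carrier K" "\<one>\<^bsub>K\<^esub> \<in> E"
  obtains d \<rho> where "d \<in> carrier R - P" "\<forall>s \<in> E. \<rho> s \<in> carrier R" "d \<ominus>\<^bsub>R\<^esub> \<rho> \<one>\<^bsub>K\<^esub> \<in> P"
    "\<forall>f \<in> fun_span L (relations_on R K E). (\<Oplus>\<^bsub>L\<^esub>s\<in>E. \<rho> s \<odot>\<^bsub>L\<^esub> f s) \<in> ideal_span L P"
proof -
  obtain d \<rho> W where W: "submodule W R K" "\<forall>r \<in> carrier R. r \<odot>\<^bsub>K\<^esub> \<one>\<^bsub>K\<^esub> \<in> W \<longrightarrow> r \<in> P"
    and d: "d \<in> carrier R - P" and \<rho>: "\<forall>s \<in> E. \<rho> s \<in> carrier R"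
    "\<forall>s \<in> E. d \<odot>\<^bsub>K\<^esub> s \<ominus>\<^bsub>K\<^esub> \<rho> s \<odot>\<^bsub>K\<^esub> \<one>\<^bsub>K\<^esub> \<in> W"
    by (rule exists_retraction[OF E(1,2)])
  have dc: "d \<in> carrier R" using d by blast
  have r: "\<rho> \<one>\<^bsub>K\<^esub> \<in> carrier R" using \<rho>(1) E(3) by blast
  have "(d \<ominus>\<^bsub>R\<^esub> \<rho> \<one>\<^bsub>K\<^esub>) \<odot>\<^bsub>K\<^esub> \<one>\<^bsub>K\<^esub> = d \<odot>\<^bsub>K\<^esub> \<one>\<^bsub>K\<^esub> \<ominus>\<^bsub>K\<^esub> \<rho> \<one>\<^bsub>K\<^esub> \<odot>\<^bsub>K\<^esub> \<one>\<^bsub>K\<^esub>"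
    using dc r by (simp add: a_minus_def K.smult_l_distr K.smult_l_minus)
  then have "d \<ominus>\<^bsub>R\<^esub> \<rho> \<one>\<^bsub>K\<^esub> \<in> P" using W(2) bspec[OF \<rho>(2) E(3)] dc r by simp
  then show ?thesis
    using that[of d \<rho>] d \<rho>(1) retraction_span[OF L E(1,2) W dc \<rho>] by blast
qed

end

text \<open>Vanishing or lifting over \<open>K\<close> is witnessed by finitely many relations, to
  which the functional \<open>\<Sum> \<rho> s f s\<close> is applied. The outcome is the same
  assertion over \<open>R\<close>, up to the factor \<open>d\<close> and modulo
  \<open>P\<close>.\<close>

lemma (in module_complex) exact_at_fibre:
  assumes K: "field_algebra R K P"
    and left: "\<And>y. y \<in> carrier (tensor R K V) \<Longrightarrow> tensor_map R K M id \<phi> y = \<zero>\<^bsub>tensor R K M\<^esub> \<Longrightarrow>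
      y = \<zero>\<^bsub>tensor R K V\<^esub>"
    and middle: "\<And>y. y \<in> carrier (tensor R K M) \<Longrightarrow> tensor_map R K N id \<delta> y = \<zero>\<^bsub>tensor R K N\<^esub> \<Longrightarrow>
      \<exists>z \<in> carrier (tensor R K V). y = tensor_map R K M id \<phi> z"
  shows "exact_at P"
proof -
  interpret R: cring R by (rule module_cring[OF V])
  interpret field_algebra R K P by fact
  interpret P: primeideal P R by (rule prime)
  interpret K: field K by (rule K_field)
  interpret V: module R V by (rule V)
  interpret M: module R M by (rule M)
  interpret N: module R N by (rule N)
  interpret KM: module R K by (rule K_module)
  have one: "\<one>\<^bsub>K\<^esub> \<in> carrier K" by simp
  have D1: "finite {\<one>\<^bsub>K\<^esub>}" "{\<one>\<^bsub>K\<^esub>} \<subseteq> carrier K" by auto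
  \<comment> \<open>With \<open>r = \<rho> 1\<close> the first summand lies in \<open>P L\<close>,
    so an assertion on \<open>\<rho> 1 x\<close> turns into one on \<open>d x\<close>.\<close>
  have split: "d \<odot>\<^bsub>L\<^esub> x = (d \<ominus>\<^bsub>R\<^esub> r) \<odot>\<^bsub>L\<^esub> x \<oplus>\<^bsub>L\<^esub> r \<odot>\<^bsub>L\<^esub> x"
    if "module R L" "d \<in> carrier R" "r \<in> carrier R" "x \<in> carrier L" for L :: "('r, 'l) module" and d r x
  proof -
    interpret L: module R L by (rule that)
    show ?thesis using that(2-) R.add_minus_cancel[OF that(2,3)]
      by (simp add: L.smult_l_distr[symmetric])
  qed
  show ?thesis unfolding exact_at_def
  proof (intro conjI ballI impI)
    fix v assume v: "v \<in> carrier V" "\<phi> v \<in> ideal_span M P"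
    have "tensor_map R K M id \<phi> (pure_tensor R K V \<one>\<^bsub>K\<^esub> v) = \<zero>\<^bsub>tensor R K M\<^esub>"
      unfolding tensor_map_pure[OF K_module V K_module M id_hom \<phi> one v(1)]
      using one_tensor_zero[OF M v(2)] by simp
    then have "pure_tensor R K V \<one>\<^bsub>K\<^esub> v = \<zero>\<^bsub>tensor R K V\<^esub>"
      by (rule left[OF pure_tensor_closed[OF K_module V one v(1)]])
    then have z: "tensor_sum R K V {\<one>\<^bsub>K\<^esub>} (single V \<one>\<^bsub>K\<^esub> v) = \<zero>\<^bsub>tensor R K V\<^esub>"
      using tensor_sum_single[OF K_module V D1 _ v(1)] by simp
    obtain E where E: "finite E" "{\<one>\<^bsub>K\<^esub>} \<subseteq> E" "E \<subseteq> carrier K"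
      "single V \<one>\<^bsub>K\<^esub> v \<in> fun_span V (relations_on R K E)"
      by (rule tensor_sum_eq_zeroE[OF K_module V D1 _ _ z]) (use v in \<open>auto simp: single_def\<close>)
    obtain d \<rho> where d: "d \<in> carrier R - P" "\<forall>s \<in> E. \<rho> s \<in> carrier R" "d \<ominus>\<^bsub>R\<^esub> \<rho> \<one>\<^bsub>K\<^esub> \<in> P"
      "\<forall>f \<in> fun_span V (relations_on R K E). (\<Oplus>\<^bsub>V\<^esub>s\<in>E. \<rho> s \<odot>\<^bsub>V\<^esub> f s) \<in> ideal_span V P"
      by (rule exists_retracted_relation[OF V E(1,3)]) (use E(2) in auto)
    have r: "\<rho> \<one>\<^bsub>K\<^esub> \<in> carrier R" using d(2) E(2) by blast
    have "(\<Oplus>\<^bsub>V\<^esub>s\<in>{\<one>\<^bsub>K\<^esub>}. \<rho> s \<odot>\<^bsub>V\<^esub> single V \<one>\<^bsub>K\<^esub> v s) = (\<Oplus>\<^bsub>V\<^esub>s\<in>E. \<rho> s \<odot>\<^bsub>V\<^esub> single V \<one>\<^bsub>K\<^esub> v s)"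
      by (rule V.add.finprod_mono_neutral_cong_left[OF E(1,2)]) (use d(2) v in \<open>auto simp: single_def\<close>)
    then have "\<rho> \<one>\<^bsub>K\<^esub> \<odot>\<^bsub>V\<^esub> v \<in> ideal_span V P" using bspec[OF d(4) E(4)] r v by (simp add: single_def)
    then have "d \<odot>\<^bsub>V\<^esub> v \<in> ideal_span V P"
      unfolding split[OF V _ r v(1), of d, OF DiffD1[OF d(1)]]
      by (rule submodule_add[OF ideal_span_submodule[OF V P.a_subset] ideal_span_base[OF V P.a_subset d(3) v(1)]])
    then show "\<exists>d \<in> carrier R - P. d \<odot>\<^bsub>V\<^esub> v \<in> ideal_span V P" using d(1) by blast
  next
    fix m assume m: "m \<in> carrier M" "\<delta> m \<in> ideal_span N P"
    let ?y = "pure_tensor R K M \<one>\<^bsub>K\<^esub> m"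
    have "tensor_map R K N id \<delta> ?y = \<zero>\<^bsub>tensor R K N\<^esub>"
      unfolding tensor_map_pure[OF K_module M K_module N id_hom \<delta> one m(1)]
      using one_tensor_zero[OF N m(2)] by simp
    then obtain z where z: "z \<in> carrier (tensor R K V)" "?y = tensor_map R K M id \<phi> z"
      using middle[OF pure_tensor_closed[OF K_module M one m(1)]] by blast
    obtain D g where D: "finite D" "D \<subseteq> carrier K" and g: "g \<in> carrier (function_module V)"
      "\<forall>s. s \<notin> D \<longrightarrow> g s = \<zero>\<^bsub>V\<^esub>" and zg: "z = tensor_sum R K V D g"
      using tensor_sum_surj[OF K_module V z(1)] by blast
    have gc: "g s \<in> carrier V" for s using g(1) by simp
    \<comment> \<open>The element \<open>1\<close> is adjoined to make room for the coordinate of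
      \<open>1 \<otimes> m\<close>, whether or not it occurs in \<open>D\<close>.\<close>
    let ?D = "insert \<one>\<^bsub>K\<^esub> D"
    have D': "finite ?D" "?D \<subseteq> carrier K" using D by auto
    interpret T: module R "tensor R K M" by (rule tensor_module[OF K_module M])
    interpret FM: module R "function_module M" by (rule function_module[OF M])
    have \<phi>g: "(\<lambda>s. \<phi> (g s)) \<in> carrier (function_module M)" using gc module_hom_closed[OF \<phi>] by simp
    have sm: "single M \<one>\<^bsub>K\<^esub> m \<in> carrier (function_module M)" using m(1) by (simp add: single_def)
    \<comment> \<open>Coordinates of \<open>1 \<otimes> m\<close> minus the image of
      \<open>z\<close>, a tensor that vanishes.\<close>
    define f where "f = single M \<one>\<^bsub>K\<^esub> m \<ominus>\<^bsub>function_module M\<^esub> (\<lambda>s. \<phi> (g s))"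
    have f: "f = (\<lambda>s. single M \<one>\<^bsub>K\<^esub> m s \<ominus>\<^bsub>M\<^esub> \<phi> (g s))"
      unfolding f_def by (rule function_minus[OF M sm \<phi>g])
    have "tensor_sum R K M D (\<lambda>s. \<phi> (g s)) = tensor_sum R K M ?D (\<lambda>s. \<phi> (g s))"
      by (rule tensor_sum_mono[OF K_module M D'(1) _ D'(2) \<phi>g])
        (use g(2) module_hom_zero[OF V M \<phi>] in auto)
    then have "tensor_sum R K M ?D (\<lambda>s. \<phi> (g s)) = ?y"
      using z(2) tensor_map_id_sum[OF K_module V M \<phi> D g(1)] zg by simp
    then have "tensor_sum R K M ?D f = ?y \<ominus>\<^bsub>tensor R K M\<^esub> ?y"
      unfolding f_def using module_hom_minus[OF FM.module_axioms T.module_axioms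
          tensor_sum_hom[OF K_module M D'] sm \<phi>g] tensor_sum_single[OF K_module M D' _ m(1)] by simp
    also have "\<dots> = \<zero>\<^bsub>tensor R K M\<^esub>"
      using pure_tensor_closed[OF K_module M one m(1)] by (simp add: a_minus_def T.r_neg)
    finally have z0: "tensor_sum R K M ?D f = \<zero>\<^bsub>tensor R K M\<^esub>" .
    obtain E where E: "finite E" "?D \<subseteq> E" "E \<subseteq> carrier K" "f \<in> fun_span M (relations_on R K E)"
    proof (rule tensor_sum_eq_zeroE[OF K_module M D' _ _ z0])
      show "f \<in> carrier (function_module M)" unfolding f_def by (rule FM.minus_closed[OF sm \<phi>g])
      show "f s = \<zero>\<^bsub>M\<^esub>" if "s \<notin> ?D" for s
        using that g(2) module_hom_zero[OF V M \<phi>] by (simp add: f single_def a_minus_def)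
    qed
    obtain d \<rho> where d: "d \<in> carrier R - P" "\<forall>s \<in> E. \<rho> s \<in> carrier R" "d \<ominus>\<^bsub>R\<^esub> \<rho> \<one>\<^bsub>K\<^esub> \<in> P"
      "\<forall>f \<in> fun_span M (relations_on R K E). (\<Oplus>\<^bsub>M\<^esub>s\<in>E. \<rho> s \<odot>\<^bsub>M\<^esub> f s) \<in> ideal_span M P"
      by (rule exists_retracted_relation[OF M E(1,3)]) (use E(2) in auto)
    have dc: "d \<in> carrier R" using d(1) by blast
    have r: "\<rho> \<one>\<^bsub>K\<^esub> \<in> carrier R" using d(2) E(2) by blast
    \<comment> \<open>The retraction applied to the coordinates of \<open>z\<close>: it lifts
      \<open>\<rho> 1 m\<close> modulo \<open>P M\<close>.\<close>
    define u where "u = (\<Oplus>\<^bsub>V\<^esub>s\<in>E. \<rho> s \<odot>\<^bsub>V\<^esub> g s)"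
    have u: "u \<in> carrier V" unfolding u_def by (rule V.finsum_closed) (use d(2) gc in auto)
    define w where "w = (\<Oplus>\<^bsub>M\<^esub>s\<in>E. \<rho> s \<odot>\<^bsub>M\<^esub> f s)"
    have w: "w \<in> ideal_span M P" unfolding w_def by (rule bspec[OF d(4) E(4)])
    have hom: "(\<lambda>f. \<Oplus>\<^bsub>M\<^esub>s\<in>E. \<rho> s \<odot>\<^bsub>M\<^esub> f s) \<in> module_hom R (function_module M) M"
      by (rule finsum_coordinates_hom[OF M M E(1) smult_hom[OF M bspec[OF d(2)]]])
    have "(\<Oplus>\<^bsub>M\<^esub>s\<in>{\<one>\<^bsub>K\<^esub>}. \<rho> s \<odot>\<^bsub>M\<^esub> single M \<one>\<^bsub>K\<^esub> m s) = (\<Oplus>\<^bsub>M\<^esub>s\<in>E. \<rho> s \<odot>\<^bsub>M\<^esub> single M \<one>\<^bsub>K\<^esub> m s)"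
      by (rule M.add.finprod_mono_neutral_cong_left[OF E(1)]) (use d(2) E(2) m in \<open>auto simp: single_def\<close>)
    then have s1: "(\<Oplus>\<^bsub>M\<^esub>s\<in>E. \<rho> s \<odot>\<^bsub>M\<^esub> single M \<one>\<^bsub>K\<^esub> m s) = \<rho> \<one>\<^bsub>K\<^esub> \<odot>\<^bsub>M\<^esub> m"
      using r m by (simp add: single_def)
    have "\<phi> u = (\<Oplus>\<^bsub>M\<^esub>s\<in>E. \<phi> (\<rho> s \<odot>\<^bsub>V\<^esub> g s))"
      unfolding u_def by (rule module_hom_finsum[OF V M \<phi>]) (use d(2) gc in auto)
    also have "\<dots> = (\<Oplus>\<^bsub>M\<^esub>s\<in>E. \<rho> s \<odot>\<^bsub>M\<^esub> \<phi> (g s))"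
      by (rule M.finsum_cong') (use d(2) gc module_hom_closed[OF \<phi>] in \<open>auto simp: module_hom_smult[OF \<phi>]\<close>)
    finally have s2: "(\<Oplus>\<^bsub>M\<^esub>s\<in>E. \<rho> s \<odot>\<^bsub>M\<^esub> \<phi> (g s)) = \<phi> u" by simp
    have "w = \<rho> \<one>\<^bsub>K\<^esub> \<odot>\<^bsub>M\<^esub> m \<ominus>\<^bsub>M\<^esub> \<phi> u"
      unfolding w_def f_def using module_hom_minus[OF FM.module_axioms M hom sm \<phi>g] s1 s2 by simp
    then have wu: "\<rho> \<one>\<^bsub>K\<^esub> \<odot>\<^bsub>M\<^esub> m = w \<oplus>\<^bsub>M\<^esub> \<phi> u"
      using M.add_minus_cancel[of "\<rho> \<one>\<^bsub>K\<^esub> \<odot>\<^bsub>M\<^esub> m" "\<phi> u"] r m(1) module_hom_closed[OF \<phi> u] by simp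
    let ?w = "(d \<ominus>\<^bsub>R\<^esub> \<rho> \<one>\<^bsub>K\<^esub>) \<odot>\<^bsub>M\<^esub> m \<oplus>\<^bsub>M\<^esub> w"
    note sub = ideal_span_submodule[OF M P.a_subset]
    have wc: "w \<in> carrier M" by (rule submodule_carrier[OF sub w])
    have "d \<odot>\<^bsub>M\<^esub> m = \<phi> u \<oplus>\<^bsub>M\<^esub> ?w"
      unfolding split[OF M dc r m(1)] wu using dc r m(1) wc module_hom_closed[OF \<phi> u] by (simp add: M.a_ac)
    moreover have "?w \<in> ideal_span M P"
      by (intro submodule_add[OF sub _ w] ideal_span_base[OF M P.a_subset] d(3) m(1))
    ultimately show "\<exists>d \<in> carrier R - P. \<exists>v \<in> carrier V. \<exists>w \<in> ideal_span M P. d \<odot>\<^bsub>M\<^esub> m = \<phi> v \<oplus>\<^bsub>M\<^esub> w"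
      using d(1) u by blast
  qed
qed

section \<open>Base change of coactions and of their invariants\<close>

section \<open>Base change\<close>

text \<open>The base changes of \<open>C\<close> as a module and as an algebra differ only in
  \<open>mult\<close> and \<open>one\<close>, which the module axioms do not see.\<close>

lemma module_cong:
  assumes "module R M" "carrier M' = carrier M" "add M' = add M" "\<zero>\<^bsub>M'\<^esub> = \<zero>\<^bsub>M\<^esub>" "smult M' = smult M"
  shows "module R M'"
proof -
  interpret M: module R M by fact
  show ?thesis
  proof (rule moduleI)
    show "cring R" by (rule module_cring[OF assms(1)])
    show "abelian_group M'" by (rule abelian_groupI) (auto simp: assms(2-4) M.a_ac intro: M.l_neg)
  qed (auto simp: assms(2-5) M.smult_l_distr M.smult_r_distr M.smult_assoc1)
qed

text \<open>The source \<open>L'\<close> is a separate record, because \<open>S \<otimes> M\<close>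
  carries an \<open>R\<close>-action of its own that agrees with the restricted one only after a
  proof.\<close>

lemma restrict_scalars_hom:
  assumes "g \<in> module_hom S L N" "algebra R S"
    and "carrier L' = carrier L" "add L' = add L"
    and "\<And>r x. r \<in> carrier R \<Longrightarrow> x \<in> carrier L \<Longrightarrow> r \<odot>\<^bsub>L'\<^esub> x = (r \<odot>\<^bsub>S\<^esub> \<one>\<^bsub>S\<^esub>) \<odot>\<^bsub>L\<^esub> x"
  shows "g \<in> module_hom R L' (restrict_scalars S N)"
proof -
  interpret S: algebra R S by fact
  show ?thesis
    by (rule module_homI)
      (simp_all add: assms(3-5) module_hom_closed[OF assms(1)] module_hom_add[OF assms(1)]
        module_hom_smult[OF assms(1)])
qed

context
  fixes R :: "('r, 'x) ring_scheme" and S :: "('r, 's) module"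
  assumes S: "algebra R S"
begin

interpretation S: algebra R S by (fact S)

lemma algebra_module: "module R S" by (rule algebra.module[OF S])

lemma algebra_mult_hom: "s \<in> carrier S \<Longrightarrow> (\<lambda>t. s \<otimes>\<^bsub>S\<^esub> t) \<in> module_hom R S S"
  by (rule module_homI) (simp_all add: S.r_distr S.smult_assoc2 S.m_comm[of s])

context
  fixes L :: "('r, 'l) module"
  assumes L: "module R L"
begin

interpretation L: module R L by (fact L)

private abbreviation (input) "BL \<equiv> tensor R S L"

lemma base_tensor_module: "module R BL" by (rule tensor_module[OF algebra_module L])

interpretation T: module R BL by (fact base_tensor_module)

lemma base_smult_hom: "s \<in> carrier S \<Longrightarrow> base_change_smult R S L s \<in> module_hom R BL BL"
  unfolding base_change_smult_def
  by (rule tensor_map_hom[OF algebra_module L algebra_module L algebra_mult_hom id_hom])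

lemma base_smult_pure:
  "s \<in> carrier S \<Longrightarrow> t \<in> carrier S \<Longrightarrow> x \<in> carrier L \<Longrightarrow>
    base_change_smult R S L s (pure_tensor R S L t x) = pure_tensor R S L (s \<otimes>\<^bsub>S\<^esub> t) x"
  unfolding base_change_smult_def
  by (simp add: tensor_map_pure[OF algebra_module L algebra_module L algebra_mult_hom id_hom])

lemma base_hom_ext:
  "g \<in> module_hom R BL P \<Longrightarrow> h \<in> module_hom R BL P \<Longrightarrow> module R P \<Longrightarrow>
    (\<And>t x. t \<in> carrier S \<Longrightarrow> x \<in> carrier L \<Longrightarrow> g (pure_tensor R S L t x) = h (pure_tensor R S L t x)) \<Longrightarrow>
    y \<in> carrier BL \<Longrightarrow> g y = h y"
  using tensor_hom_ext[OF algebra_module L] .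

text \<open>On pure tensors this is \<open>(r 1) t = r t\<close> in \<open>S\<close>. The
  \<open>R\<close>-action of the tensor product thus agrees with the one through \<open>S\<close>,
  which permits passing between linearity over \<open>R\<close> and over \<open>S\<close>.\<close>

lemma base_smult_scalar:
  assumes "r \<in> carrier R" "y \<in> carrier BL"
  shows "base_change_smult R S L (r \<odot>\<^bsub>S\<^esub> \<one>\<^bsub>S\<^esub>) y = r \<odot>\<^bsub>BL\<^esub> y"
  by (rule base_hom_ext[OF base_smult_hom smult_hom[OF base_tensor_module] base_tensor_module _ assms(2)])
    (use assms(1) in \<open>auto simp: base_smult_pure S.smult_assoc2 module_hom_smult[OF pure_hom_left[OF algebra_module L]]\<close>)

lemma base_change_simps [simp]:
  "carrier (base_change R S L) = carrier BL" "add (base_change R S L) = add BL"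
  "\<zero>\<^bsub>base_change R S L\<^esub> = \<zero>\<^bsub>BL\<^esub>" "smult (base_change R S L) = base_change_smult R S L"
  unfolding base_change_def by simp_all

text \<open>Distributivity and associativity in the scalars, and the unit law, equate two
  \<open>R\<close>-linear maps in \<open>x\<close>, so they are checked on pure tensors.\<close>

lemma base_change_module: "module S (base_change R S L)"
proof (rule moduleI)
  show "cring S" by (rule S.M_cring)
  show "abelian_group (base_change R S L)"
    unfolding base_change_def by (rule abelian_group_with_smult[OF module_abelian_group[OF base_tensor_module]])
next
  fix a x assume "a \<in> carrier S" "x \<in> carrier (base_change R S L)"
  then show "a \<odot>\<^bsub>base_change R S L\<^esub> x \<in> carrier (base_change R S L)"
    using module_hom_closed[OF base_smult_hom] by simp
next
  fix a b x assume ab: "a \<in> carrier S" "b \<in> carrier S" and x: "x \<in> carrier (base_change R S L)"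
  have "base_change_smult R S L (a \<oplus>\<^bsub>S\<^esub> b) x = base_change_smult R S L a x \<oplus>\<^bsub>BL\<^esub> base_change_smult R S L b x"
    by (rule base_hom_ext[OF base_smult_hom module_hom_plus[OF base_tensor_module base_smult_hom base_smult_hom] base_tensor_module])
      (use ab x in \<open>auto simp: base_smult_pure S.l_distr module_hom_add[OF pure_hom_left[OF algebra_module L]]\<close>)
  then show "(a \<oplus>\<^bsub>S\<^esub> b) \<odot>\<^bsub>base_change R S L\<^esub> x =
      a \<odot>\<^bsub>base_change R S L\<^esub> x \<oplus>\<^bsub>base_change R S L\<^esub> b \<odot>\<^bsub>base_change R S L\<^esub> x" by simp
  have "base_change_smult R S L (a \<otimes>\<^bsub>S\<^esub> b) x = base_change_smult R S L a (base_change_smult R S L b x)"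
    by (rule base_hom_ext[OF base_smult_hom module_hom_comp[OF base_smult_hom base_smult_hom] base_tensor_module])
      (use ab x in \<open>auto simp: base_smult_pure S.m_assoc\<close>)
  then show "(a \<otimes>\<^bsub>S\<^esub> b) \<odot>\<^bsub>base_change R S L\<^esub> x = a \<odot>\<^bsub>base_change R S L\<^esub> (b \<odot>\<^bsub>base_change R S L\<^esub> x)"
    by simp
next
  fix a x y assume "a \<in> carrier S" "x \<in> carrier (base_change R S L)" "y \<in> carrier (base_change R S L)"
  then show "a \<odot>\<^bsub>base_change R S L\<^esub> (x \<oplus>\<^bsub>base_change R S L\<^esub> y) =
      a \<odot>\<^bsub>base_change R S L\<^esub> x \<oplus>\<^bsub>base_change R S L\<^esub> a \<odot>\<^bsub>base_change R S L\<^esub> y"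
    by (simp add: module_hom_add[OF base_smult_hom])
next
  fix x assume x: "x \<in> carrier (base_change R S L)"
  have "base_change_smult R S L \<one>\<^bsub>S\<^esub> x = x"
    by (rule base_hom_ext[OF base_smult_hom module_hom_id base_tensor_module])
      (use x in \<open>auto simp: base_smult_pure\<close>)
  then show "\<one>\<^bsub>S\<^esub> \<odot>\<^bsub>base_change R S L\<^esub> x = x" by simp
qed

end

lemma tensor_map_base_smult:
  assumes "module R L" "module R L'" "h \<in> module_hom R L L'" "s \<in> carrier S" "y \<in> carrier (tensor R S L)"
  shows "tensor_map R S L' id h (base_change_smult R S L s y) =
    base_change_smult R S L' s (tensor_map R S L' id h y)"
proof -
  note tm = tensor_map_hom[OF algebra_module assms(1) algebra_module assms(2) id_hom assms(3)]
  note tp = tensor_map_pure[OF algebra_module assms(1) algebra_module assms(2) id_hom assms(3)]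
  show ?thesis
    by (rule base_hom_ext[OF assms(1) module_hom_comp[OF tm base_smult_hom[OF assms(1,4)]]
          module_hom_comp[OF base_smult_hom[OF assms(2,4)] tm] base_tensor_module[OF assms(2)] _ assms(5)])
      (use assms(4) module_hom_closed[OF assms(3)] in \<open>simp add: base_smult_pure assms(1,2) tp\<close>)
qed

context
  fixes M :: "('r, 'm) module" and C :: "('r, 'c) module"
  assumes M: "module R M" and C: "algebra R C"
begin

interpretation M: module R M by (fact M)
interpretation C: algebra R C by (fact C)

private abbreviation (input) "N \<equiv> tensor R M C"
private abbreviation (input) "SM \<equiv> base_change R S M"
private abbreviation (input) "SC \<equiv> base_change_algebra R S C"
private abbreviation (input) "SN \<equiv> base_change R S N"
private abbreviation (input) "Q \<equiv> tensor S SM SC"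
private abbreviation (input) "P \<equiv> restrict_scalars S Q"

lemma coordinate_module: "module R C" by (rule algebra.module[OF C])

lemma coaction_target_module: "module R N" by (rule tensor_module[OF M coordinate_module])

lemma base_change_left_module: "module S SM" by (rule base_change_module[OF M])

lemma base_algebra_simps [simp]:
  "carrier SC = carrier (tensor R S C)" "add SC = add (tensor R S C)"
  "\<zero>\<^bsub>SC\<^esub> = \<zero>\<^bsub>tensor R S C\<^esub>" "smult SC = base_change_smult R S C"
  "\<one>\<^bsub>SC\<^esub> = pure_tensor R S C \<one>\<^bsub>S\<^esub> \<one>\<^bsub>C\<^esub>"
  unfolding base_change_algebra_def tensor_algebra_def by simp_all

lemma base_change_algebra_module: "module S SC"
  by (rule module_cong[OF base_change_module[OF coordinate_module]]) (simp_all add: coordinate_module)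

lemma base_change_tensor_module: "module S Q" by (rule tensor_module[OF base_change_left_module base_change_algebra_module])

lemma restricted_tensor_module: "module R P" by (rule module_restrict_scalars[OF S base_change_tensor_module])

interpretation P: module R P by (fact restricted_tensor_module)
interpretation SN: module S SN by (rule base_change_module[OF coaction_target_module])

lemma outer_hom_left:
  "w \<in> carrier (tensor R S C) \<Longrightarrow> (\<lambda>u. pure_tensor S SM SC u w) \<in> module_hom R (tensor R S M) P"
  by (rule restrict_scalars_hom[OF pure_hom_left[OF base_change_left_module base_change_algebra_module] S])
    (simp_all add: M base_smult_scalar)

lemma outer_hom_right:
  "u \<in> carrier (tensor R S M) \<Longrightarrow> pure_tensor S SM SC u \<in> module_hom R (tensor R S C) P"
  by (rule restrict_scalars_hom[OF pure_hom_right[OF base_change_left_module base_change_algebra_module] S])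
    (simp_all add: M coordinate_module base_smult_scalar)

lemma distrib_trilinear:
  "trilinear R S M C P (\<lambda>s m c. pure_tensor S SM SC (pure_tensor R S M s m) (pure_tensor R S C \<one>\<^bsub>S\<^esub> c))"
  unfolding trilinear_def
proof (intro conjI ballI)
  note cM = pure_tensor_closed[OF algebra_module M] and cC = pure_tensor_closed[OF algebra_module coordinate_module S.one_closed]
  fix s m assume "s \<in> carrier S" "m \<in> carrier M"
  then show "(\<lambda>c. pure_tensor S SM SC (pure_tensor R S M s m) (pure_tensor R S C \<one>\<^bsub>S\<^esub> c)) \<in> module_hom R C P"
    by (intro module_hom_comp[OF outer_hom_right pure_hom_right[OF algebra_module coordinate_module]] cM) auto
next
  note cC = pure_tensor_closed[OF algebra_module coordinate_module S.one_closed]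
  fix s c assume "s \<in> carrier S" "c \<in> carrier C"
  then show "(\<lambda>m. pure_tensor S SM SC (pure_tensor R S M s m) (pure_tensor R S C \<one>\<^bsub>S\<^esub> c)) \<in> module_hom R M P"
    by (intro module_hom_comp[OF outer_hom_left pure_hom_right[OF algebra_module M]] cC)
next
  note cC = pure_tensor_closed[OF algebra_module coordinate_module S.one_closed]
  fix m c assume "m \<in> carrier M" "c \<in> carrier C"
  then show "(\<lambda>s. pure_tensor S SM SC (pure_tensor R S M s m) (pure_tensor R S C \<one>\<^bsub>S\<^esub> c)) \<in> module_hom R S P"
    by (intro module_hom_comp[OF outer_hom_left pure_hom_left[OF algebra_module M]] cC)
qed

lemma distrib_hom: "base_change_distrib R S M C \<in> module_hom R (tensor R S N) P"
  unfolding base_change_distrib_def Let_def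
  by (rule tensor_lift_hom[OF algebra_module coaction_target_module restricted_tensor_module
        nested_lift_right[OF algebra_module M coordinate_module restricted_tensor_module distrib_trilinear]])

lemma distrib_pure:
  assumes "s \<in> carrier S" "m \<in> carrier M" "c \<in> carrier C"
  shows "base_change_distrib R S M C (pure_tensor R S N s (pure_tensor R M C m c)) =
    pure_tensor S SM SC (pure_tensor R S M s m) (pure_tensor R S C \<one>\<^bsub>S\<^esub> c)"
  unfolding base_change_distrib_def Let_def
  using assms pure_tensor_closed[OF M coordinate_module]
  by (simp add: tensor_lift_pure[OF algebra_module coaction_target_module restricted_tensor_module
        nested_lift_right[OF algebra_module M coordinate_module restricted_tensor_module distrib_trilinear]]
      tensor_lift_pure[OF M coordinate_module restricted_tensor_module trilinear_bilinear_right[OF algebra_module M coordinate_module restricted_tensor_module distrib_trilinear]])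

text \<open>The inverse of \<open>S \<otimes> (M \<otimes> C) \<rightarrow> (S \<otimes> M) \<otimes> (S \<otimes> C)\<close>:
  \<open>(s \<otimes> m) \<otimes> (s' \<otimes> c) \<mapsto> s' \<cdot> (s \<otimes> (m \<otimes> c))\<close>.\<close>

private abbreviation (input) "act \<equiv>
  (\<lambda>u c. tensor_lift R (tensor R S N) (\<lambda>s m. pure_tensor R S N s (pure_tensor R M C m c)) u)"

private abbreviation (input) "undistrib \<equiv>
  (\<lambda>u w. tensor_lift R (tensor R S N) (\<lambda>s' c. base_change_smult R S N s' (act u c)) w)"

lemma base_coaction_target_module: "module R (tensor R S N)" by (rule base_tensor_module[OF coaction_target_module])

lemma act_trilinear:
  "trilinear R S M C (tensor R S N) (\<lambda>s m c. pure_tensor R S N s (pure_tensor R M C m c))"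
  unfolding trilinear_def
  by (intro conjI ballI module_hom_comp[OF pure_hom_right[OF algebra_module coaction_target_module] pure_hom_right[OF M coordinate_module]]
      module_hom_comp[OF pure_hom_right[OF algebra_module coaction_target_module] pure_hom_left[OF M coordinate_module]]
      pure_hom_left[OF algebra_module coaction_target_module] pure_tensor_closed[OF M coordinate_module])

lemma act_bilinear: "bilinear R (tensor R S M) C (tensor R S N) act"
  by (rule nested_lift_left[OF algebra_module M coordinate_module base_coaction_target_module act_trilinear])

lemma act_left: "c \<in> carrier C \<Longrightarrow> (\<lambda>u. act u c) \<in> module_hom R (tensor R S M) (tensor R S N)"
  and act_right: "u \<in> carrier (tensor R S M) \<Longrightarrow> act u \<in> module_hom R C (tensor R S N)"
  using act_bilinear unfolding bilinear_def by blast+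

lemma act_pure:
  "s \<in> carrier S \<Longrightarrow> m \<in> carrier M \<Longrightarrow> c \<in> carrier C \<Longrightarrow>
    act (pure_tensor R S M s m) c = pure_tensor R S N s (pure_tensor R M C m c)"
  by (rule tensor_lift_pure[OF algebra_module M base_coaction_target_module trilinear_bilinear_left[OF algebra_module M coordinate_module base_coaction_target_module act_trilinear]])

lemma act_smult:
  assumes "s \<in> carrier S" "u \<in> carrier (tensor R S M)" "c \<in> carrier C"
  shows "act (base_change_smult R S M s u) c = base_change_smult R S N s (act u c)"
  by (rule base_hom_ext[OF M module_hom_comp[OF act_left base_smult_hom[OF M]]
        module_hom_comp[OF base_smult_hom[OF coaction_target_module] act_left] base_coaction_target_module _ assms(2)])
    (use assms(1,3) in \<open>simp_all add: base_smult_pure M coaction_target_module act_pure pure_tensor_closed[OF M coordinate_module]\<close>)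

lemma undistrib_trilinear:
  "trilinear R (tensor R S M) S C (tensor R S N) (\<lambda>u s' c. base_change_smult R S N s' (act u c))"
  unfolding trilinear_def
proof (intro conjI ballI)
  fix u s' assume "u \<in> carrier (tensor R S M)" "s' \<in> carrier S"
  then show "(\<lambda>c. base_change_smult R S N s' (act u c)) \<in> module_hom R C (tensor R S N)"
    by (intro module_hom_comp[OF base_smult_hom[OF coaction_target_module] act_right])
next
  fix u c assume "u \<in> carrier (tensor R S M)" "c \<in> carrier C"
  then have a: "act u c \<in> carrier (tensor R S N)" by (rule module_hom_closed[OF act_right])
  show "(\<lambda>s'. base_change_smult R S N s' (act u c)) \<in> module_hom R S (tensor R S N)"
  proof (rule module_homI)
    fix s t assume "s \<in> carrier S" "t \<in> carrier S"
    then show "base_change_smult R S N (s \<oplus>\<^bsub>S\<^esub> t) (act u c) =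
        base_change_smult R S N s (act u c) \<oplus>\<^bsub>tensor R S N\<^esub> base_change_smult R S N t (act u c)"
      using SN.smult_l_distr[of s t "act u c"] a by (simp add: coaction_target_module)
  next
    fix r s assume r: "r \<in> carrier R" and s: "s \<in> carrier S"
    have "r \<odot>\<^bsub>S\<^esub> s = (r \<odot>\<^bsub>S\<^esub> \<one>\<^bsub>S\<^esub>) \<otimes>\<^bsub>S\<^esub> s" using r s by (simp add: S.smult_assoc2)
    then have "base_change_smult R S N (r \<odot>\<^bsub>S\<^esub> s) (act u c) =
        base_change_smult R S N (r \<odot>\<^bsub>S\<^esub> \<one>\<^bsub>S\<^esub>) (base_change_smult R S N s (act u c))"
      using SN.smult_assoc1[of "r \<odot>\<^bsub>S\<^esub> \<one>\<^bsub>S\<^esub>" s "act u c"] a r s by (simp add: coaction_target_module)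
    then show "base_change_smult R S N (r \<odot>\<^bsub>S\<^esub> s) (act u c) =
        r \<odot>\<^bsub>tensor R S N\<^esub> base_change_smult R S N s (act u c)"
      using r module_hom_closed[OF base_smult_hom[OF coaction_target_module s] a] by (simp add: base_smult_scalar coaction_target_module)
  qed (rule module_hom_closed[OF base_smult_hom[OF coaction_target_module] a])
next
  fix s' c assume "s' \<in> carrier S" "c \<in> carrier C"
  then show "(\<lambda>u. base_change_smult R S N s' (act u c)) \<in> module_hom R (tensor R S M) (tensor R S N)"
    by (intro module_hom_comp[OF base_smult_hom[OF coaction_target_module] act_left])
qed

lemma undistrib_bilinear_restricted:
  "bilinear R (tensor R S M) (tensor R S C) (tensor R S N) undistrib"
  by (rule nested_lift_right[OF base_tensor_module[OF M] algebra_module coordinate_module base_coaction_target_module undistrib_trilinear])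

lemma undistrib_left: "w \<in> carrier (tensor R S C) \<Longrightarrow>
    (\<lambda>u. undistrib u w) \<in> module_hom R (tensor R S M) (tensor R S N)"
  and undistrib_right: "u \<in> carrier (tensor R S M) \<Longrightarrow>
    undistrib u \<in> module_hom R (tensor R S C) (tensor R S N)"
  using undistrib_bilinear_restricted unfolding bilinear_def by blast+

lemma undistrib_pure:
  "u \<in> carrier (tensor R S M) \<Longrightarrow> s' \<in> carrier S \<Longrightarrow> c \<in> carrier C \<Longrightarrow>
    undistrib u (pure_tensor R S C s' c) = base_change_smult R S N s' (act u c)"
  by (rule tensor_lift_pure[OF algebra_module coordinate_module base_coaction_target_module
        trilinear_bilinear_right[OF base_tensor_module[OF M] algebra_module coordinate_module base_coaction_target_module undistrib_trilinear]])

text \<open>Additivity is inherited from bilinearity over \<open>R\<close>. What remains is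
  homogeneity over \<open>S\<close>, an identity of \<open>R\<close>-linear maps in
  \<open>w\<close>, which on pure tensors comes down to associativity and commutativity of the
  scalars.\<close>

lemma undistrib_bilinear: "bilinear S SM SC SN undistrib"
proof (rule bilinearI)
  fix u assume "u \<in> carrier SM"
  then have u: "u \<in> carrier (tensor R S M)" by (simp add: M)
  show "undistrib u \<in> module_hom S SC SN"
  proof (rule module_homI)
    fix s w assume s: "s \<in> carrier S" and "w \<in> carrier SC"
    then have w: "w \<in> carrier (tensor R S C)" by simp
    have "undistrib u (base_change_smult R S C s w) = base_change_smult R S N s (undistrib u w)"
    proof (rule base_hom_ext[OF coordinate_module module_hom_comp[OF undistrib_right[OF u] base_smult_hom[OF coordinate_module s]]
          module_hom_comp[OF base_smult_hom[OF coaction_target_module s] undistrib_right[OF u]] base_coaction_target_module _ w])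
      fix t c assume tc: "t \<in> carrier S" "c \<in> carrier C"
      have a: "act u c \<in> carrier (tensor R S N)" by (rule module_hom_closed[OF act_right[OF u] tc(2)])
      have "base_change_smult R S N (s \<otimes>\<^bsub>S\<^esub> t) (act u c) =
          base_change_smult R S N s (base_change_smult R S N t (act u c))"
        using SN.smult_assoc1[of s t "act u c"] a s tc by (simp add: coaction_target_module)
      then show "undistrib u (base_change_smult R S C s (pure_tensor R S C t c)) =
          base_change_smult R S N s (undistrib u (pure_tensor R S C t c))"
        using s tc u by (simp add: base_smult_pure coordinate_module undistrib_pure)
    qed
    then show "undistrib u (s \<odot>\<^bsub>SC\<^esub> w) = s \<odot>\<^bsub>SN\<^esub> undistrib u w" by (simp add: coaction_target_module)
  qed (use u module_hom_closed[OF undistrib_right[OF u]] module_hom_add[OF undistrib_right[OF u]] in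
      \<open>simp_all add: coaction_target_module\<close>)
next
  fix w assume "w \<in> carrier SC"
  then have w: "w \<in> carrier (tensor R S C)" by simp
  show "(\<lambda>u. undistrib u w) \<in> module_hom S SM SN"
  proof (rule module_homI)
    fix s u assume s: "s \<in> carrier S" and "u \<in> carrier SM"
    then have u: "u \<in> carrier (tensor R S M)" by (simp add: M)
    have su: "base_change_smult R S M s u \<in> carrier (tensor R S M)"
      by (rule module_hom_closed[OF base_smult_hom[OF M s] u])
    have "undistrib (base_change_smult R S M s u) w = base_change_smult R S N s (undistrib u w)"
    proof (rule base_hom_ext[OF coordinate_module undistrib_right[OF su]
          module_hom_comp[OF base_smult_hom[OF coaction_target_module s] undistrib_right[OF u]] base_coaction_target_module _ w])
      fix t c assume tc: "t \<in> carrier S" "c \<in> carrier C"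
      have a: "act u c \<in> carrier (tensor R S N)" by (rule module_hom_closed[OF act_right[OF u] tc(2)])
      have "base_change_smult R S N t (base_change_smult R S N s (act u c)) =
          base_change_smult R S N s (base_change_smult R S N t (act u c))"
        using SN.smult_assoc1[of s t "act u c"] SN.smult_assoc1[of t s "act u c"] a s tc
        by (simp add: coaction_target_module S.m_comm)
      then show "undistrib (base_change_smult R S M s u) (pure_tensor R S C t c) =
          base_change_smult R S N s (undistrib u (pure_tensor R S C t c))"
        using s tc u su by (simp add: undistrib_pure act_smult)
    qed
    then show "undistrib (s \<odot>\<^bsub>SM\<^esub> u) w = s \<odot>\<^bsub>SN\<^esub> undistrib u w" by (simp add: coaction_target_module M)
  qed (use w module_hom_closed[OF undistrib_left[OF w]] module_hom_add[OF undistrib_left[OF w]] in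
      \<open>simp_all add: coaction_target_module M\<close>)
qed

text \<open>A left inverse makes \<open>base_change_distrib\<close> injective, which is what the
  comparison of invariants rests on. The identity is tested on \<open>s \<otimes> n\<close> and
  then, for fixed \<open>s\<close>, on \<open>n = m \<otimes> c\<close>.\<close>

lemma distrib_left_inverse:
  assumes "y \<in> carrier (tensor R S N)"
  shows "tensor_lift S SN undistrib (base_change_distrib R S M C y) = y"
proof -
  let ?\<theta> = "tensor_lift S SN undistrib"
  have \<theta>: "?\<theta> \<in> module_hom S Q SN"
    by (rule tensor_lift_hom[OF base_change_left_module base_change_algebra_module SN.module_axioms undistrib_bilinear])
  \<comment> \<open>The comparison on pure tensors takes place over \<open>R\<close>, so the
    \<open>S\<close>-linear map is viewed as \<open>R\<close>-linear through the scalars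
    \<open>r 1\<close>.\<close>
  have "?\<theta> \<in> module_hom R P (tensor R S N)"
  proof (rule module_homI)
    fix r x assume r: "r \<in> carrier R" and x: "x \<in> carrier P"
    have "?\<theta> ((r \<odot>\<^bsub>S\<^esub> \<one>\<^bsub>S\<^esub>) \<odot>\<^bsub>Q\<^esub> x) = (r \<odot>\<^bsub>S\<^esub> \<one>\<^bsub>S\<^esub>) \<odot>\<^bsub>SN\<^esub> ?\<theta> x"
      by (rule module_hom_smult[OF \<theta>]) (use r x in auto)
    also have "\<dots> = r \<odot>\<^bsub>tensor R S N\<^esub> ?\<theta> x"
      using module_hom_closed[OF \<theta>, of x] x r by (simp add: coaction_target_module base_smult_scalar)
    finally show "?\<theta> (r \<odot>\<^bsub>P\<^esub> x) = r \<odot>\<^bsub>tensor R S N\<^esub> ?\<theta> x" by simp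
  qed (use module_hom_closed[OF \<theta>] module_hom_add[OF \<theta>] in \<open>simp_all add: coaction_target_module\<close>)
  note hom = module_hom_comp[OF this distrib_hom]
  show ?thesis
  proof (rule base_hom_ext[OF coaction_target_module hom module_hom_id base_coaction_target_module _ assms])
    fix s n assume s: "s \<in> carrier S" and n: "n \<in> carrier N"
    show "?\<theta> (base_change_distrib R S M C (pure_tensor R S N s n)) = pure_tensor R S N s n"
    proof (rule tensor_hom_ext[OF M coordinate_module base_coaction_target_module module_hom_comp[OF hom pure_hom_right[OF algebra_module coaction_target_module s]]
          pure_hom_right[OF algebra_module coaction_target_module s] _ n])
      fix m c assume mc: "m \<in> carrier M" "c \<in> carrier C"
      have sm: "pure_tensor R S M s m \<in> carrier (tensor R S M)"
        by (rule pure_tensor_closed[OF algebra_module M s mc(1)])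
      have a: "act (pure_tensor R S M s m) c \<in> carrier (tensor R S N)"
        by (rule module_hom_closed[OF act_right[OF sm] mc(2)])
      have "?\<theta> (base_change_distrib R S M C (pure_tensor R S N s (pure_tensor R M C m c))) =
          undistrib (pure_tensor R S M s m) (pure_tensor R S C \<one>\<^bsub>S\<^esub> c)"
        unfolding distrib_pure[OF s mc]
        by (rule tensor_lift_pure[OF base_change_left_module base_change_algebra_module SN.module_axioms undistrib_bilinear])
          (use sm mc pure_tensor_closed[OF algebra_module coordinate_module] in \<open>auto simp: M\<close>)
      also have "\<dots> = act (pure_tensor R S M s m) c"
        using sm mc a SN.smult_one[of "act (pure_tensor R S M s m) c"] by (simp add: undistrib_pure coaction_target_module)
      also have "\<dots> = pure_tensor R S N s (pure_tensor R M C m c)" by (rule act_pure[OF s mc])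
      finally show "?\<theta> (base_change_distrib R S M C (pure_tensor R S N s (pure_tensor R M C m c))) =
          pure_tensor R S N s (pure_tensor R M C m c)" .
    qed
  qed
qed

lemma unit_hom: "(\<lambda>m. pure_tensor R M C m \<one>\<^bsub>C\<^esub>) \<in> module_hom R M N"
  by (rule pure_hom_left[OF M coordinate_module C.one_closed])

lemma distrib_unit:
  assumes "y \<in> carrier (tensor R S M)"
  shows "base_change_distrib R S M C (tensor_map R S N id (\<lambda>m. pure_tensor R M C m \<one>\<^bsub>C\<^esub>) y) =
    pure_tensor S SM SC y \<one>\<^bsub>SC\<^esub>"
proof (rule base_hom_ext[OF M module_hom_comp[OF distrib_hom
        tensor_map_hom[OF algebra_module M algebra_module coaction_target_module id_hom unit_hom]] outer_hom_left restricted_tensor_module _ assms])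
  show "\<one>\<^bsub>SC\<^esub> \<in> carrier (tensor R S C)" using pure_tensor_closed[OF algebra_module coordinate_module] by simp
  fix s m assume "s \<in> carrier S" "m \<in> carrier M"
  then show "base_change_distrib R S M C (tensor_map R S N id (\<lambda>m. pure_tensor R M C m \<one>\<^bsub>C\<^esub>) (pure_tensor R S M s m)) =
      pure_tensor S SM SC (pure_tensor R S M s m) \<one>\<^bsub>SC\<^esub>"
    by (simp add: tensor_map_pure[OF algebra_module M algebra_module coaction_target_module id_hom unit_hom] distrib_pure)
qed

text \<open>Both sides of the invariance condition are values of the injective map
  \<open>base_change_distrib\<close>, at the images of \<open>y\<close> under the base changes of
  \<open>\<omega>\<close> and of \<open>m \<mapsto> m \<otimes> 1\<close>.\<close>

lemma base_change_invariant_iff: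
  assumes \<omega>: "\<omega> \<in> module_hom R M N" and y: "y \<in> carrier (tensor R S M)"
  shows "base_change_coaction R S M C \<omega> y = pure_tensor S SM SC y \<one>\<^bsub>SC\<^esub> \<longleftrightarrow>
    tensor_map R S N id (\<lambda>m. \<omega> m \<ominus>\<^bsub>N\<^esub> pure_tensor R M C m \<one>\<^bsub>C\<^esub>) y = \<zero>\<^bsub>tensor R S N\<^esub>"
proof -
  interpret T: module R "tensor R S N" by (rule base_coaction_target_module)
  interpret N: module R N by (rule coaction_target_module)
  let ?\<eta> = "\<lambda>m. pure_tensor R M C m \<one>\<^bsub>C\<^esub>"
  let ?\<delta> = "\<lambda>m. \<omega> m \<ominus>\<^bsub>N\<^esub> ?\<eta> m"
  have \<delta>: "?\<delta> \<in> module_hom R M N" by (rule module_hom_diff[OF coaction_target_module \<omega> unit_hom])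
  note tm = tensor_map_hom[OF algebra_module M algebra_module coaction_target_module id_hom]
  note tp = tensor_map_pure[OF algebra_module M algebra_module coaction_target_module id_hom]
  have a: "tensor_map R S N id \<omega> y \<in> carrier (tensor R S N)" "tensor_map R S N id ?\<eta> y \<in> carrier (tensor R S N)"
    using module_hom_closed[OF tm[OF \<omega>] y] module_hom_closed[OF tm[OF unit_hom] y] by auto
  have "base_change_coaction R S M C \<omega> y = pure_tensor S SM SC y \<one>\<^bsub>SC\<^esub> \<longleftrightarrow>
      base_change_distrib R S M C (tensor_map R S N id \<omega> y) = base_change_distrib R S M C (tensor_map R S N id ?\<eta> y)"
    unfolding distrib_unit[OF y] base_change_coaction_def by simp
  also have "\<dots> \<longleftrightarrow> tensor_map R S N id \<omega> y = tensor_map R S N id ?\<eta> y"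
    using distrib_left_inverse a by metis
  also have "\<dots> \<longleftrightarrow> tensor_map R S N id \<omega> y \<ominus>\<^bsub>tensor R S N\<^esub> tensor_map R S N id ?\<eta> y = \<zero>\<^bsub>tensor R S N\<^esub>"
    using a by (simp add: T.minus_eq_zero_iff)
  also have "tensor_map R S N id \<omega> y \<ominus>\<^bsub>tensor R S N\<^esub> tensor_map R S N id ?\<eta> y = tensor_map R S N id ?\<delta> y"
    by (rule base_hom_ext[OF M module_hom_diff[OF base_coaction_target_module tm[OF \<omega>] tm[OF unit_hom]] tm[OF \<delta>] base_coaction_target_module _ y])
      (simp add: tp[OF \<omega>] tp[OF unit_hom] tp[OF \<delta>] module_hom_closed[OF \<omega>] module_hom_closed[OF unit_hom]
        module_hom_minus[OF coaction_target_module base_coaction_target_module pure_hom_right[OF algebra_module coaction_target_module]])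
  finally show ?thesis .
qed

text \<open>Since invariants are the kernel of the base-changed difference map, bijectivity splits
  into a trivial kernel and the lifting of invariants; that images are invariant follows from
  \<open>inv\<close> on pure tensors.\<close>

lemma base_change_iso_iff:
  assumes \<omega>: "\<omega> \<in> module_hom R M N" and V: "module R V" and \<phi>: "\<phi> \<in> module_hom R V M"
    and inv: "\<And>v. v \<in> carrier V \<Longrightarrow> \<omega> (\<phi> v) = pure_tensor R M C (\<phi> v) \<one>\<^bsub>C\<^esub>"
  shows "base_change_map R S M \<phi> \<in> module_iso S (base_change R S V) (base_change_invariants R S C M \<omega>) \<longleftrightarrow>
    (\<forall>y \<in> carrier (tensor R S V). tensor_map R S M id \<phi> y = \<zero>\<^bsub>tensor R S M\<^esub> \<longrightarrow> y = \<zero>\<^bsub>tensor R S V\<^esub>) \<and>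
    (\<forall>y \<in> carrier (tensor R S M).
      tensor_map R S N id (\<lambda>m. \<omega> m \<ominus>\<^bsub>N\<^esub> pure_tensor R M C m \<one>\<^bsub>C\<^esub>) y = \<zero>\<^bsub>tensor R S N\<^esub> \<longrightarrow>
      (\<exists>z \<in> carrier (tensor R S V). y = tensor_map R S M id \<phi> z))"
    (is "?h \<in> module_iso S ?SV ?I \<longleftrightarrow> ?inj \<and> ?surj")
proof -
  let ?\<delta> = "\<lambda>m. \<omega> m \<ominus>\<^bsub>N\<^esub> pure_tensor R M C m \<one>\<^bsub>C\<^esub>"
  interpret N: module R N by (rule coaction_target_module)
  interpret TV: module R "tensor R S V" by (rule base_tensor_module[OF V])
  interpret TN: module R "tensor R S N" by (rule base_coaction_target_module)
  have TM: "module R (tensor R S M)" by (rule base_tensor_module[OF M])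
  have h: "?h = tensor_map R S M id \<phi>" unfolding base_change_map_def ..
  have \<delta>: "?\<delta> \<in> module_hom R M N" by (rule module_hom_diff[OF coaction_target_module \<omega> unit_hom])
  note hV = tensor_map_hom[OF algebra_module V algebra_module M id_hom \<phi>]
  note hM = tensor_map_hom[OF algebra_module M algebra_module coaction_target_module id_hom \<delta>]
  have I: "carrier ?I = {y \<in> carrier (tensor R S M). tensor_map R S N id ?\<delta> y = \<zero>\<^bsub>tensor R S N\<^esub>}"
    unfolding base_change_invariants_def invariants_def
    using base_change_invariant_iff[OF \<omega>] by (auto simp: M)
  have Iadd: "add ?I = add (tensor R S M)" and Ism: "smult ?I = base_change_smult R S M"
    unfolding base_change_invariants_def invariants_def by (simp_all add: M)
  have zero: "tensor_map R S N id ?\<delta> (tensor_map R S M id \<phi> y) = \<zero>\<^bsub>tensor R S N\<^esub>"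
    if y: "y \<in> carrier (tensor R S V)" for y
  proof (rule base_hom_ext[OF V module_hom_comp[OF hM hV] _ base_coaction_target_module _ y])
    show "(\<lambda>y. \<zero>\<^bsub>tensor R S N\<^esub>) \<in> module_hom R (tensor R S V) (tensor R S N)"
      by (rule module_homI) auto
    fix s v assume s: "s \<in> carrier S" and v: "v \<in> carrier V"
    have \<phi>v: "\<phi> v \<in> carrier M" by (rule module_hom_closed[OF \<phi> v])
    have "?\<delta> (\<phi> v) = \<zero>\<^bsub>N\<^esub>"
      using inv[OF v] module_hom_closed[OF unit_hom \<phi>v] by (simp add: N.minus_eq_zero_iff)
    then show "tensor_map R S N id ?\<delta> (tensor_map R S M id \<phi> (pure_tensor R S V s v)) = \<zero>\<^bsub>tensor R S N\<^esub>"
      using s v \<phi>v module_hom_zero[OF coaction_target_module base_coaction_target_module pure_hom_right[OF algebra_module coaction_target_module s]]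
      by (simp add: tensor_map_pure[OF algebra_module V algebra_module M id_hom \<phi>]
          tensor_map_pure[OF algebra_module M algebra_module coaction_target_module id_hom \<delta>])
  qed
  have hom: "?h \<in> module_hom S ?SV ?I"
    unfolding h
    by (rule module_homI)
      (use zero module_hom_closed[OF hV] in
        \<open>simp_all add: I Iadd Ism V module_hom_add[OF hV] tensor_map_base_smult[OF V M \<phi>]\<close>)
  have inj: "inj_on ?h (carrier ?SV) \<longleftrightarrow> ?inj"
  proof
    assume "inj_on ?h (carrier ?SV)"
    then show ?inj
      unfolding h using module_hom_inj_onD[OF TV.module_axioms TM hV] by (auto simp: V)
  next
    assume ?inj
    then show "inj_on ?h (carrier ?SV)"
      unfolding h using module_hom_inj_onI[OF TV.module_axioms TM hV] by (simp add: V)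
  qed
  have "?h ` carrier ?SV \<subseteq> carrier ?I" using module_hom_closed[OF hom] by blast
  moreover have "carrier ?I \<subseteq> ?h ` carrier ?SV \<longleftrightarrow> ?surj"
    unfolding I h by (auto simp: V)
  ultimately show ?thesis
    unfolding module_iso_def bij_betw_def using hom inj by blast
qed

end

end

theorem theorem1:
  fixes R :: "'r ring"
    and C :: "('r, 'c) module"
    and M :: "('r, 'm) module"
    and A :: "('r, 'a) module"
    and V :: "('a, 'v) module"
  assumes "dedekind_domain R"
    and "hopf_algebra R C \<Delta> \<epsilon> \<iota>" and "flat_module R C"
    and "right_comodule R C \<Delta> \<epsilon> \<iota> M \<omega>" and "flat_module R M"
    and "algebra R A" and "noetherian_ring A"
    and "module A V" and "finitely_generated_module A V"
    and "\<phi> \<in> module_hom R (restrict_scalars A V) (invariants R C M \<omega>)"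
    \<comment> \<open>Algebraically closed fields are taken with carrier in any one type \<open>'k\<close> that is infinite
      and at least as large as \<open>R\<close>; such a type carries an algebraic closure of every residue field
      of \<open>R\<close>.\<close>
    and "infinite (UNIV :: 'k set)" and "carrier R \<lesssim> (UNIV :: 'k set)"
    and "\<And>K :: ('r, 'k) module. algebra R K \<Longrightarrow> algebraically_closed K \<Longrightarrow>
      base_change_map R K M \<phi> \<in>
        module_iso K (base_change R K (restrict_scalars A V)) (base_change_invariants R K C M \<omega>)"
  shows "\<forall>S :: ('r, 's) module. algebra R S \<longrightarrow>
      base_change_map R S M \<phi> \<in>
        module_iso S (base_change R S (restrict_scalars A V)) (base_change_invariants R S C M \<omega>)"
proof -
  let ?V = "restrict_scalars A V"
  let ?N = "tensor R M C"
  let ?\<delta> = "\<lambda>m. \<omega> m \<ominus>\<^bsub>?N\<^esub> pure_tensor R M C m \<one>\<^bsub>C\<^esub>"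
  have noeth: "noetherian_ring R" and dom: "domain R"
    and dim: "\<And>P. primeideal P R \<Longrightarrow> P \<noteq> {\<zero>\<^bsub>R\<^esub>} \<Longrightarrow> maximalideal P R"
    using assms(1) unfolding dedekind_domain_def integrally_closed_domain_def by auto
  have R: "cring R" by (rule domain.axioms(1)[OF dom])
  interpret C: algebra R C by (rule hopf_algebra.axioms(1)[OF assms(2)])
  have C: "algebra R C" by (rule hopf_algebra.axioms(1)[OF assms(2)])
  have M: "module R M" using assms(5) unfolding flat_module_def by blast
  have V: "module R ?V" by (rule module_restrict_scalars[OF assms(6,8)])
  have N: "module R ?N" by (rule tensor_module[OF M C.module])
  interpret N: module R ?N by (rule N)
  have \<omega>: "\<omega> \<in> module_hom R M ?N" by (rule right_comodule.coaction_hom[OF assms(4)])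
  have \<delta>: "?\<delta> \<in> module_hom R M ?N"
    by (rule module_hom_diff[OF N \<omega> pure_hom_left[OF M C.module C.one_closed]])
  have \<phi>: "\<phi> \<in> module_hom R ?V M"
    and inv: "\<And>v. v \<in> carrier ?V \<Longrightarrow> \<omega> (\<phi> v) = pure_tensor R M C (\<phi> v) \<one>\<^bsub>C\<^esub>"
    using assms(10) unfolding module_hom_def invariants_def by auto
  interpret complex: module_complex R ?V M ?N \<phi> ?\<delta>
  proof (rule module_complex.intro[OF V M N \<phi> \<delta>])
    fix v assume v: "v \<in> carrier ?V"
    then show "?\<delta> (\<phi> v) = \<zero>\<^bsub>?N\<^esub>"
      using inv[OF v] module_hom_closed[OF \<phi> v] pure_tensor_closed[OF M C.module _ C.one_closed]
      by (simp add: N.minus_eq_zero_iff)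
  qed
  \<comment> \<open>Stated for a type variable of its own, because it is applied both to fields over
    \<open>'k\<close> and to algebras over \<open>'s\<close>.\<close>
  have iso_iff: "base_change_map R S M \<phi> \<in> module_iso S (base_change R S ?V) (base_change_invariants R S C M \<omega>) \<longleftrightarrow>
    (\<forall>y \<in> carrier (tensor R S ?V). tensor_map R S M id \<phi> y = \<zero>\<^bsub>tensor R S M\<^esub> \<longrightarrow> y = \<zero>\<^bsub>tensor R S ?V\<^esub>) \<and>
    (\<forall>y \<in> carrier (tensor R S M). tensor_map R S ?N id ?\<delta> y = \<zero>\<^bsub>tensor R S ?N\<^esub> \<longrightarrow>
      (\<exists>z \<in> carrier (tensor R S ?V). y = tensor_map R S M id \<phi> z))"
    if "algebra R S" for S :: "('r, 't) module"
    by (rule base_change_iso_iff[OF that M C \<omega> V \<phi> inv])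
  \<comment> \<open>The hypothesis on algebraically closed fields enters once for every prime, zero
    included, through a field in which exactly the elements of that prime become zero.\<close>
  have fibres: "complex.exact_at P" if P: "primeideal P R" for P
  proof -
    obtain K :: "('r, 'k) module" where K: "algebra R K" "algebraically_closed K"
      "\<forall>r \<in> carrier R. r \<odot>\<^bsub>K\<^esub> \<one>\<^bsub>K\<^esub> = \<zero>\<^bsub>K\<^esub> \<longleftrightarrow> r \<in> P"
      using exists_algebraically_closed_algebra[OF R P assms(11,12)] by blast
    have "field_algebra R K P"
      by (rule field_algebra.intro[OF K(1) algebraically_closed.axioms(1)[OF K(2)] P]) (use K(3) in blast)
    then show ?thesis
      by (rule complex.exact_at_fibre) (use assms(13)[OF K(1,2)] iso_iff[OF K(1)] in blast)+
  qed
  have torsion: "\<exists>k :: nat. \<forall>v \<in> carrier ?V. d [^]\<^bsub>R\<^esub> (Suc k) \<odot>\<^bsub>?V\<^esub> v = \<zero>\<^bsub>?V\<^esub> \<longrightarrow> d [^]\<^bsub>R\<^esub> k \<odot>\<^bsub>?V\<^esub> v = \<zero>\<^bsub>?V\<^esub>"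
    if "d \<in> carrier R" for d
    by (rule torsion_stable[OF assms(6-9) that])
  have ideals: "complex.exact_mod I" if "ideal I R" for I
    by (rule complex.exact_mod_all[OF dom noeth dim flat_imp_coord_flat[OF assms(5)]
          flat_tensor_coord_flat[OF assms(5,3)] fibres torsion that])
  show ?thesis
  proof (intro allI impI)
    fix S :: "('r, 's) module" assume S: "algebra R S"
    note exact = algebra.module[OF S] ideals flat_imp_coord_flat[OF assms(5)] flat_tensor_coord_flat[OF assms(5,3)]
    show "base_change_map R S M \<phi> \<in> module_iso S (base_change R S ?V) (base_change_invariants R S C M \<omega>)"
      unfolding iso_iff[OF S]
      using complex.tensor_exact_left[OF exact] complex.tensor_exact_middle[OF exact] by blast
  qed
qed

end
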